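(* Let $T$ be an operator in $L^0(\mathbb{R}^d)$. Suppose there is an increasing function $\phi:[1,\infty)\to(0,\infty)$ such that for all weights $w$ with $w^{-1}\in A_1$ and all compactly supported functions $f\in L^\infty_w(\mathbb{R}^d)$ we have $$\|Tf\|_{\mathrm{BMO}^\infty_w(\mathbb{R}^d)}\leq\phi([w^{-1}]_{A_1})\|f\|_{L^\infty_w(\mathbb{R}^d)}.$$ Then, for all Banach function spaces $X$ over $\mathbb{R}^d$ for which $M$ is bounded on $X$ and $X'$, and all compactly supported functions $f\in X$, we have $$\|Tf\|_X\lesssim_d C_X\,\phi(2\|M\|_{X\to X})\|f\|_X.$$ If $T$ is a (sub)linear operator and $X$ is order-continuous, then $T$ extends to a bounded operator $X\to X$ satisfying $$\|T\|_{X\to X}\lesssim_d C_X\,\phi(2\|M\|_{X\to X}),$$ and in particular $$\|T\|_{X\to X}\lesssim_d\|M\|_{X'\to X'}\,\phi(2\|M\|_{X\to X}).$$ The analogous assertions hold when $\mathrm{BMO}^\infty_w(\mathbb{R}^d)$ is replaced by $\mathrm{BMO}^{\infty,\mathrm{weak}}_w(\mathbb{R}^d)$ in the hypothesis and $C_X$ is replaced by $C_{X,\mathrm{weak}}$ in the conclusions.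
   Context: $L^0(\mathbb{R}^d)$ denotes the measurable functions on $\mathbb{R}^d$ and $L^0(\mathbb{R}^d)_+$ the nonnegative ones. $A\lesssim_d B$ means $A\le CB$ with $C$ depending only on $d$. A cube is a half-open cube with sides parallel to the coordinate axes. A weight is a measurable function $w$ with $0<w<\infty$ a.e. For a cube $Q$: $\langle g\rangle_Q=\frac1{|Q|}\int_Qg\,\mathrm{d}x$, $\langle g\rangle_{1,Q}=\frac1{|Q|}\int_Q|g|\,\mathrm{d}x$, $\langle g\rangle_{\infty,Q}=\operatorname{ess\,sup}_Q|g|$, and $\|g\|_{L^{1,\infty}(Q)}=\sup_{t>0}t\,|\{x\in Q:|g(x)|>t\}|$. $Mf=\sup_Q\langle f\rangle_{1,Q}\mathbf 1_Q$, the supremum over all cubes. $v\in A_1$ means $[v]_{A_1}:=\sup_Q\langle v\rangle_{1,Q}\langle v^{-1}\rangle_{\infty,Q}<\infty$. $L^\infty_w(\mathbb{R}^d)$ is defined by $\|f\|_{L^\infty_w(\mathbb{R}^d)}=\|fw\|_{L^\infty(\mathbb{R}^d)}$. Further $$\|f\|_{\mathrm{BMO}^\infty_w(\mathbb{R}^d)}=\sup_Q\langle w\rangle_{\infty,Q}\langle f-\langle f\rangle_Q\rangle_{1,Q},\qquad \|f\|_{\mathrm{BMO}^{\infty,\mathrm{weak}}_w(\mathbb{R}^d)}=\sup_Q\inf_{c\in\mathbb{R}}\langle w\rangle_{\infty,Q}|Q|^{-1}\|(f-c)\mathbf 1_Q\|_{L^{1,\infty}(Q)},$$ functions being identified modulo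 constants. Banach function space over $\mathbb{R}^d$: suppose $\rho:L^0(\mathbb{R}^d)_+\to[0,\infty]$ satisfies (i) $\rho(f)=0$ iff $f=0$ a.e.; (ii) $\rho(f+g)\le\rho(f)+\rho(g)$ and $\rho(\lambda f)=\lambda\rho(f)$ for scalars $\lambda\ge0$; (iii) if $0\le f_n\uparrow f$ a.e. then $\rho(f_n)\uparrow\rho(f)$; (iv) every measurable $E\subseteq\mathbb{R}^d$ of positive measure contains a measurable $F\subseteq E$ of positive measure with $\rho(\mathbf 1_F)<\infty$. Then $X=\{f\in L^0(\mathbb{R}^d):\|f\|_X:=\rho(|f|)<\infty\}$ is a Banach function space over $\mathbb{R}^d$. Its Köthe dual is $X'=\{g\in L^0(\mathbb{R}^d):fg\in L^1(\mathbb{R}^d)\ \forall f\in X\}$ with $\|g\|_{X'}=\sup_{\|f\|_X=1}\|fg\|_{L^1(\mathbb{R}^d)}$. $X$ is order-continuous if for all $(f_n)$ in $X$ with $f_n\downarrow0$ a.e. one has $\|f_n\|_X\to0$. Sharp maximal functions: $M^\sharp f=\sup_Q\langle f-\langle f\rangle_Q\rangle_{1,Q}\mathbf 1_Q$ and $M^\sharp_{\mathrm{weak}}f=\sup_Q\inf_{c\in\mathbb{R}}|Q|^{-1}\|(f-c)\mathbf 1_Q\|_{L^{1,\infty}(Q)}\mathbf 1_Q$. The constant $C_X$ (respectively $C_{X,\mathrm{weak}}$) is the smallest constant such that $\|f\|_X\le C_X\|M^\sharp f\|_X$ (respectively $\|f\|_X\le C_{X,\mathrm{weak}}\|M^\sharp_{\mathrm{weak}}f\|_X$)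 for all $f\in X$ with $|\{x\in\mathbb{R}^d:|f(x)|>\alpha\}|<\infty$ for all $\alpha>0$.
   Formalization: Tf=(∫f)·1 refutes the literal claim, so Tf in X is read as Tf−c, with c=0 if Tf∈X or |{|Tf|>α}|<∞ for all α>0; the extension agrees with this on compactly supported f∈X, and for sublinear T it is asserted sublinear only when all such Tf satisfy that condition. *)

theory Defs
  imports "HOL-Analysis.Analysis" "HOL-Probability.Essential_Supremum"
begin

text \<open>
  Functions are real-valued and measurable with respect to the Lebesgue measure of \<open>\<real>\<^sup>d\<close>,
  \<open>d = CARD('n)\<close>; a.e. equal functions are distinct objects, so everything below is stated up to
  null sets. Norms and (maximal) functions that may be infinite take values in \<^typ>\<open>ennreal\<close>.
\<close>

type_synonym 'n rfun = "real^'n \<Rightarrow> real"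
type_synonym 'n efun = "real^'n \<Rightarrow> ennreal"

definition L0 :: "('n::finite) rfun set" where
  "L0 = borel_measurable lebesgue"

definition ae_eq :: "('n::finite) rfun \<Rightarrow> 'n rfun \<Rightarrow> bool" where
  "ae_eq f g \<longleftrightarrow> (AE x in lebesgue. f x = g x)"

definition eabs :: "('n::finite) rfun \<Rightarrow> 'n efun" where
  "eabs f = (\<lambda>x. ennreal \<bar>f x\<bar>)"

definition compactly_supported :: "('n::finite) rfun \<Rightarrow> bool" where
  "compactly_supported f \<longleftrightarrow> (\<exists>K. compact K \<and> (AE x in lebesgue. x \<notin> K \<longrightarrow> f x = 0))"

definition finite_level_sets :: "('n::finite) rfun \<Rightarrow> bool" where
  "finite_level_sets f \<longleftrightarrow> (\<forall>\<alpha>>0. emeasure lebesgue {x. \<bar>f x\<bar> > \<alpha>} < \<infinity>)"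


section \<open>Cubes, averages, weights\<close>

definition cubes :: "(real^'n::finite) set set" where
  "cubes = {{x. \<forall>i. a $ i \<le> x $ i \<and> x $ i < a $ i + l} | a l. l > 0}"

definition mean :: "(real^'n::finite) set \<Rightarrow> 'n rfun \<Rightarrow> real" where
  "mean Q f = (LINT x:Q|lebesgue. f x) / measure lebesgue Q"

definition avg1 :: "(real^'n::finite) set \<Rightarrow> 'n rfun \<Rightarrow> ennreal" where
  "avg1 Q f = (\<integral>\<^sup>+x\<in>Q. eabs f x \<partial>lebesgue) / emeasure lebesgue Q"

definition avg_inf :: "(real^'n::finite) set \<Rightarrow> 'n rfun \<Rightarrow> ennreal" where
  "avg_inf Q f = esssup (restrict_space lebesgue Q) (eabs f)"

definition weak_L1_norm :: "(real^'n::finite) set \<Rightarrow> 'n rfun \<Rightarrow> ennreal" where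
  "weak_L1_norm Q f = (SUP t\<in>{0<..}. ennreal t * emeasure lebesgue {x\<in>Q. \<bar>f x\<bar> > t})"

text \<open>
  If \<open>f\<close> is measurable but not integrable on \<open>Q\<close>, then \<^const>\<open>mean\<close> is \<open>0\<close> by convention and
  hence \<open>osc Q f = \<infinity>\<close>, as it should be.
\<close>

definition osc :: "(real^'n::finite) set \<Rightarrow> 'n rfun \<Rightarrow> ennreal" where
  "osc Q f = avg1 Q (\<lambda>x. f x - mean Q f)"

definition osc_weak :: "(real^'n::finite) set \<Rightarrow> 'n rfun \<Rightarrow> ennreal" where
  "osc_weak Q f = (INF c. weak_L1_norm Q (\<lambda>x. f x - c) / emeasure lebesgue Q)"

definition weight :: "('n::finite) rfun \<Rightarrow> bool" where
  "weight w \<longleftrightarrow> w \<in> L0 \<and> (AE x in lebesgue. 0 < w x)"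

definition A1_const :: "('n::finite) rfun \<Rightarrow> ennreal" where
  "A1_const v = (SUP Q\<in>cubes. avg1 Q v * avg_inf Q (\<lambda>x. inverse (v x)))"

definition Linf_norm :: "('n::finite) rfun \<Rightarrow> 'n rfun \<Rightarrow> ennreal" where
  "Linf_norm w f = esssup lebesgue (eabs (\<lambda>x. f x * w x))"

definition Linf :: "('n::finite) rfun \<Rightarrow> 'n rfun set" where
  "Linf w = {f \<in> L0. Linf_norm w f < \<infinity>}"

definition BMO_norm :: "('n::finite) rfun \<Rightarrow> 'n rfun \<Rightarrow> ennreal" where
  "BMO_norm w f = (SUP Q\<in>cubes. avg_inf Q w * osc Q f)"

definition BMO_weak_norm :: "('n::finite) rfun \<Rightarrow> 'n rfun \<Rightarrow> ennreal" where
  "BMO_weak_norm w f = (SUP Q\<in>cubes. avg_inf Q w * osc_weak Q f)"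


section \<open>Maximal functions\<close>

definition HL_max :: "('n::finite) rfun \<Rightarrow> 'n efun" where
  "HL_max f x = (SUP Q\<in>cubes. avg1 Q f * indicator Q x)"

definition sharp_max :: "('n::finite) rfun \<Rightarrow> 'n efun" where
  "sharp_max f x = (SUP Q\<in>cubes. osc Q f * indicator Q x)"

definition sharp_max_weak :: "('n::finite) rfun \<Rightarrow> 'n efun" where
  "sharp_max_weak f x = (SUP Q\<in>cubes. osc_weak Q f * indicator Q x)"


section \<open>Banach function spaces\<close>

text \<open>
  The functional \<open>\<rho>\<close> is taken on \<open>[0,\<infinity>]\<close>-valued measurable functions, so that it applies to
  maximal functions. By the Fatou property a functional on finite-valued functions extends
  uniquely to these, with value \<open>\<infinity>\<close> at every function that is infinite on a set of positive measure.
\<close>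

definition banach_function_norm :: "(('n::finite) efun \<Rightarrow> ennreal) \<Rightarrow> bool" where
  "banach_function_norm \<rho> \<longleftrightarrow>
    (\<forall>f\<in>borel_measurable lebesgue. \<rho> f = 0 \<longleftrightarrow> (AE x in lebesgue. f x = 0)) \<and>
    (\<forall>f\<in>borel_measurable lebesgue. \<forall>g\<in>borel_measurable lebesgue.
       \<rho> (\<lambda>x. f x + g x) \<le> \<rho> f + \<rho> g) \<and>
    (\<forall>f\<in>borel_measurable lebesgue. \<forall>c::real. c \<ge> 0 \<longrightarrow>
       \<rho> (\<lambda>x. ennreal c * f x) = ennreal c * \<rho> f) \<and>
    (\<forall>F. \<forall>f\<in>borel_measurable lebesgue. (\<forall>n::nat. F n \<in> borel_measurable lebesgue) \<longrightarrow>
       (AE x in lebesgue. incseq (\<lambda>n. F n x) \<and> (\<lambda>n. F n x) \<longlonglongrightarrow> f x) \<longrightarrow>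
       incseq (\<lambda>n. \<rho> (F n)) \<and> (\<lambda>n. \<rho> (F n)) \<longlonglongrightarrow> \<rho> f) \<and>
    (\<forall>E\<in>sets lebesgue. emeasure lebesgue E > 0 \<longrightarrow>
       (\<exists>F\<in>sets lebesgue. F \<subseteq> E \<and> emeasure lebesgue F > 0 \<and> \<rho> (indicator F) < \<infinity>))"

definition bfs :: "(('n::finite) efun \<Rightarrow> ennreal) \<Rightarrow> 'n rfun set" where
  "bfs \<rho> = {f \<in> L0. \<rho> (eabs f) < \<infinity>}"

definition kothe_dual :: "(('n::finite) efun \<Rightarrow> ennreal) \<Rightarrow> 'n rfun set" where
  "kothe_dual \<rho> = {g \<in> L0. \<forall>f\<in>bfs \<rho>. integrable lebesgue (\<lambda>x. f x * g x)}"

definition kothe_norm :: "(('n::finite) efun \<Rightarrow> ennreal) \<Rightarrow> 'n efun \<Rightarrow> ennreal" where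
  "kothe_norm \<rho> g = (SUP f\<in>{f \<in> bfs \<rho>. \<rho> (eabs f) = 1}. \<integral>\<^sup>+x. eabs f x * g x \<partial>lebesgue)"

definition order_continuous :: "(('n::finite) efun \<Rightarrow> ennreal) \<Rightarrow> bool" where
  "order_continuous \<rho> \<longleftrightarrow>
    (\<forall>F. (\<forall>n::nat. F n \<in> bfs \<rho>) \<longrightarrow>
       (AE x in lebesgue. decseq (\<lambda>n. F n x) \<and> (\<lambda>n. F n x) \<longlonglongrightarrow> 0) \<longrightarrow>
       (\<lambda>n. \<rho> (eabs (F n))) \<longlonglongrightarrow> 0)"

text \<open>
  \<open>op_norm X \<rho> A\<close> is the norm of \<open>A\<close> on the space \<open>X\<close> normed by \<open>\<rho>\<close>, equal to \<open>\<infinity>\<close> iff \<open>A\<close> is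
  not bounded on \<open>X\<close>.
\<close>

definition op_norm :: "('n::finite) rfun set \<Rightarrow> ('n efun \<Rightarrow> ennreal) \<Rightarrow> ('n rfun \<Rightarrow> 'n efun) \<Rightarrow> ennreal" where
  "op_norm X \<rho> A = Inf {C. \<forall>f\<in>X. \<rho> (A f) \<le> C * \<rho> (eabs f)}"

text \<open>The constant \<open>C\<^sub>X\<close> (for \<^const>\<open>sharp_max\<close>) or \<open>C\<^bsub>X,weak\<^esub>\<close> (for \<^const>\<open>sharp_max_weak\<close>).\<close>

definition sharp_const :: "(('n::finite) rfun \<Rightarrow> 'n efun) \<Rightarrow> ('n efun \<Rightarrow> ennreal) \<Rightarrow> ennreal" where
  "sharp_const sharp \<rho> =
    Inf {C. \<forall>f\<in>bfs \<rho>. finite_level_sets f \<longrightarrow> \<rho> (eabs f) \<le> C * \<rho> (sharp f)}"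


section \<open>Operators\<close>

text \<open>A possibly only partially defined operator on a.e. classes, with domain \<open>D\<close>.\<close>

definition operator_in_L0 :: "('n::finite) rfun set \<Rightarrow> ('n rfun \<Rightarrow> 'n rfun) \<Rightarrow> bool" where
  "operator_in_L0 D T \<longleftrightarrow> D \<subseteq> L0 \<and> (\<forall>f\<in>D. T f \<in> L0) \<and>
    (\<forall>f\<in>D. \<forall>g\<in>L0. ae_eq f g \<longrightarrow> g \<in> D \<and> ae_eq (T f) (T g))"

definition lin_dom :: "('n::finite) rfun set \<Rightarrow> bool" where
  "lin_dom D \<longleftrightarrow> (\<lambda>x. 0) \<in> D \<and> (\<forall>f\<in>D. \<forall>g\<in>D. (\<lambda>x. f x + g x) \<in> D) \<and>
    (\<forall>f\<in>D. \<forall>a. (\<lambda>x. a * f x) \<in> D)"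

definition linear_op :: "('n::finite) rfun set \<Rightarrow> ('n rfun \<Rightarrow> 'n rfun) \<Rightarrow> bool" where
  "linear_op D T \<longleftrightarrow> lin_dom D \<and>
    (\<forall>f\<in>D. \<forall>g\<in>D. ae_eq (T (\<lambda>x. f x + g x)) (\<lambda>x. T f x + T g x)) \<and>
    (\<forall>f\<in>D. \<forall>a. ae_eq (T (\<lambda>x. a * f x)) (\<lambda>x. a * T f x))"

definition sublinear_op :: "('n::finite) rfun set \<Rightarrow> ('n rfun \<Rightarrow> 'n rfun) \<Rightarrow> bool" where
  "sublinear_op D T \<longleftrightarrow> lin_dom D \<and>
    (\<forall>f\<in>D. \<forall>g\<in>D. AE x in lebesgue. \<bar>T (\<lambda>y. f y + g y) x\<bar> \<le> \<bar>T f x\<bar> + \<bar>T g x\<bar>) \<and>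
    (\<forall>f\<in>D. \<forall>a. AE x in lebesgue. \<bar>T (\<lambda>y. a * f y) x\<bar> = \<bar>a\<bar> * \<bar>T f x\<bar>)"

text \<open>
  A BMO bound determines \<open>T f\<close> only modulo constants: \<open>T f = (\<integral>f) \<cdot> 1\<close> is linear and has BMO norm
  \<open>0\<close>, but \<open>T f\<close> is not in \<open>L\<^sup>p\<close>. Statements about \<open>T f\<close> in \<open>X\<close> therefore concern a
  representative \<open>h\<close> of \<open>g = T f\<close> modulo constants. It is \<open>g\<close> itself whenever \<open>g\<close> belongs to \<open>X\<close>
  or has level sets of finite measure, as the functions admitted in the definition of \<open>C\<^sub>X\<close> do.
\<close>

definition representative :: "(('n::finite) efun \<Rightarrow> ennreal) \<Rightarrow> 'n rfun \<Rightarrow> 'n rfun \<Rightarrow> bool" where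
  "representative \<rho> g h \<longleftrightarrow>
    (\<exists>c::real. ae_eq h (\<lambda>x. g x - c) \<and> (g \<in> bfs \<rho> \<or> finite_level_sets g \<longrightarrow> c = 0))"

end

theory Submission
  imports Defs
begin

text \<open>
  The case of a weighted \<open>L\<^sup>\<infinity>\<close> estimate contains the case of a general space \<open>X\<close> because every \<open>f\<close> in
  \<open>X\<close> lies in a weighted \<open>L\<^sup>\<infinity>\<close> space adapted to it. The Rubio de Francia algorithm gives
  \<open>v \<ge> |f|\<close> with \<open>\<parallel>v\<parallel>\<^sub>X \<le> 2 \<parallel>f\<parallel>\<^sub>X\<close> and \<open>[v]\<^bsub>A\<^sub>1\<^esub> \<le> 2 \<parallel>M\<parallel>\<close>, so that \<open>f\<close> has norm at most \<open>1\<close> for the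
  weight \<open>w = 1/v\<close> (\<open>rubio_de_francia\<close>). The hypothesis on \<open>T\<close> then bounds the oscillation of
  \<open>T f\<close> on each cube by a multiple of the essential infimum of \<open>v\<close>, that is, the sharp maximal
  function of \<open>T f\<close> by \<open>\<phi>(2 \<parallel>M\<parallel>) v\<close> (\<open>sharp_le_weight\<close>, \<open>sharp_T_bound\<close>), and the constant \<open>C\<^sub>X\<close>
  turns this into a bound of \<open>T f\<close>.

  Two things stand between this idea and a proof. A \<open>BMO\<close> bound determines \<open>T f\<close> only up to a
  constant, and \<open>C\<^sub>X\<close> speaks of functions that are known to lie in \<open>X\<close> and to have level sets of
  finite measure. The constant and membership in \<open>X\<close> are settled by a Fefferman-Stein inequality that
  presupposes neither,
  \<open>\<integral>|g - c| k \<le> C \<integral> M\<^sup>\<sharp>g \<cdot> M k\<close>, where \<open>c\<close> is the limit of the medians of \<open>g\<close> over growing cubes.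
  Its local form (\<open>fefferman_stein_local\<close>) comes from iterating a Calderon-Zygmund stopping argument.
  The medians converge if \<open>M\<^sup>\<sharp>g\<close> is in \<open>X\<close>, since the dual space contains a maximal
  function \<open>M k\<close>, which is at least a multiple of \<open>|x|\<^sup>-\<^sup>d\<close> at infinity (\<open>summable_lower_bounds\<close>,
  \<open>med_convergent\<close>); for the same reason \<open>X\<close> contains no constant but \<open>0\<close>, which makes \<open>c\<close>
  unique. Taking the supremum over \<open>k\<close> in the unit ball of the dual
  (\<open>lorentz_luxemburg_separation\<close>) gives \<open>\<parallel>g - c\<parallel>\<^sub>X \<le> C \<parallel>M\<parallel> \<parallel>M\<^sup>\<sharp>g\<parallel>\<^sub>X\<close> with the norm of \<open>M\<close> on \<open>X'\<close>
  (\<open>sharp_inequality\<close>). So \<open>T f - c\<close> is in \<open>X\<close>, and \<open>C\<^sub>X\<close> is at most \<open>C\<close> times the norm of \<open>M\<close> on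
  \<open>X'\<close> (\<open>sharp_const_bound\<close>).

  Membership in \<open>X\<close> does not make level sets finite. Here it helps that \<open>f\<close> has compact support and
  that the weight may be chosen again, without regard to constants: \<open>v\<close> can be cut down to an \<open>A\<^sub>1\<close> weight
  \<open>u \<ge> |f|\<close> that is \<open>O(|x|\<^sup>-\<^sup>1\<^sup>/\<^sup>2)\<close> at infinity (\<open>decaying_weight\<close>). Then the oscillations of \<open>T f\<close> decay,
  and the John-Nirenberg estimate on the dyadic annuli sums up to level sets of finite measure
  (\<open>finite_level_of_decay\<close>).

  The extension to \<open>X\<close> is by truncation to growing cubes: order continuity makes the truncations
  converge, and \<open>X\<close> is complete (\<open>bfs_complete\<close>).
\<close>

section \<open>Cubes and maximal functions\<close>

(* As simplification rules these replace the Lebesgue measure of Borel sets by lborel, so that facts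
   about the two measures would no longer match. *)
declare emeasure_completion [simp del] measure_completion [simp del]

definition cube :: "real^'n::finite \<Rightarrow> real \<Rightarrow> (real^'n) set" where
  "cube a l = {x. \<forall>i. a $ i \<le> x $ i \<and> x $ i < a $ i + l}"

lemma mem_cube: "x \<in> cube a l \<longleftrightarrow> (\<forall>i. a $ i \<le> x $ i \<and> x $ i < a $ i + l)"
  by (simp add: cube_def)

lemma cubes_eq: "cubes = {cube a l | a l. l > 0}"
  by (simp add: cubes_def cube_def)

lemma cube_in_cubes [intro]: "l > 0 \<Longrightarrow> cube a l \<in> cubes"
  by (auto simp: cubes_eq)

lemma cubesE: assumes "Q \<in> cubes" obtains a l where "Q = cube a l" "l > 0"
  using assms by (auto simp: cubes_eq)

lemma cube_borel [measurable]: "cube a l \<in> sets borel"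
  unfolding cube_def by measurable

lemma cube_lebesgue [measurable]: "cube a l \<in> sets lebesgue"
  using cube_borel sets_completionI_sets by (metis sets_lborel)

lemma cubes_lebesgue: "Q \<in> cubes \<Longrightarrow> Q \<in> sets lebesgue"
  by (auto elim!: cubesE)

lemma emeasure_lborel_cube:
  assumes "l > 0"
  shows "emeasure lborel (cube (a::real^'n::finite) l) = ennreal (l ^ CARD('n))"
proof -
  let ?b = "\<chi> i. a $ i + l"
  have c: "emeasure lborel (cbox a ?b) = ennreal (l ^ CARD('n))"
    and d: "emeasure lborel (box a ?b) = ennreal (l ^ CARD('n))"
    using assms by (auto simp: emeasure_lborel_cbox_eq emeasure_lborel_box_eq Basis_vec_def
        prod.UNION_disjoint inner_axis axis_eq_axis)
  have "box a ?b \<subseteq> cube a l" "cube a l \<subseteq> cbox a ?b"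
    by (auto simp: mem_cube mem_box_cart less_imp_le)
  then show ?thesis
    by (metis antisym c d cube_borel emeasure_mono sets_lborel box_borel cbox_borel)
qed

lemma emeasure_cube:
  assumes "l > 0"
  shows "emeasure lebesgue (cube (a::real^'n::finite) l) = ennreal (l ^ CARD('n))"
  using assms by (simp add: emeasure_completion emeasure_lborel_cube)

lemma emeasure_cubes_pos: "Q \<in> cubes \<Longrightarrow> 0 < emeasure lebesgue Q"
  by (auto elim!: cubesE simp: emeasure_cube)

lemma emeasure_cubes_finite: "Q \<in> cubes \<Longrightarrow> emeasure lebesgue Q < \<infinity>"
  by (auto elim!: cubesE simp: emeasure_cube)

lemma measure_cube: "l > 0 \<Longrightarrow> measure lebesgue (cube (a::real^'n::finite) l) = l ^ CARD('n)"
  by (simp add: measure_def emeasure_cube)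

text \<open>
  Averages and maximal functions of \<open>[0,\<infinity>]\<close>-valued functions: in this form the maximal operator can
  be iterated, and no case distinction is needed where a maximal function is infinite.
\<close>

definition eavg :: "(real^'n::finite) set \<Rightarrow> 'n efun \<Rightarrow> ennreal" where
  "eavg Q F = (\<integral>\<^sup>+x\<in>Q. F x \<partial>lebesgue) / emeasure lebesgue Q"

text \<open>The maximal function of a function \<open>\<tau>\<close> of cubes; \<open>HL_max\<close>, \<open>sharp_max\<close> and
  \<open>sharp_max_weak\<close> are of this form.\<close>

definition cube_sup :: "((real^'n::finite) set \<Rightarrow> ennreal) \<Rightarrow> 'n efun" where
  "cube_sup \<tau> x = (SUP Q\<in>cubes. \<tau> Q * indicator Q x)"

definition eM :: "('n::finite) efun \<Rightarrow> 'n efun" where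
  "eM F = cube_sup (\<lambda>Q. eavg Q F)"

lemma avg1_eq: "avg1 Q f = eavg Q (eabs f)"
  by (simp add: avg1_def eavg_def)

lemma HL_max_eq: "HL_max f = eM (eabs f)"
  by (simp add: fun_eq_iff HL_max_def eM_def cube_sup_def avg1_eq)

lemma sharp_max_eq: "sharp_max f = cube_sup (\<lambda>Q. osc Q f)"
  by (simp add: fun_eq_iff sharp_max_def cube_sup_def)

lemma sharp_max_weak_eq: "sharp_max_weak f = cube_sup (\<lambda>Q. osc_weak Q f)"
  by (simp add: fun_eq_iff sharp_max_weak_def cube_sup_def)

lemma cube_sup_upper: "Q \<in> cubes \<Longrightarrow> x \<in> Q \<Longrightarrow> \<tau> Q \<le> cube_sup \<tau> x"
  unfolding cube_sup_def by (rule SUP_upper2[where i=Q]) auto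

lemma cube_sup_least: "(\<And>Q. Q \<in> cubes \<Longrightarrow> x \<in> Q \<Longrightarrow> \<tau> Q \<le> c) \<Longrightarrow> cube_sup \<tau> x \<le> c"
  unfolding cube_sup_def by (rule SUP_least) (auto split: split_indicator)

text \<open>
  A cube can be enlarged slightly to a cube from a fixed countable family. If the enlargement does
  not decrease \<open>\<tau>\<close> much, then the supremum over all cubes is the supremum over this family.
  Measurability of maximal functions and all passages from \<open>a.e. on each cube\<close> to
  \<open>a.e. for all cubes simultaneously\<close> rest on this. The cube \<open>cube b m\<close> between the given one and
  its enlargements serves the mean oscillation: \<open>f\<close> may fail to be integrable on all larger
  cubes of a concentric family, and the oscillation is then infinite on every cube that contains
  one of these, but not on every larger cube.
\<close>

definition outer_cont :: "((real^'n::finite) set \<Rightarrow> ennreal) \<Rightarrow> bool" where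
  "outer_cont \<tau> \<longleftrightarrow> (\<forall>a l t. l > 0 \<longrightarrow> t < \<tau> (cube a l) \<longrightarrow>
     (\<exists>b m. \<exists>\<eta>>0. m > 0 \<and> cube a l \<subseteq> cube b m \<and>
       (\<forall>Q\<in>cubes. cube b m \<subseteq> Q \<longrightarrow> Q \<subseteq> cube (\<chi> i. b $ i - \<eta>) (m + 2 * \<eta>) \<longrightarrow> t < \<tau> Q)))"

lemma countable_cube_family:
  obtains RC :: "(real^'n::finite) set set" where "countable RC" "RC \<subseteq> cubes"
    "\<And>a l \<eta>. l > 0 \<Longrightarrow> \<eta> > 0 \<Longrightarrow> \<exists>Q\<in>RC. cube a l \<subseteq> Q \<and> Q \<subseteq> cube (\<chi> i. a $ i - \<eta>) (l + 2 * \<eta>)"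
proof -
  obtain D :: "(real^'n) set" where D: "countable D" "\<And>X. open X \<Longrightarrow> X \<noteq> {} \<Longrightarrow> \<exists>d\<in>D. d \<in> X"
    using countable_dense_exists by metis
  define RC where "RC = (\<lambda>(a, l). cube a l) ` (D \<times> {l\<in>\<rat>. l > (0::real)})"
  show ?thesis
  proof (rule that[of RC])
    have "countable {l\<in>\<rat>. l > (0::real)}"
      by (rule countable_subset[OF _ countable_rat]) auto
    then show "countable RC" using D(1) by (simp add: RC_def)
    show "RC \<subseteq> cubes" by (auto simp: RC_def)
    fix a :: "real^'n" and l \<eta> :: real assume p: "l > 0" "\<eta> > 0"
    have "(\<chi> i. a $ i - \<eta> / 4) \<in> box (\<chi> i. a $ i - \<eta> / 2) a"
      using p by (simp add: mem_box_cart)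
    then obtain a' where a': "a' \<in> D" "a' \<in> box (\<chi> i. a $ i - \<eta> / 2) a"
      using D(2)[OF open_box] by blast
    then have a'': "a $ i - \<eta> / 2 < a' $ i" "a' $ i < a $ i" for i
      by (auto simp: mem_box_cart)
    obtain l' where l': "l' \<in> \<rat>" "l + \<eta> / 2 < l'" "l' < l + \<eta>"
      using Rats_dense_in_real[of "l + \<eta> / 2" "l + \<eta>"] p by auto
    have "cube a' l' \<in> RC" using a' l' p by (auto simp: RC_def)
    moreover have "cube a l \<subseteq> cube a' l'"
    proof
      fix x assume "x \<in> cube a l"
      then have "a' $ i \<le> x $ i \<and> x $ i < a' $ i + l'" for i
        using a''[of i] l' by (auto simp: mem_cube dest: spec[of _ i])
      then show "x \<in> cube a' l'" by (simp add: mem_cube)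
    qed
    moreover have "cube a' l' \<subseteq> cube (\<chi> i. a $ i - \<eta>) (l + 2 * \<eta>)"
    proof
      fix x assume "x \<in> cube a' l'"
      then have "a $ i - \<eta> \<le> x $ i \<and> x $ i < a $ i - \<eta> + (l + 2 * \<eta>)" for i
        using a''[of i] l' p by (auto simp: mem_cube dest: spec[of _ i])
      then show "x \<in> cube (\<chi> i. a $ i - \<eta>) (l + 2 * \<eta>)" by (simp add: mem_cube)
    qed
    ultimately show "\<exists>Q\<in>RC. cube a l \<subseteq> Q \<and> Q \<subseteq> cube (\<chi> i. a $ i - \<eta>) (l + 2 * \<eta>)"
      by blast
  qed
qed


lemma outer_cont_countable:
  obtains RC :: "(real^'n::finite) set set" where "countable RC" "RC \<subseteq> cubes"
    "\<And>\<tau> x. outer_cont \<tau> \<Longrightarrow> cube_sup \<tau> x = (SUP Q\<in>RC. \<tau> Q * indicator Q x)"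
proof -
  obtain RC :: "(real^'n) set set" where RC: "countable RC" "RC \<subseteq> cubes"
    "\<And>a l \<eta>. l > 0 \<Longrightarrow> \<eta> > 0 \<Longrightarrow> \<exists>Q\<in>RC. cube a l \<subseteq> Q \<and> Q \<subseteq> cube (\<chi> i. a $ i - \<eta>) (l + 2 * \<eta>)"
    by (rule countable_cube_family) blast
  show ?thesis
  proof (rule that[OF RC(1,2)])
    fix \<tau> :: "(real^'n) set \<Rightarrow> ennreal" and x
    assume oc: "outer_cont \<tau>"
    show "cube_sup \<tau> x = (SUP Q\<in>RC. \<tau> Q * indicator Q x)"
    proof (rule antisym)
      show "(SUP Q\<in>RC. \<tau> Q * indicator Q x) \<le> cube_sup \<tau> x"
        unfolding cube_sup_def using RC(2) by (rule SUP_subset_mono) auto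
      show "cube_sup \<tau> x \<le> (SUP Q\<in>RC. \<tau> Q * indicator Q x)"
      proof (rule cube_sup_least)
        fix Q assume Q: "Q \<in> cubes" "x \<in> Q"
        then obtain a l where al: "Q = cube a l" "l > 0" by (auto elim: cubesE)
        show "\<tau> Q \<le> (SUP Q\<in>RC. \<tau> Q * indicator Q x)"
        proof (rule dense_le)
          fix t assume "t < \<tau> Q"
          then have t: "t < \<tau> (cube a l)" by (simp add: al)
          obtain b m \<eta> where \<eta>: "\<eta> > 0" "m > 0" "cube a l \<subseteq> cube b m"
            "\<And>Q. Q \<in> cubes \<Longrightarrow> cube b m \<subseteq> Q \<Longrightarrow> Q \<subseteq> cube (\<chi> i. b $ i - \<eta>) (m + 2 * \<eta>) \<Longrightarrow> t < \<tau> Q"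
            using oc[unfolded outer_cont_def, rule_format, OF al(2) t] by metis
          obtain R where R: "R \<in> RC" "cube b m \<subseteq> R" "R \<subseteq> cube (\<chi> i. b $ i - \<eta>) (m + 2 * \<eta>)"
            using RC(3)[OF \<eta>(2,1)] by blast
          have "t \<le> \<tau> R * indicator R x"
            using \<eta>(4)[of R] \<eta>(3) R RC(2) Q al by (auto simp: indicator_def less_imp_le)
          then show "t \<le> (SUP Q\<in>RC. \<tau> Q * indicator Q x)"
            using R(1) by (rule SUP_upper2[rotated])
        qed
      qed
    qed
  qed
qed

lemma cube_sup_measurable:
  assumes "outer_cont (\<tau> :: (real^'n::finite) set \<Rightarrow> ennreal)"
  shows "cube_sup \<tau> \<in> borel_measurable lebesgue"
proof -
  obtain RC :: "(real^'n) set set" where RC: "countable RC" "RC \<subseteq> cubes"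
    "\<And>x. cube_sup \<tau> x = (SUP Q\<in>RC. \<tau> Q * indicator Q x)"
    using outer_cont_countable assms by metis
  have "(\<lambda>x. SUP Q\<in>RC. \<tau> Q * indicator Q x) \<in> borel_measurable lebesgue"
  proof (rule borel_measurable_SUP[OF RC(1)])
    fix Q assume "Q \<in> RC"
    then have "Q \<in> sets lebesgue" using RC(2) cubes_lebesgue by blast
    then show "(\<lambda>x. \<tau> Q * indicator Q x) \<in> borel_measurable lebesgue"
      by (intro borel_measurable_times_ennreal borel_measurable_const borel_measurable_indicator)
  qed
  moreover have "cube_sup \<tau> = (\<lambda>x. SUP Q\<in>RC. \<tau> Q * indicator Q x)"
    using RC(3) by (rule ext)
  ultimately show ?thesis by simp
qed

lemma cube_sup_AE_le:
  assumes oc: "outer_cont (\<tau> :: (real^'n::finite) set \<Rightarrow> ennreal)"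
    and le: "\<And>Q. Q \<in> cubes \<Longrightarrow> AE x in lebesgue. x \<in> Q \<longrightarrow> \<tau> Q \<le> V x"
  shows "AE x in lebesgue. cube_sup \<tau> x \<le> V x"
proof -
  obtain RC :: "(real^'n) set set" where RC: "countable RC" "RC \<subseteq> cubes"
    "\<And>x. cube_sup \<tau> x = (SUP Q\<in>RC. \<tau> Q * indicator Q x)"
    using outer_cont_countable oc by metis
  have "AE x in lebesgue. \<forall>Q\<in>RC. x \<in> Q \<longrightarrow> \<tau> Q \<le> V x"
    using RC le by (subst AE_ball_countable) auto
  then show ?thesis
    by eventually_elim (auto simp: RC(3) intro!: SUP_least split: split_indicator)
qed

text \<open>Enlarging the cube by a factor close to \<open>1\<close> costs only a factor close to \<open>1\<close> for averages
  and for weak oscillations, because \<open>\<tau> Q \<cdot> |Q|\<close> is increasing in \<open>Q\<close>.\<close>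

lemma outer_cont_mono:
  assumes mono: "\<And>Q Q'. Q \<in> cubes \<Longrightarrow> Q' \<in> cubes \<Longrightarrow> Q \<subseteq> Q' \<Longrightarrow>
     \<tau> Q * emeasure lebesgue Q \<le> \<tau> Q' * emeasure lebesgue (Q' :: (real^'n::finite) set)"
  shows "outer_cont \<tau>"
  unfolding outer_cont_def
proof (intro allI impI)
  fix a :: "real^'n" and l :: real and t assume l: "l > 0" and t: "t < \<tau> (cube a l)"
  let ?D = "CARD('n)"
  define r where "r \<eta> = l ^ ?D / (l + 2 * \<eta>) ^ ?D" for \<eta>
  have "((\<lambda>\<eta>. \<tau> (cube a l) * ennreal (r \<eta>)) \<longlongrightarrow> \<tau> (cube a l) * ennreal 1) (at_right 0)"
  proof (intro tendsto_mult_ennreal tendsto_const tendsto_ennrealI)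
    have "((\<lambda>\<eta>. l ^ ?D / (l + 2 * \<eta>) ^ ?D) \<longlongrightarrow> l ^ ?D / (l + 2 * 0) ^ ?D) (at_right 0)"
      using l by (intro tendsto_intros) auto
    then show "(r \<longlongrightarrow> 1) (at_right 0)" using l by (simp add: r_def[abs_def])
  qed auto
  then have "\<forall>\<^sub>F \<eta> in at_right 0. t < \<tau> (cube a l) * ennreal (r \<eta>)"
    by (rule order_tendstoD(1)) (use t in simp)
  then have "\<forall>\<^sub>F \<eta> in at_right 0. t < \<tau> (cube a l) * ennreal (r \<eta>) \<and> \<eta> > (0::real)"
    using eventually_at_right_less by (rule eventually_conj)
  then obtain \<eta> where \<eta>: "t < \<tau> (cube a l) * ennreal (r \<eta>)" "\<eta> > 0"
    using eventually_happens'[OF trivial_limit_at_right_real] by blast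
  show "\<exists>b m. \<exists>\<eta>>0. m > 0 \<and> cube a l \<subseteq> cube b m \<and>
       (\<forall>Q\<in>cubes. cube b m \<subseteq> Q \<longrightarrow> Q \<subseteq> cube (\<chi> i. b $ i - \<eta>) (m + 2 * \<eta>) \<longrightarrow> t < \<tau> Q)"
  proof (rule exI[of _ a], rule exI[of _ l], rule exI[of _ \<eta>], intro conjI ballI impI \<eta>(2) l order_refl)
    fix Q assume Q: "Q \<in> cubes" "cube a l \<subseteq> Q" "Q \<subseteq> cube (\<chi> i. a $ i - \<eta>) (l + 2 * \<eta>)"
    have pos: "0 < (l + 2 * \<eta>) ^ ?D" "0 < l ^ ?D" using l \<eta> by auto
    have "emeasure lebesgue Q \<le> ennreal ((l + 2 * \<eta>) ^ ?D)"
      using emeasure_mono[OF Q(3), of lebesgue] l \<eta> by (simp add: emeasure_cube)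
    then have "\<tau> (cube a l) * ennreal (l ^ ?D) \<le> \<tau> Q * ennreal ((l + 2 * \<eta>) ^ ?D)"
      using mono[OF cube_in_cubes[OF l] Q(1,2)] l
      by (simp add: emeasure_cube) (meson mult_left_mono order_trans zero_le)
    then have "\<tau> (cube a l) * ennreal (l ^ ?D) * ennreal (1 / (l + 2 * \<eta>) ^ ?D)
        \<le> \<tau> Q * ennreal ((l + 2 * \<eta>) ^ ?D) * ennreal (1 / (l + 2 * \<eta>) ^ ?D)"
      by (rule mult_right_mono) simp
    then have "\<tau> (cube a l) * ennreal (r \<eta>) \<le> \<tau> Q"
      using pos l \<eta>(2) by (simp add: mult.assoc ennreal_mult[symmetric] r_def)
    then show "t < \<tau> Q" using \<eta>(1) by simp
  qed
qed

lemma emeasure_lebesgue_cubes: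
  assumes "Q \<in> cubes" shows "emeasure lebesgue Q = ennreal (measure lebesgue Q)" "measure lebesgue Q > 0"
  using assms by (auto elim!: cubesE simp: emeasure_cube measure_cube)

lemma ennreal_divide_mult_cancel: "m > 0 \<Longrightarrow> a / ennreal m * ennreal m = a"
  by (cases a) (auto simp: divide_ennreal ennreal_mult[symmetric] ennreal_top_divide ennreal_top_mult)

lemma ennreal_mult_divide_cancel: "m > 0 \<Longrightarrow> a * ennreal m / ennreal m = a"
  by (rule ennreal_mult_divide_eq) auto

lemma eavg_times_emeasure:
  "Q \<in> cubes \<Longrightarrow> eavg Q F * emeasure lebesgue Q = (\<integral>\<^sup>+x\<in>Q. F x \<partial>lebesgue)"
  using emeasure_lebesgue_cubes[of Q] by (simp add: eavg_def ennreal_divide_mult_cancel)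

lemma outer_cont_eavg: "outer_cont (\<lambda>Q. eavg Q F)"
  by (rule outer_cont_mono)
     (auto simp: eavg_times_emeasure split: split_indicator intro!: nn_integral_mono)

lemma weak_L1_norm_mono: "Q \<subseteq> Q' \<Longrightarrow> Q' \<in> sets lebesgue \<Longrightarrow> f \<in> L0 \<Longrightarrow> weak_L1_norm Q f \<le> weak_L1_norm Q' f"
  unfolding weak_L1_norm_def L0_def
  by (rule SUP_mono, rule bexI) (auto intro!: mult_left_mono emeasure_mono)

lemma osc_weak_times_emeasure:
  assumes "Q \<in> cubes"
  shows "osc_weak Q f * emeasure lebesgue Q = (INF c. weak_L1_norm Q (\<lambda>x. f x - c))"
proof -
  let ?m = "measure lebesgue Q"
  have m: "emeasure lebesgue Q = ennreal ?m" "?m > 0"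
    using emeasure_lebesgue_cubes[OF assms] by auto
  have eq: "osc_weak Q f = (INF c. weak_L1_norm Q (\<lambda>x. f x - c)) / emeasure lebesgue Q"
  proof (rule antisym)
    show "(INF c. weak_L1_norm Q (\<lambda>x. f x - c)) / emeasure lebesgue Q \<le> osc_weak Q f"
      unfolding osc_weak_def by (rule INF_greatest) (auto intro!: divide_right_mono_ennreal INF_lower)
    have "osc_weak Q f * emeasure lebesgue Q \<le> (INF c. weak_L1_norm Q (\<lambda>x. f x - c))"
    proof (rule INF_greatest)
      fix c
      have "osc_weak Q f * emeasure lebesgue Q \<le> weak_L1_norm Q (\<lambda>x. f x - c) / emeasure lebesgue Q * emeasure lebesgue Q"
        unfolding osc_weak_def by (intro mult_right_mono INF_lower) auto
      also have "\<dots> = weak_L1_norm Q (\<lambda>x. f x - c)"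
        using m by (simp add: ennreal_divide_mult_cancel)
      finally show "osc_weak Q f * emeasure lebesgue Q \<le> weak_L1_norm Q (\<lambda>x. f x - c)" .
    qed
    then have "osc_weak Q f * emeasure lebesgue Q / emeasure lebesgue Q \<le> (INF c. weak_L1_norm Q (\<lambda>x. f x - c)) / emeasure lebesgue Q"
      by (rule divide_right_mono_ennreal)
    then show "osc_weak Q f \<le> (INF c. weak_L1_norm Q (\<lambda>x. f x - c)) / emeasure lebesgue Q"
      using m by (simp add: ennreal_mult_divide_cancel)
  qed
  show ?thesis unfolding eq using m by (simp add: ennreal_divide_mult_cancel)
qed

lemma outer_cont_osc_weak:
  assumes "f \<in> L0" shows "outer_cont (\<lambda>Q. osc_weak Q f)"
proof (rule outer_cont_mono)
  fix Q Q' :: "(real^'a) set" assume "Q \<in> cubes" "Q' \<in> cubes" "Q \<subseteq> Q'"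
  then show "osc_weak Q f * emeasure lebesgue Q \<le> osc_weak Q' f * emeasure lebesgue Q'"
    using assms unfolding L0_def
    by (auto simp: osc_weak_times_emeasure intro!: INF_mono' weak_L1_norm_mono[unfolded L0_def] cubes_lebesgue)
qed


lemma osc_infinite:
  assumes "Q \<in> cubes" "f \<in> L0" "\<not> set_integrable lebesgue Q f"
  shows "osc Q f = \<infinity>"
proof (rule ccontr)
  assume a: "osc Q f \<noteq> \<infinity>"
  let ?m = "mean Q f"
  have "(\<integral>\<^sup>+x\<in>Q. eabs (\<lambda>x. f x - ?m) x \<partial>lebesgue) < \<infinity>"
    using a eavg_times_emeasure[OF assms(1), of "eabs (\<lambda>x. f x - ?m)"] emeasure_cubes_finite[OF assms(1)]
    by (simp add: osc_def avg1_eq ennreal_mult_less_top less_top flip: eavg_times_emeasure[OF assms(1)])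
  moreover have "(\<lambda>x. indicator Q x *\<^sub>R (f x - ?m)) \<in> borel_measurable lebesgue"
    using assms cubes_lebesgue unfolding L0_def by measurable
  ultimately have "integrable lebesgue (\<lambda>x. indicator Q x *\<^sub>R (f x - ?m))"
    by (intro integrableI_bounded)
       (auto simp: eabs_def ennreal_mult' mult.commute ennreal_indicator abs_mult cong: nn_integral_cong split: split_indicator)
  moreover have "integrable lebesgue (\<lambda>x. indicator Q x *\<^sub>R ?m)"
    using assms(1) emeasure_cubes_finite[OF assms(1)] cubes_lebesgue[OF assms(1)]
    by (intro integrable_scaleR_left integrable_real_indicator) auto
  ultimately have "integrable lebesgue (\<lambda>x. indicator Q x *\<^sub>R (f x - ?m) + indicator Q x *\<^sub>R ?m)"
    by (rule Bochner_Integration.integrable_add)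
  then show False using assms(3) by (simp add: set_integrable_def algebra_simps)
qed

lemma osc_times_measure:
  assumes "Q \<in> cubes" "set_integrable lebesgue Q f"
  shows "osc Q f = ennreal ((LINT x:Q|lebesgue. \<bar>f x - mean Q f\<bar>) / measure lebesgue Q)"
proof -
  have m: "measure lebesgue Q > 0" "emeasure lebesgue Q = ennreal (measure lebesgue Q)"
    using emeasure_lebesgue_cubes[OF assms(1)] by auto
  have "set_integrable lebesgue Q (\<lambda>x. \<bar>f x - mean Q f\<bar>)"
    using assms m cubes_lebesgue[OF assms(1)]
    by (intro set_integrable_abs set_integral_diff) (auto simp: set_integrable_def less_top[symmetric])
  then have "(\<integral>\<^sup>+x\<in>Q. eabs (\<lambda>x. f x - mean Q f) x \<partial>lebesgue) = ennreal (LINT x:Q|lebesgue. \<bar>f x - mean Q f\<bar>)"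
    unfolding set_integrable_def set_lebesgue_integral_def
    by (subst nn_integral_eq_integral[symmetric])
       (auto intro!: nn_integral_cong simp: eabs_def split: split_indicator)
  then show ?thesis using m
    by (simp add: osc_def avg1_def divide_ennreal set_lebesgue_integral_def)
qed

text \<open>If \<open>f\<close> is integrable near the cube, the mean oscillation is continuous by dominated
  convergence. Otherwise it is infinite on all cubes that contain a fixed larger one.\<close>

lemma outer_cont_osc:
  assumes f: "f \<in> L0" shows "outer_cont (\<lambda>Q. osc Q f)"
  unfolding outer_cont_def
proof (intro allI impI)
  fix a :: "real^'a" and l :: real and t assume l: "l > 0" and t: "t < osc (cube a l) f"
  define E where "E \<eta> = cube (\<chi> i. a $ i - \<eta>) (l + 2 * \<eta>)" for \<eta>
  have E0: "E 0 = cube a l" by (simp add: E_def)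
  have Emono: "E r \<subseteq> E s" if "r \<le> s" for r s
  proof
    fix x assume "x \<in> E r"
    then have "(a $ i - s) \<le> x $ i \<and> x $ i < (a $ i - s) + (l + 2 * s)" for i
      using that by (auto simp: E_def mem_cube dest: spec[of _ i])
    then show "x \<in> E s" by (simp add: E_def mem_cube)
  qed
  show "\<exists>b m. \<exists>\<eta>>0. m > 0 \<and> cube a l \<subseteq> cube b m \<and>
       (\<forall>Q\<in>cubes. cube b m \<subseteq> Q \<longrightarrow> Q \<subseteq> cube (\<chi> i. b $ i - \<eta>) (m + 2 * \<eta>) \<longrightarrow> t < osc Q f)"
  proof (cases "\<exists>\<eta>>0. set_integrable lebesgue (E \<eta>) f")
    case False
    have "t < osc Q f" if Q: "Q \<in> cubes" "E 1 \<subseteq> Q" for Q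
    proof -
      have "\<not> set_integrable lebesgue Q f"
        using False set_integrable_subset[OF _ _ Q(2), of lebesgue f] l
        by (auto simp: E_def dest!: spec[of _ 1])
      then have "osc Q f = \<infinity>" using osc_infinite Q f by blast
      then show ?thesis using t less_top by fastforce
    qed
    moreover have "cube a l \<subseteq> E 1" using Emono[of 0 1] E0 by simp
    ultimately show ?thesis using l
      by (intro exI[of _ "\<chi> i. a $ i - 1"] exI[of _ "l + 2"] exI[of _ 1]) (simp add: E_def)
  next
    case True
    then obtain \<eta>0 where \<eta>0: "\<eta>0 > 0" "set_integrable lebesgue (E \<eta>0) f" by blast
    show ?thesis
    proof (rule ccontr)
      assume neg: "\<not> ?thesis"
      have "\<exists>Q\<in>cubes. cube a l \<subseteq> Q \<and> Q \<subseteq> E (\<eta>0 / Suc n) \<and> osc Q f \<le> t" for n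
      proof (rule ccontr)
        assume "\<not> (\<exists>Q\<in>cubes. cube a l \<subseteq> Q \<and> Q \<subseteq> E (\<eta>0 / Suc n) \<and> osc Q f \<le> t)"
        then have "\<forall>Q\<in>cubes. cube a l \<subseteq> Q \<longrightarrow> Q \<subseteq> cube (\<chi> i. a $ i - \<eta>0 / Suc n) (l + 2 * (\<eta>0 / Suc n)) \<longrightarrow> t < osc Q f"
          unfolding E_def by (meson not_le)
        then show False using neg l \<eta>0(1)
          by (metis divide_pos_pos of_nat_0_less_iff order_refl zero_less_Suc)
      qed
      then obtain Q where Q: "\<And>n. Q n \<in> cubes" "\<And>n. cube a l \<subseteq> Q n"
        "\<And>n. Q n \<subseteq> E (\<eta>0 / Suc n)" "\<And>n. osc (Q n) f \<le> t" by metis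
      have QE: "Q n \<subseteq> E \<eta>0" for n
        using Q(3)[of n] Emono[of "\<eta>0 / Suc n" \<eta>0] \<eta>0(1) by (auto simp: field_simps)
      let ?Q0 = "cube a l" and ?\<mu> = "measure lebesgue"
      have Q0: "?Q0 \<in> cubes" using l by auto
      have ind: "AE x in lebesgue. (\<lambda>n. indicator (Q n) x :: real) \<longlonglongrightarrow> indicator ?Q0 x"
      proof -
        let ?b = "\<chi> i. a $ i + l"
        have "cbox a ?b - box a ?b \<in> null_sets lborel"
          using l by (subst null_sets_def)
            (auto simp: emeasure_Diff emeasure_lborel_box_eq emeasure_lborel_cbox_eq box_subset_cbox
              Basis_vec_def prod.UNION_disjoint inner_axis)
        then have "AE x in lebesgue. x \<notin> cbox a ?b - box a ?b"
          using AE_not_in null_sets_completionI by blast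
        then show ?thesis
        proof eventually_elim
          case (elim x)
          show ?case
          proof (cases "x \<in> ?Q0")
            case True
            then have "\<And>n. x \<in> Q n" using Q(2) by blast
            then show ?thesis using True by simp
          next
            case False
            have "x \<notin> cbox a ?b"
            proof
              assume "x \<in> cbox a ?b"
              with elim have "x \<in> box a ?b" by blast
              then show False using False by (auto simp: mem_cube mem_box_cart less_imp_le)
            qed
            then obtain i where i: "x $ i < a $ i \<or> x $ i > a $ i + l"
              by (auto simp: mem_box_cart not_le)
            define \<delta> where "\<delta> = max (a $ i - x $ i) (x $ i - (a $ i + l))"
            have "\<delta> > 0" using i by (auto simp: \<delta>_def)
            have "(\<lambda>n. \<eta>0 / Suc n) \<longlonglongrightarrow> 0"
              by (rule LIMSEQ_Suc[OF lim_const_over_n])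
            then have "\<forall>\<^sub>F n in sequentially. \<eta>0 / Suc n < \<delta>"
              using \<open>\<delta> > 0\<close> by (rule order_tendstoD(2))
            then have "\<forall>\<^sub>F n in sequentially. indicator (Q n) x = (0::real)"
            proof eventually_elim
              case (elim n)
              have "x \<notin> E (\<eta>0 / Suc n)"
              proof
                assume "x \<in> E (\<eta>0 / Suc n)"
                then have "a $ i - \<eta>0 / Suc n \<le> x $ i \<and> x $ i < a $ i - \<eta>0 / Suc n + (l + 2 * (\<eta>0 / Suc n))"
                  by (simp add: E_def mem_cube)
                then show False using elim i by (auto simp: \<delta>_def)
              qed
              then show ?case using Q(3)[of n] by (auto simp: indicator_def)
            qed
            then show ?thesis using False by (simp add: tendsto_eventually)
          qed
        qed
      qed
      have Elm: "E \<eta>0 \<in> sets lebesgue" by (simp add: E_def)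
      have fl: "integrable lebesgue (\<lambda>x. indicator (E \<eta>0) x * \<bar>f x\<bar>)"
        using set_integrable_abs[OF \<eta>0(2)] by (simp add: set_integrable_def)
      have cl: "integrable lebesgue (\<lambda>x. indicator (E \<eta>0) x :: real)"
        using Elm l \<eta>0 by (intro integrable_real_indicator) (auto simp: E_def emeasure_cube)
      have fm[measurable]: "f \<in> borel_measurable lebesgue" using f by (simp add: L0_def)
      have Qm[measurable]: "Q n \<in> sets lebesgue" for n using Q(1) cubes_lebesgue by blast
      have int: "(\<lambda>n. LINT x:Q n|lebesgue. f x) \<longlonglongrightarrow> (LINT x:?Q0|lebesgue. f x)"
        unfolding set_lebesgue_integral_def
      proof (rule integral_dominated_convergence[OF _ _ fl])
        show "AE x in lebesgue. (\<lambda>n. indicator (Q n) x *\<^sub>R f x) \<longlonglongrightarrow> indicator ?Q0 x *\<^sub>R f x"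
          using ind by eventually_elim (intro tendsto_intros)
        show "AE x in lebesgue. norm (indicator (Q n) x *\<^sub>R f x) \<le> indicator (E \<eta>0) x * \<bar>f x\<bar>" for n
          using QE[of n] by (auto split: split_indicator)
      qed measurable
      have meas: "(\<lambda>n. ?\<mu> (Q n)) \<longlonglongrightarrow> ?\<mu> ?Q0"
      proof -
        have "(\<lambda>n. LINT x|lebesgue. indicator (Q n) x :: real) \<longlonglongrightarrow> (LINT x|lebesgue. indicator ?Q0 x)"
          by (rule integral_dominated_convergence[OF _ _ cl])
             (use ind QE in \<open>auto split: split_indicator\<close>)
        then show ?thesis by simp
      qed
      have mpos: "?\<mu> ?Q0 > 0" using emeasure_lebesgue_cubes[OF Q0] by simp
      have mean: "(\<lambda>n. mean (Q n) f) \<longlonglongrightarrow> mean ?Q0 f"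
        unfolding mean_def using mpos by (intro tendsto_intros int meas) simp
      then have "Bseq (\<lambda>n. mean (Q n) f)"
        by (intro convergent_imp_Bseq convergentI)
      then obtain B where B: "\<And>n. \<bar>mean (Q n) f\<bar> \<le> B"
        by (auto simp: Bseq_def)
      have "(\<lambda>n. LINT x:Q n|lebesgue. \<bar>f x - mean (Q n) f\<bar>) \<longlonglongrightarrow> (LINT x:?Q0|lebesgue. \<bar>f x - mean ?Q0 f\<bar>)"
        unfolding set_lebesgue_integral_def
      proof (rule integral_dominated_convergence[OF _ _ Bochner_Integration.integrable_add[OF fl integrable_mult_right[OF cl, of B]]])
        show "AE x in lebesgue. (\<lambda>n. indicator (Q n) x *\<^sub>R \<bar>f x - mean (Q n) f\<bar>) \<longlonglongrightarrow> indicator ?Q0 x *\<^sub>R \<bar>f x - mean ?Q0 f\<bar>"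
          using ind by eventually_elim (intro tendsto_intros mean)
        have "indicator (Q n) x * \<bar>f x - mean (Q n) f\<bar> \<le> indicator (E \<eta>0) x * \<bar>f x\<bar> + B * indicator (E \<eta>0) x" for n x
          using QE[of n] B[of n] by (auto split: split_indicator intro: order_trans[OF abs_ge_zero])
        then show "AE x in lebesgue. norm (indicator (Q n) x *\<^sub>R \<bar>f x - mean (Q n) f\<bar>) \<le> indicator (E \<eta>0) x * \<bar>f x\<bar> + B * indicator (E \<eta>0) x" for n
          by simp
      qed measurable
      then have "(\<lambda>n. ennreal ((LINT x:Q n|lebesgue. \<bar>f x - mean (Q n) f\<bar>) / ?\<mu> (Q n)))
          \<longlonglongrightarrow> ennreal ((LINT x:?Q0|lebesgue. \<bar>f x - mean ?Q0 f\<bar>) / ?\<mu> ?Q0)"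
        using mpos by (intro tendsto_ennrealI tendsto_divide meas) auto
      moreover have qn: "set_integrable lebesgue (Q n) f" for n
        by (rule set_integrable_subset[OF \<eta>0(2) _ QE]) simp
      moreover have q0: "set_integrable lebesgue ?Q0 f"
        by (rule set_integrable_subset[OF \<eta>0(2)]) (use QE Q(2) in auto)
      ultimately have "(\<lambda>n. osc (Q n) f) \<longlonglongrightarrow> osc ?Q0 f"
        by (simp only: osc_times_measure[OF Q(1) qn] osc_times_measure[OF Q0 q0])
      then have "osc ?Q0 f \<le> t" using Q(4) by (intro LIMSEQ_le_const2) auto
      then show False using t by simp
    qed
  qed
qed


lemma eM_measurable [measurable]: "eM F \<in> borel_measurable lebesgue"
  unfolding eM_def by (rule cube_sup_measurable[OF outer_cont_eavg])

lemma sharp_max_weak_measurable: "f \<in> L0 \<Longrightarrow> sharp_max_weak f \<in> borel_measurable lebesgue"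
  unfolding sharp_max_weak_eq by (intro cube_sup_measurable outer_cont_osc_weak)

lemma eavg_le_eM: "Q \<in> cubes \<Longrightarrow> x \<in> Q \<Longrightarrow> eavg Q F \<le> eM F x"
  unfolding eM_def by (rule cube_sup_upper)

lemma eavg_cong_AE: "(AE x in lebesgue. F x = G x) \<Longrightarrow> eavg Q F = eavg Q G"
  unfolding eavg_def by (intro arg_cong2[where f="(/)"] nn_integral_cong_AE) auto

lemma eM_cong_AE: "(AE x in lebesgue. F x = G x) \<Longrightarrow> eM F = eM G"
  unfolding eM_def by (simp add: eavg_cong_AE)

lemma eavg_mono: "(\<And>x. F x \<le> G x) \<Longrightarrow> eavg Q F \<le> eavg Q G"
  unfolding eavg_def by (intro divide_right_mono_ennreal nn_integral_mono mult_right_mono) auto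

lemma eM_mono: "(\<And>x. F x \<le> G x) \<Longrightarrow> eM F x \<le> eM G x"
  unfolding eM_def
  by (rule cube_sup_least) (meson cube_sup_upper eavg_mono order_trans)

lemma eavg_const: "Q \<in> cubes \<Longrightarrow> eavg Q (\<lambda>x. c) = c"
  using emeasure_lebesgue_cubes[of Q] cubes_lebesgue[of Q]
  by (simp add: eavg_def nn_integral_cmult_indicator ennreal_mult_divide_cancel)

text \<open>By Chebyshev's inequality. Upper bounds of functions by the weak sharp maximal function
  are therefore the stronger ones, and only these are proved.\<close>

lemma osc_weak_le_osc:
  assumes Q: "Q \<in> cubes" and f: "f \<in> L0"
  shows "osc_weak Q f \<le> osc Q f"
proof -
  let ?g = "\<lambda>x. f x - mean Q f"
  have [measurable]: "f \<in> borel_measurable lebesgue" "Q \<in> sets lebesgue"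
    using f Q cubes_lebesgue by (auto simp: L0_def)
  have "weak_L1_norm Q ?g \<le> (\<integral>\<^sup>+x\<in>Q. eabs ?g x \<partial>lebesgue)"
    unfolding weak_L1_norm_def
  proof (rule SUP_least)
    fix t :: real assume t: "t \<in> {0<..}"
    have "ennreal t * emeasure lebesgue {x\<in>Q. \<bar>?g x\<bar> > t} = (\<integral>\<^sup>+x. ennreal t * indicator {x\<in>Q. \<bar>?g x\<bar> > t} x \<partial>lebesgue)"
      by (subst nn_integral_cmult_indicator) auto
    also have "\<dots> \<le> (\<integral>\<^sup>+x\<in>Q. eabs ?g x \<partial>lebesgue)"
      by (intro nn_integral_mono) (auto simp: eabs_def split: split_indicator intro!: ennreal_leI)
    finally show "ennreal t * emeasure lebesgue {x\<in>Q. \<bar>?g x\<bar> > t} \<le> (\<integral>\<^sup>+x\<in>Q. eabs ?g x \<partial>lebesgue)" .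
  qed
  then show ?thesis
    unfolding osc_weak_def osc_def avg1_def
    by (intro INF_lower2[of "mean Q f"] divide_right_mono_ennreal) auto
qed

section \<open>Stopping cubes\<close>

lemma cubes_lmeasurable: "Q \<in> cubes \<Longrightarrow> Q \<in> lmeasurable"
  using emeasure_cubes_finite cubes_lebesgue by (auto simp: fmeasurable_def)

definition dyadic :: "real^'n::finite \<Rightarrow> real \<Rightarrow> nat \<Rightarrow> real^'n \<Rightarrow> (real^'n) set" where
  "dyadic a l n x = cube (\<chi> i. a $ i + l / 2 ^ n * of_int \<lfloor>2 ^ n * (x $ i - a $ i) / l\<rfloor>) (l / 2 ^ n)"

lemma mem_dyadic:
  assumes "l > 0"
  shows "y \<in> dyadic a l n x \<longleftrightarrow>
    (\<forall>i. \<lfloor>2 ^ n * (y $ i - a $ i) / l\<rfloor> = \<lfloor>2 ^ n * (x $ i - a $ i) / l\<rfloor>)"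
proof -
  have "(a $ i + l / 2 ^ n * of_int k \<le> y $ i \<and> y $ i < a $ i + l / 2 ^ n * of_int k + l / 2 ^ n)
      \<longleftrightarrow> \<lfloor>2 ^ n * (y $ i - a $ i) / l\<rfloor> = k" for i k
    using assms by (subst floor_eq_iff) (auto simp: field_simps)
  then show ?thesis by (simp add: dyadic_def mem_cube)
qed

lemma dyadic_in_cubes: "l > 0 \<Longrightarrow> dyadic a l n x \<in> cubes"
  by (auto simp: dyadic_def)

lemma dyadic_self: "l > 0 \<Longrightarrow> x \<in> dyadic a l n x"
  by (simp add: mem_dyadic)

lemma dyadic_eq: "l > 0 \<Longrightarrow> y \<in> dyadic a l n x \<Longrightarrow> dyadic a l n y = dyadic a l n x"
  by (auto simp: mem_dyadic set_eq_iff)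

lemma dyadic_Suc_subset: assumes "l > 0" shows "dyadic a l (Suc n) x \<subseteq> dyadic a l n x"
proof
  fix y assume y: "y \<in> dyadic a l (Suc n) x"
  have "\<lfloor>2 ^ n * (z $ i - a $ i) / l\<rfloor> = \<lfloor>2 ^ Suc n * (z $ i - a $ i) / l\<rfloor> div 2" for z i
    using floor_divide_real_eq_div[of 2 "2 ^ Suc n * (z $ i - a $ i) / l"] by simp
  then show "y \<in> dyadic a l n x" using y assms by (simp add: mem_dyadic)
qed

lemma dyadic_antimono: "l > 0 \<Longrightarrow> m \<le> n \<Longrightarrow> dyadic a l n x \<subseteq> dyadic a l m x"
  by (rule lift_Suc_antimono_le[of "\<lambda>n. dyadic a l n x"]) (auto dest: dyadic_Suc_subset[THEN subsetD])

lemma dyadic_0: "l > 0 \<Longrightarrow> x \<in> cube a l \<Longrightarrow> dyadic a l 0 x = cube a l"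
proof -
  assume l: "l > 0" and x: "x \<in> cube a l"
  have "\<lfloor>(x $ i - a $ i) / l\<rfloor> = 0" for i
    using x l by (auto simp: mem_cube floor_eq_iff field_simps dest: spec[of _ i])
  then show ?thesis by (simp add: dyadic_def)
qed

lemma measure_dyadic: "l > 0 \<Longrightarrow> measure lebesgue (dyadic a l n (x::real^'n::finite)) = (l / 2 ^ n) ^ CARD('n)"
  by (simp add: dyadic_def measure_cube)

lemma measure_dyadic_Suc:
  "l > 0 \<Longrightarrow> measure lebesgue (dyadic a l n (x::real^'n::finite)) = 2 ^ CARD('n) * measure lebesgue (dyadic a l (Suc n) x)"
  by (simp add: measure_dyadic power_divide power_mult_distrib)

lemma cube_component_diff: "x \<in> cube b r \<Longrightarrow> y \<in> cube b r \<Longrightarrow> \<bar>x $ i - y $ i\<bar> \<le> r"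
proof -
  assume "x \<in> cube b r" "y \<in> cube b r"
  then have "b $ i \<le> x $ i" "x $ i < b $ i + r" "b $ i \<le> y $ i" "y $ i < b $ i + r"
    by (auto simp: mem_cube)
  then show "\<bar>x $ i - y $ i\<bar> \<le> r" by linarith
qed

lemma dyadic_in_open:
  assumes "l > 0" "open T" "x \<in> T"
  shows "\<exists>n. dyadic a l n (x::real^'n::finite) \<subseteq> T"
proof -
  obtain e where e: "e > 0" "ball x e \<subseteq> T" using assms openE by blast
  have "(\<lambda>n. real CARD('n) * (l * (1/2) ^ n)) \<longlonglongrightarrow> real CARD('n) * (l * 0)"
    by (intro tendsto_intros) simp
  then have "\<forall>\<^sub>F n in sequentially. real CARD('n) * (l * (1/2) ^ n) < e"
    using e(1) by (intro order_tendstoD(2)) auto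
  then obtain n where n: "real CARD('n) * (l * (1/2) ^ n) < e"
    by (auto simp: eventually_sequentially)
  have "dyadic a l n x \<subseteq> ball x e"
  proof
    fix y assume y: "y \<in> dyadic a l n x"
    have x: "x \<in> dyadic a l n x" using assms by (simp add: dyadic_self)
    have "\<bar>(x - y) $ i\<bar> \<le> l * (1/2) ^ n" for i
      using cube_component_diff[OF x[unfolded dyadic_def] y[unfolded dyadic_def], of i]
      by (simp add: power_one_over)
    then have "(\<Sum>i\<in>UNIV. \<bar>(x - y) $ i\<bar>) \<le> (\<Sum>i\<in>(UNIV::'n set). l * (1/2) ^ n)"
      by (rule sum_mono)
    then have "norm (x - y) \<le> (\<Sum>i\<in>(UNIV::'n set). l * (1/2) ^ n)"
      using norm_le_l1_cart[of "x - y"] by linarith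
    then show "y \<in> ball x e" using n by (simp add: dist_norm)
  qed
  then show ?thesis using e(2) by blast
qed

lemma cubes_interior: "Q \<in> cubes \<Longrightarrow> interior Q \<noteq> {}"
proof -
  assume "Q \<in> cubes"
  then obtain a l where al: "Q = cube a l" "l > 0" by (rule cubesE)
  have "box a (\<chi> i. a $ i + l) \<subseteq> interior Q"
    by (rule interior_maximal) (auto simp: al mem_cube mem_box_cart less_imp_le)
  moreover have "(\<chi> i. a $ i + l / 2) \<in> box a (\<chi> i. a $ i + l)" using al by (simp add: mem_box_cart)
  ultimately show ?thesis by blast
qed

lemma countable_disjoint_cubes:
  assumes "P \<subseteq> cubes" "disjoint P" shows "countable (P :: (real^'n::finite) set set)"
  by (rule countable_disjoint_nonempty_interior_subsets[OF assms(2)]) (use assms(1) cubes_interior in blast)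

lemma nn_integral_UN_disjoint:
  assumes "countable P" "disjoint P" "\<And>q. q \<in> P \<Longrightarrow> q \<in> sets M" "F \<in> borel_measurable M"
  shows "(\<integral>\<^sup>+x\<in>\<Union>P. F x \<partial>M) = (\<integral>\<^sup>+q. (\<integral>\<^sup>+x\<in>q. F x \<partial>M) \<partial>count_space P)"
proof -
  have "emeasure (density M F) (\<Union>P) = (\<integral>\<^sup>+q. emeasure (density M F) q \<partial>count_space P)"
    using emeasure_UN_countable[of P "\<lambda>q. q" "density M F"] assms
    by (simp add: disjoint_family_on_def disjoint_def)
  also have "\<dots> = (\<integral>\<^sup>+q. (\<integral>\<^sup>+x\<in>q. F x \<partial>M) \<partial>count_space P)"
    using assms by (intro nn_integral_cong) (simp add: emeasure_density)
  finally show ?thesis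
    using assms by (subst (asm) emeasure_density) (auto intro: sets.countable_Union)
qed

text \<open>
  The stopping cubes are the maximal dyadic subcubes in which an open superset of \<open>E\<close> has density
  above \<open>2\<^sup>-\<^sup>d\<^sup>-\<^sup>1\<close>. Openness makes every point of \<open>E\<close> lie in such a cube, so no density theorem is
  used; maximality bounds the density by \<open>1/2\<close>, since the parent has volume \<open>2\<^sup>d\<close> times as large.
\<close>

lemma calderon_zygmund:
  assumes Q: "Q \<in> (cubes :: (real^'n::finite) set set)" and E: "E \<in> sets lebesgue" "E \<subseteq> Q"
    and small: "measure lebesgue E < measure lebesgue Q / (4 * 2 ^ CARD('n))"
  obtains P where "countable P" "P \<subseteq> cubes" "disjoint P" "\<And>q. q \<in> P \<Longrightarrow> q \<subseteq> Q" "E \<subseteq> \<Union>P"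
    "\<And>q. q \<in> P \<Longrightarrow> measure lebesgue (E \<inter> q) \<le> measure lebesgue q / 2"
    "measure lebesgue (\<Union>P) \<le> measure lebesgue Q / 2"
proof -
  let ?\<mu> = "measure lebesgue" and ?D = "CARD('n)"
  obtain a l where al: "Q = cube a l" "l > 0" using Q by (rule cubesE)
  define D where "D = dyadic a l"
  have Qm: "Q \<in> lmeasurable" using Q emeasure_cubes_finite cubes_lebesgue by (auto simp: fmeasurable_def)
  define e where "e = ?\<mu> Q / (4 * 2 ^ ?D) - ?\<mu> E"
  have "e > 0" using small by (simp add: e_def)
  then obtain T where T: "open T" "E \<subseteq> T" "T - E \<in> lmeasurable" "emeasure lebesgue (T - E) < ennreal e"
    using sets_lebesgue_outer_open[OF E(1)] by metis
  define U where "U = T \<inter> Q"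
  have Em: "E \<in> lmeasurable" using fmeasurableI2[OF Qm E(2,1)] .
  have Um: "U \<in> lmeasurable" unfolding U_def 
    using fmeasurable_Int_fmeasurable[OF Qm, of T] T(1) by (simp add: Int_commute borel_open)
  have "?\<mu> U \<le> ?\<mu> (E \<union> (T - E))"
    using Um by (intro measure_mono_fmeasurable fmeasurable.Un Em T(3)) (auto simp: U_def fmeasurableD)
  also have "\<dots> \<le> ?\<mu> E + ?\<mu> (T - E)" using Em T(3) by (intro measure_Un_le) auto
  also have "?\<mu> (T - E) < e"
    using T(3,4) \<open>e > 0\<close> by (simp add: emeasure_eq_measure2 ennreal_less_iff)
  finally have Usmall: "?\<mu> U < ?\<mu> Q / (4 * 2 ^ ?D)" by (simp add: e_def)
  have Dm: "D n x \<in> lmeasurable" for n x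
    unfolding D_def by (rule cubes_lmeasurable[OF dyadic_in_cubes[OF al(2)]])
  \<comment> \<open>\<open>S n x\<close>: stop at generation \<open>n\<close>. It fails for \<open>n = 0\<close> since \<open>U\<close> is small in \<open>Q\<close>.\<close>
  define S where "S n x \<longleftrightarrow> ?\<mu> (U \<inter> D n x) > ?\<mu> (D n x) / (2 * 2 ^ ?D)" for n x
  have muD: "?\<mu> (D n x) > 0" for n x using al by (simp add: D_def measure_dyadic)
  have S0: "\<not> S 0 x" if "x \<in> Q" for x
  proof -
    have "D 0 x = Q" using that al by (simp add: D_def dyadic_0)
    moreover have "?\<mu> Q / (4 * 2 ^ ?D) \<le> ?\<mu> Q / (2 * 2 ^ ?D)" by (intro divide_left_mono) auto
    moreover have "U \<inter> Q = U" by (auto simp: U_def)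
    ultimately show ?thesis using Usmall by (simp add: S_def)
  qed
  have DQ: "D n x \<subseteq> Q" if "x \<in> Q" for n x
    using dyadic_antimono[OF al(2), of 0 n a x] that al by (simp add: D_def dyadic_0)
  have Sex: "\<exists>n. S n x" if x: "x \<in> U" for x
  proof -
    obtain n where n: "D n x \<subseteq> T" using dyadic_in_open[OF al(2) T(1), of x a] x by (auto simp: U_def D_def)
    then have "U \<inter> D n x = D n x" using DQ[of x n] x by (auto simp: U_def)
    moreover have "(1::real) \<le> 2 ^ ?D" by simp
    then have "(1::real) < 2 * 2 ^ ?D" by linarith
    then have "?\<mu> (D n x) / (2 * 2 ^ ?D) < ?\<mu> (D n x) / 1"
      using muD by (intro divide_strict_left_mono) auto
    ultimately have "S n x" by (simp add: S_def)
    then show ?thesis ..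
  qed
  define N where "N x = (LEAST n. S n x)" for x
  have N: "S (N x) x" if "\<exists>n. S n x" for x using that unfolding N_def by (rule LeastI_ex)
  have Nmin: "N x \<le> n" if "S n x" for x n using that unfolding N_def by (rule Least_le)
  define P where "P = (\<lambda>x. D (N x) x) ` {x\<in>Q. \<exists>n. S n x}"
  have Pc: "P \<subseteq> cubes" by (auto simp: P_def D_def al dyadic_in_cubes)
  \<comment> \<open>If two stopping cubes meet, the larger one contains both points, so both stop there.\<close>
  have same: "D (N x) x = D (N y) y"
    if xy: "\<exists>n. S n x" "\<exists>n. S n y" "N x \<le> N y" "z \<in> D (N x) x" "z \<in> D (N y) y" for x y z
  proof -
    have "z \<in> D (N x) y" using dyadic_antimono[OF al(2) xy(3)] xy(5) by (auto simp: D_def)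
    then have eq: "D (N x) y = D (N x) x" using dyadic_eq[OF al(2)] xy(4) unfolding D_def by metis
    then have "S (N x) y" using N[OF xy(1)] by (simp add: S_def)
    then have "N y \<le> N x" by (rule Nmin)
    then show ?thesis using eq xy(3) by simp
  qed
  have Pd: "disjoint P"
  proof (rule disjointI)
    fix p q assume pq: "p \<in> P" "q \<in> P" "p \<noteq> q"
    then obtain x y where xy: "p = D (N x) x" "\<exists>n. S n x" "q = D (N y) y" "\<exists>n. S n y"
      unfolding P_def by auto
    show "p \<inter> q = {}"
    proof (rule ccontr)
      assume "p \<inter> q \<noteq> {}"
      then obtain z where "z \<in> p" "z \<in> q" by auto
      then have "p = q" using same[of x y z] same[of y x z] xy by (cases "N x \<le> N y") auto
      then show False using pq by simp
    qed
  qed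
  have Pcount: "countable P" using countable_disjoint_cubes Pc Pd by blast
  have PS: "?\<mu> (U \<inter> q) > ?\<mu> q / (2 * 2 ^ ?D)" if "q \<in> P" for q
    using that N by (auto simp: P_def S_def)
  have PQ: "q \<subseteq> Q" if "q \<in> P" for q using that DQ by (auto simp: P_def)
  have EP: "E \<subseteq> \<Union>P"
  proof
    fix x assume x: "x \<in> E"
    then have "x \<in> U" "x \<in> Q" using T(2) E(2) by (auto simp: U_def)
    then have "D (N x) x \<in> P" using Sex by (auto simp: P_def)
    then show "x \<in> \<Union>P" using dyadic_self[OF al(2)] by (auto simp: D_def)
  qed
  have half: "?\<mu> (E \<inter> q) \<le> ?\<mu> q / 2" if q: "q \<in> P" for q
  proof -
    obtain x where x: "q = D (N x) x" "x \<in> Q" "\<exists>n. S n x" using q unfolding P_def by auto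
    have "N x \<noteq> 0" using N[OF x(3)] S0[OF x(2)] by metis
    then obtain m where m: "N x = Suc m" using not0_implies_Suc by blast
    have "\<not> S m x" using Nmin[of m x] m by auto
    then have "?\<mu> (U \<inter> D m x) \<le> ?\<mu> (D m x) / (2 * 2 ^ ?D)" by (simp add: S_def)
    also have "\<dots> = ?\<mu> q / 2"
      using measure_dyadic_Suc[OF al(2), of a m x] by (simp add: x m D_def)
    finally have 1: "?\<mu> (U \<inter> D m x) \<le> ?\<mu> q / 2" .
    have "E \<inter> q \<subseteq> U \<inter> D m x"
      using T(2) E(2) dyadic_Suc_subset[OF al(2), of a m x] by (auto simp: U_def x m D_def)
    then have "?\<mu> (E \<inter> q) \<le> ?\<mu> (U \<inter> D m x)"
      using sets.Int[OF E(1) cubes_lebesgue[OF subsetD[OF Pc q]]] fmeasurable_Int_fmeasurable[OF Um fmeasurableD[OF Dm]]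
      by (intro measure_mono_fmeasurable) auto
    then show ?thesis using 1 by simp
  qed
  have Pm: "q \<in> sets lebesgue" if "q \<in> P" for q using that Pc cubes_lebesgue by blast
  have "\<Union>P \<in> sets lebesgue" using Pcount Pm by (intro sets.countable_Union) auto
  then have "emeasure lebesgue (\<Union>P) = (\<integral>\<^sup>+q. emeasure lebesgue q \<partial>count_space P)"
    using nn_integral_UN_disjoint[OF Pcount Pd, of lebesgue "\<lambda>_. 1"] Pm
    by (simp cong: nn_integral_cong_simp)
  also have "\<dots> \<le> (\<integral>\<^sup>+q. ennreal (2 * 2 ^ ?D) * (\<integral>\<^sup>+x\<in>q. indicator U x \<partial>lebesgue) \<partial>count_space P)"
  proof (intro nn_integral_mono)
    fix q assume "q \<in> space (count_space P)"
    then have q: "q \<in> P" by simp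
    have "ennreal (?\<mu> q) \<le> ennreal (2 * 2 ^ ?D * ?\<mu> (U \<inter> q))"
      using PS[OF q] by (intro ennreal_leI) (simp add: field_simps)
    moreover have "U \<inter> q \<in> lmeasurable" using Um Pm[OF q] by (rule fmeasurable_Int_fmeasurable)
    ultimately have "emeasure lebesgue q \<le> ennreal (2 * 2 ^ ?D) * emeasure lebesgue (U \<inter> q)"
      using emeasure_lebesgue_cubes[of q] q Pc
      by (auto simp: emeasure_eq_measure2 ennreal_mult)
    also have "emeasure lebesgue (U \<inter> q) = (\<integral>\<^sup>+x\<in>q. indicator U x \<partial>lebesgue)"
    proof -
      have "(\<integral>\<^sup>+x\<in>q. indicator U x \<partial>lebesgue) = (\<integral>\<^sup>+x. indicator (U \<inter> q) x \<partial>lebesgue)"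
        by (intro nn_integral_cong) (simp add: indicator_inter_arith)
      then show ?thesis using Um Pm[OF q] by (simp add: fmeasurableD)
    qed
    finally show "emeasure lebesgue q \<le> ennreal (2 * 2 ^ ?D) * (\<integral>\<^sup>+x\<in>q. indicator U x \<partial>lebesgue)" .
  qed
  also have "\<dots> = ennreal (2 * 2 ^ ?D) * (\<integral>\<^sup>+x\<in>\<Union>P. indicator U x \<partial>lebesgue)"
    using Um by (subst nn_integral_UN_disjoint[OF Pcount Pd Pm]) (auto simp: nn_integral_cmult)
  also have "(\<integral>\<^sup>+x\<in>\<Union>P. indicator U x \<partial>lebesgue) \<le> (\<integral>\<^sup>+x. indicator U x \<partial>lebesgue)"
    by (intro nn_integral_mono) (auto split: split_indicator)
  also have "(\<integral>\<^sup>+x. indicator U x \<partial>lebesgue) = ennreal (?\<mu> U)"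
    using Um by (simp add: emeasure_eq_measure2)
  finally have "emeasure lebesgue (\<Union>P) \<le> ennreal (2 * 2 ^ ?D * ?\<mu> U)"
    by (simp add: ennreal_mult mult_left_mono)
  also have "\<dots> \<le> ennreal (?\<mu> Q / 2)" using Usmall by (intro ennreal_leI) (simp add: field_simps)
  finally have "enn2real (emeasure lebesgue (\<Union>P)) \<le> ?\<mu> Q / 2"
    by (rule enn2real_leI[rotated]) simp
  then have fin: "?\<mu> (\<Union>P) \<le> ?\<mu> Q / 2" by (simp only: measure_def)
  show ?thesis by (rule that[OF Pcount Pc Pd PQ EP half fin])
qed


section \<open>Medians and the iteration over stopping cubes\<close>

text \<open>Medians serve as the constants approximating \<open>g\<close>: they exist for every measurable \<open>g\<close> and depend
  only on its distribution on \<open>Q\<close>, while the infimum over constants in the weak oscillation need not be attained.\<close>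

definition med :: "(real^'n::finite) set \<Rightarrow> 'n rfun \<Rightarrow> real" where
  "med Q g = Inf {c. measure lebesgue {x\<in>Q. g x > c} \<le> measure lebesgue Q / 2}"

lemma level_lmeasurable:
  assumes "Q \<in> cubes" "g \<in> L0"
  shows "{x\<in>Q. g x > c} \<in> lmeasurable" "{x\<in>Q. g x < c} \<in> lmeasurable" "{x\<in>Q. \<bar>g x - b\<bar> > c} \<in> lmeasurable"
    "{x\<in>Q. g x \<le> c} \<in> lmeasurable"
proof -
  have [measurable]: "g \<in> borel_measurable lebesgue" "Q \<in> sets lebesgue"
    using assms cubes_lebesgue by (auto simp: L0_def)
  have "Q \<in> lmeasurable" using assms emeasure_cubes_finite by (auto simp: fmeasurable_def)
  then show "{x\<in>Q. g x > c} \<in> lmeasurable" "{x\<in>Q. g x < c} \<in> lmeasurable" "{x\<in>Q. \<bar>g x - b\<bar> > c} \<in> lmeasurable"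
    "{x\<in>Q. g x \<le> c} \<in> lmeasurable"
    by (rule fmeasurableI2; auto)+
qed

lemma measure_level_compl:
  assumes "Q \<in> cubes" "g \<in> L0"
  shows "measure lebesgue {x\<in>Q. g x \<le> c} = measure lebesgue Q - measure lebesgue {x\<in>Q. g x > c}"
proof -
  have "{x\<in>Q. g x \<le> c} = Q - {x\<in>Q. g x > c}" by auto
  then show ?thesis
    using level_lmeasurable(1)[OF assms, of c] assms emeasure_cubes_finite[of Q] cubes_lebesgue[of Q]
    by (simp add: measurable_measure_Diff fmeasurable_def fmeasurableD2)
qed

lemma med_levels:
  assumes Q: "Q \<in> cubes" and g: "g \<in> L0"
  shows "measure lebesgue {x\<in>Q. g x > med Q g} \<le> measure lebesgue Q / 2"
    and "measure lebesgue {x\<in>Q. g x < med Q g} \<le> measure lebesgue Q / 2"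
proof -
  let ?\<mu> = "measure lebesgue"
  let ?C = "{c. ?\<mu> {x\<in>Q. g x > c} \<le> ?\<mu> Q / 2}"
  note lm = level_lmeasurable[OF Q g]
  have Qm: "Q \<in> lmeasurable" using Q emeasure_cubes_finite cubes_lebesgue by (auto simp: fmeasurable_def)
  have pos: "?\<mu> Q > 0" using emeasure_lebesgue_cubes[OF Q] by simp
  have U1: "(\<Union>n. {x\<in>Q. g x \<le> real n}) = Q" using real_arch_simple by fastforce
  have U2: "(\<Union>n. {x\<in>Q. g x > - real n}) = Q"
  proof -
    have "\<exists>n. g x > - real n" for x using reals_Archimedean2[of "- g x"] by (auto simp: minus_less_iff)
    then show ?thesis by auto
  qed
  have up: "(\<lambda>n. ?\<mu> {x\<in>Q. g x \<le> real n}) \<longlonglongrightarrow> ?\<mu> (\<Union>n. {x\<in>Q. g x \<le> real n})"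
    using lm(4) Qm by (intro Lim_measure_incseq) (auto simp: incseq_def U1 fmeasurableD2)
  have low: "(\<lambda>n. ?\<mu> {x\<in>Q. g x > - real n}) \<longlonglongrightarrow> ?\<mu> (\<Union>n. {x\<in>Q. g x > - real n})"
    using lm(1) Qm by (intro Lim_measure_incseq) (auto simp: incseq_def U2 fmeasurableD2)
  have ne: "?C \<noteq> {}"
  proof -
    have "\<forall>\<^sub>F n in sequentially. ?\<mu> {x\<in>Q. g x \<le> real n} > ?\<mu> Q / 2"
      using up pos by (intro order_tendstoD(1)) (auto simp: U1)
    then obtain n where "?\<mu> {x\<in>Q. g x \<le> real n} > ?\<mu> Q / 2" by (auto simp: eventually_sequentially)
    then have "real n \<in> ?C" by (simp add: measure_level_compl[OF Q g])
    then show ?thesis by blast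
  qed
  have bdd: "bdd_below ?C"
  proof -
    have "\<forall>\<^sub>F n in sequentially. ?\<mu> {x\<in>Q. g x > - real n} > ?\<mu> Q / 2"
      using low pos by (intro order_tendstoD(1)) (auto simp: U2)
    then obtain n where n: "?\<mu> {x\<in>Q. g x > - real n} > ?\<mu> Q / 2" by (auto simp: eventually_sequentially)
    have "- real n \<le> c" if "c \<in> ?C" for c
    proof (rule ccontr)
      assume "\<not> - real n \<le> c"
      then have "?\<mu> {x\<in>Q. g x > - real n} \<le> ?\<mu> {x\<in>Q. g x > c}"
        using lm(1) by (intro measure_mono_fmeasurable) auto
      then show False using n that by auto
    qed
    then show ?thesis by (auto simp: bdd_below_def)
  qed
  have upper: "?\<mu> {x\<in>Q. g x > c} \<le> ?\<mu> Q / 2" if cm: "c > med Q g" for c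
  proof -
    have "\<exists>c'\<in>?C. c' < c" using cm unfolding med_def by (rule cInf_lessD[OF ne])
    then obtain c' where c': "c' \<in> ?C" "c' < c" by (elim bexE)
    have "?\<mu> {x\<in>Q. g x > c} \<le> ?\<mu> {x\<in>Q. g x > c'}"
      using lm(1) c' by (intro measure_mono_fmeasurable) auto
    then show ?thesis using c' by auto
  qed
  have lower: "?\<mu> {x\<in>Q. g x \<le> c} \<le> ?\<mu> Q / 2" if "c < med Q g" for c
  proof -
    have "c \<notin> ?C" using that cInf_lower[OF _ bdd, of c] by (auto simp: med_def)
    then show ?thesis by (simp add: measure_level_compl[OF Q g])
  qed
  have "(\<lambda>n. ?\<mu> {x\<in>Q. g x > med Q g + 1 / Suc n}) \<longlonglongrightarrow> ?\<mu> (\<Union>n. {x\<in>Q. g x > med Q g + 1 / Suc n})"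
  proof (rule Lim_measure_incseq)
    show "incseq (\<lambda>n. {x\<in>Q. g x > med Q g + 1 / Suc n})"
    proof (rule incseq_SucI, rule subsetI)
      fix n x assume "x \<in> {x\<in>Q. g x > med Q g + 1 / Suc n}"
      moreover have "1 / real (Suc (Suc n)) \<le> 1 / Suc n" by (simp add: field_simps)
      ultimately show "x \<in> {x\<in>Q. g x > med Q g + 1 / Suc (Suc n)}" by auto
    qed
    have "(\<Union>n. {x\<in>Q. g x > med Q g + 1 / Suc n}) \<in> lmeasurable"
      by (rule fmeasurableI2[OF Qm]) (use lm(1)[THEN fmeasurableD] in auto)
    then show "emeasure lebesgue (\<Union>n. {x\<in>Q. g x > med Q g + 1 / Suc n}) \<noteq> \<infinity>"
      by (simp add: fmeasurableD2)
  qed (use lm(1) in auto)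
  moreover have "(\<Union>n. {x\<in>Q. g x > med Q g + 1 / Suc n}) = {x\<in>Q. g x > med Q g}"
  proof (intro antisym subsetI)
    fix x assume x: "x \<in> {x\<in>Q. g x > med Q g}"
    then obtain n where "1 / real (Suc n) < g x - med Q g"
      using reals_Archimedean[of "g x - med Q g"] by (auto simp: inverse_eq_divide)
    then show "x \<in> (\<Union>n. {x\<in>Q. g x > med Q g + 1 / Suc n})" using x by (auto simp: algebra_simps intro!: exI[of _ n])
  next
    fix x assume "x \<in> (\<Union>n. {x\<in>Q. g x > med Q g + 1 / Suc n})"
    then obtain n where "x \<in> Q" "g x > med Q g + 1 / Suc n" by auto
    moreover have "1 / real (Suc n) > 0" by simp
    ultimately show "x \<in> {x\<in>Q. g x > med Q g}" by (smt (verit) mem_Collect_eq)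
  qed
  ultimately show "?\<mu> {x\<in>Q. g x > med Q g} \<le> ?\<mu> Q / 2"
    using upper by (intro LIMSEQ_le_const2) auto
  have "(\<lambda>n. ?\<mu> {x\<in>Q. g x \<le> med Q g - 1 / Suc n}) \<longlonglongrightarrow> ?\<mu> (\<Union>n. {x\<in>Q. g x \<le> med Q g - 1 / Suc n})"
  proof (rule Lim_measure_incseq)
    show "incseq (\<lambda>n. {x\<in>Q. g x \<le> med Q g - 1 / Suc n})"
    proof (rule incseq_SucI, rule subsetI)
      fix n x assume "x \<in> {x\<in>Q. g x \<le> med Q g - 1 / Suc n}"
      moreover have "1 / real (Suc (Suc n)) \<le> 1 / Suc n" by (simp add: field_simps)
      ultimately show "x \<in> {x\<in>Q. g x \<le> med Q g - 1 / Suc (Suc n)}" by auto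
    qed
    have "(\<Union>n. {x\<in>Q. g x \<le> med Q g - 1 / Suc n}) \<in> lmeasurable"
      by (rule fmeasurableI2[OF Qm]) (use lm(4)[THEN fmeasurableD] in auto)
    then show "emeasure lebesgue (\<Union>n. {x\<in>Q. g x \<le> med Q g - 1 / Suc n}) \<noteq> \<infinity>"
      by (simp add: fmeasurableD2)
  qed (use lm(4) in auto)
  moreover have "(\<Union>n. {x\<in>Q. g x \<le> med Q g - 1 / Suc n}) = {x\<in>Q. g x < med Q g}"
  proof (intro antisym subsetI)
    fix x assume x: "x \<in> {x\<in>Q. g x < med Q g}"
    then obtain n where "1 / real (Suc n) < med Q g - g x"
      using reals_Archimedean[of "med Q g - g x"] by (auto simp: inverse_eq_divide)
    then show "x \<in> (\<Union>n. {x\<in>Q. g x \<le> med Q g - 1 / Suc n})" using x by (auto simp: algebra_simps intro!: exI[of _ n])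
  next
    fix x assume "x \<in> (\<Union>n. {x\<in>Q. g x \<le> med Q g - 1 / Suc n})"
    then obtain n where "x \<in> Q" "g x \<le> med Q g - 1 / Suc n" by auto
    moreover have "1 / real (Suc n) > 0" by simp
    ultimately show "x \<in> {x\<in>Q. g x < med Q g}" by (smt (verit) mem_Collect_eq)
  qed
  ultimately show "?\<mu> {x\<in>Q. g x < med Q g} \<le> ?\<mu> Q / 2"
    using lower by (intro LIMSEQ_le_const2) auto
qed

lemma med_close:
  assumes Q: "Q \<in> cubes" and g: "g \<in> L0"
    and s: "measure lebesgue {x\<in>Q. \<bar>g x - c\<bar> > s} < measure lebesgue Q / 2"
  shows "\<bar>med Q g - c\<bar> \<le> s"
proof (rule ccontr)
  let ?\<mu> = "measure lebesgue"
  note lm = level_lmeasurable[OF Q g]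
  have Qm: "Q \<in> lmeasurable" using Q emeasure_cubes_finite cubes_lebesgue by (auto simp: fmeasurable_def)
  have cov: "?\<mu> Q \<le> ?\<mu> S + ?\<mu> {x\<in>Q. \<bar>g x - c\<bar> > s}"
    if S: "S \<in> lmeasurable" "Q \<subseteq> S \<union> {x\<in>Q. \<bar>g x - c\<bar> > s}" for S
    using measure_mono_fmeasurable[OF S(2) fmeasurableD[OF Qm] fmeasurable.Un[OF S(1) lm(3)]]
      measure_Un_le[OF fmeasurableD[OF S(1)] fmeasurableD[OF lm(3)[of s c]]] by (rule order_trans)
  assume "\<not> \<bar>med Q g - c\<bar> \<le> s"
  then consider "med Q g > c + s" | "med Q g < c - s" by linarith
  then show False
  proof cases
    case 1
    have "?\<mu> Q \<le> ?\<mu> {x\<in>Q. g x < med Q g} + ?\<mu> {x\<in>Q. \<bar>g x - c\<bar> > s}" by (rule cov[OF lm(2)]) (use 1 in auto)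
    then show False using med_levels(2)[OF Q g] s by linarith
  next
    case 2
    have "?\<mu> Q \<le> ?\<mu> {x\<in>Q. g x > med Q g} + ?\<mu> {x\<in>Q. \<bar>g x - c\<bar> > s}" by (rule cov[OF lm(1)]) (use 2 in auto)
    then show False using med_levels(1)[OF Q g] s by linarith
  qed
qed


text \<open>
  The tolerance \<open>eps_tol d\<close> is small enough for three things: a set of this relative size is
  admissible for stopping cubes, it leaves a common good point with a set of relative density
  \<open>1/2\<close>, and it still does so relative to a subcube of \<open>4\<^sup>-\<^sup>d\<close> times the volume.
\<close>

definition eps_tol :: "nat \<Rightarrow> real" where "eps_tol d = 1 / (8 * 4 ^ d)"

definition osc_mult :: "nat \<Rightarrow> real" where "osc_mult d = 3 + 8 * 4 ^ d"

lemma eps_tol_le: "eps_tol d \<le> 1 / 8"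
  by (simp add: eps_tol_def field_simps)

lemma osc_mult_pos: "osc_mult d > 0" by (simp add: osc_mult_def add_pos_pos)

text \<open>A nearly optimal constant is within \<open>3 osc\<close> of the median, and \<open>g\<close> is within \<open>8 \<cdot> 4\<^sup>d osc\<close> of this
  constant off a set of relative size \<open>eps_tol d\<close>, both by Chebyshev's inequality. The two
  distances add up to \<open>osc_mult d\<close>.\<close>

lemma med_weak_osc:
  assumes Q: "Q \<in> (cubes :: (real^'n::finite) set set)" and g: "g \<in> L0"
  shows "measure lebesgue {x\<in>Q. ennreal \<bar>g x - med Q g\<bar> > ennreal (osc_mult CARD('n)) * osc_weak Q g}
    \<le> eps_tol CARD('n) * measure lebesgue Q"
proof (cases "osc_weak Q g = \<infinity>")
  case True
  then have "{x\<in>Q. ennreal \<bar>g x - med Q g\<bar> > ennreal (osc_mult CARD('n)) * osc_weak Q g} = {}"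
    using osc_mult_pos[of "CARD('n)"] by (auto simp: ennreal_mult_top)
  then show ?thesis by (simp only: measure_empty) (simp add: eps_tol_def)
next
  case False
  let ?\<mu> = "measure lebesgue" and ?A = "osc_mult CARD('n)" and ?K = "8 * 4 ^ CARD('n) :: real"
  define \<omega> where "\<omega> = enn2real (osc_weak Q g)"
  have om: "osc_weak Q g = ennreal \<omega>" "\<omega> \<ge> 0" using False by (auto simp: \<omega>_def less_top)
  note lm = level_lmeasurable[OF Q g]
  have pos: "?\<mu> Q > 0" "emeasure lebesgue Q = ennreal (?\<mu> Q)" using emeasure_lebesgue_cubes[OF Q] by auto
  have W: "?\<mu> {x\<in>Q. \<bar>g x - med Q g\<bar> > ?A * W} \<le> eps_tol CARD('n) * ?\<mu> Q" if "W > \<omega>" for W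
  proof -
    have W0: "W > 0" using that om by simp
    have "osc_weak Q g < ennreal W" using that om by (simp add: ennreal_lessI)
    then obtain c where c: "weak_L1_norm Q (\<lambda>x. g x - c) / emeasure lebesgue Q < ennreal W"
      by (auto simp: osc_weak_def INF_less_iff)
    have "weak_L1_norm Q (\<lambda>x. g x - c) / emeasure lebesgue Q * emeasure lebesgue Q \<le> ennreal W * emeasure lebesgue Q"
      using c by (intro mult_right_mono) auto
    then have wn: "weak_L1_norm Q (\<lambda>x. g x - c) \<le> ennreal (W * ?\<mu> Q)"
      using pos W0 by (simp add: ennreal_divide_mult_cancel ennreal_mult)
    have cheb: "?\<mu> {x\<in>Q. \<bar>g x - c\<bar> > t} \<le> W * ?\<mu> Q / t" if t: "t > 0" for t
    proof -
      have "ennreal t * emeasure lebesgue {x\<in>Q. \<bar>g x - c\<bar> > t} \<le> weak_L1_norm Q (\<lambda>x. g x - c)"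
        unfolding weak_L1_norm_def using t by (intro SUP_upper) auto
      then have "ennreal (t * ?\<mu> {x\<in>Q. \<bar>g x - c\<bar> > t}) \<le> ennreal (W * ?\<mu> Q)"
        using wn t lm(3) by (simp add: ennreal_mult emeasure_eq_measure2)
      then have "t * ?\<mu> {x\<in>Q. \<bar>g x - c\<bar> > t} \<le> W * ?\<mu> Q" using W0 pos by simp
      then show ?thesis using t by (simp add: field_simps)
    qed
    have "?\<mu> {x\<in>Q. \<bar>g x - c\<bar> > 3 * W} < ?\<mu> Q / 2"
      using cheb[of "3 * W"] W0 pos by simp
    then have mc: "\<bar>med Q g - c\<bar> \<le> 3 * W" by (rule med_close[OF Q g])
    have "?\<mu> {x\<in>Q. \<bar>g x - med Q g\<bar> > ?A * W} \<le> ?\<mu> {x\<in>Q. \<bar>g x - c\<bar> > ?K * W}"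
    proof (rule measure_mono_fmeasurable)
      have "?A * W = 3 * W + ?K * W" by (simp add: osc_mult_def algebra_simps)
      then show "{x\<in>Q. \<bar>g x - med Q g\<bar> > ?A * W} \<subseteq> {x\<in>Q. \<bar>g x - c\<bar> > ?K * W}" using mc by auto
    qed (use lm(3) in auto)
    also have "\<dots> \<le> W * ?\<mu> Q / (?K * W)" using W0 by (intro cheb) auto
    also have "\<dots> = eps_tol CARD('n) * ?\<mu> Q" using W0 by (simp add: eps_tol_def)
    finally show ?thesis .
  qed
  let ?S = "\<lambda>n. {x\<in>Q. \<bar>g x - med Q g\<bar> > ?A * (\<omega> + 1 / Suc n)}"
  have Apos: "?A > 0" by (rule osc_mult_pos)
  have U: "(\<Union>n. ?S n) = {x\<in>Q. \<bar>g x - med Q g\<bar> > ?A * \<omega>}"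
  proof (intro antisym subsetI)
    fix x assume x: "x \<in> {x\<in>Q. \<bar>g x - med Q g\<bar> > ?A * \<omega>}"
    then have "(\<bar>g x - med Q g\<bar> - ?A * \<omega>) / ?A > 0" using Apos by simp
    then obtain n where "1 / real (Suc n) < (\<bar>g x - med Q g\<bar> - ?A * \<omega>) / ?A"
      using reals_Archimedean[of "(\<bar>g x - med Q g\<bar> - ?A * \<omega>) / ?A"] by (auto simp: inverse_eq_divide)
    then have "?A * (\<omega> + 1 / real (Suc n)) < \<bar>g x - med Q g\<bar>"
      using Apos by (simp only: pos_less_divide_eq) (simp add: algebra_simps)
    then show "x \<in> (\<Union>n. ?S n)" using x by blast
  next
    fix x assume "x \<in> (\<Union>n. ?S n)"
    then obtain n where "x \<in> Q" "\<bar>g x - med Q g\<bar> > ?A * (\<omega> + 1 / Suc n)" by auto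
    moreover have "?A * (\<omega> + 1 / Suc n) \<ge> ?A * \<omega>" using Apos by simp
    ultimately show "x \<in> {x\<in>Q. \<bar>g x - med Q g\<bar> > ?A * \<omega>}" by auto
  qed
  have "(\<lambda>n. ?\<mu> (?S n)) \<longlonglongrightarrow> ?\<mu> (\<Union>n. ?S n)"
  proof (rule Lim_measure_incseq)
    show "incseq ?S"
    proof (rule incseq_SucI, rule subsetI)
      fix n x assume "x \<in> ?S n"
      moreover have "?A * (\<omega> + 1 / Suc (Suc n)) \<le> ?A * (\<omega> + 1 / Suc n)"
        using Apos by (intro mult_left_mono add_left_mono) (auto simp: field_simps)
      ultimately show "x \<in> ?S (Suc n)" by auto
    qed
    show "emeasure lebesgue (\<Union>n. ?S n) \<noteq> \<infinity>"
      unfolding U using fmeasurableD2[OF lm(3)] by simp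
  qed (use lm(3)[THEN fmeasurableD] in blast)
  then have "?\<mu> {x\<in>Q. \<bar>g x - med Q g\<bar> > ?A * \<omega>} \<le> eps_tol CARD('n) * ?\<mu> Q"
    unfolding U by (rule LIMSEQ_le_const2) (auto intro!: exI[of _ 0] W)
  moreover have "{x\<in>Q. ennreal \<bar>g x - med Q g\<bar> > ennreal ?A * osc_weak Q g} = {x\<in>Q. \<bar>g x - med Q g\<bar> > ?A * \<omega>}"
    using Apos om by (auto simp: ennreal_mult[symmetric] ennreal_less_iff)
  ultimately show ?thesis by simp
qed

text \<open>Used to compare the medians of two cubes, at a point that is exceptional for neither.\<close>

lemma common_good_point:
  assumes "Q \<in> cubes" "A \<in> lmeasurable" "B \<in> lmeasurable" "measure lebesgue A + measure lebesgue B < measure lebesgue Q"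
  obtains x where "x \<in> Q" "x \<notin> A" "x \<notin> B"
proof (rule ccontr)
  assume "\<not> thesis"
  then have "Q \<subseteq> A \<union> B" using that by blast
  then have "measure lebesgue Q \<le> measure lebesgue (A \<union> B)"
    using assms cubes_lebesgue by (intro measure_mono_fmeasurable) auto
  also have "\<dots> \<le> measure lebesgue A + measure lebesgue B" using assms by (intro measure_Un_le) auto
  finally show False using assms(4) by simp
qed

lemma weak_exceptional_lmeasurable:
  assumes "Q \<in> cubes" "g \<in> L0"
  shows "{x\<in>Q. ennreal \<bar>g x - c\<bar> > w} \<in> lmeasurable"
proof -
  have [measurable]: "g \<in> borel_measurable lebesgue" "Q \<in> sets lebesgue"
    using assms cubes_lebesgue by (auto simp: L0_def)
  have "Q \<in> lmeasurable" using assms emeasure_cubes_finite by (auto simp: fmeasurable_def)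
  then show ?thesis by (rule fmeasurableI2) auto
qed

lemma ennreal_dist_triangle: "ennreal \<bar>a - c\<bar> \<le> ennreal \<bar>a - b\<bar> + ennreal \<bar>b - c\<bar>"
proof -
  have "ennreal \<bar>a - c\<bar> \<le> ennreal (\<bar>a - b\<bar> + \<bar>b - c\<bar>)" by (rule ennreal_leI) linarith
  then show ?thesis by simp
qed

lemma med_compare:
  assumes Q: "Q \<in> (cubes :: (real^'n::finite) set set)" "Q' \<in> cubes" "Q \<subseteq> Q'" and g: "g \<in> L0"
    and vol: "measure lebesgue Q' \<le> 4 ^ CARD('n) * measure lebesgue Q"
  shows "ennreal \<bar>med Q g - med Q' g\<bar> \<le> ennreal (osc_mult CARD('n)) * (osc_weak Q g + osc_weak Q' g)"
proof -
  let ?A = "ennreal (osc_mult CARD('n))"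
  let ?S = "\<lambda>Q. {x\<in>Q. ennreal \<bar>g x - med Q g\<bar> > ?A * osc_weak Q g}"
  have pos: "measure lebesgue Q > 0" using emeasure_lebesgue_cubes[OF Q(1)] by simp
  have "measure lebesgue (?S Q) \<le> measure lebesgue Q / 8"
    using med_weak_osc[OF Q(1) g] mult_right_mono[OF eps_tol_le[of "CARD('n)"], of "measure lebesgue Q"] pos
    by linarith
  moreover have "measure lebesgue (?S Q') \<le> measure lebesgue Q / 8"
    using med_weak_osc[OF Q(2) g] mult_left_mono[OF vol, of "eps_tol CARD('n)"] by (simp add: eps_tol_def)
  ultimately have "measure lebesgue (?S Q) + measure lebesgue (?S Q') < measure lebesgue Q"
    using pos by simp
  then obtain x where x: "x \<in> Q" "x \<notin> ?S Q" "x \<notin> ?S Q'"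
    using common_good_point[OF Q(1) weak_exceptional_lmeasurable[OF Q(1) g] weak_exceptional_lmeasurable[OF Q(2) g]] by blast
  then have "ennreal \<bar>g x - med Q g\<bar> \<le> ?A * osc_weak Q g" "ennreal \<bar>g x - med Q' g\<bar> \<le> ?A * osc_weak Q' g"
    using Q(3) by (auto simp: not_less)
  moreover have "ennreal \<bar>med Q g - med Q' g\<bar> \<le> ennreal \<bar>g x - med Q g\<bar> + ennreal \<bar>g x - med Q' g\<bar>"
    using ennreal_dist_triangle[of "med Q g" "med Q' g" "g x"] by (simp add: abs_minus_commute)
  ultimately show ?thesis
    by (simp add: distrib_left) (meson add_mono order_trans)
qed

text \<open>
  The one step that is iterated below, both for the integral estimate of Fefferman-Stein type and
  for the John-Nirenberg estimate. The points at which \<open>g\<close> is far from its median on \<open>Q\<close> fill at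
  most half of each stopping cube \<open>q\<close>, and those at which it is far from its median on \<open>q\<close> at most
  an eighth; at any other point of \<open>q\<close> the two medians can be compared.
\<close>

lemma stopping_step:
  assumes Q: "Q \<in> (cubes :: (real^'n::finite) set set)" and g: "g \<in> L0"
  obtains P where "countable P" "P \<subseteq> cubes" "disjoint P" "\<And>q. q \<in> P \<Longrightarrow> q \<subseteq> Q"
    "measure lebesgue (\<Union>P) \<le> measure lebesgue Q / 2"
    "\<And>x. x \<in> Q \<Longrightarrow> x \<notin> \<Union>P \<Longrightarrow> ennreal \<bar>g x - med Q g\<bar> \<le> ennreal (osc_mult CARD('n)) * osc_weak Q g"
    "\<And>q. q \<in> P \<Longrightarrow> ennreal \<bar>med q g - med Q g\<bar> \<le>
       ennreal (osc_mult CARD('n)) * osc_weak Q g + ennreal (osc_mult CARD('n)) * osc_weak q g"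
proof -
  let ?A = "ennreal (osc_mult CARD('n))"
  let ?S = "\<lambda>Q. {x\<in>Q. ennreal \<bar>g x - med Q g\<bar> > ?A * osc_weak Q g}"
  have pos: "measure lebesgue Q > 0" using emeasure_lebesgue_cubes[OF Q(1)] by simp
  have "(2::real) ^ CARD('n) \<le> 4 ^ CARD('n)" by (rule power_mono) auto
  then have "(2::real) ^ CARD('n) < 2 * 4 ^ CARD('n)" using zero_less_power[of "4::real" "CARD('n)"] by linarith
  then have "measure lebesgue (?S Q) < measure lebesgue Q / (4 * 2 ^ CARD('n))"
    using pos by (intro le_less_trans[OF med_weak_osc[OF Q g]])
      (auto simp: eps_tol_def intro!: divide_strict_left_mono)
  moreover have SQ: "?S Q \<in> lmeasurable" by (rule weak_exceptional_lmeasurable[OF Q g])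
  ultimately obtain P where P: "countable P" "P \<subseteq> cubes" "disjoint P" "\<And>q. q \<in> P \<Longrightarrow> q \<subseteq> Q" "?S Q \<subseteq> \<Union>P"
    "\<And>q. q \<in> P \<Longrightarrow> measure lebesgue (?S Q \<inter> q) \<le> measure lebesgue q / 2"
    "measure lebesgue (\<Union>P) \<le> measure lebesgue Q / 2"
    using calderon_zygmund[OF Q, of "?S Q"] by (metis (no_types, lifting) Collect_mem_eq Collect_mono fmeasurableD)
  show ?thesis
  proof (rule that[OF P(1-4,7)])
    fix x assume "x \<in> Q" "x \<notin> \<Union>P"
    then show "ennreal \<bar>g x - med Q g\<bar> \<le> ?A * osc_weak Q g" using P(5) by (auto simp: not_less)
  next
    fix q assume q: "q \<in> P"
    then have qc: "q \<in> cubes" using P(2) by auto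
    have posq: "measure lebesgue q > 0" using emeasure_lebesgue_cubes[OF qc] by simp
    have "eps_tol CARD('n) * measure lebesgue q \<le> measure lebesgue q / 8"
      using posq by (simp add: eps_tol_def field_simps)
    then have "measure lebesgue (?S Q \<inter> q) + measure lebesgue (?S q) < measure lebesgue q"
      using P(6)[OF q] med_weak_osc[OF qc g] posq by linarith
    then obtain x where x: "x \<in> q" "x \<notin> ?S Q \<inter> q" "x \<notin> ?S q"
      using common_good_point[OF qc fmeasurable_Int_fmeasurable[OF SQ cubes_lebesgue[OF qc]]
          weak_exceptional_lmeasurable[OF qc g]] by blast
    then have "ennreal \<bar>g x - med Q g\<bar> \<le> ?A * osc_weak Q g" "ennreal \<bar>g x - med q g\<bar> \<le> ?A * osc_weak q g"
      using P(4)[OF q] by (auto simp: not_less)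
    moreover have "ennreal \<bar>med q g - med Q g\<bar> \<le> ennreal \<bar>g x - med Q g\<bar> + ennreal \<bar>g x - med q g\<bar>"
      using ennreal_dist_triangle[of "med q g" "med Q g" "g x"] by (simp add: abs_minus_commute add.commute)
    ultimately show "ennreal \<bar>med q g - med Q g\<bar> \<le> ?A * osc_weak Q g + ?A * osc_weak q g"
      by (meson add_mono order_trans)
  qed
qed


definition fs_const :: "nat \<Rightarrow> real" where "fs_const d = 4 * osc_mult d"

text \<open>
  Truncating both \<open>|g - c\<^sub>Q|\<close> and \<open>k\<close> makes the quantity \<open>I Q\<close> bounded by a multiple of \<open>|Q|\<close>
  at the outset. One stopping step keeps the main term and halves this multiple, because the
  stopping cubes fill at most half of \<open>Q\<close>; so the multiple is \<open>0\<close>. No sparse family has to be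
  collected.
\<close>

lemma fefferman_stein_truncated:
  assumes g: "(g :: 'n::finite rfun) \<in> L0" and k[measurable]: "k \<in> borel_measurable lebesgue"
    and kb: "\<And>x. k x \<le> ennreal B" and B: "B \<ge> 0" and N: "N \<ge> 0" and Q: "Q \<in> cubes"
  shows "(\<integral>\<^sup>+x\<in>Q. min (ennreal \<bar>g x - med Q g\<bar>) (ennreal N) * k x \<partial>lebesgue)
    \<le> ennreal (fs_const CARD('n)) * (\<integral>\<^sup>+x\<in>Q. sharp_max_weak g x * eM k x \<partial>lebesgue)"
proof -
  let ?\<mu> = "measure lebesgue" and ?C = "ennreal (fs_const CARD('n))"
  have [measurable]: "g \<in> borel_measurable lebesgue" using g by (simp add: L0_def)
  define W where "W Q = min (ennreal (osc_mult CARD('n)) * osc_weak Q g) (ennreal N)" for Q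
  define G where "G Q x = min (ennreal \<bar>g x - med Q g\<bar>) (ennreal N) + W Q" for Q x
  define I where "I Q = (\<integral>\<^sup>+x\<in>Q. G Q x * k x \<partial>lebesgue)" for Q
  define H where "H x = sharp_max_weak g x * eM k x" for x
  define J where "J S = (\<integral>\<^sup>+x\<in>S. H x \<partial>lebesgue)" for S
  have Gm[measurable]: "G Q \<in> borel_measurable lebesgue" for Q
    unfolding G_def by measurable
  have Hm[measurable]: "H \<in> borel_measurable lebesgue"
    unfolding H_def using sharp_max_weak_measurable[OF g] by measurable
  have step: "I Q \<le> ?C * J Q + ennreal (2 * N * B * (1/2) ^ n * ?\<mu> Q)" if "Q \<in> cubes" for Q n
    using that
  proof (induction n arbitrary: Q)
    case (0 Q)
    note Qm = cubes_lebesgue[OF 0] and Qe = emeasure_lebesgue_cubes(1)[OF 0]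
    have "G Q x \<le> ennreal N + ennreal N" for x
      unfolding G_def W_def by (intro add_mono) auto
    then have "G Q x * k x \<le> ennreal (2 * N) * ennreal B" for x
      using N kb[of x] by (intro mult_mono) (auto simp flip: ennreal_plus)
    then have "I Q \<le> (\<integral>\<^sup>+x. ennreal (2 * N * B) * indicator Q x \<partial>lebesgue)"
      unfolding I_def using N B by (intro nn_integral_mono mult_right_mono) (auto simp: ennreal_mult)
    also have "\<dots> = ennreal (2 * N * B * ?\<mu> Q)"
      using Qm N B by (simp add: nn_integral_cmult_indicator Qe ennreal_mult)
    finally show ?case by (simp add: add_increasing)
  next
    case (Suc n Q)
    note Qc = Suc.prems
    obtain P where P: "countable P" "P \<subseteq> cubes" "disjoint P" "\<And>q. q \<in> P \<Longrightarrow> q \<subseteq> Q"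
      "?\<mu> (\<Union>P) \<le> ?\<mu> Q / 2"
      "\<And>x. x \<in> Q \<Longrightarrow> x \<notin> \<Union>P \<Longrightarrow> ennreal \<bar>g x - med Q g\<bar> \<le> ennreal (osc_mult CARD('n)) * osc_weak Q g"
      "\<And>q. q \<in> P \<Longrightarrow> ennreal \<bar>med q g - med Q g\<bar> \<le>
         ennreal (osc_mult CARD('n)) * osc_weak Q g + ennreal (osc_mult CARD('n)) * osc_weak q g"
      using stopping_step[OF Qc g] by blast
    have Pm: "q \<in> sets lebesgue" if "q \<in> P" for q using that P(2) cubes_lebesgue by blast
    have UP[measurable]: "\<Union>P \<in> sets lebesgue" using P(1) Pm by (intro sets.countable_Union) auto
    have UPQ: "\<Union>P \<subseteq> Q" using P(4) by blast
    have Qm[measurable]: "Q \<in> sets lebesgue" using Qc by (rule cubes_lebesgue)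
    let ?R = "Q - \<Union>P"
    have Rm: "?\<mu> Q / 2 \<le> ?\<mu> ?R"
      using P(5) UPQ cubes_lmeasurable[OF Qc] UP
      by (subst measurable_measure_Diff) (auto simp: fmeasurableD2)
    have onR: "G Q x \<le> W Q + W Q" if "x \<in> ?R" for x
      using P(6)[of x] that unfolding G_def W_def by (intro add_right_mono min.mono) auto
    have onq: "G Q x \<le> W Q + W Q + G q x" if q: "q \<in> P" for q x
    proof -
      have m: "min (u + v) w \<le> min u w + min v w" for u v w :: ennreal
        by (cases "u \<le> w"; cases "v \<le> w") (auto simp: min_def add_increasing add_increasing2)
      have "ennreal \<bar>g x - med Q g\<bar> \<le> ennreal (osc_mult CARD('n)) * osc_weak Q g +
          (ennreal (osc_mult CARD('n)) * osc_weak q g + ennreal \<bar>g x - med q g\<bar>)"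
        using add_right_mono[OF P(7)[OF q], of "ennreal \<bar>g x - med q g\<bar>"]
          ennreal_dist_triangle[of "g x" "med Q g" "med q g"]
        by (auto simp: add_ac intro: order_trans)
      then have "min (ennreal \<bar>g x - med Q g\<bar>) (ennreal N) \<le>
          min (ennreal (osc_mult CARD('n)) * osc_weak Q g +
            (ennreal (osc_mult CARD('n)) * osc_weak q g + ennreal \<bar>g x - med q g\<bar>)) (ennreal N)"
        by (rule min.mono) simp
      also have "\<dots> \<le> W Q + min (ennreal (osc_mult CARD('n)) * osc_weak q g + ennreal \<bar>g x - med q g\<bar>) (ennreal N)"
        unfolding W_def by (rule m)
      also have "\<dots> \<le> W Q + (W q + min (ennreal \<bar>g x - med q g\<bar>) (ennreal N))"
        unfolding W_def by (intro add_left_mono m)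
      finally have "min (ennreal \<bar>g x - med Q g\<bar>) (ennreal N) \<le> W Q + (W q + min (ennreal \<bar>g x - med q g\<bar>) (ennreal N))" .
      then have "min (ennreal \<bar>g x - med Q g\<bar>) (ennreal N) + W Q \<le> W Q + (W q + min (ennreal \<bar>g x - med q g\<bar>) (ennreal N)) + W Q"
        by (rule add_right_mono)
      then show ?thesis unfolding G_def by (simp add: add_ac)
    qed
    have "I Q = (\<integral>\<^sup>+x\<in>?R. G Q x * k x \<partial>lebesgue) + (\<integral>\<^sup>+x\<in>\<Union>P. G Q x * k x \<partial>lebesgue)"
    proof -
      have "I Q = (\<integral>\<^sup>+x. G Q x * k x * indicator ?R x + G Q x * k x * indicator (\<Union>P) x \<partial>lebesgue)"
        unfolding I_def using UPQ by (intro nn_integral_cong) (auto split: split_indicator)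
      then show ?thesis by (simp add: nn_integral_add)
    qed
    also have "\<dots> \<le> (\<integral>\<^sup>+x\<in>?R. (W Q + W Q) * k x \<partial>lebesgue) +
        ((\<integral>\<^sup>+x\<in>\<Union>P. (W Q + W Q) * k x \<partial>lebesgue) + (\<integral>\<^sup>+q. I q \<partial>count_space P))"
    proof (intro add_mono)
      show "(\<integral>\<^sup>+x\<in>?R. G Q x * k x \<partial>lebesgue) \<le> (\<integral>\<^sup>+x\<in>?R. (W Q + W Q) * k x \<partial>lebesgue)"
        using onR by (intro nn_integral_mono) (auto split: split_indicator intro!: mult_right_mono)
      have "(\<integral>\<^sup>+x\<in>\<Union>P. G Q x * k x \<partial>lebesgue) = (\<integral>\<^sup>+q. (\<integral>\<^sup>+x\<in>q. G Q x * k x \<partial>lebesgue) \<partial>count_space P)"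
        by (rule nn_integral_UN_disjoint[OF P(1,3) Pm]) measurable
      also have "\<dots> \<le> (\<integral>\<^sup>+q. (\<integral>\<^sup>+x\<in>q. (W Q + W Q) * k x \<partial>lebesgue) + I q \<partial>count_space P)"
      proof (rule nn_integral_mono)
        fix q assume "q \<in> space (count_space P)"
        then have q: "q \<in> P" by simp
        have [measurable]: "q \<in> sets lebesgue" by (rule Pm[OF q])
        have "(\<integral>\<^sup>+x\<in>q. G Q x * k x \<partial>lebesgue)
            \<le> (\<integral>\<^sup>+x. (W Q + W Q) * k x * indicator q x + G q x * k x * indicator q x \<partial>lebesgue)"
          using onq[OF q]
          by (intro nn_integral_mono) (auto split: split_indicator simp flip: distrib_right intro!: mult_right_mono)
        also have "\<dots> = (\<integral>\<^sup>+x\<in>q. (W Q + W Q) * k x \<partial>lebesgue) + I q"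
          unfolding I_def by (intro nn_integral_add) measurable
        finally show "(\<integral>\<^sup>+x\<in>q. G Q x * k x \<partial>lebesgue) \<le> (\<integral>\<^sup>+x\<in>q. (W Q + W Q) * k x \<partial>lebesgue) + I q" .
      qed
      also have "\<dots> = (\<integral>\<^sup>+x\<in>\<Union>P. (W Q + W Q) * k x \<partial>lebesgue) + (\<integral>\<^sup>+q. I q \<partial>count_space P)"
        by (subst nn_integral_UN_disjoint[OF P(1,3) Pm]) (auto simp: nn_integral_add)
      finally show "(\<integral>\<^sup>+x\<in>\<Union>P. G Q x * k x \<partial>lebesgue)
        \<le> (\<integral>\<^sup>+x\<in>\<Union>P. (W Q + W Q) * k x \<partial>lebesgue) + (\<integral>\<^sup>+q. I q \<partial>count_space P)" .
    qed
    also have "\<dots> = (\<integral>\<^sup>+x\<in>Q. (W Q + W Q) * k x \<partial>lebesgue) + (\<integral>\<^sup>+q. I q \<partial>count_space P)"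
    proof -
      have "(\<integral>\<^sup>+x\<in>Q. (W Q + W Q) * k x \<partial>lebesgue)
        = (\<integral>\<^sup>+x. (W Q + W Q) * k x * indicator ?R x + (W Q + W Q) * k x * indicator (\<Union>P) x \<partial>lebesgue)"
        using UPQ by (intro nn_integral_cong) (auto split: split_indicator)
      then show ?thesis by (simp add: nn_integral_add add.assoc)
    qed
    also have "(\<integral>\<^sup>+x\<in>Q. (W Q + W Q) * k x \<partial>lebesgue) \<le> ?C * J ?R"
    proof -
      have C: "?C = ennreal (2 * osc_mult CARD('n)) * ennreal 2"
        using osc_mult_pos[of "CARD('n)"]
        by (subst ennreal_mult[symmetric]) (auto simp: fs_const_def simp del: ennreal_numeral)
      have "(\<integral>\<^sup>+x\<in>Q. (W Q + W Q) * k x \<partial>lebesgue) = (W Q + W Q) * (eavg Q k * emeasure lebesgue Q)"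
        by (simp add: eavg_times_emeasure[OF Qc] nn_integral_cmult mult.assoc)
      also have "\<dots> \<le> (ennreal (2 * osc_mult CARD('n)) * osc_weak Q g) * (eavg Q k * (ennreal 2 * emeasure lebesgue ?R))"
      proof (intro mult_mono mult_left_mono)
        have "W Q + W Q \<le> ennreal (osc_mult CARD('n)) * osc_weak Q g + ennreal (osc_mult CARD('n)) * osc_weak Q g"
          unfolding W_def by (intro add_mono) auto
        also have "\<dots> = ennreal (2 * osc_mult CARD('n)) * osc_weak Q g"
          using osc_mult_pos[of "CARD('n)"] by (simp add: distrib_right[symmetric] flip: ennreal_plus)
        finally show "W Q + W Q \<le> ennreal (2 * osc_mult CARD('n)) * osc_weak Q g" .
        have "?R \<in> lmeasurable" using cubes_lmeasurable[OF Qc] UP by (rule fmeasurable_Diff)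
        then have "ennreal 2 * emeasure lebesgue ?R = ennreal (2 * ?\<mu> ?R)"
          by (simp add: emeasure_eq_measure2 ennreal_mult)
        then show "emeasure lebesgue Q \<le> ennreal 2 * emeasure lebesgue ?R"
          using Rm emeasure_lebesgue_cubes(1)[OF Qc] by (simp add: ennreal_leI)
      qed auto
      also have "\<dots> = ?C * (\<integral>\<^sup>+x. (osc_weak Q g * eavg Q k) * indicator ?R x \<partial>lebesgue)"
        by (subst nn_integral_cmult_indicator) (auto simp: C mult_ac)
      also have "\<dots> \<le> ?C * J ?R"
        unfolding J_def H_def sharp_max_weak_eq
        using cube_sup_upper[OF Qc, of _ "\<lambda>Q. osc_weak Q g"] eavg_le_eM[OF Qc]
        by (intro mult_left_mono nn_integral_mono) (auto split: split_indicator intro!: mult_mono)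
      finally show ?thesis .
    qed
    also have "(\<integral>\<^sup>+q. I q \<partial>count_space P) \<le>
      (\<integral>\<^sup>+q. ?C * J q + (\<integral>\<^sup>+x\<in>q. ennreal (2 * N * B * (1/2) ^ n) \<partial>lebesgue) \<partial>count_space P)"
    proof (rule nn_integral_mono)
      fix q assume "q \<in> space (count_space P)"
      then have q: "q \<in> cubes" using P(2) by auto
      have "(\<integral>\<^sup>+x\<in>q. ennreal (2 * N * B * (1/2) ^ n) \<partial>lebesgue) = ennreal (2 * N * B * (1/2) ^ n * ?\<mu> q)"
        using N B cubes_lebesgue[OF q] emeasure_lebesgue_cubes[OF q]
        by (simp add: nn_integral_cmult_indicator ennreal_mult)
      then show "I q \<le> ?C * J q + (\<integral>\<^sup>+x\<in>q. ennreal (2 * N * B * (1/2) ^ n) \<partial>lebesgue)"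
        using Suc.IH[OF q] by simp
    qed
    also have "\<dots> = ?C * J (\<Union>P) + (\<integral>\<^sup>+x\<in>\<Union>P. ennreal (2 * N * B * (1/2) ^ n) \<partial>lebesgue)"
      unfolding J_def
      by (subst (1 2) nn_integral_UN_disjoint[OF P(1,3) Pm]) (auto simp: nn_integral_add nn_integral_cmult)
    also have "(\<integral>\<^sup>+x\<in>\<Union>P. ennreal (2 * N * B * (1/2) ^ n) \<partial>lebesgue) \<le> ennreal (2 * N * B * (1/2) ^ Suc n * ?\<mu> Q)"
    proof -
      have "emeasure lebesgue (\<Union>P) = ennreal (?\<mu> (\<Union>P))"
        using fmeasurableI2[OF cubes_lmeasurable[OF Qc] UPQ UP] by (simp add: emeasure_eq_measure2)
      then have "(\<integral>\<^sup>+x\<in>\<Union>P. ennreal (2 * N * B * (1/2) ^ n) \<partial>lebesgue) = ennreal (2 * N * B * (1/2) ^ n * ?\<mu> (\<Union>P))"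
        using N B by (simp add: nn_integral_cmult_indicator ennreal_mult)
      also have "\<dots> \<le> ennreal (2 * N * B * (1/2) ^ n * (?\<mu> Q / 2))"
        using N B P(5) by (intro ennreal_leI mult_left_mono) auto
      finally show ?thesis by (simp add: mult_ac)
    qed
    also have "?C * J ?R + (?C * J (\<Union>P) + ennreal (2 * N * B * (1/2) ^ Suc n * ?\<mu> Q)) =
        ?C * J Q + ennreal (2 * N * B * (1/2) ^ Suc n * ?\<mu> Q)"
    proof -
      have "J Q = (\<integral>\<^sup>+x. H x * indicator ?R x + H x * indicator (\<Union>P) x \<partial>lebesgue)"
        unfolding J_def using UPQ by (intro nn_integral_cong) (auto split: split_indicator)
      then have "J Q = J ?R + J (\<Union>P)" unfolding J_def by (simp add: nn_integral_add)
      then show ?thesis by (simp add: distrib_left add.assoc)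
    qed
    finally show ?case by (simp add: add_left_mono)
  qed
  have "(\<integral>\<^sup>+x\<in>Q. min (ennreal \<bar>g x - med Q g\<bar>) (ennreal N) * k x \<partial>lebesgue) \<le> I Q"
    unfolding I_def G_def by (intro nn_integral_mono mult_right_mono) auto
  also have "I Q \<le> ?C * J Q"
  proof (rule LIMSEQ_le_const)
    have "(\<lambda>n. ?C * J Q + ennreal (2 * N * B * (1/2) ^ n * ?\<mu> Q)) \<longlonglongrightarrow> ?C * J Q + ennreal (2 * N * B * 0 * ?\<mu> Q)"
      by (intro tendsto_intros tendsto_ennrealI) simp
    then show "(\<lambda>n. ?C * J Q + ennreal (2 * N * B * (1/2) ^ n * ?\<mu> Q)) \<longlonglongrightarrow> ?C * J Q" by simp
  qed (use step[OF Q] in blast)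
  finally show ?thesis by (simp add: J_def H_def)
qed

lemma SUP_min_of_nat: "(SUP n. min u (ennreal (real n))) = u"
proof (rule antisym)
  show "u \<le> (SUP n. min u (ennreal (real n)))"
  proof (rule dense_le)
    fix t assume t: "t < u"
    then have "t < top" using less_le_trans[OF t top_greatest] by simp
    then obtain n where "t < of_nat n" using ennreal_Ex_less_of_nat by auto
    then have "t \<le> min u (ennreal (real n))" using t by (simp add: ennreal_of_nat_eq_real_of_nat less_imp_le)
    then show "t \<le> (SUP n. min u (ennreal (real n)))" by (rule SUP_upper2[rotated]) simp
  qed
qed (auto intro: SUP_least)

lemma fefferman_stein_local:
  assumes g: "(g :: 'n::finite rfun) \<in> L0" and k[measurable]: "k \<in> borel_measurable lebesgue" and Q: "Q \<in> cubes"
  shows "(\<integral>\<^sup>+x\<in>Q. ennreal \<bar>g x - med Q g\<bar> * k x \<partial>lebesgue)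
    \<le> ennreal (fs_const CARD('n)) * (\<integral>\<^sup>+x\<in>Q. sharp_max_weak g x * eM k x \<partial>lebesgue)"
proof -
  have [measurable]: "g \<in> borel_measurable lebesgue" "Q \<in> sets lebesgue"
    using g Q cubes_lebesgue by (auto simp: L0_def)
  define h where "h n x = min (ennreal \<bar>g x - med Q g\<bar>) (ennreal (real n)) * min (k x) (ennreal (real n))" for n x
  have hm[measurable]: "h n \<in> borel_measurable lebesgue" for n unfolding h_def by measurable
  have hmono: "h m x \<le> h n x" if "m \<le> n" for m n x
    unfolding h_def using that by (intro mult_mono min.mono) auto
  have "(SUP n. h n x) = ennreal \<bar>g x - med Q g\<bar> * k x" for x
  proof (rule antisym)
    show "(SUP n. h n x) \<le> ennreal \<bar>g x - med Q g\<bar> * k x"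
      unfolding h_def by (intro SUP_least mult_mono) auto
    have "ennreal \<bar>g x - med Q g\<bar> * k x =
        (SUP m. SUP n. min (ennreal \<bar>g x - med Q g\<bar>) (ennreal (real m)) * min (k x) (ennreal (real n)))"
      using SUP_min_of_nat[of "ennreal \<bar>g x - med Q g\<bar>"] SUP_min_of_nat[of "k x"]
      by (simp flip: SUP_mult_left_ennreal SUP_mult_right_ennreal)
    also have "\<dots> \<le> (SUP n. h n x)"
    proof (intro SUP_least)
      fix m n :: nat
      have "min (ennreal \<bar>g x - med Q g\<bar>) (ennreal (real m)) * min (k x) (ennreal (real n)) \<le> h (max m n) x"
        unfolding h_def by (intro mult_mono min.mono ennreal_leI) auto
      then show "min (ennreal \<bar>g x - med Q g\<bar>) (ennreal (real m)) * min (k x) (ennreal (real n)) \<le> (SUP n. h n x)"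
        by (rule SUP_upper2[rotated]) simp
    qed
    finally show "ennreal \<bar>g x - med Q g\<bar> * k x \<le> (SUP n. h n x)" .
  qed
  then have "(\<integral>\<^sup>+x\<in>Q. ennreal \<bar>g x - med Q g\<bar> * k x \<partial>lebesgue) = (\<integral>\<^sup>+x. (SUP n. h n x * indicator Q x) \<partial>lebesgue)"
    by (intro nn_integral_cong) (simp flip: SUP_mult_right_ennreal)
  also have "\<dots> = (SUP n. \<integral>\<^sup>+x\<in>Q. h n x \<partial>lebesgue)"
    by (rule nn_integral_monotone_convergence_SUP)
      (auto simp: incseq_def le_fun_def intro!: mult_right_mono hmono)
  also have "\<dots> \<le> ennreal (fs_const CARD('n)) * (\<integral>\<^sup>+x\<in>Q. sharp_max_weak g x * eM k x \<partial>lebesgue)"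
  proof (rule SUP_least)
    fix n
    have "(\<integral>\<^sup>+x\<in>Q. h n x \<partial>lebesgue)
        \<le> ennreal (fs_const CARD('n)) * (\<integral>\<^sup>+x\<in>Q. sharp_max_weak g x * eM (\<lambda>x. min (k x) (ennreal (real n))) x \<partial>lebesgue)"
      unfolding h_def by (rule fefferman_stein_truncated[OF g _ _ _ _ Q, where B = "real n"]) auto
    also have "\<dots> \<le> ennreal (fs_const CARD('n)) * (\<integral>\<^sup>+x\<in>Q. sharp_max_weak g x * eM k x \<partial>lebesgue)"
      by (intro mult_left_mono nn_integral_mono mult_right_mono eM_mono) auto
    finally show "(\<integral>\<^sup>+x\<in>Q. h n x \<partial>lebesgue)
        \<le> ennreal (fs_const CARD('n)) * (\<integral>\<^sup>+x\<in>Q. sharp_max_weak g x * eM k x \<partial>lebesgue)" .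
  qed
  finally show ?thesis .
qed

text \<open>Each stopping step adds \<open>2 osc_mult d \<omega>\<close> to the deviation from the median and halves the volume.\<close>

lemma john_nirenberg:
  assumes g: "(g :: 'n::finite rfun) \<in> L0" and Q: "Q \<in> cubes" and \<omega>: "\<omega> \<ge> 0"
    and osc: "\<And>q. q \<in> cubes \<Longrightarrow> q \<subseteq> Q \<Longrightarrow> osc_weak q g \<le> ennreal \<omega>"
  shows "emeasure lebesgue {x\<in>Q. \<bar>g x - med Q g\<bar> > real j * (2 * osc_mult CARD('n) * \<omega>)}
    \<le> ennreal ((1/2) ^ j * measure lebesgue Q)"
  using Q osc
proof (induction j arbitrary: Q)
  case (0 Q)
  have [measurable]: "g \<in> borel_measurable lebesgue" "Q \<in> sets lebesgue"
    using g 0 cubes_lebesgue by (auto simp: L0_def)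
  have "emeasure lebesgue {x\<in>Q. \<bar>g x - med Q g\<bar> > real 0 * (2 * osc_mult CARD('n) * \<omega>)} \<le> emeasure lebesgue Q"
    by (intro emeasure_mono) auto
  then show ?case using emeasure_lebesgue_cubes[OF 0(1)] by simp
next
  case (Suc j Q)
  note Qc = Suc.prems(1)
  let ?A = "osc_mult CARD('n)" and ?\<mu> = "measure lebesgue"
  have Apos: "?A > 0" by (rule osc_mult_pos)
  obtain P where P: "countable P" "P \<subseteq> cubes" "disjoint P" "\<And>q. q \<in> P \<Longrightarrow> q \<subseteq> Q"
    "?\<mu> (\<Union>P) \<le> ?\<mu> Q / 2"
    "\<And>x. x \<in> Q \<Longrightarrow> x \<notin> \<Union>P \<Longrightarrow> ennreal \<bar>g x - med Q g\<bar> \<le> ennreal ?A * osc_weak Q g"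
    "\<And>q. q \<in> P \<Longrightarrow> ennreal \<bar>med q g - med Q g\<bar> \<le> ennreal ?A * osc_weak Q g + ennreal ?A * osc_weak q g"
    using stopping_step[OF Qc g] by blast
  have Pm: "q \<in> sets lebesgue" if "q \<in> P" for q using that P(2) cubes_lebesgue by blast
  have UP[measurable]: "\<Union>P \<in> sets lebesgue" using P(1) Pm by (intro sets.countable_Union) auto
  have UPQ: "\<Union>P \<subseteq> Q" using P(4) by blast
  have [measurable]: "g \<in> borel_measurable lebesgue" using g by (auto simp: L0_def)
  have le: "ennreal ?A * osc_weak q g \<le> ennreal (?A * \<omega>)" if "q \<in> cubes" "q \<subseteq> Q" for q
    using mult_left_mono[OF Suc.prems(2)[OF that], of "ennreal ?A"] Apos \<omega> by (simp add: ennreal_mult)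
  have R: "\<bar>g x - med Q g\<bar> \<le> ?A * \<omega>" if "x \<in> Q" "x \<notin> \<Union>P" for x
    using order_trans[OF P(6)[OF that] le[OF Qc]] Apos \<omega> by (simp add: ennreal_le_iff)
  have qb: "\<bar>med q g - med Q g\<bar> \<le> 2 * ?A * \<omega>" if q: "q \<in> P" for q
  proof -
    have "ennreal \<bar>med q g - med Q g\<bar> \<le> ennreal (?A * \<omega>) + ennreal (?A * \<omega>)"
      using q P(2,4) by (intro order_trans[OF P(7)[OF q]] add_mono le) (auto simp: Qc)
    also have "\<dots> = ennreal (2 * ?A * \<omega>)" using Apos \<omega> by (simp flip: ennreal_plus)
    finally show ?thesis using Apos \<omega> by (simp add: ennreal_le_iff)
  qed
  define L where "L j Q = {x\<in>Q. \<bar>g x - med Q g\<bar> > real j * (2 * ?A * \<omega>)}" for j Q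
  have Lm: "L j q \<in> sets lebesgue" if "q \<in> sets lebesgue" for j q using that unfolding L_def by measurable
  have sub: "L (Suc j) Q \<inter> q \<subseteq> L j q" if "q \<in> P" for q
    using qb[OF that] by (auto simp: L_def algebra_simps)
  have "L (Suc j) Q \<subseteq> \<Union>P"
  proof
    fix x assume x: "x \<in> L (Suc j) Q"
    have "?A * \<omega> \<le> real (Suc j) * (2 * ?A * \<omega>)" using Apos \<omega> by (simp add: algebra_simps)
    then show "x \<in> \<Union>P" using R[of x] x by (force simp: L_def)
  qed
  moreover have "emeasure lebesgue (L (Suc j) Q) = (\<integral>\<^sup>+x. indicator (L (Suc j) Q) x \<partial>lebesgue)"
    using Lm[OF cubes_lebesgue[OF Qc]] by simp
  ultimately have "emeasure lebesgue (L (Suc j) Q) = (\<integral>\<^sup>+x\<in>\<Union>P. indicator (L (Suc j) Q) x \<partial>lebesgue)"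
    by (subst \<open>emeasure lebesgue (L (Suc j) Q) = _\<close>) (intro nn_integral_cong; auto split: split_indicator)
  also have "\<dots> = (\<integral>\<^sup>+q. (\<integral>\<^sup>+x\<in>q. indicator (L (Suc j) Q) x \<partial>lebesgue) \<partial>count_space P)"
    using Lm[OF cubes_lebesgue[OF Qc]] by (intro nn_integral_UN_disjoint[OF P(1,3) Pm]) auto
  also have "\<dots> \<le> (\<integral>\<^sup>+q. (\<integral>\<^sup>+x\<in>q. ennreal ((1/2) ^ j) \<partial>lebesgue) \<partial>count_space P)"
  proof (rule nn_integral_mono)
    fix q assume "q \<in> space (count_space P)"
    then have q: "q \<in> P" "q \<in> cubes" using P(2) by auto
    have "(\<integral>\<^sup>+x\<in>q. indicator (L (Suc j) Q) x \<partial>lebesgue) \<le> (\<integral>\<^sup>+x. indicator (L j q) x \<partial>lebesgue)"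
      using sub[OF q(1)] by (intro nn_integral_mono) (auto split: split_indicator)
    also have "\<dots> = emeasure lebesgue (L j q)" using Lm[OF Pm[OF q(1)]] by simp
    also have "\<dots> \<le> ennreal ((1/2) ^ j * ?\<mu> q)"
      unfolding L_def using P(4)[OF q(1)] Suc.prems(2) by (intro Suc.IH[OF q(2)]) auto
    also have "\<dots> = (\<integral>\<^sup>+x\<in>q. ennreal ((1/2) ^ j) \<partial>lebesgue)"
      using Pm[OF q(1)] emeasure_lebesgue_cubes[OF q(2)] by (simp add: nn_integral_cmult_indicator ennreal_mult)
    finally show "(\<integral>\<^sup>+x\<in>q. indicator (L (Suc j) Q) x \<partial>lebesgue) \<le> (\<integral>\<^sup>+x\<in>q. ennreal ((1/2) ^ j) \<partial>lebesgue)" .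
  qed
  also have "\<dots> = (\<integral>\<^sup>+x\<in>\<Union>P. ennreal ((1/2) ^ j) \<partial>lebesgue)"
    by (rule nn_integral_UN_disjoint[OF P(1,3) Pm, symmetric]) auto
  also have "\<dots> = ennreal ((1/2) ^ j * ?\<mu> (\<Union>P))"
    using fmeasurableI2[OF cubes_lmeasurable[OF Qc] UPQ UP]
    by (simp add: nn_integral_cmult_indicator ennreal_mult emeasure_eq_measure2)
  also have "\<dots> \<le> ennreal ((1/2) ^ j * (?\<mu> Q / 2))"
    using P(5) by (intro ennreal_leI mult_left_mono) auto
  finally show ?case by (simp add: L_def mult_ac)
qed


section \<open>Banach function norms\<close>

definition big :: "nat \<Rightarrow> (real^'n::finite) set" where
  "big n = cube (\<chi> i. - (2 ^ n)) (2 ^ Suc n)"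

lemma big_in_cubes [simp]: "big n \<in> cubes"
  by (auto simp: big_def)

lemma big_lebesgue [measurable]: "big n \<in> sets lebesgue"
  by (simp add: big_def)

lemma mem_big: "x \<in> big n \<longleftrightarrow> (\<forall>i. - (2 ^ n) \<le> x $ i \<and> x $ i < 2 ^ n)"
  by (simp add: big_def mem_cube)

lemma big_mono: "m \<le> n \<Longrightarrow> big m \<subseteq> big n"
proof
  fix x assume mn: "m \<le> n" and x: "x \<in> big m"
  have "(2::real) ^ m \<le> 2 ^ n" using mn by simp
  then show "x \<in> big n" using x unfolding mem_big by (meson le_minus_iff less_le_trans minus_le_iff neg_le_iff_le order_trans)
qed

lemma norm_le_big:
  assumes "norm x < 2 ^ n" shows "x \<in> big n"
  unfolding mem_big
proof
  fix i
  have "\<bar>x $ i\<bar> < 2 ^ n" using component_le_norm_cart[of x i] assms by linarith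
  then show "- (2 ^ n) \<le> x $ i \<and> x $ i < 2 ^ n" by linarith
qed

lemma eventually_big: "\<forall>\<^sub>F n in sequentially. x \<in> big n"
proof -
  obtain n where "norm x < 2 ^ n" using real_arch_pow[of 2 "norm x"] by auto
  then have "x \<in> big m" if "n \<le> m" for m using big_mono[OF that] norm_le_big by blast
  then show ?thesis by (auto simp: eventually_sequentially)
qed

lemma measure_big: "measure lebesgue (big n :: (real^'n::finite) set) = (2 ^ Suc n) ^ CARD('n)"
  unfolding big_def by (rule measure_cube) simp

lemma emeasure_big_finite: "emeasure lebesgue (big n) < \<infinity>"
  by (rule emeasure_cubes_finite) simp

lemma not_AE_zero_big:
  assumes [measurable]: "F \<in> borel_measurable lebesgue" and nz: "\<not> (AE x in lebesgue. F x = 0)"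
  obtains n where "(\<integral>\<^sup>+x\<in>big n. F x \<partial>lebesgue) > 0"
proof -
  have "\<exists>n. (\<integral>\<^sup>+x\<in>big n. F x \<partial>lebesgue) \<noteq> 0"
  proof (rule ccontr)
    assume "\<not> ?thesis"
    then have "AE x in lebesgue. \<forall>n. F x * indicator (big n) x = 0"
      by (subst AE_all_countable) (auto simp: nn_integral_0_iff_AE)
    then have "AE x in lebesgue. F x = 0"
    proof eventually_elim
      case (elim x)
      obtain n where "x \<in> big n" using eventually_big[of x] by (auto simp: eventually_sequentially)
      then show ?case using elim[rule_format, of n] by simp
    qed
    then show False using nz by simp
  qed
  then show ?thesis using that by (auto simp: zero_less_iff_neq_zero)
qed

lemma eM_pos:
  assumes "F \<in> borel_measurable lebesgue" "\<not> (AE x in lebesgue. F x = 0)"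
  shows "eM F x > 0"
proof -
  obtain n where n: "(\<integral>\<^sup>+y\<in>big n. F y \<partial>lebesgue) > 0" using not_AE_zero_big[OF assms] by blast
  obtain N where "\<And>n. n \<ge> N \<Longrightarrow> x \<in> big n" using eventually_big[of x]
    unfolding eventually_sequentially by blast
  then have N: "n \<le> max n N" "x \<in> big (max n N)" by auto
  have "(\<integral>\<^sup>+y\<in>big n. F y \<partial>lebesgue) \<le> (\<integral>\<^sup>+y\<in>big (max n N). F y \<partial>lebesgue)"
    using big_mono[OF N(1)] by (intro nn_integral_mono) (auto split: split_indicator)
  then have "(\<integral>\<^sup>+y\<in>big (max n N). F y \<partial>lebesgue) \<noteq> 0" using n by auto
  then have "eavg (big (max n N)) F \<noteq> 0"
    using eavg_times_emeasure[OF big_in_cubes, of "max n N" F] by auto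
  then show ?thesis using eavg_le_eM[OF big_in_cubes N(2), of F]
    by (auto simp: zero_less_iff_neq_zero)
qed

text \<open>Bounded functions supported in a cube, from which the general case follows by the Fatou property
  and by monotone convergence.\<close>

definition trunc :: "nat \<Rightarrow> ('n::finite) efun \<Rightarrow> 'n rfun" where
  "trunc n f x = enn2real (min (f x) (ennreal (real n))) * indicator (big n) x"

lemma trunc_measurable [measurable]: "f \<in> borel_measurable lebesgue \<Longrightarrow> trunc n f \<in> borel_measurable lebesgue"
  unfolding trunc_def[abs_def]
  by (intro borel_measurable_times borel_measurable_indicator big_lebesgue) measurable

lemma ennreal_trunc: "ennreal (trunc n f x) = min (f x) (ennreal (real n)) * indicator (big n) x"
proof -
  have "min (f x) (ennreal (real n)) < top" by (simp add: min_less_iff_disj)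
  then show ?thesis by (auto simp: trunc_def split: split_indicator)
qed

lemma trunc_nonneg: "0 \<le> trunc n f x"
  by (simp add: trunc_def)

lemma trunc_le: "trunc n f x \<le> real n"
proof -
  have "enn2real (min (f x) (ennreal (real n))) \<le> real n" by (rule enn2real_leI) auto
  then show ?thesis by (auto simp: trunc_def split: split_indicator)
qed

lemma ennreal_trunc_le: "ennreal (trunc n f x) \<le> f x"
  unfolding ennreal_trunc by (auto split: split_indicator)

lemma trunc_support: "x \<notin> big n \<Longrightarrow> trunc n f x = 0"
  by (simp add: trunc_def)

lemma ennreal_trunc_mono: "m \<le> n \<Longrightarrow> ennreal (trunc m f x) \<le> ennreal (trunc n f x)"
  unfolding ennreal_trunc using big_mono[of m n]
  by (intro mult_mono min.mono ennreal_leI) (auto split: split_indicator)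

lemma trunc_SUP: "(SUP n. ennreal (trunc n f x)) = f x"
proof (rule antisym)
  have "(SUP n. min (f x) (ennreal (real n))) \<le> (SUP n. ennreal (trunc n f x))"
  proof (rule SUP_least)
    fix n :: nat
    obtain m where m: "m \<ge> n" "x \<in> big m"
      using eventually_big[of x] by (auto simp: eventually_sequentially) (meson nat_le_linear)
    have "min (f x) (ennreal (real n)) \<le> ennreal (trunc m f x)"
      unfolding ennreal_trunc using m min.mono[OF order_refl ennreal_leI[of "real n" "real m"], of "f x"] by simp
    then show "min (f x) (ennreal (real n)) \<le> (SUP n. ennreal (trunc n f x))"
      by (rule SUP_upper2[rotated]) simp
  qed
  then show "f x \<le> (SUP n. ennreal (trunc n f x))" by (simp only: SUP_min_of_nat)
qed (auto intro!: SUP_least ennreal_trunc_le)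

lemma trunc_tendsto: "(\<lambda>n. ennreal (trunc n f x)) \<longlonglongrightarrow> f x"
proof -
  have "incseq (\<lambda>n. ennreal (trunc n f x))" by (rule monoI) (rule ennreal_trunc_mono)
  from LIMSEQ_SUP[OF this] show ?thesis by (simp add: trunc_SUP)
qed

lemma summable_diff_convergent:
  fixes F :: "nat \<Rightarrow> real"
  assumes "(\<Sum>n. ennreal \<bar>F (Suc n) - F n\<bar>) < \<infinity>"
  shows "convergent F"
proof -
  have "summable (\<lambda>n. \<bar>F (Suc n) - F n\<bar>)"
    using assms by (intro summable_suminf_not_top) (auto simp: less_top)
  then have "summable (\<lambda>n. F (Suc n) - F n)" by (rule summable_rabs_cancel)
  then have "convergent (\<lambda>n. \<Sum>i<n. F (Suc i) - F i)" by (simp add: summable_iff_convergent)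
  then have "convergent (\<lambda>n. (F n - F 0) + F 0)"
    by (intro convergent_add convergent_const) (simp add: sum_lessThan_telescope)
  then show ?thesis by simp
qed

locale bf_norm =
  fixes \<rho> :: "('n::finite) efun \<Rightarrow> ennreal"
  assumes bfn: "banach_function_norm \<rho>"
begin

lemma rho_0_iff: "f \<in> borel_measurable lebesgue \<Longrightarrow> \<rho> f = 0 \<longleftrightarrow> (AE x in lebesgue. f x = 0)"
  and rho_triangle: "f \<in> borel_measurable lebesgue \<Longrightarrow> g \<in> borel_measurable lebesgue \<Longrightarrow>
    \<rho> (\<lambda>x. f x + g x) \<le> \<rho> f + \<rho> g"
  and rho_scale: "f \<in> borel_measurable lebesgue \<Longrightarrow> c \<ge> 0 \<Longrightarrow> \<rho> (\<lambda>x. ennreal c * f x) = ennreal c * \<rho> f"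
  and rho_fatou: "f \<in> borel_measurable lebesgue \<Longrightarrow> (\<And>n. F n \<in> borel_measurable lebesgue) \<Longrightarrow>
    AE x in lebesgue. incseq (\<lambda>n. F n x) \<and> (\<lambda>n. F n x) \<longlonglongrightarrow> f x \<Longrightarrow>
    incseq (\<lambda>n. \<rho> (F n)) \<and> (\<lambda>n. \<rho> (F n)) \<longlonglongrightarrow> \<rho> f"
  and rho_saturated: "E \<in> sets lebesgue \<Longrightarrow> emeasure lebesgue E > 0 \<Longrightarrow>
    \<exists>F\<in>sets lebesgue. F \<subseteq> E \<and> emeasure lebesgue F > 0 \<and> \<rho> (indicator F) < \<infinity>"
  using bfn unfolding banach_function_norm_def by blast+

text \<open>Monotonicity is contained in the Fatou property: \<open>f, g, g, g, \<dots>\<close> increases to \<open>g\<close>.\<close>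

lemma rho_mono_AE:
  assumes "f \<in> borel_measurable lebesgue" "g \<in> borel_measurable lebesgue" "AE x in lebesgue. f x \<le> g x"
  shows "\<rho> f \<le> \<rho> g"
proof -
  define F where "F n = (if n = 0 then f else g)" for n :: nat
  have "AE x in lebesgue. incseq (\<lambda>n. F n x) \<and> (\<lambda>n. F n x) \<longlonglongrightarrow> g x"
    using assms(3)
  proof eventually_elim
    case (elim x)
    have "(\<lambda>n. F n x) \<longlonglongrightarrow> g x"
      by (rule tendsto_eventually) (auto simp: F_def eventually_sequentially intro!: exI[of _ 1])
    then show ?case using elim by (auto simp: F_def incseq_def)
  qed
  then have "incseq (\<lambda>n. \<rho> (F n))" using rho_fatou[of g F] assms by (auto simp: F_def)
  then show ?thesis using incseqD[of "\<lambda>n. \<rho> (F n)" 0 1] by (simp add: F_def)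
qed

lemma rho_cong_AE:
  assumes "f \<in> borel_measurable lebesgue" "g \<in> borel_measurable lebesgue" "AE x in lebesgue. f x = g x"
  shows "\<rho> f = \<rho> g"
  using assms by (intro antisym rho_mono_AE) auto

lemma rho_tendsto_le:
  assumes F[measurable]: "\<And>n. F n \<in> borel_measurable lebesgue" and [measurable]: "f \<in> borel_measurable lebesgue"
    and lim: "AE x in lebesgue. (\<lambda>n. F n x) \<longlonglongrightarrow> f x" and le: "\<forall>\<^sub>F n in sequentially. \<rho> (F n) \<le> c"
  shows "\<rho> f \<le> c"
proof -
  define G where "G n x = (INF m\<in>{n..}. F m x)" for n x
  have Gm[measurable]: "G n \<in> borel_measurable lebesgue" for n
    unfolding G_def by measurable
  have "AE x in lebesgue. incseq (\<lambda>n. G n x) \<and> (\<lambda>n. G n x) \<longlonglongrightarrow> f x"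
    using lim
  proof eventually_elim
    case (elim x)
    have inc: "incseq (\<lambda>n. G n x)" unfolding incseq_def G_def by (auto intro!: INF_superset_mono)
    moreover have "(SUP n. G n x) = f x"
      using lim_imp_Liminf[OF _ elim] by (simp add: liminf_SUP_INF G_def)
    ultimately show ?case using LIMSEQ_SUP[OF inc] by simp
  qed
  then have "(\<lambda>n. \<rho> (G n)) \<longlonglongrightarrow> \<rho> f" using rho_fatou[of f G] by simp
  moreover have "\<forall>\<^sub>F n in sequentially. \<rho> (G n) \<le> c"
    using le
  proof eventually_elim
    case (elim n)
    have "\<rho> (G n) \<le> \<rho> (F n)"
      by (rule rho_mono_AE) (auto simp: G_def intro: INF_lower)
    then show ?case using elim by simp
  qed
  ultimately show ?thesis by (intro tendsto_upperbound[where F=sequentially]) auto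
qed

lemma rho_zero [simp]: "\<rho> (\<lambda>x. 0) = 0"
  by (subst rho_0_iff) auto

lemma rho_sum:
  assumes "\<And>i. F i \<in> borel_measurable lebesgue"
  shows "\<rho> (\<lambda>x. \<Sum>i<(n::nat). F i x) \<le> (\<Sum>i<n. \<rho> (F i))"
proof (induction n)
  case (Suc n)
  have "\<rho> (\<lambda>x. \<Sum>i<Suc n. F i x) \<le> \<rho> (\<lambda>x. \<Sum>i<n. F i x) + \<rho> (F n)"
    using rho_triangle[of "\<lambda>x. \<Sum>i<n. F i x" "F n"] assms by simp
  then show ?case using Suc.IH by (simp add: add_right_mono order_trans)
qed simp

lemma rho_suminf:
  assumes [measurable]: "\<And>i::nat. F i \<in> borel_measurable lebesgue"
  shows "\<rho> (\<lambda>x. \<Sum>i. F i x) \<le> (\<Sum>i. \<rho> (F i))"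
proof (rule rho_tendsto_le)
  show "AE x in lebesgue. (\<lambda>n. \<Sum>i<n. F i x) \<longlonglongrightarrow> (\<Sum>i. F i x)"
    by (intro AE_I2 summable_LIMSEQ) simp
  show "\<forall>\<^sub>F n in sequentially. \<rho> (\<lambda>x. \<Sum>i<n. F i x) \<le> (\<Sum>i. \<rho> (F i))"
    by (intro always_eventually allI order_trans[OF rho_sum] sum_le_suminf) auto
qed auto

text \<open>On the set where \<open>f\<close> is infinite, \<open>f\<close> dominates every multiple of the indicator function.\<close>

lemma rho_finite_AE:
  assumes [measurable]: "f \<in> borel_measurable lebesgue" and fin: "\<rho> f < \<infinity>"
  shows "AE x in lebesgue. f x < \<infinity>"
proof -
  let ?E = "{x. f x = \<infinity>}"
  have "{x\<in>space lebesgue. f x = \<infinity>} \<in> sets lebesgue" by measurable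
  then have E[measurable]: "?E \<in> sets lebesgue" by simp
  have n: "ennreal (real n) * \<rho> (indicator ?E) \<le> \<rho> f" for n
    by (subst rho_scale[symmetric]) (auto intro!: rho_mono_AE AE_I2 split: split_indicator)
  have "\<rho> (indicator ?E) = 0"
  proof (rule ccontr)
    assume "\<rho> (indicator ?E) \<noteq> 0"
    then have pos: "\<rho> (indicator ?E) > 0" by (simp add: zero_less_iff_neq_zero)
    obtain m where m: "\<rho> f / \<rho> (indicator ?E) < of_nat m"
    proof -
      have "\<rho> f / \<rho> (indicator ?E) \<noteq> top" using fin pos by (auto simp: ennreal_divide_eq_top_iff)
      then show thesis using ennreal_Ex_less_of_nat that by (meson top.not_eq_extremum)
    qed
    have "\<rho> (indicator ?E) < \<infinity>" using n[of 1] fin by (simp add: le_less_trans)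
    then have "\<rho> f < of_nat m * \<rho> (indicator ?E)"
      using m pos fin by (cases "\<rho> f"; cases "\<rho> (indicator ?E)")
        (auto simp: divide_ennreal ennreal_of_nat_eq_real_of_nat ennreal_less_iff field_simps simp flip: ennreal_mult)
    then show False using n[of m] by (simp add: ennreal_of_nat_eq_real_of_nat)
  qed
  then have "AE x in lebesgue. indicator ?E x = (0::ennreal)" by (subst (asm) rho_0_iff) auto
  then show ?thesis by eventually_elim (auto simp: indicator_def less_top split: if_splits)
qed

lemma eabs_measurable [measurable]: "f \<in> borel_measurable lebesgue \<Longrightarrow> eabs f \<in> borel_measurable lebesgue"
  unfolding eabs_def[abs_def] by measurable

lemma bfs_measurable: "f \<in> bfs \<rho> \<Longrightarrow> f \<in> borel_measurable lebesgue"
  by (simp add: bfs_def L0_def)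

lemma rho_eabs_add:
  assumes [measurable]: "f \<in> borel_measurable lebesgue" "g \<in> borel_measurable lebesgue"
  shows "\<rho> (eabs (\<lambda>x. f x + g x)) \<le> \<rho> (eabs f) + \<rho> (eabs g)"
proof -
  have "ennreal \<bar>f x + g x\<bar> \<le> ennreal \<bar>f x\<bar> + ennreal \<bar>g x\<bar>" for x
    by (subst ennreal_plus[symmetric]) (auto intro!: ennreal_leI simp del: ennreal_plus)
  then have "\<rho> (eabs (\<lambda>x. f x + g x)) \<le> \<rho> (\<lambda>x. eabs f x + eabs g x)"
    by (intro rho_mono_AE) (auto simp: eabs_def)
  also have "\<dots> \<le> \<rho> (eabs f) + \<rho> (eabs g)" by (rule rho_triangle) auto
  finally show ?thesis .
qed

lemma rho_eabs_scale:
  assumes [measurable]: "f \<in> borel_measurable lebesgue"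
  shows "\<rho> (eabs (\<lambda>x. a * f x)) = ennreal \<bar>a\<bar> * \<rho> (eabs f)"
  using rho_scale[of "eabs f" "\<bar>a\<bar>"] by (simp add: eabs_def[abs_def] abs_mult ennreal_mult)

lemma rho_eabs_diff:
  assumes [measurable]: "f \<in> borel_measurable lebesgue" "g \<in> borel_measurable lebesgue"
  shows "\<rho> (eabs (\<lambda>x. f x - g x)) \<le> \<rho> (eabs f) + \<rho> (eabs g)"
  using rho_eabs_add[of f "\<lambda>x. - g x"] by (simp add: eabs_def[abs_def])

lemma bfs_add: "f \<in> bfs \<rho> \<Longrightarrow> g \<in> bfs \<rho> \<Longrightarrow> (\<lambda>x. f x + g x) \<in> bfs \<rho>"
  using rho_eabs_add[of f g] by (auto simp: bfs_def L0_def intro: le_less_trans)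

lemma bfs_scale: "f \<in> bfs \<rho> \<Longrightarrow> (\<lambda>x. a * f x) \<in> bfs \<rho>"
  using rho_eabs_scale[of f a] by (auto simp: bfs_def L0_def ennreal_mult_less_top)

lemma bfs_diff: "f \<in> bfs \<rho> \<Longrightarrow> g \<in> bfs \<rho> \<Longrightarrow> (\<lambda>x. f x - g x) \<in> bfs \<rho>"
  using bfs_add[of f "\<lambda>x. (-1) * g x"] bfs_scale[of g "-1"] by simp

lemma bfs_dominated:
  assumes "f \<in> bfs \<rho>" "g \<in> borel_measurable lebesgue" "AE x in lebesgue. \<bar>g x\<bar> \<le> \<bar>f x\<bar>"
  shows "g \<in> bfs \<rho>" "\<rho> (eabs g) \<le> \<rho> (eabs f)"
proof -
  have [measurable]: "f \<in> borel_measurable lebesgue" using assms(1) by (rule bfs_measurable)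
  show "\<rho> (eabs g) \<le> \<rho> (eabs f)"
    using assms(2,3) by (intro rho_mono_AE) (auto simp: eabs_def intro: ennreal_leI)
  then show "g \<in> bfs \<rho>" using assms by (auto simp: bfs_def L0_def intro: le_less_trans)
qed

text \<open>Completeness: a fast subsequence converges almost everywhere, and the Fatou property
  transfers the Cauchy estimate to its limit.\<close>

lemma bfs_complete:
  assumes F: "\<And>n. F n \<in> bfs \<rho>"
    and cauchy: "\<And>e. e > 0 \<Longrightarrow> \<exists>N. \<forall>m\<ge>N. \<forall>n\<ge>N. \<rho> (eabs (\<lambda>x. F m x - F n x)) \<le> ennreal e"
  shows "\<exists>G\<in>bfs \<rho>. (\<lambda>n. \<rho> (eabs (\<lambda>x. F n x - G x))) \<longlonglongrightarrow> 0"
proof -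
  have [measurable]: "F n \<in> borel_measurable lebesgue" for n using F by (rule bfs_measurable)
  have "\<exists>N. \<forall>m\<ge>N. \<forall>n\<ge>N. \<rho> (eabs (\<lambda>x. F m x - F n x)) \<le> ennreal ((1/2) ^ k)" for k
    by (rule cauchy) simp
  then obtain N where N: "\<And>k m n. m \<ge> N k \<Longrightarrow> n \<ge> N k \<Longrightarrow> \<rho> (eabs (\<lambda>x. F m x - F n x)) \<le> ennreal ((1/2) ^ k)"
    by metis
  define r where "r k = (\<Sum>j\<le>k. N j) + k" for k
  have "N k \<le> (\<Sum>j\<le>k. N j)" for k by (rule member_le_sum) auto
  then have rN: "N k \<le> r k" "N k \<le> r (Suc k)" "k \<le> r k" for k
    by (auto simp: r_def intro: trans_le_add1 le_SucI)
  define S where "S x = (\<Sum>k. ennreal \<bar>F (r (Suc k)) x - F (r k) x\<bar>)" for x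
  have S: "S = (\<lambda>x. \<Sum>k. eabs (\<lambda>x. F (r (Suc k)) x - F (r k) x) x)"
    by (rule ext) (simp only: S_def eabs_def)
  have "\<rho> S \<le> (\<Sum>k. \<rho> (eabs (\<lambda>x. F (r (Suc k)) x - F (r k) x)))"
    unfolding S by (rule rho_suminf) measurable
  also have "\<dots> \<le> (\<Sum>k. ennreal ((1/2) ^ k))" by (intro suminf_le N rN) auto
  also have "\<dots> = ennreal (\<Sum>k. (1/2) ^ k)" by (rule suminf_ennreal2) (auto intro: summable_geometric)
  finally have "\<rho> S < \<infinity>" by (rule le_less_trans) simp
  then have "AE x in lebesgue. S x < \<infinity>" by (rule rho_finite_AE[rotated]) (simp add: S)
  then have conv: "AE x in lebesgue. convergent (\<lambda>k. F (r k) x)"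
    unfolding S_def by eventually_elim (rule summable_diff_convergent)
  define G where "G x = lim (\<lambda>k. F (r k) x)" for x
  have [measurable]: "G \<in> borel_measurable lebesgue" unfolding G_def by measurable
  have lim: "AE x in lebesgue. (\<lambda>k. F (r k) x) \<longlonglongrightarrow> G x"
    using conv by eventually_elim (simp add: G_def convergent_LIMSEQ_iff)
  have est: "\<exists>N. \<forall>n\<ge>N. \<rho> (eabs (\<lambda>x. F n x - G x)) \<le> ennreal e" if e: "e > 0" for e
  proof -
    obtain N where N: "\<And>m n. m \<ge> N \<Longrightarrow> n \<ge> N \<Longrightarrow> \<rho> (eabs (\<lambda>x. F m x - F n x)) \<le> ennreal e"
      using cauchy[OF e] by blast
    have "\<rho> (eabs (\<lambda>x. F n x - G x)) \<le> ennreal e" if n: "n \<ge> N" for n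
    proof (rule rho_tendsto_le)
      show "AE x in lebesgue. (\<lambda>k. eabs (\<lambda>x. F n x - F (r k) x) x) \<longlonglongrightarrow> eabs (\<lambda>x. F n x - G x) x"
        using lim unfolding eabs_def by eventually_elim (intro tendsto_ennrealI tendsto_intros)
      show "\<forall>\<^sub>F k in sequentially. \<rho> (eabs (\<lambda>x. F n x - F (r k) x)) \<le> ennreal e"
        using n rN(3) by (auto simp: eventually_sequentially intro!: exI[of _ N] N intro: order_trans)
    qed auto
    then show ?thesis by blast
  qed
  obtain n where "\<rho> (eabs (\<lambda>x. F n x - G x)) \<le> ennreal 1" using est[of 1] by auto
  then have "(\<lambda>x. F n x - G x) \<in> bfs \<rho>"
    by (auto simp: bfs_def L0_def intro: le_less_trans)
  then have "(\<lambda>x. F n x - (F n x - G x)) \<in> bfs \<rho>" by (rule bfs_diff[OF F])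
  then have "G \<in> bfs \<rho>" by simp
  moreover have "(\<lambda>n. \<rho> (eabs (\<lambda>x. F n x - G x))) \<longlonglongrightarrow> 0"
  proof (rule order_tendstoI)
    fix a :: ennreal assume "0 < a"
    then obtain e where e: "0 < e" "ennreal e < a"
      using ennreal_rat_dense[of 0 a] by (metis ennreal_0 ennreal_less_zero_iff less_irrefl of_rat_0)
    then show "\<forall>\<^sub>F n in sequentially. \<rho> (eabs (\<lambda>x. F n x - G x)) < a"
      using est[OF e(1)] by (auto simp: eventually_sequentially intro: le_less_trans)
  qed simp
  ultimately show ?thesis by blast
qed


text \<open>
  The Lorentz-Luxemburg theorem in separation form. Hahn-Banach is replaced by a projection: let
  \<open>F\<close> be a bounded truncation of \<open>f\<close> with \<open>\<rho> F > 1\<close>, and let \<open>g\<close> minimise \<open>\<integral>(F - g)\<^sup>2\<close> over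
  \<open>0 \<le> g \<le> F\<close>, \<open>\<rho> g \<le> 1\<close>. The minimiser exists because a minimising sequence converges almost
  everywhere (parallelogram law) and the constraint survives by the Fatou property. Then
  \<open>k = F - g\<close> satisfies \<open>\<integral> k u \<le> \<integral> k g\<close> for all \<open>u\<close> in the unit ball, while
  \<open>\<integral> k F = \<integral> k g + \<integral> k\<^sup>2\<close> is larger. Saturation makes \<open>\<integral> k g\<close> positive, so \<open>k\<close> can be normalised.
\<close>

lemma lorentz_luxemburg_separation:
  assumes f[measurable]: "f \<in> borel_measurable lebesgue" and f1: "\<rho> f > 1"
  obtains k :: "'n rfun" where "k \<in> borel_measurable lebesgue" "\<And>x. k x \<ge> 0"
    "\<And>g. g \<in> borel_measurable lebesgue \<Longrightarrow> \<rho> g \<le> 1 \<Longrightarrow> (\<integral>\<^sup>+x. g x * ennreal (k x) \<partial>lebesgue) \<le> 1"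
    "(\<integral>\<^sup>+x. f x * ennreal (k x) \<partial>lebesgue) > 1"
proof -
  have "AE x in lebesgue. incseq (\<lambda>n. ennreal (trunc n f x)) \<and> (\<lambda>n. ennreal (trunc n f x)) \<longlonglongrightarrow> f x"
    by (intro AE_I2 conjI trunc_tendsto monoI ennreal_trunc_mono)
  then have "(\<lambda>n. \<rho> (\<lambda>x. ennreal (trunc n f x))) \<longlonglongrightarrow> \<rho> f"
    using rho_fatou[of f "\<lambda>n x. ennreal (trunc n f x)"] by simp
  then have "\<forall>\<^sub>F n in sequentially. \<rho> (\<lambda>x. ennreal (trunc n f x)) > 1" using f1 by (rule order_tendstoD(1))
  then obtain n where n: "\<rho> (\<lambda>x. ennreal (trunc n f x)) > 1" by (auto simp: eventually_sequentially)
  define F where "F = trunc n f"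
  have Fm[measurable]: "F \<in> borel_measurable lebesgue" by (simp add: F_def)
  have F0: "0 \<le> F x" "F x \<le> real n" and Fs: "x \<notin> big n \<Longrightarrow> F x = 0" and Ff: "ennreal (F x) \<le> f x" for x
    by (simp_all add: F_def trunc_nonneg trunc_le trunc_support ennreal_trunc_le)
  have Frho: "\<rho> (\<lambda>x. ennreal (F x)) > 1" using n by (simp add: F_def)
  define I where "I h = (LINT x|lebesgue. h x)" for h :: "'n rfun"
  \<comment> \<open>All integrands below are bounded and vanish outside \<open>big n\<close>.\<close>
  define Bd where "Bd h \<longleftrightarrow> h \<in> borel_measurable lebesgue \<and> (\<exists>B. \<forall>x. \<bar>h x\<bar> \<le> B) \<and> (\<forall>x. x \<notin> big n \<longrightarrow> h x = 0)"
    for h :: "'n rfun"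
  have Bdi: "integrable lebesgue h" if h: "Bd h" for h
  proof -
    obtain B where B: "\<And>x. \<bar>h x\<bar> \<le> B" "h \<in> borel_measurable lebesgue" "\<And>x. x \<notin> big n \<Longrightarrow> h x = 0"
      using h by (auto simp: Bd_def)
    have "integrable lebesgue (\<lambda>x. B * indicator (big n) x)"
      using emeasure_big_finite[of n] by (intro integrable_mult_right integrable_real_indicator) auto
    then show ?thesis
      by (rule Bochner_Integration.integrable_bound) (use B in \<open>auto split: split_indicator intro!: AE_I2 order_trans[OF B(1)]\<close>)
  qed
  have Bd_add: "Bd (\<lambda>x. g x + h x)" if "Bd g" "Bd h" for g h
  proof -
    obtain B C where "\<And>x. \<bar>g x\<bar> \<le> B" "\<And>x. \<bar>h x\<bar> \<le> C" using \<open>Bd g\<close> \<open>Bd h\<close> by (auto simp: Bd_def)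
    then have "\<bar>g x + h x\<bar> \<le> B + C" for x by (meson abs_triangle_ineq add_mono order_trans)
    then show ?thesis using that by (auto simp: Bd_def)
  qed
  have Bd_mult: "Bd (\<lambda>x. g x * h x)" if "Bd g" "Bd h" for g h
  proof -
    obtain B C where "\<And>x. \<bar>g x\<bar> \<le> B" "\<And>x. \<bar>h x\<bar> \<le> C" using \<open>Bd g\<close> \<open>Bd h\<close> by (auto simp: Bd_def)
    then have "\<bar>g x * h x\<bar> \<le> B * C" for x
      unfolding abs_mult by (meson abs_ge_zero mult_mono order_trans)
    then show ?thesis using that by (auto simp: Bd_def)
  qed
  have Bd_scale: "Bd (\<lambda>x. c * h x)" if "Bd h" for c h
  proof -
    obtain B where "\<And>x. \<bar>h x\<bar> \<le> B" using \<open>Bd h\<close> by (auto simp: Bd_def)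
    then have "\<bar>c * h x\<bar> \<le> \<bar>c\<bar> * B" for x unfolding abs_mult by (simp add: mult_left_mono)
    then show ?thesis using that by (auto simp: Bd_def)
  qed
  have Bd_diff: "Bd (\<lambda>x. g x - h x)" if "Bd g" "Bd h" for g h
    using Bd_add[OF \<open>Bd g\<close> Bd_scale[OF \<open>Bd h\<close>, of "-1"]] by simp
  have BdF: "Bd F" unfolding Bd_def using F0 Fs by (auto intro!: exI[of _ "real n"])
  define U where "U = {g \<in> borel_measurable lebesgue. (\<forall>x. 0 \<le> g x \<and> g x \<le> F x) \<and> \<rho> (\<lambda>x. ennreal (g x)) \<le> 1}"
  have BdU: "Bd g" if "g \<in> U" for g
    unfolding Bd_def
  proof (intro conjI exI[of _ "real n"] allI impI)
    fix x
    have "0 \<le> g x" "g x \<le> F x" using that by (auto simp: U_def)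
    then show "\<bar>g x\<bar> \<le> real n" and "x \<notin> big n \<Longrightarrow> g x = 0" using F0[of x] Fs[of x] by auto
  qed (use that in \<open>simp add: U_def\<close>)
  define e where "e g = I (\<lambda>x. (F x - g x)^2)" for g
  have Bd2: "Bd (\<lambda>x. (g x - h x)^2)" if "Bd g" "Bd h" for g h
    using Bd_mult[OF Bd_diff[OF that] Bd_diff[OF that]] by (simp add: power2_eq_square)
  have e0: "0 \<le> e g" for g unfolding e_def I_def by simp
  define d where "d = Inf (e ` U)"
  have U0: "(\<lambda>x. 0) \<in> U" using F0 by (auto simp: U_def)
  have bdd: "bdd_below (e ` U)" using e0 by (auto simp: bdd_below_def)
  have dle: "d \<le> e g" if "g \<in> U" for g unfolding d_def by (rule cInf_lower[OF imageI[OF that] bdd])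
  have "\<exists>g\<in>U. e g < d + (1/16) ^ m" for m
  proof -
    have "\<exists>y\<in>e ` U. y < d + (1/16) ^ m"
      by (rule cInf_lessD) (use U0 in \<open>auto simp: d_def\<close>)
    then show ?thesis by blast
  qed
  then obtain g where g: "\<And>m. g m \<in> U" "\<And>m. e (g m) < d + (1/16) ^ m" by metis
  have gm[measurable]: "g m \<in> borel_measurable lebesgue" for m using g(1)[of m] by (simp add: U_def)
  have gb: "0 \<le> g m x" "g m x \<le> F x" for m x using g(1)[of m] by (auto simp: U_def)
  have mid: "(\<lambda>x. (u x + v x) / 2) \<in> U" if u: "u \<in> U" and v: "v \<in> U" for u v
  proof -
    have [measurable]: "u \<in> borel_measurable lebesgue" "v \<in> borel_measurable lebesgue" using u v by (auto simp: U_def)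
    have uv: "0 \<le> u x" "0 \<le> v x" "u x \<le> F x" "v x \<le> F x" for x using u v by (auto simp: U_def)
    have "ennreal ((u x + v x) / 2) = ennreal (1/2) * ennreal (u x) + ennreal (1/2) * ennreal (v x)" for x
      using uv[of x] by (subst (1 2) ennreal_mult[symmetric]) (auto simp: add_divide_distrib simp flip: ennreal_plus)
    then have "\<rho> (\<lambda>x. ennreal ((u x + v x) / 2)) \<le> \<rho> (\<lambda>x. ennreal (1/2) * ennreal (u x)) + \<rho> (\<lambda>x. ennreal (1/2) * ennreal (v x))"
      by (simp only:) (rule rho_triangle; measurable)
    also have "\<dots> = ennreal (1/2) * \<rho> (\<lambda>x. ennreal (u x)) + ennreal (1/2) * \<rho> (\<lambda>x. ennreal (v x))"
      by (subst (1 2) rho_scale) auto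
    also have "\<dots> \<le> ennreal (1/2) * 1 + ennreal (1/2) * 1"
      using u v by (intro add_mono mult_left_mono) (auto simp: U_def)
    also have "\<dots> = ennreal (1/2 + 1/2)" by (subst ennreal_plus) (auto simp only: mult_1_right)
    also have "\<dots> = 1" by simp
    finally have "\<rho> (\<lambda>x. ennreal ((u x + v x) / 2)) \<le> 1" .
    moreover have "0 \<le> (u x + v x) / 2 \<and> (u x + v x) / 2 \<le> F x" for x using uv[of x] by simp
    ultimately show ?thesis unfolding U_def by simp
  qed
  have close: "I (\<lambda>x. (g (Suc m) x - g m x)^2) \<le> 4 * (1/16) ^ m" for m
  proof -
    let ?h = "\<lambda>x. (g (Suc m) x + g m x) / 2"
    have "I (\<lambda>x. (g (Suc m) x - g m x)^2) =
        I (\<lambda>x. 2 * (F x - g (Suc m) x)^2 + 2 * (F x - g m x)^2 - 4 * (F x - ?h x)^2)"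
      unfolding I_def by (intro Bochner_Integration.integral_cong refl) (simp add: power2_eq_square algebra_simps)
    also have "\<dots> = 2 * e (g (Suc m)) + 2 * e (g m) - 4 * e ?h"
      using Bdi[OF Bd2[OF BdF BdU[OF g(1)[of m]]]] Bdi[OF Bd2[OF BdF BdU[OF g(1)[of "Suc m"]]]]
        Bdi[OF Bd2[OF BdF BdU[OF mid[OF g(1)[of "Suc m"] g(1)[of m]]]]]
      unfolding e_def I_def by simp
    also have "\<dots> \<le> 2 * (d + (1/16) ^ Suc m) + 2 * (d + (1/16) ^ m) - 4 * d"
      using g(2)[of m] g(2)[of "Suc m"] dle[OF mid[OF g(1)[of "Suc m"] g(1)[of m]]]
      by (intro diff_mono add_mono mult_left_mono) (auto intro: less_imp_le)
    also have "\<dots> \<le> 4 * (1/16) ^ m" by simp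
    finally show ?thesis .
  qed
  have "(\<integral>\<^sup>+x. (\<Sum>m. ennreal \<bar>g (Suc m) x - g m x\<bar>) \<partial>lebesgue) = (\<Sum>m. \<integral>\<^sup>+x. ennreal \<bar>g (Suc m) x - g m x\<bar> \<partial>lebesgue)"
    by (rule nn_integral_suminf) measurable
  also have "\<dots> \<le> (\<Sum>m. ennreal ((measure lebesgue (big n :: (real^'n) set) + 4) * (1/2) ^ m))"
  proof (intro suminf_le allI)
    fix m
    let ?D = "\<lambda>x. g (Suc m) x - g m x"
    have "(\<integral>\<^sup>+x. ennreal \<bar>?D x\<bar> \<partial>lebesgue) = ennreal (I (\<lambda>x. \<bar>?D x\<bar>))"
      unfolding I_def using Bdi[OF Bd_diff[OF BdU[OF g(1)[of "Suc m"]] BdU[OF g(1)[of m]]]]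
      by (intro nn_integral_eq_integral) auto
    also have "I (\<lambda>x. \<bar>?D x\<bar>) \<le> I (\<lambda>x. (1/2) ^ m * indicator (big n) x + 2 ^ m * (?D x)^2)"
      unfolding I_def
    proof (rule integral_mono)
      show "integrable lebesgue (\<lambda>x. \<bar>?D x\<bar>)"
        using Bdi[OF Bd_diff[OF BdU[OF g(1)[of "Suc m"]] BdU[OF g(1)[of m]]]] by auto
      show "integrable lebesgue (\<lambda>x. (1/2) ^ m * indicator (big n) x + 2 ^ m * (?D x)^2)"
        using Bdi[OF Bd2[OF BdU[OF g(1)[of "Suc m"]] BdU[OF g(1)[of m]]]] emeasure_big_finite[of n]
        by (intro Bochner_Integration.integrable_add integrable_mult_right integrable_real_indicator) auto
      fix x
      have "t \<le> s + t^2 / s" if "s > 0" "t \<ge> 0" for s t :: real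
      proof -
        have "s^2 + t^2 - t * s = (s - t)^2 + s * t" by (simp add: power2_eq_square algebra_simps)
        moreover have "0 \<le> (s - t)^2 + s * t" using that by simp
        ultimately have "t * s \<le> s^2 + t^2" by linarith
        then show ?thesis using that by (simp add: field_simps power2_eq_square)
      qed
      from this[of "(1/2)^m" "\<bar>?D x\<bar>"] show "\<bar>?D x\<bar> \<le> (1/2) ^ m * indicator (big n) x + 2 ^ m * (?D x)^2"
        using gb[of m x] gb[of "Suc m" x] Fs[of x] by (cases "x \<in> big n") (auto simp: power_one_over field_simps)
    qed
    also have "\<dots> = (1/2) ^ m * measure lebesgue (big n :: (real^'n) set) + 2 ^ m * I (\<lambda>x. (?D x)^2)"
      unfolding I_def using Bdi[OF Bd2[OF BdU[OF g(1)[of "Suc m"]] BdU[OF g(1)[of m]]]] emeasure_big_finite[of n]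
      by (subst Bochner_Integration.integral_add) auto
    also have "\<dots> \<le> (1/2) ^ m * measure lebesgue (big n :: (real^'n) set) + 2 ^ m * (4 * (1/16) ^ m)"
      by (intro add_left_mono mult_left_mono close) auto
    also have "(2::real) ^ m * (4 * (1/16) ^ m) = 4 * (1/8) ^ m"
      by (simp add: power_mult_distrib[symmetric])
    also have "(1/8::real) ^ m \<le> (1/2) ^ m" by (rule power_mono) auto
    finally show "(\<integral>\<^sup>+x. ennreal \<bar>?D x\<bar> \<partial>lebesgue) \<le> ennreal ((measure lebesgue (big n :: (real^'n) set) + 4) * (1/2) ^ m)"
      by (simp add: algebra_simps ennreal_leI)
  qed auto
  also have "\<dots> < \<infinity>"
    by (subst suminf_ennreal2) (auto intro!: summable_mult summable_geometric)
  finally have "AE x in lebesgue. (\<Sum>m. ennreal \<bar>g (Suc m) x - g m x\<bar>) \<noteq> \<infinity>"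
    by (intro nn_integral_PInf_AE) auto
  then have "AE x in lebesgue. (\<Sum>m. ennreal \<bar>g (Suc m) x - g m x\<bar>) < \<infinity>"
    by (simp add: less_top)
  then have conv: "AE x in lebesgue. convergent (\<lambda>m. g m x)"
    by eventually_elim (rule summable_diff_convergent)
  \<comment> \<open>The clamping keeps \<open>0 \<le> gs \<le> F\<close> also where the limit does not exist.\<close>
  define gs where "gs x = min (F x) (max 0 (lim (\<lambda>m. g m x)))" for x
  have gsm[measurable]: "gs \<in> borel_measurable lebesgue" unfolding gs_def by measurable
  have gsb: "0 \<le> gs x" "gs x \<le> F x" for x using F0 by (auto simp: gs_def)
  have glim: "AE x in lebesgue. (\<lambda>m. g m x) \<longlonglongrightarrow> gs x"
    using conv
  proof eventually_elim
    case (elim x)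
    then have l: "(\<lambda>m. g m x) \<longlonglongrightarrow> lim (\<lambda>m. g m x)" by (simp add: convergent_LIMSEQ_iff)
    have "0 \<le> lim (\<lambda>m. g m x)" using l by (rule LIMSEQ_le_const) (use gb in auto)
    moreover have "lim (\<lambda>m. g m x) \<le> F x" using l by (rule LIMSEQ_le_const2) (use gb in auto)
    ultimately show ?case using l by (simp add: gs_def)
  qed
  have "\<rho> (\<lambda>x. ennreal (gs x)) \<le> 1"
  proof (rule rho_tendsto_le)
    show "AE x in lebesgue. (\<lambda>m. ennreal (g m x)) \<longlonglongrightarrow> ennreal (gs x)"
      using glim by eventually_elim (rule tendsto_ennrealI)
    show "\<forall>\<^sub>F m in sequentially. \<rho> (\<lambda>x. ennreal (g m x)) \<le> 1" using g(1) by (simp add: U_def)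
  qed auto
  then have gsU: "gs \<in> U" using gsb by (simp add: U_def)
  have "(\<lambda>m. e (g m)) \<longlonglongrightarrow> e gs"
    unfolding e_def I_def
  proof (rule integral_dominated_convergence)
    show "integrable lebesgue (\<lambda>x. (F x)^2)" using Bdi[OF Bd_mult[OF BdF BdF]] by (simp add: power2_eq_square)
    show "AE x in lebesgue. (\<lambda>m. (F x - g m x)^2) \<longlonglongrightarrow> (F x - gs x)^2"
      using glim by eventually_elim (intro tendsto_intros)
    show "AE x in lebesgue. norm ((F x - g m x)^2) \<le> (F x)^2" for m
      using gb by (intro AE_I2) (auto intro!: power_mono)
  qed measurable
  moreover have "(\<lambda>m. d + (1/16) ^ m) \<longlonglongrightarrow> d + 0" by (intro tendsto_intros) simp
  ultimately have "e gs \<le> d + 0" by (rule LIMSEQ_le) (use g(2) less_imp_le in blast)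
  then have emin: "e gs \<le> e h" if "h \<in> U" for h using dle[OF that] by simp
  define k where "k x = F x - gs x" for x
  have km[measurable]: "k \<in> borel_measurable lebesgue" unfolding k_def by measurable
  have k0: "0 \<le> k x" and ks: "x \<notin> big n \<Longrightarrow> k x = 0" for x using gsb[of x] Fs[of x] by (auto simp: k_def)
  have Bdk: "Bd k" using Bd_diff[OF BdF BdU[OF gsU]] by (simp add: k_def[abs_def])
  have Bdg: "Bd gs" by (rule BdU[OF gsU])
  define a where "a = I (\<lambda>x. k x * gs x)"
  have a0: "a \<ge> 0" unfolding a_def I_def using k0 gsb by (intro Bochner_Integration.integral_nonneg) auto
  have var: "I (\<lambda>x. k x * G x) \<le> a"
    if G: "G \<in> borel_measurable lebesgue" "\<And>x. 0 \<le> G x" "Bd G" "\<rho> (\<lambda>x. ennreal (G x)) \<le> 1" for G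
  proof (rule ccontr)
    have [measurable]: "G \<in> borel_measurable lebesgue" by fact
    assume "\<not> ?thesis"
    then have J: "I (\<lambda>x. k x * G x) - a > 0" (is "?J > 0") by simp
    define V where "V = I (\<lambda>x. (G x - gs x)^2)"
    have V0: "V \<ge> 0" unfolding V_def I_def by simp
    \<comment> \<open>Moving from \<open>gs\<close> towards \<open>G\<close> by \<open>t\<close> (and cutting off at \<open>F\<close>) must not decrease the distance to \<open>F\<close>;
      the first-order term in \<open>t\<close> gives a contradiction.\<close>
    have key: "2 * t * ?J \<le> t^2 * V" if t: "0 < t" "t \<le> 1" for t
    proof -
      define h where "h x = min (F x) ((1 - t) * gs x + t * G x)" for x
      have [measurable]: "h \<in> borel_measurable lebesgue" unfolding h_def by measurable
      have h0: "0 \<le> h x" "h x \<le> F x" for x unfolding h_def using F0 gsb G(2) t by auto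
      have "ennreal (h x) \<le> ennreal (1 - t) * ennreal (gs x) + ennreal t * ennreal (G x)" for x
      proof -
        have "ennreal (h x) \<le> ennreal ((1 - t) * gs x + t * G x)" by (rule ennreal_leI) (simp add: h_def)
        also have "\<dots> = ennreal (1 - t) * ennreal (gs x) + ennreal t * ennreal (G x)"
          using t gsb[of x] G(2)[of x] by (simp add: ennreal_mult)
        finally show ?thesis .
      qed
      then have "\<rho> (\<lambda>x. ennreal (h x)) \<le> \<rho> (\<lambda>x. ennreal (1 - t) * ennreal (gs x) + ennreal t * ennreal (G x))"
        by (intro rho_mono_AE AE_I2) measurable
      also have "\<dots> \<le> \<rho> (\<lambda>x. ennreal (1 - t) * ennreal (gs x)) + \<rho> (\<lambda>x. ennreal t * ennreal (G x))"
        by (rule rho_triangle) measurable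
      also have "\<dots> = ennreal (1 - t) * \<rho> (\<lambda>x. ennreal (gs x)) + ennreal t * \<rho> (\<lambda>x. ennreal (G x))"
        using t by (subst (1 2) rho_scale) auto
      also have "\<dots> \<le> ennreal (1 - t) * 1 + ennreal t * 1"
        using gsU G(4) by (intro add_mono mult_left_mono) (auto simp: U_def)
      also have "\<dots> = 1" using t by (simp flip: ennreal_plus)
      finally have "h \<in> U" using h0 by (simp add: U_def)
      then have "e gs \<le> e h" by (rule emin)
      also have "e h \<le> I (\<lambda>x. (k x - t * (G x - gs x))^2)"
        unfolding e_def I_def
      proof (rule integral_mono)
        show "integrable lebesgue (\<lambda>x. (F x - h x)^2)" by (rule Bdi[OF Bd2[OF BdF BdU[OF \<open>h \<in> U\<close>]]])
        show "integrable lebesgue (\<lambda>x. (k x - t * (G x - gs x))^2)"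
          by (rule Bdi[OF Bd2[OF Bdk Bd_scale[OF Bd_diff[OF G(3) Bdg]]]])
        fix x
        have "F x - ((1 - t) * gs x + t * G x) = k x - t * (G x - gs x)" by (simp add: k_def algebra_simps)
        then show "(F x - h x)^2 \<le> (k x - t * (G x - gs x))^2" by (auto simp: h_def min_def)
      qed
      also have "\<dots> = I (\<lambda>x. (F x - gs x)^2 - 2 * t * (k x * G x - k x * gs x) + t^2 * (G x - gs x)^2)"
        unfolding I_def by (intro Bochner_Integration.integral_cong refl) (simp add: k_def power2_eq_square algebra_simps)
      also have "\<dots> = e gs - 2 * t * ?J + t^2 * V"
        using Bdi[OF Bd2[OF BdF Bdg]] Bdi[OF Bd_mult[OF Bdk G(3)]] Bdi[OF Bd_mult[OF Bdk Bdg]] Bdi[OF Bd2[OF G(3) Bdg]]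
        unfolding e_def I_def a_def V_def by simp
      finally show ?thesis by simp
    qed
    define t where "t = min 1 (?J / (V + 1))"
    have "t * (V + 1) \<le> ?J / (V + 1) * (V + 1)"
      by (rule mult_right_mono) (use V0 in \<open>auto simp: t_def\<close>)
    then have t: "0 < t" "t \<le> 1" "t * (V + 1) \<le> ?J" using J V0 by (auto simp: t_def)
    have "2 * ?J \<le> t * V" using key[OF t(1,2)] t(1) by (simp add: power2_eq_square)
    also have "\<dots> \<le> t * (V + 1)" using t(1) by simp
    finally have "2 * ?J \<le> ?J" using t(3) by (rule order_trans)
    then show False using J by simp
  qed
  have nnB: "(\<integral>\<^sup>+x. ennreal (h x) \<partial>lebesgue) = ennreal (I h)" if "Bd h" "\<And>x. 0 \<le> h x" for h
    unfolding I_def using that Bdi by (intro nn_integral_eq_integral) auto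
  have ball: "(\<integral>\<^sup>+x. u x * ennreal (k x) \<partial>lebesgue) \<le> ennreal a"
    if [measurable]: "u \<in> borel_measurable lebesgue" and u: "\<rho> u \<le> 1" for u
  proof -
    have "u x * ennreal (k x) = (SUP m. ennreal (trunc m u x) * ennreal (k x))" for x
      by (simp add: trunc_SUP flip: SUP_mult_right_ennreal)
    then have "(\<integral>\<^sup>+x. u x * ennreal (k x) \<partial>lebesgue) = (SUP m. \<integral>\<^sup>+x. ennreal (trunc m u x) * ennreal (k x) \<partial>lebesgue)"
      by (simp only:, intro nn_integral_monotone_convergence_SUP)
        (auto simp: incseq_def le_fun_def intro!: mult_right_mono ennreal_trunc_mono)
    also have "\<dots> \<le> ennreal a"
    proof (rule SUP_least)
      fix m
      define G where "G x = trunc m u x * indicator (big n) x" for x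
      have Gm[measurable]: "G \<in> borel_measurable lebesgue"
        unfolding G_def[abs_def] by (intro borel_measurable_times borel_measurable_indicator big_lebesgue) measurable
      have G0: "0 \<le> G x" "G x \<le> real m" for x
        unfolding G_def using trunc_nonneg[of m u x] trunc_le[of m u x] by (auto split: split_indicator)
      have "Bd G" unfolding Bd_def using G0 by (auto simp: G_def intro!: exI[of _ "real m"])
      have "\<rho> (\<lambda>x. ennreal (G x)) \<le> \<rho> u"
        by (intro rho_mono_AE AE_I2) (auto simp: G_def ennreal_trunc_le split: split_indicator)
      then have "I (\<lambda>x. k x * G x) \<le> a" using u \<open>Bd G\<close> G0 by (intro var) auto
      moreover have "(\<integral>\<^sup>+x. ennreal (trunc m u x) * ennreal (k x) \<partial>lebesgue) = (\<integral>\<^sup>+x. ennreal (k x * G x) \<partial>lebesgue)"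
        using ks k0 trunc_nonneg[of m u]
        by (intro nn_integral_cong) (auto simp: G_def ennreal_mult mult.commute split: split_indicator)
      moreover have "\<dots> = ennreal (I (\<lambda>x. k x * G x))"
        using Bd_mult[OF Bdk \<open>Bd G\<close>] k0 G0 by (intro nnB) auto
      ultimately show "(\<integral>\<^sup>+x. ennreal (trunc m u x) * ennreal (k x) \<partial>lebesgue) \<le> ennreal a"
        by (simp add: ennreal_leI)
    qed
    finally show ?thesis .
  qed
  have epos: "e gs > 0"
  proof (rule ccontr)
    assume "\<not> e gs > 0"
    then have "e gs = 0" using e0[of gs] by simp
    then have "AE x in lebesgue. (F x - gs x)^2 = 0"
      unfolding e_def I_def using Bdi[OF Bd2[OF BdF Bdg]]
      by (subst (asm) integral_nonneg_eq_0_iff_AE) auto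
    then have "\<rho> (\<lambda>x. ennreal (F x)) = \<rho> (\<lambda>x. ennreal (gs x))"
      by (intro rho_cong_AE) auto
    then show False using Frho gsU by (auto simp: U_def)
  qed
  have apos: "a > 0"
  proof -
    have "\<not> (AE x in lebesgue. k x = 0)"
    proof
      assume "AE x in lebesgue. k x = 0"
      then have "e gs = I (\<lambda>x. 0)" unfolding e_def I_def k_def[symmetric]
        by (intro integral_cong_AE) auto
      then show False using epos by (simp add: I_def)
    qed
    moreover have mE: "{x. k x \<noteq> 0} \<in> sets lebesgue"
    proof -
      have "{x\<in>space lebesgue. k x \<noteq> 0} \<in> sets lebesgue" by measurable
      then show ?thesis by simp
    qed
    ultimately have "emeasure lebesgue {x. k x \<noteq> 0} > 0"
      by (subst (asm) AE_iff_measurable[OF mE]) (auto simp: zero_less_iff_neq_zero)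
    then obtain S where S: "S \<in> sets lebesgue" "S \<subseteq> {x. k x \<noteq> 0}" "emeasure lebesgue S > 0" "\<rho> (indicator S) < \<infinity>"
      using rho_saturated[OF mE] by blast
    have [measurable]: "S \<in> sets lebesgue" by (rule S(1))
    define r where "r = enn2real (\<rho> (indicator S))"
    have r: "\<rho> (indicator S) = ennreal r" "r \<ge> 0" using S(4) by (auto simp: r_def less_top)
    define c where "c = 1 / (1 + r)"
    have c: "c > 0" "c * r \<le> 1" using r by (auto simp: c_def field_simps)
    have "\<rho> (\<lambda>x. ennreal c * indicator S x) \<le> 1"
      using c r by (subst rho_scale) (auto simp flip: ennreal_mult)
    then have le: "(\<integral>\<^sup>+x. (ennreal c * indicator S x) * ennreal (k x) \<partial>lebesgue) \<le> ennreal a"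
      by (rule ball[rotated]) measurable
    show "a > 0"
    proof (rule ccontr)
      assume "\<not> a > 0"
      then have "(\<integral>\<^sup>+x. (ennreal c * indicator S x) * ennreal (k x) \<partial>lebesgue) = 0" using le a0 by simp
      then have "AE x in lebesgue. (ennreal c * indicator S x) * ennreal (k x) = 0"
        by (subst (asm) nn_integral_0_iff_AE) auto
      then have "AE x in lebesgue. x \<notin> S"
      proof eventually_elim
        case (elim x)
        show ?case
        proof
          assume x: "x \<in> S"
          then have "k x > 0" using S(2) k0[of x] by (force simp: less_le)
          then show False using elim x c by simp
        qed
      qed
      then have "emeasure lebesgue S = 0" using AE_iff_measurable[OF S(1), of "\<lambda>x. x \<notin> S"] by simp
      then show False using S(3) by simp
    qed
  qed
  show ?thesis
  proof (rule that[of "\<lambda>x. k x / a"])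
    fix u assume u[measurable]: "u \<in> borel_measurable lebesgue" "\<rho> u \<le> 1"
    have "(\<integral>\<^sup>+x. u x * ennreal (k x / a) \<partial>lebesgue) = (\<integral>\<^sup>+x. (u x * ennreal (k x)) * ennreal (1 / a) \<partial>lebesgue)"
      using k0 apos by (intro nn_integral_cong) (simp add: mult.assoc flip: ennreal_mult)
    also have "\<dots> = (\<integral>\<^sup>+x. u x * ennreal (k x) \<partial>lebesgue) * ennreal (1 / a)" by (rule nn_integral_multc) measurable
    also have "\<dots> \<le> ennreal a * ennreal (1 / a)" by (intro mult_right_mono ball[OF u]) auto
    also have "\<dots> = 1" using apos by (simp flip: ennreal_mult)
    finally show "(\<integral>\<^sup>+x. u x * ennreal (k x / a) \<partial>lebesgue) \<le> 1" .
  next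
    have "e gs + a = I (\<lambda>x. (F x - gs x)^2 + k x * gs x)"
      unfolding e_def a_def I_def using Bdi[OF Bd2[OF BdF Bdg]] Bdi[OF Bd_mult[OF Bdk Bdg]] by simp
    also have "\<dots> = I (\<lambda>x. F x * k x)"
      unfolding I_def by (intro Bochner_Integration.integral_cong refl) (simp add: k_def power2_eq_square algebra_simps)
    finally have "I (\<lambda>x. F x * k x) > a" using epos by simp
    then have "1 < ennreal (I (\<lambda>x. F x * k x)) * ennreal (1 / a)"
      using apos by (simp add: divide_simps flip: ennreal_mult)
    also have "ennreal (I (\<lambda>x. F x * k x)) = (\<integral>\<^sup>+x. ennreal (F x * k x) \<partial>lebesgue)"
      using Bd_mult[OF BdF Bdk] F0 k0 by (intro nnB[symmetric]) auto
    also have "(\<integral>\<^sup>+x. ennreal (F x * k x) \<partial>lebesgue) * ennreal (1 / a) = (\<integral>\<^sup>+x. ennreal (F x * k x) * ennreal (1 / a) \<partial>lebesgue)"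
      by (rule nn_integral_multc[symmetric]) measurable
    also have "\<dots> \<le> (\<integral>\<^sup>+x. f x * ennreal (k x / a) \<partial>lebesgue)"
    proof (rule nn_integral_mono)
      fix x
      have "ennreal (F x * k x) * ennreal (1 / a) = ennreal (F x) * ennreal (k x / a)"
        using F0[of x] k0[of x] apos by (simp flip: ennreal_mult)
      also have "\<dots> \<le> f x * ennreal (k x / a)" by (intro mult_right_mono Ff) simp
      finally show "ennreal (F x * k x) * ennreal (1 / a) \<le> f x * ennreal (k x / a)" .
    qed
    finally show "(\<integral>\<^sup>+x. f x * ennreal (k x / a) \<partial>lebesgue) > 1" .
  qed (use k0 apos in auto)
qed

end


section \<open>Duality and the sharp inequality\<close>

text \<open>A best constant is attained at each \<open>f\<close> with \<open>b f < \<infinity>\<close>. The case \<open>b f = 0\<close> needs one admissible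
  constant, the case \<open>b f = \<infinity>\<close> would fail for the constant \<open>0\<close>.\<close>

lemma best_constant_bound:
  fixes a b :: "'a \<Rightarrow> ennreal"
  assumes fin: "Inf {C. \<forall>f\<in>X. a f \<le> C * b f} < \<infinity>" and f: "f \<in> X" and b: "b f < \<infinity>"
  shows "a f \<le> Inf {C. \<forall>f\<in>X. a f \<le> C * b f} * b f"
proof (cases "b f = 0")
  case True
  obtain C where "\<forall>f\<in>X. a f \<le> C * b f"
    using fin by (auto simp: Inf_less_iff)
  then show ?thesis using f True by auto
next
  case False
  then obtain s where s: "b f = ennreal s" "s > 0" using b by (cases "b f") auto
  have "a f / ennreal s \<le> Inf {C. \<forall>f\<in>X. a f \<le> C * b f}"
  proof (rule Inf_greatest)
    fix C assume "C \<in> {C. \<forall>f\<in>X. a f \<le> C * b f}"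
    then have "a f / ennreal s \<le> C * ennreal s / ennreal s"
      using f s(1) by (intro divide_right_mono_ennreal) auto
    then show "a f / ennreal s \<le> C" by (simp add: ennreal_mult_divide_cancel[OF s(2)])
  qed
  then have "a f / ennreal s * ennreal s \<le> Inf {C. \<forall>f\<in>X. a f \<le> C * b f} * ennreal s"
    by (rule mult_right_mono) simp
  then show ?thesis by (simp add: ennreal_divide_mult_cancel[OF s(2)] s(1))
qed

lemma op_norm_bound:
  "op_norm X r A < \<infinity> \<Longrightarrow> f \<in> X \<Longrightarrow> r (eabs f) < \<infinity> \<Longrightarrow> r (A f) \<le> op_norm X r A * r (eabs f)"
  unfolding op_norm_def by (rule best_constant_bound)

lemma sharp_const_attained:
  "sharp_const sh r < \<infinity> \<Longrightarrow> f \<in> bfs r \<Longrightarrow> finite_level_sets f \<Longrightarrow> r (sh f) < \<infinity> \<Longrightarrow>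
    r (eabs f) \<le> sharp_const sh r * r (sh f)"
  using best_constant_bound[of "{f \<in> bfs r. finite_level_sets f}" "\<lambda>f. r (eabs f)" "\<lambda>f. r (sh f)" f]
  by (simp add: sharp_const_def imp_conjL Ball_def)

lemma op_norm_leI: "(\<And>f. f \<in> X \<Longrightarrow> r (A f) \<le> C * r (eabs f)) \<Longrightarrow> op_norm X r A \<le> C"
  unfolding op_norm_def by (rule Inf_lower) blast

text \<open>The medians over growing cubes; their limit is the constant to be subtracted from \<open>T f\<close>.\<close>

definition lim_med :: "('n::finite) rfun \<Rightarrow> real" where
  "lim_med g = lim (\<lambda>n. med (big n) g)"

lemma med_cong_AE:
  assumes "ae_eq f g" "f \<in> L0" "g \<in> L0" "Q \<in> cubes"
  shows "med Q f = med Q g"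
proof -
  have "measure lebesgue {x\<in>Q. f x > c} = measure lebesgue {x\<in>Q. g x > c}" for c
    using assms level_lmeasurable(1)[OF assms(4,2), of c] level_lmeasurable(1)[OF assms(4,3), of c]
    by (intro measure_eq_AE) (auto simp: ae_eq_def)
  then show ?thesis by (simp add: med_def)
qed

lemma lim_med_cong_AE: "ae_eq f g \<Longrightarrow> f \<in> L0 \<Longrightarrow> g \<in> L0 \<Longrightarrow> lim_med f = lim_med g"
  by (simp add: lim_med_def med_cong_AE)

text \<open>Once the cube has more than twice the volume of \<open>{|g| > s}\<close>, its median is at most \<open>s\<close> in
  absolute value.\<close>

lemma med_big_finite_level:
  assumes g: "(g :: 'n::finite rfun) \<in> L0" and fl: "finite_level_sets g"
  shows "(\<lambda>n. med (big n) g) \<longlonglongrightarrow> 0"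
proof (rule LIMSEQ_I)
  fix r :: real assume "r > 0"
  define s where "s = r / 2"
  have s: "s > 0" "s < r" using \<open>r > 0\<close> by (auto simp: s_def)
  have [measurable]: "g \<in> borel_measurable lebesgue" using g by (simp add: L0_def)
  have "{x\<in>space lebesgue. \<bar>g x\<bar> > s} \<in> sets lebesgue" by measurable
  then have L: "{x. \<bar>g x\<bar> > s} \<in> lmeasurable"
    using fl s by (simp add: finite_level_sets_def fmeasurable_def)
  let ?m = "measure lebesgue {x. \<bar>g x\<bar> > s}"
  obtain N :: nat where N: "2 * ?m < 2 ^ N" using real_arch_pow[of 2 "2 * ?m"] by auto
  have "norm (med (big n) g - 0) < r" if n: "n \<ge> N" for n
  proof -
    have "measure lebesgue {x\<in>big n. \<bar>g x - 0\<bar> > s} \<le> ?m"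
      using L level_lmeasurable(3)[OF big_in_cubes g, of n s 0] by (intro measure_mono_fmeasurable) (auto simp: fmeasurableD)
    also have "\<dots> < 2 ^ N / 2" using N by simp
    also have "(2::real) ^ N \<le> measure lebesgue (big n :: (real^'n) set)"
    proof -
      have "(2::real) ^ N \<le> 2 ^ Suc n" using n by (intro power_increasing) auto
      also have "\<dots> = (2 ^ Suc n) ^ 1" by simp
      also have "\<dots> \<le> (2 ^ Suc n) ^ CARD('n)"
        by (intro power_increasing) (auto simp: Suc_le_eq simp del: power_Suc)
      finally show ?thesis by (simp only: measure_big)
    qed
    finally have "measure lebesgue {x\<in>big n. \<bar>g x - 0\<bar> > s} < measure lebesgue (big n :: (real^'n) set) / 2" by simp
    then have "\<bar>med (big n) g - 0\<bar> \<le> s" by (rule med_close[OF big_in_cubes g])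
    then show ?thesis using s by simp
  qed
  then show "\<exists>no. \<forall>n\<ge>no. norm (med (big n) g - 0) < r" by blast
qed

text \<open>Letting the cubes grow in the local estimate, by Fatou's lemma.\<close>

lemma fefferman_stein_global:
  assumes g: "(g :: 'n::finite rfun) \<in> L0" and k[measurable]: "k \<in> borel_measurable lebesgue" and k0: "\<And>x. 0 \<le> k x"
    and c: "(\<lambda>n. med (big n) g) \<longlonglongrightarrow> c"
  shows "(\<integral>\<^sup>+x. ennreal \<bar>g x - c\<bar> * ennreal (k x) \<partial>lebesgue)
    \<le> ennreal (fs_const CARD('n)) * (\<integral>\<^sup>+x. sharp_max_weak g x * eM (\<lambda>x. ennreal (k x)) x \<partial>lebesgue)"
proof -
  have [measurable]: "g \<in> borel_measurable lebesgue" using g by (simp add: L0_def)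
  define h where "h n x = ennreal \<bar>g x - med (big n) g\<bar> * ennreal (k x) * indicator (big n) x" for n x
  have hm: "h n \<in> borel_measurable lebesgue" for n
    unfolding h_def by (intro borel_measurable_times_ennreal borel_measurable_indicator big_lebesgue) measurable
  have "(\<lambda>n. h n x) \<longlonglongrightarrow> ennreal \<bar>g x - c\<bar> * ennreal (k x)" for x
  proof -
    have "(\<lambda>n. ennreal (\<bar>g x - med (big n) g\<bar> * k x)) \<longlonglongrightarrow> ennreal (\<bar>g x - c\<bar> * k x)"
      by (intro tendsto_ennrealI tendsto_intros c)
    moreover have "\<forall>\<^sub>F n in sequentially. ennreal (\<bar>g x - med (big n) g\<bar> * k x) = h n x"
      using eventually_big[of x] by eventually_elim (simp add: h_def ennreal_mult k0)
    ultimately show ?thesis using k0 by (simp add: ennreal_mult filterlim_cong)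
  qed
  then have "(\<integral>\<^sup>+x. ennreal \<bar>g x - c\<bar> * ennreal (k x) \<partial>lebesgue) = (\<integral>\<^sup>+x. liminf (\<lambda>n. h n x) \<partial>lebesgue)"
    by (intro nn_integral_cong lim_imp_Liminf[symmetric]) auto
  also have "\<dots> \<le> liminf (\<lambda>n. \<integral>\<^sup>+x. h n x \<partial>lebesgue)" by (rule nn_integral_liminf[OF hm])
  also have "\<dots> \<le> ennreal (fs_const CARD('n)) * (\<integral>\<^sup>+x. sharp_max_weak g x * eM (\<lambda>x. ennreal (k x)) x \<partial>lebesgue)"
  proof (rule Liminf_le)
    have "(\<integral>\<^sup>+x. h n x \<partial>lebesgue)
        \<le> ennreal (fs_const CARD('n)) * (\<integral>\<^sup>+x\<in>big n. sharp_max_weak g x * eM (\<lambda>x. ennreal (k x)) x \<partial>lebesgue)" for n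
      unfolding h_def by (rule fefferman_stein_local[OF g _ big_in_cubes]) measurable
    also have "\<dots> n \<le> ennreal (fs_const CARD('n)) * (\<integral>\<^sup>+x. sharp_max_weak g x * eM (\<lambda>x. ennreal (k x)) x \<partial>lebesgue)" for n
      by (intro mult_left_mono nn_integral_mono) (auto split: split_indicator)
    finally show "\<forall>\<^sub>F n in sequentially. (\<integral>\<^sup>+x. h n x \<partial>lebesgue)
        \<le> ennreal (fs_const CARD('n)) * (\<integral>\<^sup>+x. sharp_max_weak g x * eM (\<lambda>x. ennreal (k x)) x \<partial>lebesgue)" by simp
  qed simp
  finally show ?thesis .
qed

context bf_norm
begin

text \<open>The positive part of the unit ball of the dual space, tested on \<open>[0,\<infinity>]\<close>-valued functions.\<close>

definition dual_ball :: "'n rfun \<Rightarrow> bool" where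
  "dual_ball k \<longleftrightarrow> k \<in> borel_measurable lebesgue \<and> (\<forall>x. k x \<ge> 0) \<and>
    (\<forall>g\<in>borel_measurable lebesgue. \<rho> g \<le> 1 \<longrightarrow> (\<integral>\<^sup>+x. g x * ennreal (k x) \<partial>lebesgue) \<le> 1)"

lemma dual_ball_integral_le:
  assumes k: "dual_ball k" and [measurable]: "g \<in> borel_measurable lebesgue" and fin: "\<rho> g < \<infinity>"
  shows "(\<integral>\<^sup>+x. g x * ennreal (k x) \<partial>lebesgue) < \<infinity>"
proof -
  have [measurable]: "k \<in> borel_measurable lebesgue" using k by (simp add: dual_ball_def)
  define r where "r = enn2real (\<rho> g) + 1"
  have r: "r > 0" "\<rho> g \<le> ennreal r" using fin by (auto simp: r_def add_nonneg_pos ennreal_enn2real_if intro!: order_trans[OF _ ennreal_leI[of "enn2real (\<rho> g)"]])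
  have "\<rho> (\<lambda>x. ennreal (1 / r) * g x) = ennreal (1 / r) * \<rho> g" using r by (intro rho_scale) auto
  also have "\<dots> \<le> ennreal (1 / r) * ennreal r" using r by (intro mult_left_mono) auto
  also have "\<dots> = 1" using r by (simp flip: ennreal_mult)
  finally have le: "(\<integral>\<^sup>+x. ennreal (1 / r) * g x * ennreal (k x) \<partial>lebesgue) \<le> 1"
    using k by (simp add: dual_ball_def)
  have "(\<integral>\<^sup>+x. g x * ennreal (k x) \<partial>lebesgue) = ennreal r * (\<integral>\<^sup>+x. ennreal (1 / r) * g x * ennreal (k x) \<partial>lebesgue)"
  proof (subst nn_integral_cmult[symmetric])
    have "ennreal r * (ennreal (1 / r) * g x * ennreal (k x)) = (ennreal r * ennreal (1 / r)) * (g x * ennreal (k x))" for x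
      by (simp only: mult_ac)
    moreover have "ennreal r * ennreal (1 / r) = 1" using r by (simp flip: ennreal_mult)
    ultimately show "(\<integral>\<^sup>+x. g x * ennreal (k x) \<partial>lebesgue)
        = (\<integral>\<^sup>+x. ennreal r * (ennreal (1 / r) * g x * ennreal (k x)) \<partial>lebesgue)" by simp
  qed measurable
  also have "\<dots> \<le> ennreal r * 1" by (intro mult_left_mono le) auto
  finally show ?thesis by (rule le_less_trans) simp
qed

lemma dual_ball_kothe:
  assumes k: "dual_ball k"
  shows "k \<in> kothe_dual \<rho>" "kothe_norm \<rho> (eabs k) \<le> 1"
proof -
  have [measurable]: "k \<in> borel_measurable lebesgue" and k0: "\<And>x. k x \<ge> 0"
    using k by (auto simp: dual_ball_def)
  have "integrable lebesgue (\<lambda>x. f x * k x)" if f: "f \<in> bfs \<rho>" for f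
  proof (rule integrableI_bounded)
    have [measurable]: "f \<in> borel_measurable lebesgue" using f by (rule bfs_measurable)
    show "(\<lambda>x. f x * k x) \<in> borel_measurable lebesgue" by measurable
    have "(\<integral>\<^sup>+x. eabs f x * ennreal (k x) \<partial>lebesgue) < \<infinity>"
      using f by (intro dual_ball_integral_le[OF k]) (auto simp: bfs_def)
    then show "(\<integral>\<^sup>+x. ennreal (norm (f x * k x)) \<partial>lebesgue) < \<infinity>"
      using k0 by (simp add: eabs_def abs_mult ennreal_mult)
  qed
  then show "k \<in> kothe_dual \<rho>" by (simp add: kothe_dual_def L0_def)
  show "kothe_norm \<rho> (eabs k) \<le> 1"
    unfolding kothe_norm_def
  proof (rule SUP_least)
    fix f assume "f \<in> {f \<in> bfs \<rho>. \<rho> (eabs f) = 1}"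
    then have "(\<integral>\<^sup>+x. eabs f x * ennreal (k x) \<partial>lebesgue) \<le> 1"
      using k bfs_measurable by (simp add: dual_ball_def)
    then show "(\<integral>\<^sup>+x. eabs f x * eabs k x \<partial>lebesgue) \<le> 1" using k0 by (simp add: eabs_def[of k])
  qed
qed

lemma holder_kothe:
  assumes [measurable]: "G \<in> borel_measurable lebesgue" "H \<in> borel_measurable lebesgue" and fin: "\<rho> G < \<infinity>"
  shows "(\<integral>\<^sup>+x. G x * H x \<partial>lebesgue) \<le> \<rho> G * kothe_norm \<rho> H"
proof (cases "\<rho> G = 0")
  case True
  then have "AE x in lebesgue. G x = 0" by (subst (asm) rho_0_iff) auto
  then have "AE x in lebesgue. G x * H x = 0" by eventually_elim simp
  then have "(\<integral>\<^sup>+x. G x * H x \<partial>lebesgue) = 0" by (subst nn_integral_0_iff_AE) auto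
  then show ?thesis by simp
next
  case False
  then obtain r where r: "\<rho> G = ennreal r" "r > 0" using fin by (cases "\<rho> G") auto
  define f where "f x = enn2real (G x) / r" for x
  have [measurable]: "f \<in> borel_measurable lebesgue" unfolding f_def by measurable
  have Gfin: "AE x in lebesgue. G x < \<infinity>" by (rule rho_finite_AE[OF _ fin]) measurable
  have fG: "AE x in lebesgue. ennreal r * eabs f x = G x"
    using Gfin by eventually_elim (use r in \<open>auto simp: eabs_def f_def simp flip: ennreal_mult\<close>)
  have "ennreal r * \<rho> (eabs f) = \<rho> (\<lambda>x. ennreal r * eabs f x)" using r by (subst rho_scale) auto
  also have "\<dots> = ennreal r" unfolding r(1)[symmetric] by (rule rho_cong_AE) (use fG r in auto)
  finally have "\<rho> (eabs f) = 1"
    using r(2) by (cases "\<rho> (eabs f)") (auto simp: ennreal_mult_top simp flip: ennreal_mult)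
  then have "f \<in> {f \<in> bfs \<rho>. \<rho> (eabs f) = 1}" by (simp add: bfs_def L0_def)
  then have le: "(\<integral>\<^sup>+x. eabs f x * H x \<partial>lebesgue) \<le> kothe_norm \<rho> H"
    unfolding kothe_norm_def by (rule SUP_upper)
  have "(\<integral>\<^sup>+x. G x * H x \<partial>lebesgue) = (\<integral>\<^sup>+x. ennreal r * (eabs f x * H x) \<partial>lebesgue)"
  proof (rule nn_integral_cong_AE)
    show "AE x in lebesgue. G x * H x = ennreal r * (eabs f x * H x)"
      using fG by eventually_elim (simp add: mult.assoc[symmetric])
  qed
  also have "\<dots> = ennreal r * (\<integral>\<^sup>+x. eabs f x * H x \<partial>lebesgue)" by (rule nn_integral_cmult) measurable
  also have "\<dots> \<le> \<rho> G * kothe_norm \<rho> H" unfolding r(1) by (rule mult_left_mono[OF le]) simp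
  finally show ?thesis .
qed

lemma exists_finite_indicator:
  obtains S where "S \<in> sets lebesgue" "emeasure lebesgue S > 0" "\<rho> (indicator S) < \<infinity>" "\<rho> (indicator S) > 0"
proof -
  have "emeasure lebesgue (UNIV :: (real^'n) set) > 0"
    by (rule less_le_trans[OF emeasure_cubes_pos[OF big_in_cubes[of 0]] emeasure_mono]) auto
  then obtain S where S: "S \<in> sets lebesgue" "emeasure lebesgue S > 0" "\<rho> (indicator S) < \<infinity>"
    using rho_saturated[of UNIV] by auto
  have "\<rho> (indicator S) \<noteq> 0"
  proof
    assume "\<rho> (indicator S) = 0"
    then have "AE x in lebesgue. indicator S x = (0::ennreal)" using S(1) by (subst (asm) rho_0_iff) auto
    then have "AE x in lebesgue. x \<notin> S" by eventually_elim (auto simp: indicator_def split: if_splits)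
    then show False using AE_iff_measurable[OF S(1), of "\<lambda>x. x \<notin> S"] S(2) by simp
  qed
  then show ?thesis using that S by (simp add: zero_less_iff_neq_zero)
qed

text \<open>The dual space is not trivial: a multiple of an indicator function has norm above \<open>1\<close>, and
  separation from the unit ball yields \<open>k\<close>.\<close>

lemma exists_dual_ball:
  obtains k S where "dual_ball k" "S \<in> sets lebesgue" "\<rho> (indicator S) < \<infinity>"
    "\<not> (AE x in lebesgue. x \<notin> S)" "\<not> (AE x in lebesgue. ennreal (k x) = 0)"
proof -
  obtain S where S[measurable]: "S \<in> sets lebesgue" and fin: "\<rho> (indicator S) < \<infinity>" and pos: "\<rho> (indicator S) > 0"
    using exists_finite_indicator by metis
  obtain r where r: "\<rho> (indicator S) = ennreal r" "r > 0" using fin pos by (cases "\<rho> (indicator S)") auto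
  have "\<rho> (\<lambda>x. ennreal (2 / r) * indicator S x) = ennreal (2 / r) * ennreal r"
    using r by (subst rho_scale) auto
  also have "\<dots> = ennreal 2" using r by (simp flip: ennreal_mult del: ennreal_numeral)
  finally have "\<rho> (\<lambda>x. ennreal (2 / r) * indicator S x) > 1" by simp
  then obtain k where k: "k \<in> borel_measurable lebesgue" "\<And>x. k x \<ge> 0"
    "\<And>g. g \<in> borel_measurable lebesgue \<Longrightarrow> \<rho> g \<le> 1 \<Longrightarrow> (\<integral>\<^sup>+x. g x * ennreal (k x) \<partial>lebesgue) \<le> 1"
    "(\<integral>\<^sup>+x. (ennreal (2 / r) * indicator S x) * ennreal (k x) \<partial>lebesgue) > 1"
    by (rule lorentz_luxemburg_separation[rotated]) auto
  have [measurable]: "k \<in> borel_measurable lebesgue" by (rule k(1))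
  have "(\<integral>\<^sup>+x. (ennreal (2 / r) * indicator S x) * ennreal (k x) \<partial>lebesgue) = ennreal (2 / r) * (\<integral>\<^sup>+x\<in>S. ennreal (k x) \<partial>lebesgue)"
    by (subst nn_integral_cmult[symmetric]) (auto simp: mult_ac)
  then have "(\<integral>\<^sup>+x\<in>S. ennreal (k x) \<partial>lebesgue) \<noteq> 0" using k(4) by auto
  moreover have "(\<lambda>x. ennreal (k x) * indicator S x) \<in> borel_measurable lebesgue" by measurable
  ultimately have nz: "\<not> (AE x in lebesgue. ennreal (k x) * indicator S x = 0)"
    by (subst (asm) nn_integral_0_iff_AE) auto
  show ?thesis
  proof (rule that[of k S])
    show "\<not> (AE x in lebesgue. x \<notin> S)"
    proof
      assume "AE x in lebesgue. x \<notin> S"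
      then have "AE x in lebesgue. ennreal (k x) * indicator S x = 0" by eventually_elim simp
      then show False using nz by simp
    qed
    show "\<not> (AE x in lebesgue. ennreal (k x) = 0)"
    proof
      assume "AE x in lebesgue. ennreal (k x) = 0"
      then have "AE x in lebesgue. ennreal (k x) * indicator S x = 0" by eventually_elim simp
      then show False using nz by simp
    qed
  qed (use k fin in \<open>simp_all add: dual_ball_def\<close>)
qed

end

locale bf_norm_max = bf_norm \<rho> for \<rho> :: "('n::finite) efun \<Rightarrow> ennreal" +
  assumes M_X: "op_norm (bfs \<rho>) \<rho> HL_max < \<infinity>"
    and M_X': "op_norm (kothe_dual \<rho>) (kothe_norm \<rho>) HL_max < \<infinity>"
begin

abbreviation "MX \<equiv> op_norm (bfs \<rho>) \<rho> HL_max"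
abbreviation "MX' \<equiv> op_norm (kothe_dual \<rho>) (kothe_norm \<rho>) HL_max"

lemma dual_ball_maximal:
  assumes k: "dual_ball k" and [measurable]: "G \<in> borel_measurable lebesgue" and fin: "\<rho> G < \<infinity>"
  shows "(\<integral>\<^sup>+x. G x * eM (\<lambda>x. ennreal (k x)) x \<partial>lebesgue) \<le> \<rho> G * MX'"
proof -
  have ek: "eabs k = (\<lambda>x. ennreal (k x))" using k by (auto simp: eabs_def dual_ball_def)
  have "kothe_norm \<rho> (eM (\<lambda>x. ennreal (k x))) \<le> MX' * kothe_norm \<rho> (eabs k)"
    unfolding ek[symmetric] HL_max_eq[symmetric]
    by (rule op_norm_bound[OF M_X' dual_ball_kothe(1)[OF k]])
       (rule le_less_trans[OF dual_ball_kothe(2)[OF k]], simp)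
  also have "\<dots> \<le> MX' * 1" by (intro mult_left_mono dual_ball_kothe k) simp
  finally have "\<rho> G * kothe_norm \<rho> (eM (\<lambda>x. ennreal (k x))) \<le> \<rho> G * MX'" by (simp add: mult_left_mono)
  then show ?thesis using holder_kothe[OF _ eM_measurable fin] by (meson assms(2) order_trans)
qed

text \<open>A maximal function is bounded below by a multiple of \<open>|x|\<^sup>-\<^sup>d\<close> at infinity. As there is one
  in the dual space, functions in \<open>X\<close> decay in the following averaged sense.\<close>

lemma summable_lower_bounds:
  assumes G[measurable]: "G \<in> borel_measurable lebesgue" and fin: "\<rho> G < \<infinity>"
    and le: "\<And>n x. x \<in> big n \<Longrightarrow> a n \<le> G x"
  shows "\<exists>N. (\<Sum>n. a (n + N)) < \<infinity>"
proof -
  let ?d = "CARD('n)"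
  obtain k S where k: "dual_ball k" and nz: "\<not> (AE x in lebesgue. ennreal (k x) = 0)"
    using exists_dual_ball by metis
  have [measurable]: "k \<in> borel_measurable lebesgue" using k by (simp add: dual_ball_def)
  have "(\<lambda>x. ennreal (k x)) \<in> borel_measurable lebesgue" by measurable
  then obtain m where m: "(\<integral>\<^sup>+x\<in>big m. ennreal (k x) \<partial>lebesgue) > 0"
    using not_AE_zero_big nz by blast
  \<comment> \<open>The integral of \<open>k\<close> over \<open>big m\<close> may be infinite, so a finite lower bound \<open>c\<close> is chosen.\<close>
  obtain c where c: "0 < c" "ennreal c \<le> (\<integral>\<^sup>+x\<in>big m. ennreal (k x) \<partial>lebesgue)"
  proof (cases "(\<integral>\<^sup>+x\<in>big m. ennreal (k x) \<partial>lebesgue)")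
    case (real r)
    then show thesis using that[of r] m by simp
  next
    case top
    then show thesis using that[of 1] by simp
  qed
  define V where "V n = (2 ^ Suc n :: real) ^ ?d" for n
  have V: "V n > 0" "emeasure lebesgue (big n :: (real^'n) set) = ennreal (V n)" for n
    using emeasure_lebesgue_cubes(1)[OF big_in_cubes, of n] by (auto simp: V_def measure_big)
  have lower: "ennreal (c / V n) \<le> eM (\<lambda>x. ennreal (k x)) x" if "m \<le> n" "x \<in> big n" for n x
  proof -
    have "ennreal c \<le> (\<integral>\<^sup>+x\<in>big n. ennreal (k x) \<partial>lebesgue)"
      using big_mono[OF that(1)] by (intro order_trans[OF c(2)] nn_integral_mono) (auto split: split_indicator)
    then have "ennreal c / ennreal (V n) \<le> eavg (big n) (\<lambda>x. ennreal (k x))"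
      unfolding eavg_def V(2) by (rule divide_right_mono_ennreal)
    also have "\<dots> \<le> eM (\<lambda>x. ennreal (k x)) x" by (rule eavg_le_eM[OF big_in_cubes that(2)])
    finally show ?thesis using c V(1) by (simp add: divide_ennreal)
  qed
  \<comment> \<open>On the annulus \<open>A n\<close> the integrand \<open>G \<cdot> M k\<close> is at least \<open>b n\<close>, and \<open>A n\<close> fills at least half of its cube, so
    that the factor \<open>1/V\<close> from \<open>M k\<close> cancels against the volume.\<close>
  define A where "A n = (big (Suc n + m) - big (n + m) :: (real^'n) set)" for n
  have disj: "disjoint_family A"
    unfolding disjoint_family_on_def
  proof (intro ballI impI)
    have "A i \<inter> A j = {}" if "i < j" for i j
      using big_mono[of "Suc i + m" "j + m"] that by (auto simp: A_def)
    then show "A i \<inter> A j = {}" if "i \<noteq> j" for i j using that by (metis Int_commute nat_neq_iff)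
  qed
  have Am[measurable]: "A n \<in> sets lebesgue" for n unfolding A_def by (intro sets.Diff big_lebesgue)
  define b where "b n = a (Suc n + m) * ennreal (c / V (Suc n + m))" for n
  have eA: "emeasure lebesgue (A n) \<ge> ennreal (V (Suc n + m) / 2)" for n
  proof -
    have "emeasure lebesgue (A n) = ennreal (V (Suc n + m)) - ennreal (V (n + m))"
      unfolding A_def using V big_mono[of "n + m" "Suc n + m"] by (subst emeasure_Diff) auto
    also have "\<dots> = ennreal (V (Suc n + m) - V (n + m))" using V(1)[of "n + m"] by (simp add: ennreal_minus)
    also have "\<dots> \<ge> ennreal (V (Suc n + m) / 2)"
    proof (rule ennreal_leI)
      have "(2::real) ^ 1 \<le> 2 ^ ?d" by (rule power_increasing) (auto simp: Suc_le_eq)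
      then have "2 * V (n + m) \<le> 2 ^ ?d * V (n + m)" using V(1)[of "n + m"] by simp
      also have "\<dots> = V (Suc n + m)" by (simp only: V_def power_mult_distrib[symmetric] add_Suc power_Suc)
      finally show "V (Suc n + m) / 2 \<le> V (Suc n + m) - V (n + m)" by simp
    qed
    finally show ?thesis .
  qed
  have "(\<Sum>n. a (n + Suc m)) * ennreal (c / 2) = (\<Sum>n. a (Suc n + m) * ennreal (c / 2))" by simp
  also have "\<dots> \<le> (\<Sum>n. b n * emeasure lebesgue (A n))"
  proof (intro suminf_le allI)
    fix n
    have "a (Suc n + m) * ennreal (c / 2) = b n * ennreal (V (Suc n + m) / 2)"
      using c V(1)[of "Suc n + m"] by (simp add: b_def mult.assoc flip: ennreal_mult)
    also have "\<dots> \<le> b n * emeasure lebesgue (A n)" by (intro mult_left_mono eA) simp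
    finally show "a (Suc n + m) * ennreal (c / 2) \<le> b n * emeasure lebesgue (A n)" .
  qed auto
  also have "\<dots> = (\<Sum>n. \<integral>\<^sup>+x. b n * indicator (A n) x \<partial>lebesgue)" by (simp add: nn_integral_cmult_indicator)
  also have "\<dots> = (\<integral>\<^sup>+x. (\<Sum>n. b n * indicator (A n) x) \<partial>lebesgue)"
    by (rule nn_integral_suminf[symmetric]) measurable
  also have "\<dots> \<le> (\<integral>\<^sup>+x. G x * eM (\<lambda>x. ennreal (k x)) x \<partial>lebesgue)"
  proof (rule nn_integral_mono)
    fix x
    show "(\<Sum>n. b n * indicator (A n) x) \<le> G x * eM (\<lambda>x. ennreal (k x)) x"
    proof (cases "\<exists>n. x \<in> A n")
      case True
      then obtain n where n: "x \<in> A n" by blast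
      then have xb: "x \<in> big (Suc n + m)" by (simp add: A_def)
      have "(\<Sum>n. b n * indicator (A n) x) = b n" by (rule suminf_cmult_indicator[OF disj n])
      also have "\<dots> \<le> G x * eM (\<lambda>x. ennreal (k x)) x"
        unfolding b_def by (intro mult_mono le[OF xb] lower xb) auto
      finally show ?thesis .
    qed simp
  qed
  also have "\<dots> \<le> \<rho> G * MX'" by (rule dual_ball_maximal[OF k G fin])
  also have "\<dots> < \<infinity>" using fin M_X' by (simp add: ennreal_mult_less_top)
  finally have "(\<Sum>n. a (n + Suc m)) < \<infinity>"
    using c by (cases "\<Sum>n. a (n + Suc m)") (auto simp: ennreal_top_mult)
  then show ?thesis by blast
qed

text \<open>A constant is its own lower bound on every cube, and these bounds are not summable.\<close>

lemma const_in_bfs: "(\<lambda>x. c) \<in> bfs \<rho> \<Longrightarrow> c = 0"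
proof (rule ccontr)
  assume c: "(\<lambda>x. c) \<in> bfs \<rho>" "c \<noteq> 0"
  have "\<rho> (eabs (\<lambda>x. c)) < \<infinity>" using c(1) unfolding bfs_def by blast
  then have "\<exists>N::nat. (\<Sum>n. (\<lambda>n. ennreal \<bar>c\<bar>) (n + N)) < \<infinity>"
    by (intro summable_lower_bounds[of "eabs (\<lambda>x. c)"]) (simp_all add: eabs_def)
  then have "(\<Sum>n::nat. ennreal \<bar>c\<bar>) \<noteq> top" by (simp add: less_top)
  then have "summable (\<lambda>n::nat. \<bar>c\<bar>)"
    by (intro summable_suminf_not_top) simp_all
  then show False using c(2) by (simp add: summable_const_iff)
qed

text \<open>Consecutive medians differ by a multiple of the oscillations, which are lower bounds of the sharp
  maximal function on the cubes and hence summable.\<close>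

lemma med_convergent:
  assumes g: "g \<in> L0" and fin: "\<rho> (sharp_max_weak g) < \<infinity>"
  shows "(\<lambda>n. med (big n) g) \<longlonglongrightarrow> lim_med g"
proof -
  let ?A = "ennreal (osc_mult CARD('n))"
  define a where "a n = osc_weak (big n) g" for n
  have "\<exists>N. (\<Sum>n. a (n + N)) < \<infinity>"
    using cube_sup_upper[OF big_in_cubes, where \<tau>="\<lambda>Q. osc_weak Q g"]
    by (intro summable_lower_bounds[OF sharp_max_weak_measurable[OF g] fin])
       (auto simp: a_def sharp_max_weak_eq)
  then obtain N where N: "(\<Sum>n. a (n + N)) < \<infinity>" by blast
  have "(\<Sum>n. ennreal \<bar>med (big (Suc n + N)) g - med (big (n + N)) g\<bar>) \<le> (\<Sum>n. ?A * a (n + N) + ?A * a (Suc n + N))"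
  proof (intro suminf_le allI)
    fix n
    have "measure lebesgue (big (Suc n + N) :: (real^'n) set) \<le> 4 ^ CARD('n) * measure lebesgue (big (n + N) :: (real^'n) set)"
      by (simp add: measure_big power_mult_distrib mult_right_mono power_mono)
    then have "ennreal \<bar>med (big (n + N)) g - med (big (Suc n + N)) g\<bar> \<le> ?A * (a (n + N) + a (Suc n + N))"
      unfolding a_def by (intro med_compare big_in_cubes big_mono g) auto
    then show "ennreal \<bar>med (big (Suc n + N)) g - med (big (n + N)) g\<bar> \<le> ?A * a (n + N) + ?A * a (Suc n + N)"
      by (simp add: abs_minus_commute distrib_left)
  qed auto
  also have "\<dots> = ?A * (\<Sum>n. a (n + N)) + ?A * (\<Sum>n. a (Suc n + N))"
    by (simp add: suminf_add[symmetric])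
  also have "\<dots> \<le> ?A * (\<Sum>n. a (n + N)) + ?A * (\<Sum>n. a (n + N))"
  proof (intro add_left_mono mult_left_mono)
    have "(\<Sum>n. a (n + N)) = (\<Sum>n. a (n + 1 + N)) + (\<Sum>i<1. a (i + N))"
      by (rule suminf_offset) simp
    then show "(\<Sum>n. a (Suc n + N)) \<le> (\<Sum>n. a (n + N))" by simp
  qed simp
  also have "\<dots> < \<infinity>" using N by (simp add: ennreal_mult_less_top)
  finally have "convergent (\<lambda>n. med (big (n + N)) g)" by (intro summable_diff_convergent) simp
  then have "convergent (\<lambda>n. med (big n) g)" by (subst (asm) convergent_ignore_initial_segment)
  then show ?thesis by (simp add: lim_med_def convergent_LIMSEQ_iff)
qed

lemma lim_med_finite_level: "g \<in> L0 \<Longrightarrow> finite_level_sets g \<Longrightarrow> lim_med g = 0"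
  unfolding lim_med_def by (rule limI[OF med_big_finite_level])

lemma MX'_pos: "MX' > 0"
proof -
  obtain k S where k: "dual_ball k" and S[measurable]: "S \<in> sets lebesgue" and fin: "\<rho> (indicator S) < \<infinity>"
    and nz: "\<not> (AE x in lebesgue. x \<notin> S)" "\<not> (AE x in lebesgue. ennreal (k x) = 0)"
    using exists_dual_ball by metis
  have "k \<in> borel_measurable lebesgue" using k by (simp add: dual_ball_def)
  then have pos: "eM (\<lambda>x. ennreal (k x)) x > 0" for x by (intro eM_pos nz(2)) measurable
  have "MX' \<noteq> 0"
  proof
    assume "MX' = 0"
    then have "(\<integral>\<^sup>+x. indicator S x * eM (\<lambda>x. ennreal (k x)) x \<partial>lebesgue) = 0"
      using dual_ball_maximal[OF k _ fin] by simp
    then have "AE x in lebesgue. indicator S x * eM (\<lambda>x. ennreal (k x)) x = 0"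
      by (subst (asm) nn_integral_0_iff_AE) auto
    then have "AE x in lebesgue. x \<notin> S"
    proof eventually_elim
      case (elim x)
      then show ?case using pos[of x] by (auto split: split_indicator_asm)
    qed
    then show False using nz(1) by simp
  qed
  then show ?thesis by (simp add: zero_less_iff_neq_zero)
qed

text \<open>If the bound failed, separation would give \<open>k\<close> in the dual unit ball for which the integral of
  \<open>|g - c| k\<close> exceeds it. The global integral estimate and Hoelder's inequality exclude that.\<close>

theorem sharp_inequality:
  assumes g: "g \<in> L0" and fin: "\<rho> (sharp_max_weak g) < \<infinity>"
  shows "\<rho> (eabs (\<lambda>x. g x - lim_med g)) \<le> ennreal (fs_const CARD('n)) * MX' * \<rho> (sharp_max_weak g)"
proof (rule ccontr)
  have [measurable]: "g \<in> borel_measurable lebesgue" using g by (simp add: L0_def)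
  let ?h = "eabs (\<lambda>x. g x - lim_med g)" and ?R = "ennreal (fs_const CARD('n)) * MX' * \<rho> (sharp_max_weak g)"
  assume "\<not> \<rho> ?h \<le> ?R"
  then have "?R < \<rho> ?h" by simp
  then obtain s where s: "?R < s" "s < \<rho> ?h" using dense by blast
  have "0 < s" by (rule le_less_trans[OF _ s(1)]) simp
  then obtain r where r: "s = ennreal r" "r > 0" using s(2) by (cases s) auto
  have h[measurable]: "?h \<in> borel_measurable lebesgue" by measurable
  have "\<rho> (\<lambda>x. ennreal (1 / r) * ?h x) = ennreal (1 / r) * \<rho> ?h" using r by (intro rho_scale) auto
  moreover have "ennreal (1 / r) * \<rho> ?h > 1"
  proof -
    have "\<rho> ?h > ennreal r" using s(2) r by simp
    then show ?thesis using r(2)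
      by (cases "\<rho> ?h") (auto simp: ennreal_mult_top ennreal_less_iff field_simps simp flip: ennreal_mult ennreal_1)
  qed
  ultimately have "\<rho> (\<lambda>x. ennreal (1 / r) * ?h x) > 1" by simp
  then obtain k where k: "k \<in> borel_measurable lebesgue" "\<And>x. k x \<ge> 0"
    "\<And>g. g \<in> borel_measurable lebesgue \<Longrightarrow> \<rho> g \<le> 1 \<Longrightarrow> (\<integral>\<^sup>+x. g x * ennreal (k x) \<partial>lebesgue) \<le> 1"
    "(\<integral>\<^sup>+x. (ennreal (1 / r) * ?h x) * ennreal (k x) \<partial>lebesgue) > 1"
    by (rule lorentz_luxemburg_separation[rotated]) auto
  have [measurable]: "k \<in> borel_measurable lebesgue" by (rule k(1))
  have db: "dual_ball k" using k by (simp add: dual_ball_def)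
  have "(\<integral>\<^sup>+x. ?h x * ennreal (k x) \<partial>lebesgue)
      \<le> ennreal (fs_const CARD('n)) * (\<integral>\<^sup>+x. sharp_max_weak g x * eM (\<lambda>x. ennreal (k x)) x \<partial>lebesgue)"
    unfolding eabs_def by (rule fefferman_stein_global[OF g k(1,2) med_convergent[OF g fin]])
  also have "\<dots> \<le> ennreal (fs_const CARD('n)) * (\<rho> (sharp_max_weak g) * MX')"
    by (intro mult_left_mono dual_ball_maximal[OF db sharp_max_weak_measurable[OF g] fin]) simp
  also have "\<dots> \<le> ennreal r" using s(1) r(1) by (simp add: mult_ac)
  finally have le: "(\<integral>\<^sup>+x. ?h x * ennreal (k x) \<partial>lebesgue) \<le> ennreal r" .
  have "(\<integral>\<^sup>+x. (ennreal (1 / r) * ?h x) * ennreal (k x) \<partial>lebesgue) = ennreal (1 / r) * (\<integral>\<^sup>+x. ?h x * ennreal (k x) \<partial>lebesgue)"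
    by (simp add: mult.assoc nn_integral_cmult)
  also have "\<dots> \<le> ennreal (1 / r) * ennreal r" by (intro mult_left_mono le) simp
  also have "\<dots> = 1" using r by (simp flip: ennreal_mult)
  finally show False using k(4) by simp
qed

lemma sharp_const_bound:
  assumes sh: "\<And>f x. f \<in> L0 \<Longrightarrow> sharp_max_weak f x \<le> sh f x" "\<And>f. f \<in> L0 \<Longrightarrow> sh f \<in> borel_measurable lebesgue"
  shows "sharp_const sh \<rho> \<le> ennreal (fs_const CARD('n)) * MX'"
  unfolding sharp_const_def
proof (rule Inf_lower, rule CollectI, intro ballI impI)
  fix f assume f: "f \<in> bfs \<rho>" "finite_level_sets f"
  have fL: "f \<in> L0" using f by (simp add: bfs_def)
  have fs: "fs_const CARD('n) > 0" using osc_mult_pos by (simp add: fs_const_def)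
  have le: "\<rho> (sharp_max_weak f) \<le> \<rho> (sh f)"
    by (intro rho_mono_AE AE_I2 sh fL sharp_max_weak_measurable)
  show "\<rho> (eabs f) \<le> ennreal (fs_const CARD('n)) * MX' * \<rho> (sh f)"
  proof (cases "\<rho> (sharp_max_weak f) = \<infinity>")
    case True
    then have "ennreal (fs_const CARD('n)) * MX' * \<rho> (sh f) = \<infinity>"
      using le fs MX'_pos by (auto simp: top_unique ennreal_mult_eq_top_iff)
    then show ?thesis by simp
  next
    case False
    then have "\<rho> (eabs (\<lambda>x. f x - lim_med f)) \<le> ennreal (fs_const CARD('n)) * MX' * \<rho> (sharp_max_weak f)"
      using fL by (intro sharp_inequality) (auto simp: less_top)
    also have "\<dots> \<le> ennreal (fs_const CARD('n)) * MX' * \<rho> (sh f)" by (intro mult_left_mono le) simp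
    finally show ?thesis using lim_med_finite_level[OF fL f(2)] by simp
  qed
qed

lemma sharp_const_finite:
  assumes "\<And>f x. f \<in> L0 \<Longrightarrow> sharp_max_weak f x \<le> sh f x" "\<And>f. f \<in> L0 \<Longrightarrow> sh f \<in> borel_measurable lebesgue"
  shows "sharp_const sh \<rho> < \<infinity>"
  by (rule le_less_trans[OF sharp_const_bound[OF assms]]) (use M_X' in \<open>simp_all add: ennreal_mult_less_top\<close>)

end


section \<open>Weights\<close>

lemma AE_cube_witness:
  assumes Q: "Q \<in> cubes" and ae: "AE x in lebesgue. x \<in> Q \<longrightarrow> P x"
  obtains x where "x \<in> Q" "P x"
proof (rule ccontr)
  assume "\<not> thesis"
  then have "\<And>x. x \<in> Q \<Longrightarrow> \<not> P x" using that by blast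
  then have "AE x in lebesgue. x \<notin> Q" by (intro eventually_mono[OF ae]) blast
  then have "emeasure lebesgue Q = 0" using AE_iff_measurable[OF cubes_lebesgue[OF Q], of "\<lambda>x. x \<notin> Q"] by simp
  then show False using emeasure_cubes_pos[OF Q] by simp
qed

lemma avg_inf_AE:
  assumes "Q \<in> cubes"
  shows "AE x in lebesgue. x \<in> Q \<longrightarrow> eabs f x \<le> avg_inf Q f"
  using esssup_AE[of "eabs f" "restrict_space lebesgue Q"] cubes_lebesgue[OF assms]
  by (simp add: avg_inf_def AE_restrict_space_iff)

lemma avg_inf_leI:
  assumes Q: "Q \<in> cubes" and f: "f \<in> L0" and ae: "AE x in lebesgue. x \<in> Q \<longrightarrow> eabs f x \<le> c"
  shows "avg_inf Q f \<le> c"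
  unfolding avg_inf_def
proof (rule esssup_I)
  have "eabs f \<in> borel_measurable lebesgue" using f unfolding L0_def eabs_def[abs_def] by measurable
  then show "eabs f \<in> borel_measurable (restrict_space lebesgue Q)" by (rule measurable_restrict_space1)
  show "AE x in restrict_space lebesgue Q. eabs f x \<le> c"
    using ae cubes_lebesgue[OF Q] by (simp add: AE_restrict_space_iff)
qed

text \<open>The weights \<open>w = 1/v\<close> are described by \<open>v\<close>. The condition \<open>\<langle>v\<rangle>\<^sub>Q \<le> B v\<close> a.e. on every cube \<open>Q\<close>
  is the \<open>A\<^sub>1\<close> condition with constant \<open>B\<close>.\<close>

definition A1_weight :: "real \<Rightarrow> ('n::finite) rfun \<Rightarrow> bool" where
  "A1_weight B v \<longleftrightarrow> v \<in> borel_measurable lebesgue \<and> (\<forall>x. 0 \<le> v x) \<and> (AE x in lebesgue. 0 < v x) \<and>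
    (\<forall>Q\<in>cubes. AE x in lebesgue. x \<in> Q \<longrightarrow> eavg Q (\<lambda>x. ennreal (v x)) \<le> ennreal B * ennreal (v x))"

lemma A1_const_le:
  assumes v: "A1_weight B v"
  shows "A1_const v \<le> ennreal B"
  unfolding A1_const_def
proof (rule SUP_least)
  fix Q :: "(real^'a) set" assume Q: "Q \<in> cubes"
  have vm[measurable]: "v \<in> borel_measurable lebesgue" using v by (simp add: A1_weight_def)
  have ev: "eabs v = (\<lambda>x. ennreal (v x))" using v by (simp add: A1_weight_def eabs_def fun_eq_iff)
  define a where "a = eavg Q (\<lambda>x. ennreal (v x))"
  have ae: "AE x in lebesgue. x \<in> Q \<longrightarrow> a \<le> ennreal B * ennreal (v x)"
    using v Q by (simp add: A1_weight_def a_def)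
  obtain x where "a \<le> ennreal B * ennreal (v x)" using AE_cube_witness[OF Q ae] by blast
  then have afin: "a < top" by (rule le_less_trans) (simp add: ennreal_mult_less_top)
  show "avg1 Q v * avg_inf Q (\<lambda>x. inverse (v x)) \<le> ennreal B"
  proof (cases "a = 0")
    case True
    then show ?thesis by (simp add: avg1_eq ev a_def[symmetric])
  next
    case False
    then obtain r where r: "a = ennreal r" "r > 0" using afin by (cases a) auto
    have "avg_inf Q (\<lambda>x. inverse (v x)) \<le> ennreal (B / r)"
    proof (rule avg_inf_leI[OF Q])
      show "(\<lambda>x. inverse (v x)) \<in> L0" unfolding L0_def by measurable
      have "AE x in lebesgue. 0 < v x" using v by (simp add: A1_weight_def)
      with ae show "AE x in lebesgue. x \<in> Q \<longrightarrow> eabs (\<lambda>x. inverse (v x)) x \<le> ennreal (B / r)"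
      proof eventually_elim
        case (elim x)
        show ?case
        proof
        assume "x \<in> Q"
        then have le: "ennreal r \<le> ennreal B * ennreal (v x)" using r elim by simp
        have B: "B > 0"
        proof (rule ccontr)
          assume "\<not> B > 0"
          then have "ennreal B = 0" by (simp add: ennreal_eq_0_iff)
          then show False using le r by simp
        qed
        then have "ennreal r \<le> ennreal (B * v x)" using le elim by (simp add: ennreal_mult)
        then have "r \<le> B * v x" using B elim by (subst (asm) ennreal_le_iff) auto
        then show "eabs (\<lambda>x. inverse (v x)) x \<le> ennreal (B / r)"
          using r elim by (auto simp: eabs_def field_simps intro!: ennreal_leI)
        qed
      qed
    qed
    then have "avg1 Q v * avg_inf Q (\<lambda>x. inverse (v x)) \<le> ennreal r * ennreal (B / r)"
      by (simp add: avg1_eq ev a_def[symmetric] r(1) mult_left_mono)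
    also have "\<dots> = ennreal B" using r by (subst ennreal_mult'[symmetric]) auto
    finally show ?thesis .
  qed
qed

lemma A1_const_ge_1:
  assumes v: "A1_weight B v"
  shows "1 \<le> A1_const v"
proof -
  have [measurable]: "v \<in> borel_measurable lebesgue" using v by (simp add: A1_weight_def)
  let ?Q = "big 0 :: (real^'a) set" and ?i = "\<lambda>x. inverse (v x)"
  have Q: "?Q \<in> cubes" by simp
  note m = emeasure_lebesgue_cubes[OF Q]
  have "emeasure lebesgue ?Q = (\<integral>\<^sup>+x. indicator ?Q x \<partial>lebesgue)" by simp
  also have "\<dots> \<le> (\<integral>\<^sup>+x. avg_inf ?Q ?i * (eabs v x * indicator ?Q x) \<partial>lebesgue)"
  proof (rule nn_integral_mono_AE)
    have "AE x in lebesgue. 0 < v x" using v by (simp add: A1_weight_def)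
    with avg_inf_AE[OF Q, of ?i]
    show "AE x in lebesgue. indicator ?Q x \<le> avg_inf ?Q ?i * (eabs v x * indicator ?Q x)"
    proof eventually_elim
      case (elim x)
      have "1 = eabs ?i x * eabs v x" using elim by (simp add: eabs_def flip: ennreal_mult)
      then show ?case using elim mult_right_mono[of "eabs ?i x" "avg_inf ?Q ?i" "eabs v x"]
        by (auto split: split_indicator)
    qed
  qed
  also have "\<dots> = avg_inf ?Q ?i * (\<integral>\<^sup>+x\<in>?Q. eabs v x \<partial>lebesgue)"
    by (rule nn_integral_cmult) (simp add: eabs_def[abs_def])
  also have "\<dots> = avg_inf ?Q ?i * (avg1 ?Q v * emeasure lebesgue ?Q)"
    by (simp add: avg1_eq eavg_times_emeasure)
  finally have "emeasure lebesgue ?Q \<le> (avg1 ?Q v * avg_inf ?Q ?i) * emeasure lebesgue ?Q" by (simp add: mult_ac)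
  also have "\<dots> \<le> A1_const v * emeasure lebesgue ?Q"
    unfolding A1_const_def by (intro mult_right_mono SUP_upper Q) simp
  finally have "emeasure lebesgue ?Q / emeasure lebesgue ?Q \<le> A1_const v * emeasure lebesgue ?Q / emeasure lebesgue ?Q"
    by (rule divide_right_mono_ennreal)
  then show ?thesis using m by (simp add: ennreal_mult_divide_cancel divide_ennreal)
qed

text \<open>A weighted \<open>BMO\<close> bound is a pointwise bound of the sharp maximal function by \<open>v = 1/w\<close>,
  because \<open>\<langle>w\<rangle>\<^sub>\<infinity>\<^sub>,\<^sub>Q\<close> is the reciprocal of the essential infimum of \<open>v\<close>.\<close>

lemma sharp_le_weight:
  assumes v: "A1_weight B v" and oc: "outer_cont \<tau>"
    and le: "(SUP Q\<in>cubes. avg_inf Q (\<lambda>x. inverse (v x)) * \<tau> Q) \<le> K"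
  shows "AE x in lebesgue. cube_sup \<tau> x \<le> K * ennreal (v x)"
proof (rule cube_sup_AE_le[OF oc])
  fix Q :: "(real^'a) set" assume Q: "Q \<in> cubes"
  have K: "avg_inf Q (\<lambda>x. inverse (v x)) * \<tau> Q \<le> K" using le Q by (meson SUP_upper order_trans)
  have "AE x in lebesgue. 0 < v x" using v by (simp add: A1_weight_def)
  with avg_inf_AE[OF Q, of "\<lambda>x. inverse (v x)"]
  show "AE x in lebesgue. x \<in> Q \<longrightarrow> \<tau> Q \<le> K * ennreal (v x)"
  proof eventually_elim
    case (elim x)
    show ?case
    proof
    assume "x \<in> Q"
    then have "ennreal (inverse (v x)) * \<tau> Q \<le> K"
      using elim mult_right_mono[of "eabs (\<lambda>x. inverse (v x)) x" "avg_inf Q (\<lambda>x. inverse (v x))" "\<tau> Q"] K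
      by (auto simp: eabs_def)
    then have "ennreal (inverse (v x)) * \<tau> Q * ennreal (v x) \<le> K * ennreal (v x)"
      by (rule mult_right_mono) simp
    moreover have "ennreal (inverse (v x)) * \<tau> Q * ennreal (v x) = \<tau> Q"
    proof -
      have "ennreal (inverse (v x)) * \<tau> Q * ennreal (v x) = (ennreal (inverse (v x)) * ennreal (v x)) * \<tau> Q"
        by (simp only: mult_ac)
      also have "ennreal (inverse (v x)) * ennreal (v x) = 1" using elim by (simp flip: ennreal_mult)
      finally show ?thesis by simp
    qed
    ultimately show "\<tau> Q \<le> K * ennreal (v x)" by simp
    qed
  qed
qed

text \<open>Applying the hypothesis on \<open>T\<close> with the weight \<open>1/v\<close> where \<open>|f| \<le> v\<close>, so that \<open>f\<close> has norm
  at most \<open>1\<close> in the weighted \<open>L\<^sup>\<infinity>\<close> space.\<close>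

lemma weighted_hypothesis:
  assumes v: "A1_weight B v" and f: "f \<in> L0" "compactly_supported f" "AE x in lebesgue. \<bar>f x\<bar> \<le> v x"
    and H: "\<And>w f. weight w \<Longrightarrow> A1_const (\<lambda>x. inverse (w x)) < \<infinity> \<Longrightarrow> f \<in> Linf w \<Longrightarrow> compactly_supported f \<Longrightarrow>
       f \<in> D \<and> (SUP Q\<in>cubes. avg_inf Q w * \<tau> Q (T f)) \<le> ennreal (\<phi> (enn2real (A1_const (\<lambda>x. inverse (w x))))) * Linf_norm w f"
    and \<tau>: "f \<in> D \<Longrightarrow> outer_cont (\<lambda>Q. \<tau> Q (T f))"
  shows "f \<in> D"
    and "AE x in lebesgue. cube_sup (\<lambda>Q. \<tau> Q (T f)) x \<le> ennreal (\<phi> (enn2real (A1_const v))) * ennreal (v x)"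
proof -
  have [measurable]: "v \<in> borel_measurable lebesgue" "f \<in> borel_measurable lebesgue"
    using v f by (auto simp: A1_weight_def L0_def)
  have pos: "AE x in lebesgue. 0 < v x" using v by (simp add: A1_weight_def)
  let ?w = "\<lambda>x. inverse (v x)"
  have w: "weight ?w" using pos by (auto simp: weight_def L0_def)
  have A: "A1_const (\<lambda>x. inverse (?w x)) < \<infinity>" using A1_const_le[OF v] by (simp add: le_less_trans)
  have n: "Linf_norm ?w f \<le> 1"
    unfolding Linf_norm_def
  proof (rule esssup_I)
    show "eabs (\<lambda>x. f x * ?w x) \<in> borel_measurable lebesgue" unfolding eabs_def[abs_def] by measurable
    from f(3) pos show "AE x in lebesgue. eabs (\<lambda>x. f x * ?w x) x \<le> 1"
    proof eventually_elim
      case (elim x)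
      then have "\<bar>f x * ?w x\<bar> \<le> 1" by (simp add: abs_mult field_simps)
      then show ?case unfolding eabs_def by simp
    qed
  qed
  have fw: "f \<in> Linf ?w" using n f(1) by (simp add: Linf_def le_less_trans)
  show D: "f \<in> D" using H[OF w A fw f(2)] by simp
  have "(SUP Q\<in>cubes. avg_inf Q ?w * \<tau> Q (T f)) \<le> ennreal (\<phi> (enn2real (A1_const v))) * Linf_norm ?w f"
    using H[OF w A fw f(2)] by simp
  also have "\<dots> \<le> ennreal (\<phi> (enn2real (A1_const v))) * 1" by (intro mult_left_mono n) simp
  finally show "AE x in lebesgue. cube_sup (\<lambda>Q. \<tau> Q (T f)) x \<le> ennreal (\<phi> (enn2real (A1_const v))) * ennreal (v x)"
    by (intro sharp_le_weight[OF v \<tau>[OF D]]) simp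
qed

context bf_norm_max
begin

text \<open>The Rubio de Francia algorithm: \<open>v = \<Sum>\<^sub>k M\<^sup>k|f| / (2 \<parallel>M\<parallel>)\<^sup>k\<close>. The norm series is dominated by
  \<open>\<Sum>\<^sub>k 2\<^sup>-\<^sup>k\<close>, and applying \<open>M\<close> shifts the series by one term, so that \<open>M v \<le> 2 \<parallel>M\<parallel> v\<close>. Every term but
  the first is positive everywhere, because \<open>f\<close> is not the zero function.\<close>

lemma rubio_de_francia:
  assumes f: "f \<in> bfs \<rho>" and nz: "\<not> (AE x in lebesgue. f x = 0)"
  obtains v where "A1_weight (2 * enn2real MX) v" "AE x in lebesgue. \<bar>f x\<bar> \<le> v x"
    "\<rho> (\<lambda>x. ennreal (v x)) \<le> 2 * \<rho> (eabs f)"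
proof -
  have [measurable]: "f \<in> borel_measurable lebesgue" using f by (rule bfs_measurable)
  have ffin: "\<rho> (eabs f) < \<infinity>" using f by (simp add: bfs_def)
  define m where "m = enn2real MX"
  have m0: "MX = ennreal m" "m \<ge> 0" using M_X by (auto simp: m_def less_top)
  define F where "F k = (eM ^^ k) (eabs f)" for k
  have F0: "F 0 = eabs f" and FS: "F (Suc k) = eM (F k)" for k by (simp_all add: F_def)
  have Fm[measurable]: "F k \<in> borel_measurable lebesgue" for k by (cases k) (simp_all add: F0 FS)
  have F1pos: "F 1 x > 0" for x
  proof -
    have "eabs f \<in> borel_measurable lebesgue" by measurable
    moreover have "\<not> (AE x in lebesgue. eabs f x = 0)" using nz by (simp add: eabs_def)
    ultimately show ?thesis unfolding F_def by (simp add: eM_pos)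
  qed
  have step: "\<rho> (F (Suc k)) \<le> ennreal m * \<rho> (F k)" if fin: "\<rho> (F k) < \<infinity>" for k
  proof -
    define h where "h x = enn2real (F k x)" for x
    have hm[measurable]: "h \<in> borel_measurable lebesgue" unfolding h_def by measurable
    have "AE x in lebesgue. F k x < \<infinity>" by (rule rho_finite_AE[OF Fm fin])
    then have ae: "AE x in lebesgue. eabs h x = F k x"
      by eventually_elim (simp add: eabs_def h_def)
    have eq: "\<rho> (eabs h) = \<rho> (F k)" by (rule rho_cong_AE[OF _ _ ae]) measurable
    then have "h \<in> bfs \<rho>" using fin by (simp add: bfs_def L0_def)
    then have "\<rho> (HL_max h) \<le> MX * \<rho> (eabs h)" using fin eq by (intro op_norm_bound M_X) auto
    moreover have "HL_max h = F (Suc k)" unfolding HL_max_eq FS by (rule eM_cong_AE[OF ae])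
    ultimately show ?thesis by (simp add: eq m0)
  qed
  have Fb: "\<rho> (F k) \<le> ennreal (m ^ k) * \<rho> (eabs f)" for k
  proof (induction k)
    case 0 then show ?case by (simp add: F0)
  next
    case (Suc k)
    have "\<rho> (F k) < \<infinity>" by (rule le_less_trans[OF Suc]) (use ffin in \<open>simp add: ennreal_mult_less_top\<close>)
    then have "\<rho> (F (Suc k)) \<le> ennreal m * (ennreal (m ^ k) * \<rho> (eabs f))"
      by (intro order_trans[OF step] mult_left_mono Suc) auto
    then show ?case using m0 by (simp add: ennreal_mult mult.assoc)
  qed
  have m: "m > 0"
  proof (rule ccontr)
    assume "\<not> m > 0"
    then have "\<rho> (F 1) = 0" using Fb[of 1] m0 by simp
    then have "AE x in lebesgue. F 1 x = 0" by (subst (asm) rho_0_iff) auto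
    then have ae: "AE x in lebesgue. x \<in> big 0 \<longrightarrow> F 1 x = 0" by (auto elim: eventually_mono)
    obtain x where "F 1 x = 0" by (rule AE_cube_witness[OF big_in_cubes ae])
    then show False using F1pos[of x] by simp
  qed
  define V where "V x = (\<Sum>k. ennreal ((1 / (2 * m)) ^ k) * F k x)" for x
  have Vm[measurable]: "V \<in> borel_measurable lebesgue" unfolding V_def by measurable
  have "\<rho> V \<le> (\<Sum>k. \<rho> (\<lambda>x. ennreal ((1 / (2 * m)) ^ k) * F k x))"
    unfolding V_def[abs_def] by (rule rho_suminf) measurable
  also have "\<dots> \<le> (\<Sum>k. ennreal ((1/2) ^ k) * \<rho> (eabs f))"
  proof (intro suminf_le allI)
    fix k
    have "\<rho> (\<lambda>x. ennreal ((1 / (2 * m)) ^ k) * F k x) = ennreal ((1 / (2 * m)) ^ k) * \<rho> (F k)"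
      using m by (intro rho_scale) auto
    also have "\<dots> \<le> ennreal ((1 / (2 * m)) ^ k) * (ennreal (m ^ k) * \<rho> (eabs f))" by (intro mult_left_mono Fb) simp
    also have "\<dots> = ennreal ((1 / (2 * m)) ^ k * m ^ k) * \<rho> (eabs f)" using m by (simp add: ennreal_mult mult.assoc)
    also have "(1 / (2 * m)) ^ k * m ^ k = (1/2) ^ k" using m by (simp flip: power_mult_distrib)
    finally show "\<rho> (\<lambda>x. ennreal ((1 / (2 * m)) ^ k) * F k x) \<le> ennreal ((1/2) ^ k) * \<rho> (eabs f)" .
  qed auto
  also have "\<dots> = (\<Sum>k. ennreal ((1/2) ^ k)) * \<rho> (eabs f)" by simp
  also have "(\<Sum>k. ennreal ((1/2) ^ k)) = ennreal (\<Sum>k. (1/2) ^ k)"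
    by (rule suminf_ennreal2) (auto intro: summable_geometric)
  also have "(\<Sum>k. (1/2 :: real) ^ k) = 2" by (subst suminf_geometric) auto
  finally have Vrho: "\<rho> V \<le> 2 * \<rho> (eabs f)" by simp
  then have Vfin: "\<rho> V < \<infinity>" using ffin by (simp add: le_less_trans ennreal_mult_less_top)
  have VA: "eavg Q V \<le> ennreal (2 * m) * V x" if Q: "Q \<in> cubes" "x \<in> Q" for Q x
  proof -
    have [measurable]: "Q \<in> sets lebesgue" by (rule cubes_lebesgue[OF Q(1)])
    note mQ = emeasure_lebesgue_cubes[OF Q(1)]
    have "(\<integral>\<^sup>+y\<in>Q. V y \<partial>lebesgue) = (\<integral>\<^sup>+y. (\<Sum>k. ennreal ((1 / (2 * m)) ^ k) * (F k y * indicator Q y)) \<partial>lebesgue)"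
      unfolding V_def by (simp add: mult.assoc flip: ennreal_suminf_multc)
    also have "\<dots> = (\<Sum>k. ennreal ((1 / (2 * m)) ^ k) * (\<integral>\<^sup>+y\<in>Q. F k y \<partial>lebesgue))"
      by (subst nn_integral_suminf) (auto simp: nn_integral_cmult)
    also have "\<dots> = (\<Sum>k. ennreal ((1 / (2 * m)) ^ k) * (eavg Q (F k) * emeasure lebesgue Q))"
      by (simp add: eavg_times_emeasure[OF Q(1)])
    also have "\<dots> \<le> (\<Sum>k. ennreal ((1 / (2 * m)) ^ k) * F (Suc k) x * emeasure lebesgue Q)"
      unfolding FS mult.assoc
      by (intro suminf_le allI mult_left_mono mult_right_mono eavg_le_eM Q) auto
    also have "\<dots> = (\<Sum>k. ennreal (2 * m) * (ennreal ((1 / (2 * m)) ^ Suc k) * F (Suc k) x)) * emeasure lebesgue Q"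
    proof -
      have "ennreal (2 * m) * ennreal ((1 / (2 * m)) ^ Suc k) = ennreal ((1 / (2 * m)) ^ k)" for k
        using m by (subst ennreal_mult[symmetric]) auto
      then have "ennreal (2 * m) * (ennreal ((1 / (2 * m)) ^ Suc k) * F (Suc k) x) = ennreal ((1 / (2 * m)) ^ k) * F (Suc k) x" for k
        by (simp only: mult.assoc[symmetric])
      then show ?thesis by (simp only: ennreal_suminf_multc)
    qed
    also have "\<dots> = ennreal (2 * m) * (\<Sum>k. ennreal ((1 / (2 * m)) ^ Suc k) * F (Suc k) x) * emeasure lebesgue Q"
      by (simp only: ennreal_suminf_cmult)
    also have "\<dots> \<le> ennreal (2 * m) * V x * emeasure lebesgue Q"
    proof (intro mult_left_mono mult_right_mono)
      let ?t = "\<lambda>k. ennreal ((1 / (2 * m)) ^ k) * F k x"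
      have "(\<Sum>k. ?t k) = (\<Sum>k. ?t (k + 1)) + (\<Sum>k<1. ?t k)" by (rule suminf_offset) simp
      then show "(\<Sum>k. ennreal ((1 / (2 * m)) ^ Suc k) * F (Suc k) x) \<le> V x" by (simp add: V_def)
    qed auto
    finally have "eavg Q V \<le> ennreal (2 * m) * V x * emeasure lebesgue Q / emeasure lebesgue Q"
      unfolding eavg_def by (rule divide_right_mono_ennreal)
    then show ?thesis using mQ by (simp add: ennreal_mult_divide_cancel)
  qed
  define v where "v x = enn2real (V x)" for x
  have vm[measurable]: "v \<in> borel_measurable lebesgue" unfolding v_def by measurable
  have "AE x in lebesgue. V x < \<infinity>" by (rule rho_finite_AE[OF Vm Vfin])
  then have vV: "AE x in lebesgue. ennreal (v x) = V x" by eventually_elim (simp add: v_def)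
  have termle: "ennreal ((1 / (2 * m)) ^ k) * F k x \<le> V x" for k x
  proof -
    have "(\<Sum>i\<in>{k}. ennreal ((1 / (2 * m)) ^ i) * F i x) \<le> V x"
      unfolding V_def by (rule sum_le_suminf) auto
    then show ?thesis by simp
  qed
  show ?thesis
  proof (rule that[of v])
    show "A1_weight (2 * enn2real MX) v"
      unfolding A1_weight_def m_def[symmetric]
    proof (intro conjI allI ballI)
      from vV show "AE x in lebesgue. 0 < v x"
      proof eventually_elim
        case (elim x)
        have "0 < ennreal ((1 / (2 * m)) ^ 1) * F 1 x" using m F1pos[of x] by (simp add: ennreal_zero_less_mult_iff)
        also have "\<dots> \<le> ennreal (v x)" unfolding elim by (rule termle)
        finally show ?case by simp
      qed
      fix Q :: "(real^'n) set" assume Q: "Q \<in> cubes"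
      from vV show "AE x in lebesgue. x \<in> Q \<longrightarrow> eavg Q (\<lambda>x. ennreal (v x)) \<le> ennreal (2 * m) * ennreal (v x)"
        by eventually_elim (simp add: eavg_cong_AE[OF vV] VA[OF Q])
    qed (auto simp: v_def)
    from vV show "AE x in lebesgue. \<bar>f x\<bar> \<le> v x"
    proof eventually_elim
      case (elim x)
      have "ennreal \<bar>f x\<bar> \<le> ennreal (v x)" using termle[of 0 x] by (simp add: elim F0 eabs_def)
      then show ?case by (simp add: v_def)
    qed
    have "\<rho> (\<lambda>x. ennreal (v x)) = \<rho> V" by (rule rho_cong_AE[OF _ _ vV]) measurable
    then show "\<rho> (\<lambda>x. ennreal (v x)) \<le> 2 * \<rho> (eabs f)" using Vrho by simp
  qed
qed

end


section \<open>A weight that decays at infinity\<close>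

lemma infnorm_diff_le_cube:
  assumes "x \<in> cube a l" "y \<in> cube a l"
  shows "infnorm y \<le> infnorm x + l"
proof -
  have "\<bar>(y - x) $ i\<bar> \<le> l" for i using cube_component_diff[OF assms(2,1), of i] by simp
  then have "infnorm (y - x) \<le> l" unfolding infnorm_cart by (intro cSup_least) auto
  then show ?thesis using absdiff_infnorm[of y x] by linarith
qed

lemma infnorm_less_big: "infnorm x < 2 ^ n \<Longrightarrow> x \<in> big n"
  unfolding mem_big
proof
  fix i assume "infnorm x < 2 ^ n"
  then have "\<bar>x $ i\<bar> < 2 ^ n" using component_le_infnorm_cart[of x i] by linarith
  then show "- (2 ^ n) \<le> x $ i \<and> x $ i < 2 ^ n" by linarith
qed

lemma infnorm_measurable [measurable]: "infnorm \<in> borel_measurable (lebesgue :: (real^'n::finite) measure)"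
proof -
  have "continuous_on UNIV (infnorm :: real^'n \<Rightarrow> real)"
    using continuous_on_infnorm[OF continuous_on_id] by simp
  then have "infnorm \<in> borel_measurable (lborel :: (real^'n) measure)"
    by (simp add: borel_measurable_continuous_onI)
  then show ?thesis by (rule measurable_completion)
qed

definition decay :: "nat \<Rightarrow> real \<Rightarrow> real" where
  "decay d r = max (1 / r ^ d) (1 / sqrt r)"

lemma decay_pos: "r > 0 \<Longrightarrow> decay d r > 0"
  by (simp add: decay_def less_max_iff_disj)

lemma decay_antimono: "0 < r \<Longrightarrow> r \<le> s \<Longrightarrow> decay d s \<le> decay d r"
  unfolding decay_def by (intro max.mono divide_left_mono power_mono) auto

lemma decay_half:
  assumes "0 < r" "d \<ge> 1" shows "decay d (r / 2) \<le> 2 ^ d * decay d r"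
proof -
  have "sqrt 2 \<le> 2 ^ d"
  proof -
    have "(2::real) ^ 1 \<le> 2 ^ d" using assms by (intro power_increasing) auto
    moreover have "sqrt 2 \<le> 2" by (rule real_le_lsqrt) auto
    ultimately show ?thesis by simp
  qed
  then have "sqrt 2 * (1 / sqrt r) \<le> 2 ^ d * (1 / sqrt r)" using assms by (intro mult_right_mono) auto
  then show ?thesis using assms
    by (auto simp: decay_def real_sqrt_divide power_divide le_max_iff_disj max_mult_distrib_left)
qed

lemma decay_ge_1: "r \<ge> 1 \<Longrightarrow> d \<ge> 1 \<Longrightarrow> decay d r = 1 / sqrt r"
proof -
  assume r: "r \<ge> 1" "d \<ge> 1"
  have "sqrt r \<le> r" using r by (intro real_le_lsqrt) (auto simp: power2_eq_square)
  also have "r ^ 1 \<le> r ^ d" using r by (intro power_increasing) auto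
  finally have "sqrt r \<le> r ^ d" by simp
  then have "1 / r ^ d \<le> 1 / sqrt r" using r by (intro divide_left_mono) auto
  then show ?thesis by (simp add: decay_def)
qed

text \<open>
  If \<open>|f| \<le> v\<close> with \<open>v \<in> A\<^sub>1\<close> and \<open>f\<close> vanishes outside the cube \<open>|x|\<^sub>\<infinity> \<le> R\<close>, then \<open>v\<close> can be cut down to
  an \<open>A\<^sub>1\<close> weight \<open>u \<ge> |f|\<close> that is \<open>O(|x|\<^sup>-\<^sup>1\<^sup>/\<^sup>2)\<close> at infinity: put \<open>u = min v (\<kappa> decay \<delta>)\<close>, where \<open>\<delta>\<close>
  is the distance to that cube, and \<open>u = v\<close> on the cube itself. The power \<open>\<delta>\<^sup>-\<^sup>d\<close> near the cube is what
  makes this work: a cube of side \<open>l\<close> touching the boundary has \<open>v\<close>-average at most \<open>l\<^sup>-\<^sup>d \<integral> v\<close>,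
  which is comparable with the cutoff there. At infinity any exponent strictly between
  \<open>-d\<close> and \<open>0\<close> would do.
\<close>

lemma decaying_weight:
  fixes v :: "'n::finite rfun"
  assumes v: "A1_weight B v" and R: "R \<ge> 1"
  obtains u B' C N where "A1_weight B' u" "\<And>x. infnorm x \<le> R \<Longrightarrow> u x = v x"
    "\<And>n x. n \<ge> N \<Longrightarrow> x \<notin> big n \<Longrightarrow> u x \<le> C / sqrt (2 ^ n)"
proof -
  let ?d = "CARD('n)"
  have d1: "?d \<ge> 1" by (simp add: Suc_le_eq)
  have vm[measurable]: "v \<in> borel_measurable lebesgue" and v0: "\<And>x. 0 \<le> v x"
    using v by (auto simp: A1_weight_def)
  define \<delta> where "\<delta> x = infnorm x - R" for x :: "real^'n"
  have dm[measurable]: "\<delta> \<in> borel_measurable lebesgue" unfolding \<delta>_def by measurable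
  define E where "E r = {x. \<delta> x \<le> r}" for r
  have Em[measurable]: "E r \<in> sets lebesgue" for r
  proof -
    have "{x\<in>space lebesgue. \<delta> x \<le> r} \<in> sets lebesgue" by measurable
    then show ?thesis by (simp add: E_def)
  qed
  have Ebig: "\<exists>n. E r \<subseteq> big n" for r
  proof -
    obtain n where "R + r < 2 ^ n" using real_arch_pow[of 2 "R + r"] by auto
    then have "E r \<subseteq> big n" by (auto simp: E_def \<delta>_def intro!: infnorm_less_big)
    then show ?thesis ..
  qed
  have vint: "(\<integral>\<^sup>+x\<in>big n. ennreal (v x) \<partial>lebesgue) < \<infinity>" for n
  proof -
    have ae: "AE x in lebesgue. x \<in> big n \<longrightarrow> eavg (big n) (\<lambda>x. ennreal (v x)) \<le> ennreal B * ennreal (v x)"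
      using v by (auto simp: A1_weight_def)
    obtain x where "eavg (big n) (\<lambda>x. ennreal (v x)) \<le> ennreal B * ennreal (v x)"
      by (rule AE_cube_witness[OF big_in_cubes ae])
    then have "eavg (big n) (\<lambda>x. ennreal (v x)) < \<infinity>" by (rule le_less_trans) (simp add: ennreal_mult_less_top)
    then have "eavg (big n) (\<lambda>x. ennreal (v x)) * emeasure lebesgue (big n :: (real^'n) set) < \<infinity>"
      using emeasure_big_finite[where 'a='n, of n] by (simp add: ennreal_mult_less_top)
    then show ?thesis by (simp add: eavg_times_emeasure)
  qed
  \<comment> \<open>The summand \<open>1\<close> keeps \<open>\<kappa>\<close> positive.\<close>
  define \<kappa> where "\<kappa> = enn2real (\<integral>\<^sup>+x\<in>E 1. ennreal (v x) \<partial>lebesgue) + 1"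
  have \<kappa>: "\<kappa> > 0" "(\<integral>\<^sup>+x\<in>E 1. ennreal (v x) \<partial>lebesgue) \<le> ennreal \<kappa>"
  proof -
    show "\<kappa> > 0" by (simp add: \<kappa>_def add_nonneg_pos)
    obtain n where "E 1 \<subseteq> big n" using Ebig by blast
    then have "(\<integral>\<^sup>+x\<in>E 1. ennreal (v x) \<partial>lebesgue) \<le> (\<integral>\<^sup>+x\<in>big n. ennreal (v x) \<partial>lebesgue)"
      by (intro nn_integral_mono) (auto split: split_indicator)
    then have "(\<integral>\<^sup>+x\<in>E 1. ennreal (v x) \<partial>lebesgue) < top" using vint[of n] by (simp add: le_less_trans)
    then show "(\<integral>\<^sup>+x\<in>E 1. ennreal (v x) \<partial>lebesgue) \<le> ennreal \<kappa>"
      by (simp add: \<kappa>_def ennreal_plus)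
  qed
  define u where "u x = (if \<delta> x \<le> 0 then v x else min (v x) (\<kappa> * decay ?d (\<delta> x)))" for x
  have um[measurable]: "u \<in> borel_measurable lebesgue" unfolding u_def decay_def by measurable
  have u0: "0 \<le> u x" "u x \<le> v x" for x
    using v0[of x] \<kappa>(1) decay_pos[of "\<delta> x" ?d] by (auto simp: u_def)
  have ud: "u x \<le> \<kappa> * decay ?d (\<delta> x)" if "\<delta> x > 0" for x using that by (simp add: u_def)
  define G where "G r = (\<integral>\<^sup>+x\<in>E r. ennreal (u x) \<partial>lebesgue)" for r
  have Gmono: "G r \<le> G s" if "r \<le> s" for r s
    unfolding G_def using that by (intro nn_integral_mono) (auto simp: E_def split: split_indicator)
  have G1: "G 1 \<le> ennreal \<kappa>"
    unfolding G_def by (rule order_trans[OF nn_integral_mono \<kappa>(2)]) (auto intro!: mult_right_mono ennreal_leI u0)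
  define c where "c = (2 * (R + 3)) ^ ?d"
  have c: "c > 0" using R by (simp add: c_def)
  have Emeas: "emeasure lebesgue (E (2 ^ Suc m)) \<le> ennreal (c * (2 ^ m) ^ ?d)" for m
  proof -
    let ?s = "R + 3 * 2 ^ m"
    have "?s > 0" using R by (simp add: add_pos_pos)
    have "E (2 ^ Suc m) \<subseteq> cube (\<chi> i. - ?s) (2 * ?s)"
    proof
      fix x assume "x \<in> E (2 ^ Suc m)"
      then have x: "infnorm x \<le> R + 2 * 2 ^ m" by (simp add: E_def \<delta>_def)
      have "- ?s \<le> x $ i \<and> x $ i < ?s" for i
        using x component_le_infnorm_cart[of x i] zero_less_power[of "2::real" m] by linarith
      then show "x \<in> cube (\<chi> i. - ?s) (2 * ?s)" by (simp add: mem_cube)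
    qed
    then have "emeasure lebesgue (E (2 ^ Suc m)) \<le> emeasure lebesgue (cube (\<chi> i. - ?s) (2 * ?s) :: (real^'n) set)"
      by (intro emeasure_mono) auto
    also have "\<dots> = ennreal ((2 * ?s) ^ ?d)" using \<open>?s > 0\<close> by (intro emeasure_cube) simp
    also have "\<dots> \<le> ennreal (c * (2 ^ m) ^ ?d)"
    proof (rule ennreal_leI)
      have "R * 1 \<le> R * 2 ^ m" using R by (intro mult_left_mono) auto
      then have "2 * ?s \<le> 2 * (R + 3) * 2 ^ m" by (simp add: algebra_simps)
      then have "(2 * ?s) ^ ?d \<le> (2 * (R + 3) * 2 ^ m) ^ ?d" using \<open>?s > 0\<close> by (intro power_mono) auto
      then show "(2 * ?s) ^ ?d \<le> c * (2 ^ m) ^ ?d" by (simp add: c_def power_mult_distrib)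
    qed
    finally show ?thesis .
  qed
  define q where "q m = (2 ^ m) ^ ?d / sqrt (2 ^ m)" for m :: nat
  have q0: "q m > 0" for m by (simp add: q_def)
  have qS: "q (Suc m) \<ge> sqrt 2 * q m" for m
  proof -
    have "sqrt 2 * sqrt 2 \<le> 2 ^ ?d" using power_increasing[of 1 ?d "2::real"] d1 by simp
    then have "sqrt 2 * (sqrt 2 * (2 ^ m) ^ ?d) \<le> 2 ^ ?d * (2 ^ m) ^ ?d"
      unfolding mult.assoc[symmetric] by (intro mult_right_mono) auto
    then show ?thesis by (simp add: q_def real_sqrt_mult power_mult_distrib field_simps)
  qed
  define C1 where "C1 = 1 + 3 * c"
  have C1: "C1 > 0" "C1 \<ge> 1" using c by (auto simp: C1_def)
  \<comment> \<open>\<open>q m\<close> grows by a factor of at least \<open>sqrt 2 > 4/3\<close>, and \<open>C1 = 1 + 3 c\<close> makes the sum over the dyadic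
    shells close up: \<open>C1 + c \<le> 4/3 C1\<close>.\<close>
  have Gdy: "G (2 ^ m) \<le> ennreal (C1 * \<kappa> * q m)" for m
  proof (induction m)
    case 0
    have "\<kappa> \<le> C1 * \<kappa> * q 0" using C1 \<kappa> by (simp add: q_def)
    then show ?case using G1 by (simp add: order_trans ennreal_leI)
  next
    case (Suc m)
    let ?r = "2 ^ m :: real"
    have "G (2 ^ Suc m) \<le> (\<integral>\<^sup>+x. ennreal (u x) * indicator (E ?r) x + ennreal (\<kappa> * decay ?d ?r) * indicator (E (2 ^ Suc m)) x \<partial>lebesgue)"
      unfolding G_def
    proof (rule nn_integral_mono)
      fix x
      have "ennreal (u x) \<le> ennreal (\<kappa> * decay ?d ?r)" if "x \<notin> E ?r"
      proof (rule ennreal_leI)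
        have dx: "\<delta> x > ?r" using that by (simp add: E_def)
        then have "u x \<le> \<kappa> * decay ?d (\<delta> x)" by (intro ud) (simp add: less_trans[OF zero_less_power[of 2 m]])
        also have "\<dots> \<le> \<kappa> * decay ?d ?r" using dx \<kappa> by (intro mult_left_mono decay_antimono) auto
        finally show "u x \<le> \<kappa> * decay ?d ?r" .
      qed
      then show "ennreal (u x) * indicator (E (2 ^ Suc m)) x
          \<le> ennreal (u x) * indicator (E ?r) x + ennreal (\<kappa> * decay ?d ?r) * indicator (E (2 ^ Suc m)) x"
        by (auto split: split_indicator)
    qed
    also have "\<dots> = G ?r + ennreal (\<kappa> * decay ?d ?r) * emeasure lebesgue (E (2 ^ Suc m))"
      unfolding G_def by (subst nn_integral_add) (auto simp: nn_integral_cmult_indicator)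
    also have "\<dots> \<le> ennreal (C1 * \<kappa> * q m) + ennreal (\<kappa> * decay ?d ?r) * ennreal (c * ?r ^ ?d)"
      by (intro add_mono Suc.IH mult_left_mono Emeas) auto
    also have "\<dots> = ennreal (C1 * \<kappa> * q m + \<kappa> * c * q m)"
    proof -
      have A: "\<kappa> * decay ?d ?r * (c * ?r ^ ?d) = \<kappa> * c * q m"
        using d1 by (simp add: decay_ge_1 q_def)
      have B: "ennreal (\<kappa> * decay ?d ?r) * ennreal (c * ?r ^ ?d) = ennreal (\<kappa> * decay ?d ?r * (c * ?r ^ ?d))"
        using \<kappa> c decay_pos[of ?r ?d] by (intro ennreal_mult[symmetric]) auto
      show ?thesis unfolding B A using C1 \<kappa> q0[of m] c by simp
    qed
    also have "\<dots> \<le> ennreal (C1 * \<kappa> * q (Suc m))"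
    proof (rule ennreal_leI)
      have s: "sqrt 2 \<ge> 4 / 3" by (rule real_le_rsqrt) (simp add: power2_eq_square)
      have "C1 + c \<le> C1 * (4 / 3)" using c by (simp add: C1_def)
      also have "\<dots> \<le> C1 * sqrt 2" using s C1 by (intro mult_left_mono) auto
      finally have "(C1 + c) * (\<kappa> * q m) \<le> (C1 * sqrt 2) * (\<kappa> * q m)" using \<kappa> q0[of m] by (intro mult_right_mono) auto
      also have "\<dots> = C1 * \<kappa> * (sqrt 2 * q m)" by simp
      also have "\<dots> \<le> C1 * \<kappa> * q (Suc m)" using qS[of m] C1 \<kappa> by (intro mult_left_mono) auto
      finally show "C1 * \<kappa> * q m + \<kappa> * c * q m \<le> C1 * \<kappa> * q (Suc m)" by (simp add: algebra_simps)
    qed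
    finally show ?case .
  qed
  define C2 where "C2 = C1 * 2 ^ ?d"
  have C2: "C2 \<ge> 1" "C2 > 0" unfolding C2_def using C1
    by (auto intro!: mult_pos_pos order_trans[OF _ mult_mono[of 1 C1 1 "2 ^ ?d"]])
  have Gall: "G r \<le> ennreal (C2 * \<kappa> * (r ^ ?d * decay ?d r))" if r: "r > 0" for r
  proof (cases "r \<le> 1")
    case True
    have "1 \<le> r ^ ?d * decay ?d r" using r by (simp add: decay_def max_mult_distrib_left le_max_iff_disj)
    then have "1 * \<kappa> * 1 \<le> C2 * \<kappa> * (r ^ ?d * decay ?d r)" using C2 \<kappa> by (intro mult_mono) auto
    then have "ennreal \<kappa> \<le> ennreal (C2 * \<kappa> * (r ^ ?d * decay ?d r))" by (simp add: ennreal_leI)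
    moreover have "G r \<le> ennreal \<kappa>" using Gmono[OF True] G1 by (rule order_trans)
    ultimately show ?thesis by (rule order_trans[rotated])
  next
    case False
    define m where "m = (LEAST m. r < 2 ^ m)"
    have ex: "\<exists>m. r < 2 ^ m" using real_arch_pow[of 2 r] by auto
    have m: "r < 2 ^ m" unfolding m_def using ex by (rule LeastI_ex)
    have "m \<noteq> 0" by (rule notI) (use m False in simp)
    then obtain k where k: "m = Suc k" using not0_implies_Suc by blast
    have "\<not> r < 2 ^ k" using not_less_Least[of k "\<lambda>m. r < 2 ^ m"] k by (simp add: m_def)
    then have le: "2 ^ m \<le> 2 * r" using k by simp
    have "G r \<le> G (2 ^ m)" using m by (intro Gmono) simp
    also have "\<dots> \<le> ennreal (C1 * \<kappa> * q m)" by (rule Gdy)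
    also have "\<dots> \<le> ennreal (C2 * \<kappa> * (r ^ ?d * decay ?d r))"
    proof (rule ennreal_leI)
      have "q m \<le> (2 * r) ^ ?d / sqrt r"
        unfolding q_def using m le r by (intro frac_le power_mono) auto
      also have "\<dots> = 2 ^ ?d * (r ^ ?d * decay ?d r)"
        using False d1 by (simp add: decay_ge_1 power_mult_distrib)
      finally have "C1 * \<kappa> * q m \<le> C1 * \<kappa> * (2 ^ ?d * (r ^ ?d * decay ?d r))"
        using C1 \<kappa> by (intro mult_left_mono) auto
      then show "C1 * \<kappa> * q m \<le> C2 * \<kappa> * (r ^ ?d * decay ?d r)" by (simp add: C2_def mult_ac)
    qed
    finally show ?thesis .
  qed
  define B' where "B' = max B (max (2 ^ ?d) (C2 * 3 ^ ?d))"
  have key: "eavg Q (\<lambda>x. ennreal (u x)) \<le> ennreal B' * ennreal (\<kappa> * decay ?d (\<delta> x))"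
    if Q: "Q \<in> cubes" "x \<in> Q" and dx: "\<delta> x > 0" for Q x
  proof -
    obtain a l where al: "Q = cube a l" "l > 0" using Q(1) by (rule cubesE)
    note mQ = emeasure_cube[OF al(2), of a]
    have dd: "\<delta> y \<le> \<delta> x + l" "\<delta> x \<le> \<delta> y + l" if "y \<in> Q" for y
      using infnorm_diff_le_cube[of x a l y] infnorm_diff_le_cube[of y a l x] that Q(2) by (auto simp: al \<delta>_def)
    have zp: "decay ?d (\<delta> x) > 0" by (rule decay_pos[OF dx])
    \<comment> \<open>Cubes that are small compared with their distance \<open>\<delta>\<close> see a nearly constant cutoff; the others
      are contained in \<open>E (3 l)\<close>, where \<open>Gall\<close> bounds the whole integral of \<open>u\<close>.\<close>
    show ?thesis
    proof (cases "l \<le> \<delta> x / 2")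
      case True
      have "(\<integral>\<^sup>+y\<in>Q. ennreal (u y) \<partial>lebesgue) \<le> (\<integral>\<^sup>+y. ennreal (2 ^ ?d * (\<kappa> * decay ?d (\<delta> x))) * indicator Q y \<partial>lebesgue)"
      proof (rule nn_integral_mono)
        fix y
        have "u y \<le> 2 ^ ?d * (\<kappa> * decay ?d (\<delta> x))" if y: "y \<in> Q"
        proof -
          have h: "\<delta> x / 2 \<le> \<delta> y" using dd(2)[OF y] True by simp
          then have "u y \<le> \<kappa> * decay ?d (\<delta> y)" using dx by (intro ud) simp
          also have "\<dots> \<le> \<kappa> * decay ?d (\<delta> x / 2)" using h dx \<kappa> by (intro mult_left_mono decay_antimono) auto
          also have "\<dots> \<le> \<kappa> * (2 ^ ?d * decay ?d (\<delta> x))" using \<kappa> by (intro mult_left_mono decay_half dx d1) auto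
          finally show ?thesis by (simp add: mult_ac)
        qed
        then show "ennreal (u y) * indicator Q y \<le> ennreal (2 ^ ?d * (\<kappa> * decay ?d (\<delta> x))) * indicator Q y"
          by (auto split: split_indicator intro!: ennreal_leI)
      qed
      also have "\<dots> = ennreal (2 ^ ?d * (\<kappa> * decay ?d (\<delta> x))) * emeasure lebesgue Q"
        using cubes_lebesgue[OF Q(1)] by (simp add: nn_integral_cmult_indicator)
      finally have "eavg Q (\<lambda>x. ennreal (u x)) \<le> ennreal (2 ^ ?d * (\<kappa> * decay ?d (\<delta> x))) * emeasure lebesgue Q / emeasure lebesgue Q"
        unfolding eavg_def by (rule divide_right_mono_ennreal)
      also have "\<dots> = ennreal (2 ^ ?d) * ennreal (\<kappa> * decay ?d (\<delta> x))"
        using emeasure_lebesgue_cubes[OF Q(1)] \<kappa> zp by (simp add: ennreal_mult_divide_cancel ennreal_mult)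
      also have "\<dots> \<le> ennreal B' * ennreal (\<kappa> * decay ?d (\<delta> x))"
        by (intro mult_right_mono ennreal_leI) (auto simp: B'_def)
      finally show ?thesis .
    next
      case False
      have "Q \<subseteq> E (3 * l)" using dd(1) False by (force simp: E_def)
      then have "(\<integral>\<^sup>+y\<in>Q. ennreal (u y) \<partial>lebesgue) \<le> G (3 * l)"
        unfolding G_def by (intro nn_integral_mono) (auto split: split_indicator)
      also have "\<dots> \<le> ennreal (C2 * \<kappa> * ((3 * l) ^ ?d * decay ?d (3 * l)))" using al by (intro Gall) simp
      also have "\<dots> \<le> ennreal (C2 * 3 ^ ?d * (\<kappa> * decay ?d (\<delta> x)) * l ^ ?d)"
      proof (rule ennreal_leI)
        have "decay ?d (3 * l) \<le> decay ?d (\<delta> x)" using dx False by (intro decay_antimono) auto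
        then have "(C2 * \<kappa> * (3 * l) ^ ?d) * decay ?d (3 * l) \<le> (C2 * \<kappa> * (3 * l) ^ ?d) * decay ?d (\<delta> x)"
          using C2 \<kappa> al by (intro mult_left_mono) auto
        then show "C2 * \<kappa> * ((3 * l) ^ ?d * decay ?d (3 * l)) \<le> C2 * 3 ^ ?d * (\<kappa> * decay ?d (\<delta> x)) * l ^ ?d"
          by (simp add: power_mult_distrib mult_ac)
      qed
      also have "\<dots> = ennreal (C2 * 3 ^ ?d) * ennreal (\<kappa> * decay ?d (\<delta> x)) * ennreal (l ^ ?d)"
        using C2 \<kappa> zp al by (simp add: ennreal_mult)
      finally have "eavg Q (\<lambda>x. ennreal (u x)) \<le> ennreal (C2 * 3 ^ ?d) * ennreal (\<kappa> * decay ?d (\<delta> x)) * ennreal (l ^ ?d) / ennreal (l ^ ?d)"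
        unfolding eavg_def al(1) mQ by (rule divide_right_mono_ennreal)
      also have "\<dots> = ennreal (C2 * 3 ^ ?d) * ennreal (\<kappa> * decay ?d (\<delta> x))"
        using al by (intro ennreal_mult_divide_cancel) simp
      also have "\<dots> \<le> ennreal B' * ennreal (\<kappa> * decay ?d (\<delta> x))"
        by (intro mult_right_mono ennreal_leI) (auto simp: B'_def)
      finally show ?thesis .
    qed
  qed
  have uA: "A1_weight B' u"
    unfolding A1_weight_def
  proof (intro conjI allI ballI um u0(1))
    have "AE x in lebesgue. 0 < v x" using v by (simp add: A1_weight_def)
    then show "AE x in lebesgue. 0 < u x"
      by eventually_elim (use \<kappa> in \<open>auto simp: u_def decay_pos\<close>)
    fix Q :: "(real^'n) set" assume Q: "Q \<in> cubes"
    have "AE x in lebesgue. x \<in> Q \<longrightarrow> eavg Q (\<lambda>x. ennreal (v x)) \<le> ennreal B * ennreal (v x)"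
      using v Q by (simp add: A1_weight_def)
    then show "AE x in lebesgue. x \<in> Q \<longrightarrow> eavg Q (\<lambda>x. ennreal (u x)) \<le> ennreal B' * ennreal (u x)"
    proof eventually_elim
      case (elim x)
      show ?case
      proof
        assume x: "x \<in> Q"
        show "eavg Q (\<lambda>x. ennreal (u x)) \<le> ennreal B' * ennreal (u x)"
        proof (cases "u x = v x")
          case True
          have "eavg Q (\<lambda>x. ennreal (u x)) \<le> eavg Q (\<lambda>x. ennreal (v x))" by (intro eavg_mono ennreal_leI u0)
          also have "\<dots> \<le> ennreal B * ennreal (v x)" using elim x by simp
          also have "\<dots> \<le> ennreal B' * ennreal (u x)" unfolding True
            by (intro mult_right_mono ennreal_leI) (auto simp: B'_def)
          finally show ?thesis .
        next
          case False
          then have "\<delta> x > 0" "u x = \<kappa> * decay ?d (\<delta> x)" by (auto simp: u_def min_def split: if_splits)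
          then show ?thesis using key[OF Q x] by simp
        qed
      qed
    qed
  qed
  obtain N where N: "2 * R < 2 ^ N" using real_arch_pow[of 2 "2 * R"] by auto
  have far: "u x \<le> \<kappa> * sqrt 2 / sqrt (2 ^ n)" if n: "n \<ge> N" "x \<notin> big n" for n x
  proof -
    have "(2::real) ^ N \<le> 2 ^ n" using n by simp
    then have "2 ^ n / 2 \<le> 2 ^ n - R" using N by linarith
    moreover have "\<not> infnorm x < 2 ^ n" using n(2) infnorm_less_big by blast
    ultimately have h: "2 ^ n / 2 \<le> \<delta> x" unfolding \<delta>_def by linarith
    have h1: "1 \<le> (2::real) ^ n / 2" using \<open>(2::real) ^ N \<le> 2 ^ n\<close> N R by linarith
    have "u x \<le> \<kappa> * decay ?d (\<delta> x)" using h h1 by (intro ud) simp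
    also have "\<dots> \<le> \<kappa> * decay ?d (2 ^ n / 2)" using h h1 \<kappa> by (intro mult_left_mono decay_antimono) auto
    also have "\<dots> = \<kappa> * sqrt 2 / sqrt (2 ^ n)" using h1 d1 by (simp add: decay_ge_1 real_sqrt_divide)
    finally show ?thesis .
  qed
  show ?thesis by (rule that[OF uA _ far]) (auto simp: u_def \<delta>_def)
qed


section \<open>Level sets of finite measure\<close>

text \<open>
  The region \<open>big (n+1) - big n\<close> is split into dyadic cubes of side \<open>2\<^sup>n\<close>. On these the oscillations
  are \<open>O(2\<^sup>-\<^sup>n\<^sup>/\<^sup>2)\<close> and the medians are close to \<open>c\<close>, so a deviation \<open>\<alpha>\<close> from \<open>c\<close> allows the
  John-Nirenberg estimate with \<open>j = n (d + 1)\<close> steps. The exceptional part has measure \<open>O(2\<^sup>-\<^sup>n)\<close>.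
\<close>

lemma finite_level_of_decay:
  fixes g :: "'n::finite rfun"
  assumes g: "g \<in> L0" and sharp: "AE x in lebesgue. sharp_max_weak g x \<le> ennreal K * ennreal (u x)"
    and decay: "\<And>n x. n \<ge> N \<Longrightarrow> x \<notin> big n \<Longrightarrow> u x \<le> C / sqrt (2 ^ n)"
    and c: "(\<lambda>n. med (big n) g) \<longlonglongrightarrow> c"
  shows "finite_level_sets (\<lambda>x. g x - c)"
  unfolding finite_level_sets_def
proof (intro allI impI)
  fix \<alpha> :: real assume \<alpha>: "\<alpha> > 0"
  let ?d = "CARD('n)" and ?A = "osc_mult CARD('n)" and ?\<mu> = "measure lebesgue"
  have A: "?A > 0" by (rule osc_mult_pos)
  have [measurable]: "g \<in> borel_measurable lebesgue" using g by (simp add: L0_def)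
  define K' where "K' = max K 0 * max C 0"
  define \<omega> where "\<omega> n = K' / sqrt (2 ^ n)" for n :: nat
  have \<omega>0: "\<omega> n \<ge> 0" for n by (simp add: \<omega>_def K'_def)
  have sw: "AE x in lebesgue. x \<notin> big n \<longrightarrow> sharp_max_weak g x \<le> ennreal (\<omega> n)" if n: "n \<ge> N" for n
    using sharp
  proof eventually_elim
    case (elim x)
    show ?case
    proof
      assume x: "x \<notin> big n"
      have "C / sqrt (2 ^ n) \<le> max C 0 / sqrt (2 ^ n)" by (rule divide_right_mono) auto
      then have "ennreal K * ennreal (u x) \<le> ennreal (max K 0) * ennreal (max C 0 / sqrt (2 ^ n))"
        using decay[OF n x] by (intro mult_mono ennreal_leI) auto
      also have "\<dots> = ennreal (\<omega> n)" by (simp add: \<omega>_def K'_def flip: ennreal_mult)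
      finally show "sharp_max_weak g x \<le> ennreal (\<omega> n)" using elim by simp
    qed
  qed
  have oscq: "osc_weak Q g \<le> ennreal (\<omega> n)" if n: "n \<ge> N" and q: "q \<in> cubes" "q \<inter> big n = {}" and Q: "Q \<in> cubes" "q \<subseteq> Q" for n q Q
  proof -
    have ae: "AE x in lebesgue. x \<in> q \<longrightarrow> sharp_max_weak g x \<le> ennreal (\<omega> n)"
      using sw[OF n] by eventually_elim (use q(2) in blast)
    obtain x where x: "x \<in> q" "sharp_max_weak g x \<le> ennreal (\<omega> n)" by (rule AE_cube_witness[OF q(1) ae])
    have "osc_weak Q g \<le> sharp_max_weak g x"
      unfolding sharp_max_weak_eq using Q x(1) by (intro cube_sup_upper) auto
    then show ?thesis using x(2) by simp
  qed
  have lim1: "(\<lambda>n. real n * (1 / sqrt 2) ^ n) \<longlonglongrightarrow> 0" by (rule powser_times_n_limit_0) simp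
  have lim2: "(\<lambda>n. (1 / sqrt 2) ^ n) \<longlonglongrightarrow> 0" by (rule LIMSEQ_realpow_zero) auto
  have \<omega>eq: "\<omega> n = K' * (1 / sqrt 2) ^ n" for n
    by (simp add: \<omega>_def real_sqrt_power power_one_over)
  have "(\<lambda>n. 2 * ?A * \<omega> n + \<bar>med (big (Suc n)) g - c\<bar> + real (?d + 1) * (2 * ?A * K') * (real n * (1 / sqrt 2) ^ n))
      \<longlonglongrightarrow> 2 * ?A * (K' * 0) + \<bar>c - c\<bar> + real (?d + 1) * (2 * ?A * K') * 0"
    unfolding \<omega>eq by (intro tendsto_intros lim1 lim2 LIMSEQ_Suc[OF c])
  then have "\<forall>\<^sub>F n in sequentially. 2 * ?A * \<omega> n + \<bar>med (big (Suc n)) g - c\<bar> + real (?d + 1) * (2 * ?A * K') * (real n * (1 / sqrt 2) ^ n) < \<alpha>"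
    using \<alpha> by (intro order_tendstoD(2)) auto
  then have "\<forall>\<^sub>F n in sequentially. 2 * ?A * \<omega> n + \<bar>med (big (Suc n)) g - c\<bar> + real (n * (?d + 1)) * (2 * ?A * \<omega> n) < \<alpha>"
    by eventually_elim (simp add: \<omega>eq algebra_simps)
  then obtain N0 where N0: "\<And>n. n \<ge> N0 \<Longrightarrow> 2 * ?A * \<omega> n + \<bar>med (big (Suc n)) g - c\<bar> + real (n * (?d + 1)) * (2 * ?A * \<omega> n) < \<alpha>"
    by (auto simp: eventually_sequentially)
  \<comment> \<open>From \<open>N0\<close> on, the medians on the dyadic cubes of the annulus together with \<open>n (d + 1)\<close>
    John-Nirenberg steps account for less than \<open>\<alpha>\<close>.\<close>
  define N1 where "N1 = max N N0"
  define S where "S = {x. \<bar>g x - c\<bar> > \<alpha>}"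
  have Sm[measurable]: "S \<in> sets lebesgue"
  proof -
    have "{x\<in>space lebesgue. \<bar>g x - c\<bar> > \<alpha>} \<in> sets lebesgue" by measurable
    then show ?thesis by (simp add: S_def)
  qed
  define R where "R n = (big (Suc n) - big n :: (real^'n) set)" for n
  have Rm[measurable]: "R n \<in> sets lebesgue" for n unfolding R_def by (intro sets.Diff big_lebesgue)
  have est: "emeasure lebesgue (S \<inter> R n) \<le> ennreal (4 ^ ?d * (1/2) ^ n)" if n: "n \<ge> N1" for n
  proof -
    have nN: "n \<ge> N" "n \<ge> N0" using n by (auto simp: N1_def)
    define a :: "real^'n" where "a = (\<chi> i. - (2 ^ Suc n))"
    define l :: real where "l = 2 ^ Suc (Suc n)"
    have l: "l > 0" by (simp add: l_def)
    have bigS: "big (Suc n) = cube a l" by (simp add: big_def a_def l_def)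
    define P where "P = dyadic a l 2 ` R n"
    have Pc: "P \<subseteq> cubes" using dyadic_in_cubes[OF l] by (auto simp: P_def)
    have Pd: "disjoint P"
    proof (rule disjointI)
      fix p q assume pq: "p \<in> P" "q \<in> P" "p \<noteq> q"
      then obtain x y where xy: "p = dyadic a l 2 x" "q = dyadic a l 2 y" by (auto simp: P_def)
      show "p \<inter> q = {}"
      proof (rule ccontr)
        assume "p \<inter> q \<noteq> {}"
        then obtain z where "z \<in> dyadic a l 2 x" "z \<in> dyadic a l 2 y" using xy by auto
        then show False using dyadic_eq[OF l] pq(3) xy by metis
      qed
    qed
    have Pcount: "countable P" by (rule countable_disjoint_cubes[OF Pc Pd])
    have Pm: "q \<in> sets lebesgue" if "q \<in> P" for q using that Pc cubes_lebesgue by blast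
    have qbig: "q \<subseteq> big (Suc n)" "q \<inter> big n = {}" "?\<mu> q = (2 ^ n) ^ ?d" if q: "q \<in> P" for q
    proof -
      obtain x where x: "q = dyadic a l 2 x" "x \<in> R n" using q by (auto simp: P_def)
      have "x \<in> cube a l" using x(2) by (simp add: R_def bigS)
      then show "q \<subseteq> big (Suc n)"
        using dyadic_antimono[OF l, of 0 2 a x] dyadic_0[OF l, of x a] by (simp add: x bigS)
      show "?\<mu> q = (2 ^ n) ^ ?d" unfolding x(1) measure_dyadic[OF l] by (simp add: l_def)
      show "q \<inter> big n = {}"
      proof (rule ccontr)
        assume "q \<inter> big n \<noteq> {}"
        then obtain y where y: "y \<in> q" "y \<in> big n" by blast
        have fl: "(- (2 ^ n) \<le> z $ i \<and> z $ i < 2 ^ n) \<longleftrightarrow> \<lfloor>2 ^ 2 * (z $ i - a $ i) / l\<rfloor> \<in> {1, 2}" for z :: "real^'n" and i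
        proof -
          have i12: "(1 \<le> k \<and> k < 3) \<longleftrightarrow> k \<in> {1, 2}" for k :: int by auto
          have e: "2 ^ 2 * (z $ i - a $ i) / l = z $ i / 2 ^ n + 2" by (simp add: a_def l_def field_simps)
          have "(- (2 ^ n) \<le> z $ i \<and> z $ i < 2 ^ n) \<longleftrightarrow> (1 \<le> z $ i / 2 ^ n + 2 \<and> z $ i / 2 ^ n + 2 < 3)"
            by (auto simp: field_simps)
          also have "\<dots> \<longleftrightarrow> 1 \<le> \<lfloor>z $ i / 2 ^ n + 2\<rfloor> \<and> \<lfloor>z $ i / 2 ^ n + 2\<rfloor> < 3"
            by (simp only: le_floor_iff floor_less_iff of_int_1 of_int_numeral)
          also have "\<dots> \<longleftrightarrow> \<lfloor>z $ i / 2 ^ n + 2\<rfloor> \<in> {1, 2}" by (rule i12)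
          finally show ?thesis unfolding e .
        qed
        have "\<lfloor>2 ^ 2 * (y $ i - a $ i) / l\<rfloor> = \<lfloor>2 ^ 2 * (x $ i - a $ i) / l\<rfloor>" for i
          using y(1) unfolding x(1) mem_dyadic[OF l] by (rule spec)
        then have "x \<in> big n" using y(2) unfolding mem_big fl by (simp only: simp_thms)
        then show False using x(2) by (simp add: R_def)
      qed
    qed
    have each: "emeasure lebesgue (S \<inter> q) \<le> ennreal ((1/2) ^ (n * (?d + 1)) * ?\<mu> q)" if q: "q \<in> P" for q
    proof -
      have qc: "q \<in> cubes" using q Pc by blast
      have "ennreal \<bar>med q g - med (big (Suc n)) g\<bar> \<le> ennreal ?A * (osc_weak q g + osc_weak (big (Suc n)) g)"
      proof (rule med_compare[OF qc big_in_cubes qbig(1)[OF q] g])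
        have "(2 ^ Suc (Suc n) :: real) ^ ?d = (4 * 2 ^ n) ^ ?d" by simp
        also have "\<dots> = 4 ^ ?d * (2 ^ n) ^ ?d" by (rule power_mult_distrib)
        finally show "?\<mu> (big (Suc n) :: (real^'n) set) \<le> 4 ^ ?d * ?\<mu> q"
          unfolding measure_big qbig(3)[OF q] by (rule eq_refl)
      qed
      also have "\<dots> \<le> ennreal ?A * (ennreal (\<omega> n) + ennreal (\<omega> n))"
        using qbig[OF q] qc by (intro mult_left_mono add_mono oscq[OF nN(1) qc]) auto
      also have "\<dots> = ennreal (2 * ?A * \<omega> n)"
        using A \<omega>0[of n] by (simp flip: ennreal_mult ennreal_plus)
      finally have mq: "\<bar>med q g - med (big (Suc n)) g\<bar> \<le> 2 * ?A * \<omega> n"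
        using A \<omega>0[of n] by (simp add: ennreal_le_iff)
      have "S \<inter> q \<subseteq> {x\<in>q. \<bar>g x - med q g\<bar> > real (n * (?d + 1)) * (2 * ?A * \<omega> n)}"
        using mq N0[OF nN(2)] by (auto simp: S_def simp del: of_nat_mult)
      then have "emeasure lebesgue (S \<inter> q) \<le> emeasure lebesgue {x\<in>q. \<bar>g x - med q g\<bar> > real (n * (?d + 1)) * (2 * ?A * \<omega> n)}"
        using level_lmeasurable(3)[OF qc g] by (intro emeasure_mono) (auto dest: fmeasurableD)
      also have "\<dots> \<le> ennreal ((1/2) ^ (n * (?d + 1)) * ?\<mu> q)"
      proof (rule john_nirenberg[OF g qc \<omega>0])
        fix q' assume q': "q' \<in> cubes" "q' \<subseteq> q"
        show "osc_weak q' g \<le> ennreal (\<omega> n)"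
          using qbig(2)[OF q] q' by (intro oscq[OF nN(1) q'(1) _ q'(1)]) auto
      qed
      finally show ?thesis .
    qed
    have UP[measurable]: "\<Union>P \<in> sets lebesgue" using Pcount Pm by (intro sets.countable_Union) auto
    have "S \<inter> R n \<subseteq> \<Union>P" using dyadic_self[OF l] by (auto simp: P_def)
    then have "emeasure lebesgue (S \<inter> R n) \<le> emeasure lebesgue (S \<inter> \<Union>P)" by (intro emeasure_mono) auto
    also have "\<dots> = (\<integral>\<^sup>+x. indicator (S \<inter> \<Union>P) x \<partial>lebesgue)" by simp
    also have "\<dots> = (\<integral>\<^sup>+x\<in>\<Union>P. indicator S x \<partial>lebesgue)"
      by (intro nn_integral_cong) (simp add: indicator_inter_arith)
    also have "\<dots> = (\<integral>\<^sup>+q. (\<integral>\<^sup>+x\<in>q. indicator S x \<partial>lebesgue) \<partial>count_space P)"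
      by (intro nn_integral_UN_disjoint[OF Pcount Pd Pm]) auto
    also have "\<dots> \<le> (\<integral>\<^sup>+q. (\<integral>\<^sup>+x\<in>q. ennreal ((1/2) ^ (n * (?d + 1))) \<partial>lebesgue) \<partial>count_space P)"
    proof (rule nn_integral_mono)
      fix q assume "q \<in> space (count_space P)"
      then have q: "q \<in> P" "q \<in> cubes" using Pc by auto
      have "(\<integral>\<^sup>+x\<in>q. indicator S x \<partial>lebesgue) = (\<integral>\<^sup>+x. indicator (S \<inter> q) x \<partial>lebesgue)"
        by (intro nn_integral_cong) (simp add: indicator_inter_arith)
      also have "\<dots> = emeasure lebesgue (S \<inter> q)" using Pm[OF q(1)] by simp
      also have "\<dots> \<le> ennreal ((1/2) ^ (n * (?d + 1)) * ?\<mu> q)" by (rule each[OF q(1)])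
      also have "\<dots> = (\<integral>\<^sup>+x\<in>q. ennreal ((1/2) ^ (n * (?d + 1))) \<partial>lebesgue)"
        using Pm[OF q(1)] emeasure_lebesgue_cubes[OF q(2)]
        by (subst nn_integral_cmult_indicator) (auto simp only: ennreal_mult[symmetric] measure_nonneg zero_le_power zero_le_divide_1_iff zero_le_numeral)
      finally show "(\<integral>\<^sup>+x\<in>q. indicator S x \<partial>lebesgue) \<le> (\<integral>\<^sup>+x\<in>q. ennreal ((1/2) ^ (n * (?d + 1))) \<partial>lebesgue)" .
    qed
    also have "\<dots> = (\<integral>\<^sup>+x\<in>\<Union>P. ennreal ((1/2) ^ (n * (?d + 1))) \<partial>lebesgue)"
      by (rule nn_integral_UN_disjoint[OF Pcount Pd Pm, symmetric]) auto
    also have "\<dots> = ennreal ((1/2) ^ (n * (?d + 1))) * emeasure lebesgue (\<Union>P)"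
      by (rule nn_integral_cmult_indicator) measurable
    also have "\<dots> \<le> ennreal ((1/2) ^ (n * (?d + 1))) * emeasure lebesgue (big (Suc n) :: (real^'n) set)"
      using qbig(1) by (intro mult_left_mono emeasure_mono) auto
    also have "emeasure lebesgue (big (Suc n) :: (real^'n) set) = ennreal ((2 ^ Suc (Suc n)) ^ ?d)"
      using emeasure_lebesgue_cubes(1)[OF big_in_cubes, of "Suc n"] by (simp only: measure_big)
    also have "ennreal ((1/2) ^ (n * (?d + 1))) * ennreal ((2 ^ Suc (Suc n)) ^ ?d) = ennreal ((1/2) ^ (n * (?d + 1)) * (2 ^ Suc (Suc n)) ^ ?d)"
      by (rule ennreal_mult[symmetric]) auto
    also have "(1/2) ^ (n * (?d + 1)) * (2 ^ Suc (Suc n)) ^ ?d = 4 ^ ?d * (1/2 :: real) ^ n"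
    proof -
      have "(2 ^ Suc (Suc n) :: real) ^ ?d = (4 * 2 ^ n) ^ ?d" by simp
      also have "\<dots> = 4 ^ ?d * 2 ^ (n * ?d)" by (simp only: power_mult_distrib power_mult)
      finally have "(2 ^ Suc (Suc n) :: real) ^ ?d = 4 ^ ?d * 2 ^ (n * ?d)" .
      moreover have "(1/2 :: real) ^ (n * (?d + 1)) = (1/2) ^ (n * ?d) * (1/2) ^ n"
        by (simp add: power_add)
      moreover have "(1/2 :: real) ^ (n * ?d) * 2 ^ (n * ?d) = 1" by (simp only: power_mult_distrib[symmetric]) simp
      ultimately show ?thesis by simp
    qed
    finally show ?thesis .
  qed
  have cover: "S \<subseteq> big N1 \<union> (\<Union>n. S \<inter> R (n + N1))"
  proof
    fix x assume x: "x \<in> S"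
    show "x \<in> big N1 \<union> (\<Union>n. S \<inter> R (n + N1))"
    proof (cases "x \<in> big N1")
      case False
      obtain M where "\<And>n. n \<ge> M \<Longrightarrow> x \<in> big n" using eventually_big[of x] by (auto simp: eventually_sequentially)
      then have ex: "\<exists>k. x \<in> big (k + N1)" by (meson le_add1)
      define k where "k = (LEAST k. x \<in> big (k + N1))"
      have k: "x \<in> big (k + N1)" unfolding k_def using ex by (rule LeastI_ex)
      have "k \<noteq> 0" by (rule notI) (use k False in simp)
      then obtain j where j: "k = Suc j" using not0_implies_Suc by blast
      have "x \<notin> big (j + N1)" using not_less_Least[of j "\<lambda>k. x \<in> big (k + N1)"] j by (simp add: k_def)
      then have "x \<in> R (j + N1)" using k j by (simp add: R_def)
      then show ?thesis using x by blast
    qed simp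
  qed
  have "emeasure lebesgue S \<le> emeasure lebesgue (big N1 \<union> (\<Union>n. S \<inter> R (n + N1)))"
    using cover by (rule emeasure_mono) (auto intro!: sets.Un big_lebesgue)
  also have "\<dots> \<le> emeasure lebesgue (big N1 :: (real^'n) set) + emeasure lebesgue (\<Union>n. S \<inter> R (n + N1))"
    by (rule emeasure_subadditive) auto
  also have "emeasure lebesgue (\<Union>n. S \<inter> R (n + N1)) \<le> (\<Sum>n. emeasure lebesgue (S \<inter> R (n + N1)))"
    by (rule emeasure_subadditive_countably) auto
  also have "\<dots> \<le> (\<Sum>n. ennreal (4 ^ ?d * (1/2) ^ n))"
  proof (intro suminf_le allI order_trans[OF est] ennreal_leI mult_left_mono)
    show "(1/2 :: real) ^ (n + N1) \<le> (1/2) ^ n" for n by (rule power_decreasing) auto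
  qed auto
  also have "\<dots> = ennreal (\<Sum>n. 4 ^ ?d * (1/2) ^ n)"
    by (rule suminf_ennreal2) (auto intro!: summable_mult summable_geometric)
  finally have "emeasure lebesgue S \<le> emeasure lebesgue (big N1 :: (real^'n) set) + ennreal (\<Sum>n. 4 ^ ?d * (1/2) ^ n)"
    by (simp add: add_left_mono)
  also have "\<dots> < \<infinity>" using emeasure_big_finite[where 'a='n, of N1] by simp
  finally show "emeasure lebesgue {x. \<alpha> < \<bar>g x - c\<bar>} < \<infinity>" by (simp add: S_def)
qed

section \<open>The bound on compactly supported functions\<close>

lemma osc_weak_shift: "osc_weak Q (\<lambda>x. g x - c) = osc_weak Q g"
  unfolding osc_weak_def
proof (rule antisym)
  let ?W = "\<lambda>g c. weak_L1_norm Q (\<lambda>x. g x - c) / emeasure lebesgue Q"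
  show "(INF d. ?W (\<lambda>x. g x - c) d) \<le> (INF d. ?W g d)"
  proof (rule INF_greatest)
    fix d show "(INF d. ?W (\<lambda>x. g x - c) d) \<le> ?W g d"
      by (rule INF_lower2[of "d - c"]) auto
  qed
  show "(INF d. ?W g d) \<le> (INF d. ?W (\<lambda>x. g x - c) d)"
  proof (rule INF_greatest)
    fix d show "(INF d. ?W g d) \<le> ?W (\<lambda>x. g x - c) d"
      by (rule INF_lower2[of "d + c"]) (auto simp: algebra_simps)
  qed
qed

lemma osc_shift:
  assumes g: "g \<in> L0" and Q: "Q \<in> cubes"
  shows "osc Q (\<lambda>x. g x - c) = osc Q g"
proof -
  note m = emeasure_lebesgue_cubes[OF Q]
  have ci: "set_integrable lebesgue Q (\<lambda>x. c)" for c :: real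
    using cubes_lebesgue[OF Q] m by (simp add: set_integrable_def less_top[symmetric])
  have gc: "(\<lambda>x. g x - c) \<in> L0" using g by (simp add: L0_def)
  show ?thesis
  proof (cases "set_integrable lebesgue Q g")
    case True
    have "mean Q (\<lambda>x. g x - c) = mean Q g - c"
      using True ci[of c] m cubes_lebesgue[OF Q] unfolding mean_def
      by (subst set_integral_diff) (auto simp: set_lebesgue_integral_def diff_divide_distrib)
    then show ?thesis by (simp add: osc_def)
  next
    case False
    have "\<not> set_integrable lebesgue Q (\<lambda>x. g x - c)"
    proof
      assume "set_integrable lebesgue Q (\<lambda>x. g x - c)"
      then have "set_integrable lebesgue Q (\<lambda>x. g x - c + c)" using ci[of c] by (rule set_integral_add(1))
      then show False using False by simp
    qed
    then show ?thesis using osc_infinite[OF Q g False] osc_infinite[OF Q gc] by simp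
  qed
qed


text \<open>
  \<open>\<tau> Q g\<close> stands for either kind of oscillation of \<open>g\<close> on \<open>Q\<close>; only the listed properties are used,
  so that both cases are treated at once.
\<close>

locale bmo_operator = bf_norm_max \<rho> for \<rho> :: "('n::finite) efun \<Rightarrow> ennreal" +
  fixes \<tau> :: "(real^'n) set \<Rightarrow> 'n rfun \<Rightarrow> ennreal" and D :: "'n rfun set"
    and T :: "'n rfun \<Rightarrow> 'n rfun" and \<phi> :: "real \<Rightarrow> real"
  assumes osc_weak_le: "\<And>g Q. g \<in> L0 \<Longrightarrow> Q \<in> cubes \<Longrightarrow> osc_weak Q g \<le> \<tau> Q g"
    and outer_cont_tau: "\<And>g. g \<in> L0 \<Longrightarrow> outer_cont (\<lambda>Q. \<tau> Q g)"
    and tau_shift: "\<And>g Q c. g \<in> L0 \<Longrightarrow> Q \<in> cubes \<Longrightarrow> \<tau> Q (\<lambda>x. g x - c) = \<tau> Q g"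
    and T_op: "operator_in_L0 D T"
    and phi_mono: "mono_on {1..} \<phi>"
    and T_bmo: "\<And>w f. weight w \<Longrightarrow> A1_const (\<lambda>x. inverse (w x)) < \<infinity> \<Longrightarrow> f \<in> Linf w \<Longrightarrow> compactly_supported f \<Longrightarrow>
       f \<in> D \<and> (SUP Q\<in>cubes. avg_inf Q w * \<tau> Q (T f)) \<le> ennreal (\<phi> (enn2real (A1_const (\<lambda>x. inverse (w x))))) * Linf_norm w f"
begin

definition sh :: "'n rfun \<Rightarrow> 'n efun" where "sh g = cube_sup (\<lambda>Q. \<tau> Q g)"

abbreviation "\<Phi> \<equiv> ennreal (\<phi> (2 * enn2real MX))"

lemma sh_ge: "g \<in> L0 \<Longrightarrow> sharp_max_weak g x \<le> sh g x"
  unfolding sharp_max_weak_eq sh_def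
  by (rule cube_sup_least) (meson cube_sup_upper osc_weak_le order_trans)

lemma sh_measurable: "g \<in> L0 \<Longrightarrow> sh g \<in> borel_measurable lebesgue"
  unfolding sh_def by (intro cube_sup_measurable outer_cont_tau)

lemma sh_shift: "g \<in> L0 \<Longrightarrow> sh (\<lambda>x. g x - c) = sh g"
  unfolding sh_def cube_sup_def by (auto simp: fun_eq_iff tau_shift intro!: SUP_cong)

lemma T_L0: "f \<in> D \<Longrightarrow> T f \<in> L0"
  using T_op by (simp add: operator_in_L0_def)

lemma T_weighted:
  assumes v: "A1_weight B v" and f: "f \<in> L0" "compactly_supported f" "AE x in lebesgue. \<bar>f x\<bar> \<le> v x"
  shows "f \<in> D" "AE x in lebesgue. sh (T f) x \<le> ennreal (\<phi> (enn2real (A1_const v))) * ennreal (v x)"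
proof -
  show D: "f \<in> D"
    by (rule weighted_hypothesis(1)[OF v f, where \<tau>=\<tau> and T=T and D=D and \<phi>=\<phi>])
      (use T_bmo outer_cont_tau T_L0 in blast)+
  show "AE x in lebesgue. sh (T f) x \<le> ennreal (\<phi> (enn2real (A1_const v))) * ennreal (v x)"
    unfolding sh_def
    by (rule weighted_hypothesis(2)[OF v f, where \<tau>=\<tau> and T=T and D=D and \<phi>=\<phi>])
      (use T_bmo outer_cont_tau T_L0 in blast)+
qed

text \<open>Each constant \<open>\<epsilon> > 0\<close> is an \<open>A\<^sub>1\<close> weight above \<open>|f| = 0\<close>, and \<open>\<epsilon>\<close> may tend to \<open>0\<close>.\<close>

lemma T_zero:
  assumes f: "f \<in> L0" and 0: "AE x in lebesgue. f x = 0"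
  shows "f \<in> D" "AE x in lebesgue. sh (T f) x = 0"
proof -
  have cs: "compactly_supported f"
    unfolding compactly_supported_def using 0 by (intro exI[of _ "{}"]) auto
  have A: "A1_weight 1 (\<lambda>x::real^'n. \<epsilon>)" if "\<epsilon> > 0" for \<epsilon>
    using that by (auto simp: A1_weight_def eavg_const)
  have C: "A1_const (\<lambda>x::real^'n. \<epsilon>) = 1" if "\<epsilon> > 0" for \<epsilon>
    using A1_const_le[OF A[OF that]] A1_const_ge_1[OF A[OF that]] by (intro antisym) auto
  have W: "f \<in> D" "AE x in lebesgue. sh (T f) x \<le> ennreal (\<phi> 1) * ennreal \<epsilon>" if \<epsilon>: "\<epsilon> > 0" for \<epsilon>
  proof -
    from 0 have "AE x in lebesgue. \<bar>f x\<bar> \<le> \<epsilon>" by eventually_elim (use \<epsilon> in simp)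
    note T_weighted[OF A[OF \<epsilon>] f cs this]
    then show "f \<in> D" "AE x in lebesgue. sh (T f) x \<le> ennreal (\<phi> 1) * ennreal \<epsilon>"
      by (simp_all add: C[OF \<epsilon>])
  qed
  show "f \<in> D" by (rule W(1)[of 1]) simp
  have "AE x in lebesgue. \<forall>n::nat. sh (T f) x \<le> ennreal (\<phi> 1) * ennreal ((1/2) ^ n)"
    by (subst AE_all_countable) (auto intro!: W(2))
  then show "AE x in lebesgue. sh (T f) x = 0"
  proof eventually_elim
    case (elim x)
    have "(\<lambda>n. ennreal (max (\<phi> 1) 0 * (1/2) ^ n)) \<longlonglongrightarrow> ennreal (max (\<phi> 1) 0 * 0)"
      by (intro tendsto_ennrealI tendsto_intros LIMSEQ_realpow_zero) auto
    moreover have "ennreal (max (\<phi> 1) 0 * (1/2) ^ n) = ennreal (\<phi> 1) * ennreal ((1/2) ^ n)" for n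
      by (subst ennreal_mult) (auto simp: max_def ennreal_neg)
    ultimately have "sh (T f) x \<le> 0" using elim by (intro LIMSEQ_le_const[where X="\<lambda>n. ennreal (\<phi> 1) * ennreal ((1/2) ^ n)"]) auto
    then show ?case by simp
  qed
qed

text \<open>The Rubio de Francia weight \<open>v\<close> gives the quantitative bound; as \<open>1 \<le> [v] \<le> 2 \<parallel>M\<parallel>\<close>, the value of \<open>\<phi>\<close>
  at its \<open>A\<^sub>1\<close> constant is at most \<open>\<Phi>\<close>.\<close>

lemma sharp_T_bound:
  assumes f: "f \<in> bfs \<rho>" and cs: "compactly_supported f"
  shows "f \<in> D" "\<rho> (sh (T f)) \<le> \<Phi> * (2 * \<rho> (eabs f))"
proof -
  have fL: "f \<in> L0" using f by (simp add: bfs_def)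
  have "f \<in> D \<and> \<rho> (sh (T f)) \<le> \<Phi> * (2 * \<rho> (eabs f))"
  proof (cases "AE x in lebesgue. f x = 0")
    case True
    note Z = T_zero[OF fL True]
    have "\<rho> (sh (T f)) = 0" using sh_measurable[OF T_L0[OF Z(1)]] Z(2) by (simp add: rho_0_iff)
    then show ?thesis using Z(1) by simp
  next
    case False
    obtain v where v: "A1_weight (2 * enn2real MX) v" "AE x in lebesgue. \<bar>f x\<bar> \<le> v x"
      "\<rho> (\<lambda>x. ennreal (v x)) \<le> 2 * \<rho> (eabs f)" by (rule rubio_de_francia[OF f False])
    have [measurable]: "v \<in> borel_measurable lebesgue" using v(1) by (simp add: A1_weight_def)
    note W = T_weighted[OF v(1) fL cs v(2)]
    have A: "1 \<le> A1_const v" "A1_const v \<le> ennreal (2 * enn2real MX)"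
      by (rule A1_const_ge_1[OF v(1)], rule A1_const_le[OF v(1)])
    then have A': "1 \<le> enn2real (A1_const v)" "enn2real (A1_const v) \<le> 2 * enn2real MX"
    proof -
      have "A1_const v < top" using A(2) by (rule le_less_trans) simp
      then obtain r where r: "A1_const v = ennreal r" "r \<ge> 0" by (cases "A1_const v") auto
      show "1 \<le> enn2real (A1_const v)" using A(1) r by (simp add: ennreal_1[symmetric] del: ennreal_1)
      show "enn2real (A1_const v) \<le> 2 * enn2real MX" using A(2) by (intro enn2real_leI) auto
    qed
    then have "\<phi> (enn2real (A1_const v)) \<le> \<phi> (2 * enn2real MX)"
      by (intro mono_onD[OF phi_mono]) auto
    then have le: "ennreal (\<phi> (enn2real (A1_const v))) \<le> \<Phi>" by (rule ennreal_leI)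
    have "\<rho> (sh (T f)) \<le> \<rho> (\<lambda>x. \<Phi> * ennreal (v x))"
    proof (rule rho_mono_AE[OF sh_measurable[OF T_L0[OF W(1)]]])
      show "AE x in lebesgue. sh (T f) x \<le> \<Phi> * ennreal (v x)"
        using W(2) by eventually_elim (meson le mult_right_mono order_trans zero_le)
    qed measurable
    also have "\<dots> = \<Phi> * \<rho> (\<lambda>x. ennreal (v x))"
    proof -
      have P: "\<Phi> = ennreal (max 0 (\<phi> (2 * enn2real MX)))" by (simp add: max_def ennreal_neg)
      show ?thesis unfolding P by (rule rho_scale) auto
    qed
    also have "\<dots> \<le> \<Phi> * (2 * \<rho> (eabs f))" by (intro mult_left_mono v(3)) simp
    finally show ?thesis using W(1) by simp
  qed
  then show "f \<in> D" "\<rho> (sh (T f)) \<le> \<Phi> * (2 * \<rho> (eabs f))" by auto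
qed

lemma sharp_T_finite: "f \<in> bfs \<rho> \<Longrightarrow> compactly_supported f \<Longrightarrow> \<rho> (sh (T f)) < \<infinity>"
  by (rule le_less_trans[OF sharp_T_bound(2)]) (auto simp: bfs_def ennreal_mult_less_top)

lemma sharp_weak_T_finite: "f \<in> bfs \<rho> \<Longrightarrow> compactly_supported f \<Longrightarrow> \<rho> (sharp_max_weak (T f)) < \<infinity>"
  by (rule le_less_trans[OF rho_mono_AE sharp_T_finite])
     (auto intro!: sharp_max_weak_measurable sh_measurable T_L0 sharp_T_bound sh_ge AE_I2)

text \<open>For compactly supported \<open>f\<close> this is the representative of \<open>T f\<close> modulo constants that lies in \<open>X\<close>.\<close>

definition S0 :: "'n rfun \<Rightarrow> 'n rfun" where "S0 f = (\<lambda>x. T f x - lim_med (T f))"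

lemma S0_bfs:
  assumes f: "f \<in> bfs \<rho>" and cs: "compactly_supported f"
  shows "S0 f \<in> bfs \<rho>"
proof -
  have TL: "T f \<in> L0" by (rule T_L0[OF sharp_T_bound(1)[OF f cs]])
  have "\<rho> (eabs (S0 f)) \<le> ennreal (fs_const CARD('n)) * MX' * \<rho> (sharp_max_weak (T f))"
    unfolding S0_def by (rule sharp_inequality[OF TL sharp_weak_T_finite[OF f cs]])
  also have "\<dots> < \<infinity>" using sharp_weak_T_finite[OF f cs] M_X' by (simp add: ennreal_mult_less_top)
  finally show ?thesis using TL by (simp add: bfs_def L0_def S0_def)
qed

text \<open>Here the decaying weight is needed, since a function in \<open>X\<close> may have level sets of infinite
  measure, while \<open>C\<^sub>X\<close> refers to functions without such level sets.\<close>

lemma S0_finite_level: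
  assumes f: "f \<in> bfs \<rho>" and cs: "compactly_supported f"
  shows "finite_level_sets (S0 f)"
proof -
  have fL: "f \<in> L0" using f by (simp add: bfs_def)
  have TL: "T f \<in> L0" by (rule T_L0[OF sharp_T_bound(1)[OF f cs]])
  note lim = med_convergent[OF TL sharp_weak_T_finite[OF f cs]]
  show ?thesis
  proof (cases "AE x in lebesgue. f x = 0")
    case True
    from T_zero(2)[OF fL True] have "AE x in lebesgue. sharp_max_weak (T f) x \<le> ennreal 0 * ennreal 0"
      by eventually_elim (use sh_ge[OF TL] in \<open>metis mult_zero_left ennreal_0\<close>)
    then show ?thesis unfolding S0_def
      by (rule finite_level_of_decay[OF TL _ _ lim, where u="\<lambda>_. 0" and C=0]) simp
  next
    case False
    obtain v where v: "A1_weight (2 * enn2real MX) v" "AE x in lebesgue. \<bar>f x\<bar> \<le> v x"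
      by (rule rubio_de_francia[OF f False])
    obtain K where K: "compact K" "AE x in lebesgue. x \<notin> K \<longrightarrow> f x = 0" using cs by (auto simp: compactly_supported_def)
    obtain b where b: "\<And>x. x \<in> K \<Longrightarrow> norm x \<le> b" using compact_imp_bounded[OF K(1)] by (auto simp: bounded_iff)
    define R where "R = max 1 b"
    obtain u B' C N where u: "A1_weight B' u" "\<And>x. infnorm x \<le> R \<Longrightarrow> u x = v x"
      "\<And>n x. n \<ge> N \<Longrightarrow> x \<notin> big n \<Longrightarrow> u x \<le> C / sqrt (2 ^ n)"
      by (rule decaying_weight[OF v(1), of R]) (auto simp: R_def)
    have "AE x in lebesgue. \<bar>f x\<bar> \<le> u x"
      using v(2) K(2)
    proof eventually_elim
      case (elim x)
      show ?case
      proof (cases "x \<in> K")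
        case True
        then have "infnorm x \<le> R" using b[of x] infnorm_le_norm[of x] by (simp add: R_def)
        then show ?thesis using elim u(2) by simp
      next
        case False
        then show ?thesis using elim u(1) by (simp add: A1_weight_def)
      qed
    qed
    from T_weighted(2)[OF u(1) fL cs this]
    have "AE x in lebesgue. sharp_max_weak (T f) x \<le> ennreal (\<phi> (enn2real (A1_const u))) * ennreal (u x)"
      by eventually_elim (use sh_ge[OF TL] in \<open>meson order_trans\<close>)
    then show ?thesis unfolding S0_def by (rule finite_level_of_decay[OF TL _ u(3) lim])
  qed
qed

definition Kc :: ennreal where "Kc = 2 * sharp_const sh \<rho> * \<Phi>"

lemma Kc_finite: "Kc < \<infinity>"
  using sharp_const_finite[of sh] sh_ge sh_measurable by (simp add: Kc_def ennreal_mult_less_top)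

lemma S0_bound:
  assumes f: "f \<in> bfs \<rho>" and cs: "compactly_supported f"
  shows "\<rho> (eabs (S0 f)) \<le> Kc * \<rho> (eabs f)"
proof -
  have TL: "T f \<in> L0" by (rule T_L0[OF sharp_T_bound(1)[OF f cs]])
  have eq: "sh (S0 f) = sh (T f)" unfolding S0_def by (rule sh_shift[OF TL])
  have "\<rho> (eabs (S0 f)) \<le> sharp_const sh \<rho> * \<rho> (sh (S0 f))"
    using sharp_const_finite[of sh] sh_ge sh_measurable sharp_T_finite[OF f cs]
    by (intro sharp_const_attained S0_bfs[OF f cs] S0_finite_level[OF f cs]) (auto simp: eq)
  also have "\<dots> \<le> sharp_const sh \<rho> * (\<Phi> * (2 * \<rho> (eabs f)))"
    unfolding eq by (intro mult_left_mono sharp_T_bound f cs) simp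
  finally show ?thesis by (simp add: Kc_def mult_ac)
qed

text \<open>The only constant in \<open>X\<close> is \<open>0\<close>, so at most one representative modulo constants lies in \<open>X\<close>.\<close>

lemma bfs_constant_unique:
  assumes "(\<lambda>x. g x - c) \<in> bfs \<rho>" "(\<lambda>x. g x - c') \<in> bfs \<rho>"
  shows "c = c'"
proof -
  have "(\<lambda>x. (g x - c') - (g x - c)) \<in> bfs \<rho>" by (rule bfs_diff[OF assms(2,1)])
  then have "(\<lambda>x. c - c') \<in> bfs \<rho>" by simp
  then show ?thesis using const_in_bfs by fastforce
qed

lemma S0_lim_med_zero:
  assumes f: "f \<in> bfs \<rho>" and cs: "compactly_supported f" and g: "T f \<in> bfs \<rho> \<or> finite_level_sets (T f)"
  shows "lim_med (T f) = 0"
  using g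
proof
  assume "T f \<in> bfs \<rho>"
  then show ?thesis using bfs_constant_unique[of "T f" "lim_med (T f)" 0] S0_bfs[OF f cs] by (simp add: S0_def)
next
  assume "finite_level_sets (T f)"
  then show ?thesis by (rule lim_med_finite_level[OF T_L0[OF sharp_T_bound(1)[OF f cs]]])
qed

lemma S0_representative:
  assumes f: "f \<in> bfs \<rho>" and cs: "compactly_supported f" and h: "ae_eq h (S0 f)"
  shows "representative \<rho> (T f) h"
  unfolding representative_def
proof (intro exI conjI impI)
  show "ae_eq h (\<lambda>x. T f x - lim_med (T f))" using h by (simp add: S0_def)
  show "lim_med (T f) = 0" if "T f \<in> bfs \<rho> \<or> finite_level_sets (T f)"
    by (rule S0_lim_med_zero[OF f cs that])
qed

lemma S0_cong: 
  assumes fg: "ae_eq f g" and f: "f \<in> D" and g: "g \<in> L0"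
  shows "g \<in> D" "ae_eq (S0 f) (S0 g)"
proof -
  have T: "g \<in> D" "ae_eq (T f) (T g)" using T_op f g fg by (auto simp: operator_in_L0_def)
  show "g \<in> D" by (rule T(1))
  have "lim_med (T f) = lim_med (T g)" by (rule lim_med_cong_AE[OF T(2) T_L0[OF f] T_L0[OF T(1)]])
  then show "ae_eq (S0 f) (S0 g)" using T(2) by (simp add: S0_def ae_eq_def)
qed

end


section \<open>Extension to the whole space\<close>

definition cut :: "nat \<Rightarrow> ('n::finite) rfun \<Rightarrow> 'n rfun" where
  "cut n f = (\<lambda>x. f x * indicator (big n) x)"

lemma cut_measurable [measurable]: "f \<in> borel_measurable lebesgue \<Longrightarrow> cut n f \<in> borel_measurable lebesgue"
  unfolding cut_def by (intro borel_measurable_times borel_measurable_indicator big_lebesgue)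

lemma cut_abs_le: "\<bar>cut n f x\<bar> \<le> \<bar>f x\<bar>"
  by (simp add: cut_def split: split_indicator)

lemma bounded_big: "bounded (big n :: (real^'n::finite) set)"
proof (rule bounded_subset[OF bounded_cbox])
  show "big n \<subseteq> cbox (\<chi> i. - (2 ^ n)) (\<chi> i. 2 ^ n)"
    by (auto simp: mem_big mem_box_cart less_imp_le)
qed

lemma cut_compactly_supported: "compactly_supported (cut n f)"
  unfolding compactly_supported_def
proof (intro exI conjI AE_I2 impI)
  show "compact (closure (big n :: (real^'a) set))" using bounded_big by (simp add: compact_closure)
  fix x :: "real^'a" assume "x \<notin> closure (big n)"
  then have "x \<notin> big n" using closure_subset by blast
  then show "cut n f x = 0" by (simp add: cut_def)
qed

lemma compactly_supported_big:
  assumes "compactly_supported f"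
  obtains N where "\<And>n. n \<ge> N \<Longrightarrow> ae_eq (cut n f) f"
proof -
  obtain K where K: "compact K" "AE x in lebesgue. x \<notin> K \<longrightarrow> f x = 0" using assms by (auto simp: compactly_supported_def)
  obtain b where b: "\<And>x. x \<in> K \<Longrightarrow> norm x \<le> b" using compact_imp_bounded[OF K(1)] by (auto simp: bounded_iff)
  obtain N where N: "b < 2 ^ N" using real_arch_pow[of 2 b] by auto
  have "ae_eq (cut n f) f" if n: "n \<ge> N" for n
    unfolding ae_eq_def using K(2)
  proof eventually_elim
    case (elim x)
    have "x \<in> big n" if "x \<in> K"
      using norm_le_big[of x N] b[OF that] N big_mono[OF n] by auto
    then show ?case using elim by (auto simp: cut_def split: split_indicator)
  qed
  then show ?thesis using that by blast
qed

lemma compactly_supported_cong: "ae_eq f g \<Longrightarrow> compactly_supported f \<Longrightarrow> compactly_supported g"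
  unfolding compactly_supported_def ae_eq_def
proof (elim exE conjE)
  fix K assume "AE x in lebesgue. f x = g x" and K: "compact K" "AE x in lebesgue. x \<notin> K \<longrightarrow> f x = 0"
  then have "AE x in lebesgue. x \<notin> K \<longrightarrow> g x = 0" by eventually_elim simp
  then show "\<exists>K. compact K \<and> (AE x in lebesgue. x \<notin> K \<longrightarrow> g x = 0)" using K(1) by blast
qed

lemma compactly_supported_add:
  assumes "compactly_supported f" "compactly_supported g"
  shows "compactly_supported (\<lambda>x. f x + g x)"
proof -
  obtain K L where K: "compact K" "AE x in lebesgue. x \<notin> K \<longrightarrow> f x = 0"
    and L: "compact L" "AE x in lebesgue. x \<notin> L \<longrightarrow> g x = 0"
    using assms by (auto simp: compactly_supported_def)
  have "AE x in lebesgue. x \<notin> K \<union> L \<longrightarrow> f x + g x = 0" using K(2) L(2) by eventually_elim simp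
  then show ?thesis unfolding compactly_supported_def using compact_Un[OF K(1) L(1)] by blast
qed

lemma compactly_supported_scale: "compactly_supported f \<Longrightarrow> compactly_supported (\<lambda>x. a * f x)"
  unfolding compactly_supported_def by (auto elim!: eventually_mono)

lemma ae_eq_refl [simp]: "ae_eq f f" by (simp add: ae_eq_def)

lemma ae_eq_sym: "ae_eq f g \<Longrightarrow> ae_eq g f" by (auto simp: ae_eq_def elim: eventually_mono)

lemma linear_op_sublinear: "linear_op D T \<Longrightarrow> sublinear_op D T"
  unfolding linear_op_def sublinear_op_def ae_eq_def
proof (elim conjE, intro conjI ballI allI)
  assume a: "\<forall>f\<in>D. \<forall>g\<in>D. AE x in lebesgue. T (\<lambda>x. f x + g x) x = T f x + T g x"
    and s: "\<forall>f\<in>D. \<forall>a. AE x in lebesgue. T (\<lambda>x. a * f x) x = a * T f x"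
  fix f assume f: "f \<in> D"
  show "AE x in lebesgue. \<bar>T (\<lambda>y. f y + g y) x\<bar> \<le> \<bar>T f x\<bar> + \<bar>T g x\<bar>" if g: "g \<in> D" for g
    using a[rule_format, OF f g] by eventually_elim simp
  show "AE x in lebesgue. \<bar>T (\<lambda>y. a * f y) x\<bar> = \<bar>a\<bar> * \<bar>T f x\<bar>" for a
    using s[rule_format, OF f, of a] by eventually_elim (simp add: abs_mult)
qed

lemma ennreal_tendsto_0_mono:
  fixes a b :: "nat \<Rightarrow> ennreal"
  assumes "\<And>n. a n \<le> b n" "b \<longlonglongrightarrow> 0" shows "a \<longlonglongrightarrow> 0"
proof (rule tendsto_sandwich[OF _ _ tendsto_const assms(2)])
  show "\<forall>\<^sub>F n in sequentially. 0 \<le> a n" by simp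
  show "\<forall>\<^sub>F n in sequentially. a n \<le> b n" using assms(1) by simp
qed

context bf_norm
begin

definition Xlim :: "(nat \<Rightarrow> 'n rfun) \<Rightarrow> 'n rfun \<Rightarrow> bool" where
  "Xlim F G \<longleftrightarrow> (\<forall>n. F n \<in> bfs \<rho>) \<and> G \<in> bfs \<rho> \<and> (\<lambda>n. \<rho> (eabs (\<lambda>x. F n x - G x))) \<longlonglongrightarrow> 0"

lemma rho_eabs_cong: "ae_eq f g \<Longrightarrow> f \<in> borel_measurable lebesgue \<Longrightarrow> g \<in> borel_measurable lebesgue \<Longrightarrow> \<rho> (eabs f) = \<rho> (eabs g)"
  by (rule rho_cong_AE) (auto simp: ae_eq_def eabs_def elim: eventually_mono)

lemma bfs_cong: "ae_eq f g \<Longrightarrow> f \<in> bfs \<rho> \<Longrightarrow> g \<in> L0 \<Longrightarrow> g \<in> bfs \<rho>"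
  using rho_eabs_cong[of f g] by (auto simp: bfs_def L0_def)

lemma ae_eq_zero_norm:
  assumes [measurable]: "f \<in> borel_measurable lebesgue" and "\<rho> (eabs f) = 0"
  shows "AE x in lebesgue. f x = 0"
  using assms(2) by (subst (asm) rho_0_iff) (auto simp: eabs_def elim: eventually_mono)

lemma Xlim_dominated:
  assumes F: "Xlim F G" and H: "\<And>n. H n \<in> bfs \<rho>" "K \<in> bfs \<rho>"
    and le: "\<And>n. AE x in lebesgue. \<bar>H n x - K x\<bar> \<le> \<bar>F n x - G x\<bar>"
  shows "Xlim H K"
  unfolding Xlim_def
proof (intro conjI allI H)
  have "F n \<in> bfs \<rho>" "G \<in> bfs \<rho>" for n using F by (auto simp: Xlim_def)
  then have "\<rho> (eabs (\<lambda>x. H n x - K x)) \<le> \<rho> (eabs (\<lambda>x. F n x - G x))" for n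
    by (rule bfs_dominated(2)[OF bfs_diff bfs_measurable[OF bfs_diff[OF H]] le])
  then show "(\<lambda>n. \<rho> (eabs (\<lambda>x. H n x - K x))) \<longlonglongrightarrow> 0"
    by (rule ennreal_tendsto_0_mono) (use F in \<open>simp add: Xlim_def\<close>)
qed

lemma Xlim_add:
  assumes F: "Xlim F G" and F': "Xlim F' G'"
  shows "Xlim (\<lambda>n x. F n x + F' n x) (\<lambda>x. G x + G' x)"
  unfolding Xlim_def
proof (intro conjI allI)
  have b: "F n \<in> bfs \<rho>" "F' n \<in> bfs \<rho>" "G \<in> bfs \<rho>" "G' \<in> bfs \<rho>" for n using F F' by (auto simp: Xlim_def)
  then have [measurable]: "F n \<in> borel_measurable lebesgue" "F' n \<in> borel_measurable lebesgue"
    "G \<in> borel_measurable lebesgue" "G' \<in> borel_measurable lebesgue" for n by (auto intro: bfs_measurable)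
  show "(\<lambda>x. F n x + F' n x) \<in> bfs \<rho>" "(\<lambda>x. G x + G' x) \<in> bfs \<rho>" for n using b by (auto intro: bfs_add)
  have A: "\<rho> (eabs (\<lambda>x. F n x + F' n x - (G x + G' x))) \<le> \<rho> (eabs (\<lambda>x. F n x - G x)) + \<rho> (eabs (\<lambda>x. F' n x - G' x))" for n
    using rho_eabs_add[of "\<lambda>x. F n x - G x" "\<lambda>x. F' n x - G' x"] by (simp add: algebra_simps)
  have "(\<lambda>n. \<rho> (eabs (\<lambda>x. F n x - G x)) + \<rho> (eabs (\<lambda>x. F' n x - G' x))) \<longlonglongrightarrow> 0 + 0"
    using F F' by (intro tendsto_add) (auto simp: Xlim_def)
  then show "(\<lambda>n. \<rho> (eabs (\<lambda>x. F n x + F' n x - (G x + G' x)))) \<longlonglongrightarrow> 0"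
    by (intro ennreal_tendsto_0_mono[OF A]) simp
qed

lemma Xlim_scale:
  assumes F: "Xlim F G"
  shows "Xlim (\<lambda>n x. a * F n x) (\<lambda>x. a * G x)"
  unfolding Xlim_def
proof (intro conjI allI)
  have b: "F n \<in> bfs \<rho>" "G \<in> bfs \<rho>" for n using F by (auto simp: Xlim_def)
  then have [measurable]: "F n \<in> borel_measurable lebesgue" "G \<in> borel_measurable lebesgue" for n
    by (auto intro: bfs_measurable)
  show "(\<lambda>x. a * F n x) \<in> bfs \<rho>" "(\<lambda>x. a * G x) \<in> bfs \<rho>" for n using b by (auto intro: bfs_scale)
  have "\<rho> (eabs (\<lambda>x. a * F n x - a * G x)) = ennreal \<bar>a\<bar> * \<rho> (eabs (\<lambda>x. F n x - G x))" for n
    using rho_eabs_scale[of "\<lambda>x. F n x - G x" a] by (simp add: algebra_simps)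
  moreover have "(\<lambda>n. ennreal \<bar>a\<bar> * \<rho> (eabs (\<lambda>x. F n x - G x))) \<longlonglongrightarrow> ennreal \<bar>a\<bar> * 0"
    using F by (intro tendsto_mult_ennreal tendsto_const) (auto simp: Xlim_def)
  ultimately show "(\<lambda>n. \<rho> (eabs (\<lambda>x. a * F n x - a * G x))) \<longlonglongrightarrow> 0" by simp
qed

lemma Xlim_abs:
  assumes "Xlim F G" shows "Xlim (\<lambda>n x. \<bar>F n x\<bar>) (\<lambda>x. \<bar>G x\<bar>)"
proof (rule Xlim_dominated[OF assms])
  have "(\<lambda>x. \<bar>h x\<bar>) \<in> bfs \<rho>" if "h \<in> bfs \<rho>" for h
  proof (rule bfs_dominated(1)[OF that])
    show "(\<lambda>x. \<bar>h x\<bar>) \<in> borel_measurable lebesgue" using bfs_measurable[OF that] by measurable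
  qed simp
  then show "(\<lambda>x. \<bar>F n x\<bar>) \<in> bfs \<rho>" "(\<lambda>x. \<bar>G x\<bar>) \<in> bfs \<rho>" for n using assms by (auto simp: Xlim_def)
qed auto

lemma Xlim_cong:
  assumes F: "Xlim F G" and FH: "\<And>n. ae_eq (F n) (H n)" and H: "\<And>n. H n \<in> bfs \<rho>"
  shows "Xlim H G"
proof (rule Xlim_dominated[OF F H])
  show "G \<in> bfs \<rho>" using F by (simp add: Xlim_def)
  show "AE x in lebesgue. \<bar>H n x - G x\<bar> \<le> \<bar>F n x - G x\<bar>" for n
    using FH[of n] unfolding ae_eq_def by eventually_elim simp
qed

text \<open>The positive part of \<open>G - G'\<close> is dominated by \<open>|F n - G| + |F' n - G'|\<close>.\<close>

lemma Xlim_mono: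
  assumes F: "Xlim F G" and F': "Xlim F' G'" and le: "\<And>n. AE x in lebesgue. F n x \<le> F' n x"
  shows "AE x in lebesgue. G x \<le> G' x"
proof -
  have b: "F n \<in> bfs \<rho>" "F' n \<in> bfs \<rho>" "G \<in> bfs \<rho>" "G' \<in> bfs \<rho>" for n using F F' by (auto simp: Xlim_def)
  then have [measurable]: "F n \<in> borel_measurable lebesgue" "F' n \<in> borel_measurable lebesgue"
    "G \<in> borel_measurable lebesgue" "G' \<in> borel_measurable lebesgue" for n by (auto intro: bfs_measurable)
  let ?p = "\<lambda>x. max 0 (G x - G' x)"
  have "\<rho> (eabs ?p) \<le> \<rho> (eabs (\<lambda>x. F n x - G x)) + \<rho> (eabs (\<lambda>x. F' n x - G' x))" for n
  proof -
    have "\<rho> (eabs ?p) \<le> \<rho> (\<lambda>x. eabs (\<lambda>x. F n x - G x) x + eabs (\<lambda>x. F' n x - G' x) x)"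
    proof (rule rho_mono_AE)
      show "AE x in lebesgue. eabs ?p x \<le> eabs (\<lambda>x. F n x - G x) x + eabs (\<lambda>x. F' n x - G' x) x"
        using le[of n]
      proof eventually_elim
        case (elim x)
        have "ennreal \<bar>?p x\<bar> \<le> ennreal (\<bar>F n x - G x\<bar> + \<bar>F' n x - G' x\<bar>)"
          using elim by (intro ennreal_leI) linarith
        then show ?case by (simp add: eabs_def)
      qed
    qed measurable
    also have "\<dots> \<le> \<rho> (eabs (\<lambda>x. F n x - G x)) + \<rho> (eabs (\<lambda>x. F' n x - G' x))" by (rule rho_triangle) measurable
    finally show ?thesis .
  qed
  moreover have "(\<lambda>n. \<rho> (eabs (\<lambda>x. F n x - G x)) + \<rho> (eabs (\<lambda>x. F' n x - G' x))) \<longlonglongrightarrow> 0 + 0"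
    using F F' by (intro tendsto_add) (auto simp: Xlim_def)
  ultimately have "\<rho> (eabs ?p) \<le> 0 + 0" by (intro LIMSEQ_le_const) auto
  then have "AE x in lebesgue. ?p x = 0" by (intro ae_eq_zero_norm) auto
  then show ?thesis by eventually_elim (simp add: max_def split: if_splits)
qed

lemma Xlim_unique: "Xlim F G \<Longrightarrow> Xlim F G' \<Longrightarrow> ae_eq G G'"
  using Xlim_mono[of F G F G'] Xlim_mono[of F G' F G] unfolding ae_eq_def
  by (auto elim: eventually_elim2)

lemma Xlim_eventually:
  assumes F: "\<And>n. F n \<in> bfs \<rho>" and G: "G \<in> bfs \<rho>" and ev: "\<And>n. n \<ge> N \<Longrightarrow> ae_eq (F n) G"
  shows "Xlim F G"
  unfolding Xlim_def
proof (intro conjI allI F G)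
  have "\<rho> (eabs (\<lambda>x. F n x - G x)) = 0" if "n \<ge> N" for n
    using ev[OF that] F[of n] G bfs_measurable
    by (subst rho_0_iff) (auto simp: ae_eq_def eabs_def elim: eventually_mono)
  then show "(\<lambda>n. \<rho> (eabs (\<lambda>x. F n x - G x))) \<longlonglongrightarrow> 0"
    by (intro tendsto_eventually) (auto simp: eventually_sequentially)
qed

lemma Xlim_norm:
  assumes F: "Xlim F G" and le: "\<And>n. \<rho> (eabs (F n)) \<le> c"
  shows "\<rho> (eabs G) \<le> c"
proof -
  have b: "F n \<in> bfs \<rho>" "G \<in> bfs \<rho>" for n using F by (auto simp: Xlim_def)
  then have [measurable]: "F n \<in> borel_measurable lebesgue" "G \<in> borel_measurable lebesgue" for n
    by (auto intro: bfs_measurable)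
  have "\<rho> (eabs G) \<le> c + \<rho> (eabs (\<lambda>x. F n x - G x))" for n
  proof -
    have "\<rho> (eabs G) \<le> \<rho> (eabs (F n)) + \<rho> (eabs (\<lambda>x. F n x - G x))"
      using rho_eabs_diff[of "F n" "\<lambda>x. F n x - G x"] by simp
    also have "\<dots> \<le> c + \<rho> (eabs (\<lambda>x. F n x - G x))" by (intro add_right_mono le)
    finally show ?thesis .
  qed
  moreover have "(\<lambda>n. c + \<rho> (eabs (\<lambda>x. F n x - G x))) \<longlonglongrightarrow> c + 0"
    using F by (intro tendsto_add tendsto_const) (auto simp: Xlim_def)
  ultimately have "\<rho> (eabs G) \<le> c + 0" by (intro LIMSEQ_le_const) auto
  then show ?thesis by simp
qed

lemma cut_bfs: "f \<in> bfs \<rho> \<Longrightarrow> cut n f \<in> bfs \<rho>" "f \<in> bfs \<rho> \<Longrightarrow> \<rho> (eabs (cut n f)) \<le> \<rho> (eabs f)"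
  using bfs_dominated[of f "cut n f"] bfs_measurable[of f] cut_abs_le[of n f] by auto

lemma Xlim_cut:
  assumes oc: "order_continuous \<rho>" and f: "f \<in> bfs \<rho>"
  shows "Xlim (\<lambda>n. cut n f) f"
  unfolding Xlim_def
proof (intro conjI allI cut_bfs f)
  have [measurable]: "f \<in> borel_measurable lebesgue" using f by (rule bfs_measurable)
  define F where "F n x = \<bar>cut n f x - f x\<bar>" for n x
  have "F n \<in> bfs \<rho>" for n
  proof (rule bfs_dominated(1)[OF f])
    show "F n \<in> borel_measurable lebesgue" unfolding F_def by measurable
    show "AE x in lebesgue. \<bar>F n x\<bar> \<le> \<bar>f x\<bar>" by (auto simp: F_def cut_def split: split_indicator)
  qed
  moreover have "AE x in lebesgue. decseq (\<lambda>n. F n x) \<and> (\<lambda>n. F n x) \<longlonglongrightarrow> 0"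
  proof (intro AE_I2 conjI)
    fix x
    show "decseq (\<lambda>n. F n x)"
      using big_mono by (auto simp: decseq_def F_def cut_def split: split_indicator)
    have "\<forall>\<^sub>F n in sequentially. F n x = 0"
      using eventually_big[of x] by eventually_elim (simp add: F_def cut_def)
    then show "(\<lambda>n. F n x) \<longlonglongrightarrow> 0" by (rule tendsto_eventually)
  qed
  ultimately have "(\<lambda>n. \<rho> (eabs (F n))) \<longlonglongrightarrow> 0" using oc by (simp add: order_continuous_def)
  then show "(\<lambda>n. \<rho> (eabs (\<lambda>x. cut n f x - f x))) \<longlonglongrightarrow> 0" by (simp add: F_def[abs_def] eabs_def)
qed

text \<open>A sequence controlled by the truncations \<open>cut n f\<close> converges in \<open>X\<close>.\<close>

lemma Xlim_controlled:
  assumes oc: "order_continuous \<rho>" and f: "f \<in> bfs \<rho>" and F: "\<And>n. F n \<in> bfs \<rho>" and c: "c < \<infinity>"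
    and le: "\<And>m n. \<rho> (eabs (\<lambda>x. F m x - F n x)) \<le> c * \<rho> (eabs (\<lambda>x. cut m f x - cut n f x))"
  shows "\<exists>G. Xlim F G"
proof -
  have [measurable]: "f \<in> borel_measurable lebesgue" using f by (rule bfs_measurable)
  let ?r = "\<lambda>n. \<rho> (eabs (\<lambda>x. cut n f x - f x))"
  have le': "\<rho> (eabs (\<lambda>x. F m x - F n x)) \<le> c * (?r m + ?r n)" for m n
  proof -
    have "\<rho> (eabs (\<lambda>x. cut m f x - cut n f x)) \<le> ?r m + ?r n"
      using rho_eabs_diff[of "\<lambda>x. cut m f x - f x" "\<lambda>x. cut n f x - f x"] by simp
    then show ?thesis by (intro order_trans[OF le] mult_left_mono) auto
  qed
  have lim: "(\<lambda>n. c * ?r n) \<longlonglongrightarrow> c * 0"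
    using Xlim_cut[OF oc f] c by (intro tendsto_mult_ennreal tendsto_const) (auto simp: Xlim_def)
  have "\<exists>G\<in>bfs \<rho>. (\<lambda>n. \<rho> (eabs (\<lambda>x. F n x - G x))) \<longlonglongrightarrow> 0"
  proof (rule bfs_complete[OF F])
    fix e :: real assume e: "e > 0"
    have "\<forall>\<^sub>F n in sequentially. c * ?r n < ennreal (e / 2)"
      using lim e by (intro order_tendstoD(2)) auto
    then obtain N where N: "\<And>n. n \<ge> N \<Longrightarrow> c * ?r n < ennreal (e / 2)" by (auto simp: eventually_sequentially)
    have "\<rho> (eabs (\<lambda>x. F m x - F n x)) \<le> ennreal e" if "m \<ge> N" "n \<ge> N" for m n
    proof -
      have "\<rho> (eabs (\<lambda>x. F m x - F n x)) \<le> c * ?r m + c * ?r n" using le'[of m n] by (simp add: distrib_left)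
      also have "\<dots> \<le> ennreal (e / 2) + ennreal (e / 2)"
        using N[OF that(1)] N[OF that(2)] by (intro add_mono less_imp_le) auto
      also have "\<dots> = ennreal e" using e by (subst ennreal_plus[symmetric]) auto
      finally show ?thesis .
    qed
    then show "\<exists>N. \<forall>m\<ge>N. \<forall>n\<ge>N. \<rho> (eabs (\<lambda>x. F m x - F n x)) \<le> ennreal e" by blast
  qed
  then show ?thesis using F by (auto simp: Xlim_def)
qed

end

context bmo_operator
begin

text \<open>Both sides represent the same function modulo constants and lie in \<open>X\<close>.\<close>

lemma S0_linear:
  assumes lin: "linear_op D T"
  shows "f \<in> bfs \<rho> \<Longrightarrow> g \<in> bfs \<rho> \<Longrightarrow> compactly_supported f \<Longrightarrow> compactly_supported g \<Longrightarrow>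
      ae_eq (S0 (\<lambda>x. f x + g x)) (\<lambda>x. S0 f x + S0 g x)"
    and "f \<in> bfs \<rho> \<Longrightarrow> compactly_supported f \<Longrightarrow> ae_eq (S0 (\<lambda>x. a * f x)) (\<lambda>x. a * S0 f x)"
proof -
  assume f: "f \<in> bfs \<rho>" and cs: "compactly_supported f"
  have fD: "f \<in> D" by (rule sharp_T_bound(1)[OF f cs])
  show "ae_eq (S0 (\<lambda>x. a * f x)) (\<lambda>x. a * S0 f x)"
  proof -
    let ?h = "\<lambda>x. a * f x"
    have h: "?h \<in> bfs \<rho>" "compactly_supported ?h" by (rule bfs_scale[OF f], rule compactly_supported_scale[OF cs])
    have T: "ae_eq (T ?h) (\<lambda>x. a * T f x)" using lin fD by (simp add: linear_op_def)
    have "(\<lambda>x. a * T f x - a * lim_med (T f)) \<in> bfs \<rho>"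
      using bfs_scale[OF S0_bfs[OF f cs], of a] by (simp add: S0_def algebra_simps)
    moreover have "(\<lambda>x. a * T f x - lim_med (T ?h)) \<in> bfs \<rho>"
      by (rule bfs_cong[OF _ S0_bfs[OF h]])
        (use T T_L0[OF fD] in \<open>auto simp: ae_eq_def S0_def L0_def elim: eventually_mono\<close>)
    ultimately have "a * lim_med (T f) = lim_med (T ?h)" by (rule bfs_constant_unique)
    then show ?thesis using T by (auto simp: ae_eq_def S0_def algebra_simps elim: eventually_mono)
  qed
  assume g: "g \<in> bfs \<rho>" and cs': "compactly_supported g"
  have gD: "g \<in> D" by (rule sharp_T_bound(1)[OF g cs'])
  show "ae_eq (S0 (\<lambda>x. f x + g x)) (\<lambda>x. S0 f x + S0 g x)"
  proof -
    let ?h = "\<lambda>x. f x + g x"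
    have h: "?h \<in> bfs \<rho>" "compactly_supported ?h" by (rule bfs_add[OF f g], rule compactly_supported_add[OF cs cs'])
    have T: "ae_eq (T ?h) (\<lambda>x. T f x + T g x)" using lin fD gD by (simp add: linear_op_def)
    have "(\<lambda>x. T f x + T g x - (lim_med (T f) + lim_med (T g))) \<in> bfs \<rho>"
      using bfs_add[OF S0_bfs[OF f cs] S0_bfs[OF g cs']] by (simp add: S0_def algebra_simps)
    moreover have "(\<lambda>x. T f x + T g x - lim_med (T ?h)) \<in> bfs \<rho>"
      by (rule bfs_cong[OF _ S0_bfs[OF h]])
        (use T T_L0[OF fD] T_L0[OF gD] in \<open>auto simp: ae_eq_def S0_def L0_def elim: eventually_mono\<close>)
    ultimately have "lim_med (T f) + lim_med (T g) = lim_med (T ?h)" by (rule bfs_constant_unique)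
    then show ?thesis using T by (auto simp: ae_eq_def S0_def algebra_simps elim: eventually_mono)
  qed
qed

lemma cut_D: "f \<in> bfs \<rho> \<Longrightarrow> cut n f \<in> D"
  by (intro sharp_T_bound(1) cut_bfs cut_compactly_supported)

lemma S0_cut_bfs: "f \<in> bfs \<rho> \<Longrightarrow> S0 (cut n f) \<in> bfs \<rho>"
  by (intro S0_bfs cut_bfs cut_compactly_supported)

lemma S0_cut_bound: "f \<in> bfs \<rho> \<Longrightarrow> \<rho> (eabs (S0 (cut n f))) \<le> Kc * \<rho> (eabs f)"
  by (intro order_trans[OF S0_bound] mult_left_mono cut_bfs cut_compactly_supported) auto

lemma S0_cut_cong:
  assumes fg: "ae_eq f g" and f: "f \<in> bfs \<rho>" and g: "g \<in> L0"
  shows "ae_eq (S0 (cut n f)) (S0 (cut n g))"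
proof (rule S0_cong(2)[OF _ cut_D[OF f]])
  show "ae_eq (cut n f) (cut n g)" using fg by (auto simp: ae_eq_def cut_def elim: eventually_mono)
  show "cut n g \<in> L0" using g by (simp add: L0_def)
qed

lemma cut_diff_bfs:
  assumes "f \<in> bfs \<rho>"
  shows "(\<lambda>x. cut m f x - cut n f x) \<in> bfs \<rho>" "compactly_supported (\<lambda>x. cut m f x - cut n f x)"
  using bfs_diff[OF cut_bfs(1)[OF assms] cut_bfs(1)[OF assms]]
    compactly_supported_add[OF cut_compactly_supported compactly_supported_scale[OF cut_compactly_supported, of "-1"], of m f n f]
  by simp_all

definition bounded_extension :: "('n rfun \<Rightarrow> 'n rfun) \<Rightarrow> bool" where
  "bounded_extension S \<longleftrightarrow> operator_in_L0 (bfs \<rho>) S \<and> (\<forall>f\<in>bfs \<rho>. S f \<in> bfs \<rho> \<and> \<rho> (eabs (S f)) \<le> Kc * \<rho> (eabs f)) \<and>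
    (\<forall>f\<in>bfs \<rho>. compactly_supported f \<longrightarrow> representative \<rho> (T f) (S f))"

text \<open>For linear \<open>T\<close> the chosen representatives depend linearly on \<open>f\<close>, so their limit along the
  truncations of \<open>f\<close> does too.\<close>

lemma linear_extension:
  assumes oc: "order_continuous \<rho>" and lin: "linear_op D T"
  shows "\<exists>S. bounded_extension S \<and> linear_op (bfs \<rho>) S"
proof -
  define F where "F f n = S0 (cut n f)" for f n
  have Fb: "F f n \<in> bfs \<rho>" if "f \<in> bfs \<rho>" for f n unfolding F_def by (rule S0_cut_bfs[OF that])
  have diff: "ae_eq (\<lambda>x. F f m x - F f n x) (S0 (\<lambda>x. cut m f x - cut n f x))" if f: "f \<in> bfs \<rho>" for f m n
  proof -
    have c: "cut n f \<in> bfs \<rho>" "compactly_supported (cut n f)" for n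
      by (rule cut_bfs(1)[OF f], rule cut_compactly_supported)
    have "ae_eq (S0 (\<lambda>x. cut m f x + (-1) * cut n f x)) (\<lambda>x. F f m x + S0 (\<lambda>x. (-1) * cut n f x) x)"
      unfolding F_def by (rule S0_linear(1)[OF lin c(1) bfs_scale[OF c(1)] c(2) compactly_supported_scale[OF c(2)]])
    moreover have "ae_eq (S0 (\<lambda>x. (-1) * cut n f x)) (\<lambda>x. (-1) * F f n x)"
      unfolding F_def by (rule S0_linear(2)[OF lin c])
    ultimately show ?thesis unfolding ae_eq_def by (auto elim: eventually_elim2)
  qed
  have ex: "\<exists>G. Xlim (F f) G" if f: "f \<in> bfs \<rho>" for f
  proof (rule Xlim_controlled[OF oc f Fb[OF f] Kc_finite])
    fix m n
    have "\<rho> (eabs (\<lambda>x. F f m x - F f n x)) = \<rho> (eabs (S0 (\<lambda>x. cut m f x - cut n f x)))"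
      using bfs_measurable[OF bfs_diff[OF Fb[OF f] Fb[OF f]]] bfs_measurable[OF S0_bfs[OF cut_diff_bfs[OF f]]]
      by (intro rho_eabs_cong diff f)
    also have "\<dots> \<le> Kc * \<rho> (eabs (\<lambda>x. cut m f x - cut n f x))" by (rule S0_bound[OF cut_diff_bfs[OF f]])
    finally show "\<rho> (eabs (\<lambda>x. F f m x - F f n x)) \<le> Kc * \<rho> (eabs (\<lambda>x. cut m f x - cut n f x))" .
  qed
  define S where "S f = (SOME G. Xlim (F f) G)" for f
  have S: "Xlim (F f) (S f)" if "f \<in> bfs \<rho>" for f unfolding S_def by (rule someI_ex[OF ex[OF that]])
  have Sb: "S f \<in> bfs \<rho>" if "f \<in> bfs \<rho>" for f using S[OF that] by (simp add: Xlim_def)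
  have "operator_in_L0 (bfs \<rho>) S"
    unfolding operator_in_L0_def
  proof (intro conjI ballI impI)
    show "bfs \<rho> \<subseteq> L0" by (auto simp: bfs_def)
    show "S f \<in> L0" if "f \<in> bfs \<rho>" for f using Sb[OF that] by (simp add: bfs_def)
    fix f g assume f: "f \<in> bfs \<rho>" and g: "g \<in> L0" and fg: "ae_eq f g"
    show gb: "g \<in> bfs \<rho>" by (rule bfs_cong[OF fg f g])
    have "Xlim (F g) (S f)"
      by (rule Xlim_cong[OF S[OF f] _ Fb[OF gb]]) (unfold F_def, rule S0_cut_cong[OF fg f g])
    then show "ae_eq (S f) (S g)" using S[OF gb] by (rule Xlim_unique)
  qed
  moreover have "\<rho> (eabs (S f)) \<le> Kc * \<rho> (eabs f)" if f: "f \<in> bfs \<rho>" for f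
    by (rule Xlim_norm[OF S[OF f]]) (unfold F_def, rule S0_cut_bound[OF f])
  moreover have "representative \<rho> (T f) (S f)" if f: "f \<in> bfs \<rho>" and cs: "compactly_supported f" for f
  proof -
    obtain N where N: "\<And>n. n \<ge> N \<Longrightarrow> ae_eq (cut n f) f" using compactly_supported_big[OF cs] by blast
    have fL: "f \<in> L0" using f by (simp add: bfs_def)
    have "Xlim (F f) (S0 f)"
      by (rule Xlim_eventually[OF Fb[OF f] S0_bfs[OF f cs], of N]) (unfold F_def, rule S0_cong(2)[OF N cut_D[OF f] fL])
    then show ?thesis by (intro S0_representative f cs Xlim_unique[OF S[OF f]])
  qed
  ultimately have "bounded_extension S" using Sb by (simp add: bounded_extension_def)
  moreover have "linear_op (bfs \<rho>) S"
    unfolding linear_op_def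
  proof (intro conjI ballI allI)
    have "(\<lambda>x. 0) \<in> bfs \<rho>" by (simp add: bfs_def L0_def eabs_def)
    then show "lin_dom (bfs \<rho>)" using bfs_add bfs_scale by (simp add: lin_dom_def)
    fix f assume f: "f \<in> bfs \<rho>"
    show "ae_eq (S (\<lambda>x. a * f x)) (\<lambda>x. a * S f x)" for a
    proof (rule Xlim_unique[OF S[OF bfs_scale[OF f]]])
      have "cut n (\<lambda>x. a * f x) = (\<lambda>x. a * cut n f x)" for n by (simp add: cut_def fun_eq_iff)
      then have "ae_eq (\<lambda>x. a * F f n x) (F (\<lambda>x. a * f x) n)" for n
        unfolding F_def using S0_linear(2)[OF lin cut_bfs(1)[OF f, of n] cut_compactly_supported, of a] by (simp add: ae_eq_sym)
      then show "Xlim (F (\<lambda>x. a * f x)) (\<lambda>x. a * S f x)"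
        by (rule Xlim_cong[OF Xlim_scale[OF S[OF f]] _ Fb[OF bfs_scale[OF f]]])
    qed
    fix g assume g: "g \<in> bfs \<rho>"
    show "ae_eq (S (\<lambda>x. f x + g x)) (\<lambda>x. S f x + S g x)"
    proof (rule Xlim_unique[OF S[OF bfs_add[OF f g]]])
      have "cut n (\<lambda>x. f x + g x) = (\<lambda>x. cut n f x + cut n g x)" for n by (simp add: cut_def fun_eq_iff algebra_simps)
      then have "ae_eq (\<lambda>x. F f n x + F g n x) (F (\<lambda>x. f x + g x) n)" for n
        unfolding F_def using S0_linear(1)[OF lin cut_bfs(1)[OF f, of n] cut_bfs(1)[OF g, of n] cut_compactly_supported cut_compactly_supported]
        by (simp add: ae_eq_sym)
      then show "Xlim (F (\<lambda>x. f x + g x)) (\<lambda>x. S f x + S g x)"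
        by (rule Xlim_cong[OF Xlim_add[OF S[OF f] S[OF g]] _ Fb[OF bfs_add[OF f g]]])
    qed
  qed
  ultimately show ?thesis by blast
qed

text \<open>For sublinear \<open>T\<close> only \<open>|T f|\<close> depends continuously on \<open>f\<close>. So \<open>T f\<close> is kept for compactly
  supported \<open>f\<close>, and \<open>S f\<close> is the limit of \<open>|T (f 1\<^sub>Q)|\<close> over growing cubes \<open>Q\<close> for the others.\<close>

lemma sublinear_extension:
  assumes oc: "order_continuous \<rho>" and sub: "sublinear_op D T"
    and dec: "\<And>f. f \<in> bfs \<rho> \<Longrightarrow> compactly_supported f \<Longrightarrow> T f \<in> bfs \<rho> \<or> finite_level_sets (T f)"
  shows "\<exists>S. bounded_extension S \<and> sublinear_op (bfs \<rho>) S"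
proof -
  have S0T: "S0 f = T f" if "f \<in> bfs \<rho>" "compactly_supported f" for f
    using S0_lim_med_zero[OF that dec[OF that]] by (simp add: S0_def)
  have Tadd: "AE x in lebesgue. \<bar>T (\<lambda>y. f y + g y) x\<bar> \<le> \<bar>T f x\<bar> + \<bar>T g x\<bar>" if "f \<in> D" "g \<in> D" for f g
    using sub that by (simp add: sublinear_op_def)
  have Tscale: "AE x in lebesgue. \<bar>T (\<lambda>y. a * f y) x\<bar> = \<bar>a\<bar> * \<bar>T f x\<bar>" if "f \<in> D" for f a
    using sub that by (simp add: sublinear_op_def)
  define F where "F f n = (\<lambda>x. \<bar>T (cut n f) x\<bar>)" for f n
  have Tb: "T (cut n f) \<in> bfs \<rho>" if f: "f \<in> bfs \<rho>" for f n
    using S0_cut_bfs[OF f, of n] by (simp only: S0T[OF cut_bfs(1)[OF f] cut_compactly_supported])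
  have absb: "(\<lambda>x. \<bar>h x\<bar>) \<in> bfs \<rho>" if "h \<in> bfs \<rho>" for h
  proof (rule bfs_dominated(1)[OF that])
    show "(\<lambda>x. \<bar>h x\<bar>) \<in> borel_measurable lebesgue" using bfs_measurable[OF that] by measurable
  qed simp
  have eabs_abs: "eabs (\<lambda>x. \<bar>h x\<bar>) = eabs h" for h :: "'n rfun" by (simp add: eabs_def)
  have Fb: "F f n \<in> bfs \<rho>" if "f \<in> bfs \<rho>" for f n unfolding F_def by (rule absb[OF Tb[OF that]])
  have ex: "\<exists>G. Xlim (F f) G" if f: "f \<in> bfs \<rho>" for f
  proof (rule Xlim_controlled[OF oc f Fb[OF f] Kc_finite])
    fix m n
    let ?h = "\<lambda>x. cut m f x - cut n f x"
    note h = cut_diff_bfs[OF f, of m n]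
    have hD: "?h \<in> D" by (rule sharp_T_bound(1)[OF h])
    have "AE x in lebesgue. \<bar>T (\<lambda>y. ?h y + cut n f y) x\<bar> \<le> \<bar>T ?h x\<bar> + \<bar>T (cut n f) x\<bar>" by (rule Tadd[OF hD cut_D[OF f]])
    moreover have "AE x in lebesgue. \<bar>T (\<lambda>y. (-1) * ?h y) x\<bar> = \<bar>-1\<bar> * \<bar>T ?h x\<bar>" by (rule Tscale[OF hD])
    moreover have "AE x in lebesgue. \<bar>T (\<lambda>y. (-1) * ?h y + cut m f y) x\<bar> \<le> \<bar>T (\<lambda>y. (-1) * ?h y) x\<bar> + \<bar>T (cut m f) x\<bar>"
      by (rule Tadd[OF sharp_T_bound(1)[OF bfs_scale[OF h(1)] compactly_supported_scale[OF h(2)]] cut_D[OF f]])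
    ultimately have ae: "AE x in lebesgue. \<bar>F f m x - F f n x\<bar> \<le> \<bar>T ?h x\<bar>"
    proof eventually_elim
      case (elim x)
      then show ?case unfolding F_def by simp linarith
    qed
    have hb: "T ?h \<in> bfs \<rho>" using S0_bfs[OF h] S0T[OF h] by simp
    have "\<rho> (eabs (\<lambda>x. F f m x - F f n x)) \<le> \<rho> (eabs (T ?h))"
      by (rule bfs_dominated(2)[OF hb bfs_measurable[OF bfs_diff[OF Fb[OF f] Fb[OF f]]] ae])
    also have "\<dots> \<le> Kc * \<rho> (eabs ?h)" using S0_bound[OF h] S0T[OF h] by simp
    finally show "\<rho> (eabs (\<lambda>x. F f m x - F f n x)) \<le> Kc * \<rho> (eabs ?h)" .
  qed
  define L where "L f = (SOME G. Xlim (F f) G)" for f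
  have L: "Xlim (F f) (L f)" if "f \<in> bfs \<rho>" for f unfolding L_def by (rule someI_ex[OF ex[OF that]])
  define S where "S f = (if compactly_supported f then T f else L f)" for f
  have SL: "Xlim (F f) (\<lambda>x. \<bar>S f x\<bar>)" and Sb: "S f \<in> bfs \<rho>" if f: "f \<in> bfs \<rho>" for f
  proof -
    have "Xlim (F f) (\<lambda>x. \<bar>S f x\<bar>) \<and> S f \<in> bfs \<rho>"
    proof (cases "compactly_supported f")
      case True
      obtain N where N: "\<And>n. n \<ge> N \<Longrightarrow> ae_eq (cut n f) f" using compactly_supported_big[OF True] by blast
      have fL: "f \<in> L0" using f by (simp add: bfs_def)
      have Tf: "T f \<in> bfs \<rho>" using S0_bfs[OF f True] S0T[OF f True] by simp
      have "ae_eq (F f n) (\<lambda>x. \<bar>T f x\<bar>)" if "n \<ge> N" for n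
      proof -
        have "ae_eq (T (cut n f)) (T f)" using T_op N[OF that] cut_D[OF f] fL by (auto simp: operator_in_L0_def)
        then show ?thesis by (auto simp: F_def ae_eq_def elim: eventually_mono)
      qed
      then have "Xlim (F f) (\<lambda>x. \<bar>T f x\<bar>)" by (rule Xlim_eventually[OF Fb[OF f] absb[OF Tf]])
      then show ?thesis using Tf True by (simp add: S_def)
    next
      case False
      have "(\<lambda>n x. \<bar>F f n x\<bar>) = F f" by (simp add: F_def fun_eq_iff)
      then have "Xlim (F f) (\<lambda>x. \<bar>L f x\<bar>)" using Xlim_abs[OF L[OF f]] by simp
      then show ?thesis using L[OF f] False by (simp add: S_def Xlim_def)
    qed
    then show "Xlim (F f) (\<lambda>x. \<bar>S f x\<bar>)" "S f \<in> bfs \<rho>" by auto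
  qed
  have "operator_in_L0 (bfs \<rho>) S"
    unfolding operator_in_L0_def
  proof (intro conjI ballI impI)
    show "bfs \<rho> \<subseteq> L0" by (auto simp: bfs_def)
    show "S f \<in> L0" if "f \<in> bfs \<rho>" for f using Sb[OF that] by (simp add: bfs_def)
    fix f g assume f: "f \<in> bfs \<rho>" and g: "g \<in> L0" and fg: "ae_eq f g"
    show gb: "g \<in> bfs \<rho>" by (rule bfs_cong[OF fg f g])
    have cs: "compactly_supported f \<longleftrightarrow> compactly_supported g"
      using compactly_supported_cong fg ae_eq_sym by blast
    have Tc: "ae_eq (T (cut n f)) (T (cut n g))" for n
    proof -
      have "ae_eq (cut n f) (cut n g)" using fg by (auto simp: ae_eq_def cut_def elim: eventually_mono)
      moreover have "cut n g \<in> L0" using g by (simp add: L0_def)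
      ultimately show ?thesis using T_op cut_D[OF f] by (auto simp: operator_in_L0_def)
    qed
    show "ae_eq (S f) (S g)"
    proof (cases "compactly_supported f")
      case True
      then show ?thesis using T_op fg g sharp_T_bound(1)[OF f True] cs by (auto simp: S_def operator_in_L0_def)
    next
      case False
      have "Xlim (F g) (L f)"
      proof (rule Xlim_cong[OF L[OF f] _ Fb[OF gb]])
        show "ae_eq (F f n) (F g n)" for n
          using Tc[of n] unfolding F_def ae_eq_def by eventually_elim simp
      qed
      then show ?thesis using Xlim_unique L[OF gb] False cs by (simp add: S_def)
    qed
  qed
  moreover have "\<rho> (eabs (S f)) \<le> Kc * \<rho> (eabs f)" if f: "f \<in> bfs \<rho>" for f
  proof -
    have "\<rho> (eabs (F f n)) \<le> Kc * \<rho> (eabs f)" for n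
      using S0_cut_bound[OF f, of n] S0T[OF cut_bfs(1)[OF f] cut_compactly_supported, of n] by (simp add: F_def eabs_abs)
    then show ?thesis using Xlim_norm[OF SL[OF f]] by (simp add: eabs_abs)
  qed
  moreover have "representative \<rho> (T f) (S f)" if f: "f \<in> bfs \<rho>" and cs: "compactly_supported f" for f
    by (rule S0_representative[OF f cs]) (simp add: S_def cs S0T[OF f cs])
  ultimately have "bounded_extension S" using Sb by (simp add: bounded_extension_def)
  moreover have "sublinear_op (bfs \<rho>) S"
    unfolding sublinear_op_def
  proof (intro conjI ballI allI)
    have "(\<lambda>x. 0) \<in> bfs \<rho>" by (simp add: bfs_def L0_def eabs_def)
    then show "lin_dom (bfs \<rho>)" using bfs_add bfs_scale by (simp add: lin_dom_def)
    fix f assume f: "f \<in> bfs \<rho>"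
    show "AE x in lebesgue. \<bar>S (\<lambda>y. a * f y) x\<bar> = \<bar>a\<bar> * \<bar>S f x\<bar>" for a
    proof -
      have "cut n (\<lambda>x. a * f x) = (\<lambda>x. a * cut n f x)" for n by (simp add: cut_def fun_eq_iff)
      then have "ae_eq (\<lambda>x. \<bar>a\<bar> * F f n x) (F (\<lambda>x. a * f x) n)" for n
        using Tscale[OF cut_D[OF f], of a n] by (auto simp: F_def ae_eq_def elim: eventually_mono)
      then have "Xlim (F (\<lambda>x. a * f x)) (\<lambda>x. \<bar>a\<bar> * \<bar>S f x\<bar>)"
        by (rule Xlim_cong[OF Xlim_scale[OF SL[OF f]] _ Fb[OF bfs_scale[OF f]]])
      from Xlim_unique[OF SL[OF bfs_scale[OF f]] this] show ?thesis by (simp add: ae_eq_def)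
    qed
    fix g assume g: "g \<in> bfs \<rho>"
    show "AE x in lebesgue. \<bar>S (\<lambda>y. f y + g y) x\<bar> \<le> \<bar>S f x\<bar> + \<bar>S g x\<bar>"
    proof (rule Xlim_mono[OF SL[OF bfs_add[OF f g]] Xlim_add[OF SL[OF f] SL[OF g]]])
      fix n
      have "cut n (\<lambda>x. f x + g x) = (\<lambda>x. cut n f x + cut n g x)" by (simp add: cut_def fun_eq_iff algebra_simps)
      then show "AE x in lebesgue. F (\<lambda>x. f x + g x) n x \<le> F f n x + F g n x"
        using Tadd[OF cut_D[OF f] cut_D[OF g], of n n] by (simp add: F_def)
    qed
  qed
  ultimately show ?thesis by blast
qed

text \<open>Subtracting constants from the \<open>T f\<close> may destroy sublinearity, and then there is no continuity to
  extend by. The bounds still hold if the functions without compact support are sent to \<open>0\<close>.\<close>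

lemma trivial_extension: "\<exists>S. bounded_extension S"
proof -
  define S where "S f = (if compactly_supported f then S0 f else (\<lambda>x. 0))" for f
  have zero: "(\<lambda>x. 0) \<in> bfs \<rho>" "\<rho> (eabs (\<lambda>x. 0)) = 0" by (simp_all add: bfs_def L0_def eabs_def)
  have Sb: "S f \<in> bfs \<rho>" "\<rho> (eabs (S f)) \<le> Kc * \<rho> (eabs f)" if "f \<in> bfs \<rho>" for f
    using zero S0_bfs[OF that] S0_bound[OF that] by (auto simp: S_def)
  have "operator_in_L0 (bfs \<rho>) S"
    unfolding operator_in_L0_def
  proof (intro conjI ballI impI)
    show "bfs \<rho> \<subseteq> L0" by (auto simp: bfs_def)
    show "S f \<in> L0" if "f \<in> bfs \<rho>" for f using Sb(1)[OF that] by (simp add: bfs_def)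
    fix f g assume f: "f \<in> bfs \<rho>" and g: "g \<in> L0" and fg: "ae_eq f g"
    show "g \<in> bfs \<rho>" by (rule bfs_cong[OF fg f g])
    have "compactly_supported f \<longleftrightarrow> compactly_supported g"
      using compactly_supported_cong fg ae_eq_sym by blast
    then show "ae_eq (S f) (S g)" using S0_cong(2)[OF fg sharp_T_bound(1)[OF f] g] by (simp add: S_def)
  qed
  moreover have "representative \<rho> (T f) (S f)" if "f \<in> bfs \<rho>" "compactly_supported f" for f
    by (rule S0_representative[OF that]) (simp add: S_def that)
  ultimately show ?thesis using Sb by (auto simp: bounded_extension_def)
qed

theorem extrapolation:
  fixes C :: real
  assumes C: "C = 2 * (1 + fs_const CARD('n))"
  shows "(\<forall>f\<in>bfs \<rho>. compactly_supported f \<longrightarrow>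
             f \<in> D \<and> (\<exists>h. representative \<rho> (T f) h \<and>
                  \<rho> (eabs h) \<le> ennreal C * sharp_const sh \<rho> * \<Phi> * \<rho> (eabs f))) \<and>
    ((linear_op D T \<or> sublinear_op D T) \<and> order_continuous \<rho> \<longrightarrow>
       (\<exists>S. operator_in_L0 (bfs \<rho>) S \<and> (\<forall>f\<in>bfs \<rho>. S f \<in> bfs \<rho>) \<and>
            (\<forall>f\<in>bfs \<rho>. compactly_supported f \<longrightarrow> representative \<rho> (T f) (S f)) \<and>
            (linear_op D T \<longrightarrow> linear_op (bfs \<rho>) S) \<and>
            (sublinear_op D T \<and>
             (\<forall>f\<in>bfs \<rho>. compactly_supported f \<longrightarrow> T f \<in> bfs \<rho> \<or> finite_level_sets (T f)) \<longrightarrow>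
               sublinear_op (bfs \<rho>) S) \<and>
            op_norm (bfs \<rho>) \<rho> (\<lambda>f. eabs (S f)) < \<infinity> \<and>
            op_norm (bfs \<rho>) \<rho> (\<lambda>f. eabs (S f)) \<le> ennreal C * sharp_const sh \<rho> * \<Phi> \<and>
            op_norm (bfs \<rho>) \<rho> (\<lambda>f. eabs (S f)) \<le> ennreal C * MX' * \<Phi>))"
proof -
  have fs: "fs_const CARD('n) \<ge> 0" using osc_mult_pos[of "CARD('n)"] by (simp add: fs_const_def)
  have "2 \<le> ennreal C" using ennreal_leI[of 2 C] fs by (simp add: C)
  then have KcC: "Kc \<le> ennreal C * sharp_const sh \<rho> * \<Phi>"
    unfolding Kc_def by (intro mult_right_mono) auto
  have "2 * sharp_const sh \<rho> \<le> 2 * (ennreal (fs_const CARD('n)) * MX')"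
    using sh_ge sh_measurable by (intro mult_left_mono sharp_const_bound) auto
  also have "\<dots> = ennreal (2 * fs_const CARD('n)) * MX'" using fs by (simp add: ennreal_mult mult.assoc)
  also have "\<dots> \<le> ennreal C * MX'" using fs by (intro mult_right_mono ennreal_leI) (auto simp: C)
  finally have KcM: "Kc \<le> ennreal C * MX' * \<Phi>" unfolding Kc_def by (intro mult_right_mono) auto
  have norm: "op_norm (bfs \<rho>) \<rho> (\<lambda>f. eabs (S f)) \<le> Kc" if "bounded_extension S" for S
    using that by (intro op_norm_leI) (simp add: bounded_extension_def)
  show ?thesis
  proof (intro conjI ballI impI)
    fix f assume f: "f \<in> bfs \<rho>" and cs: "compactly_supported f"
    show "f \<in> D" by (rule sharp_T_bound(1)[OF f cs])
    have "\<rho> (eabs (S0 f)) \<le> ennreal C * sharp_const sh \<rho> * \<Phi> * \<rho> (eabs f)"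
      by (rule order_trans[OF S0_bound[OF f cs] mult_right_mono[OF KcC]]) simp
    then show "\<exists>h. representative \<rho> (T f) h \<and> \<rho> (eabs h) \<le> ennreal C * sharp_const sh \<rho> * \<Phi> * \<rho> (eabs f)"
      using S0_representative[OF f cs, of "S0 f"] by auto
  next
    assume a: "(linear_op D T \<or> sublinear_op D T) \<and> order_continuous \<rho>"
    then have oc: "order_continuous \<rho>" by simp
    let ?dec = "\<forall>f\<in>bfs \<rho>. compactly_supported f \<longrightarrow> T f \<in> bfs \<rho> \<or> finite_level_sets (T f)"
    have "\<exists>S. bounded_extension S \<and> (linear_op D T \<longrightarrow> linear_op (bfs \<rho>) S) \<and>
        (sublinear_op D T \<and> ?dec \<longrightarrow> sublinear_op (bfs \<rho>) S)"
    proof (cases "linear_op D T")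
      case True
      then show ?thesis using linear_extension[OF oc] linear_op_sublinear by blast
    next
      case False
      then show ?thesis using sublinear_extension[OF oc] trivial_extension by blast
    qed
    then obtain S where S: "bounded_extension S" "linear_op D T \<longrightarrow> linear_op (bfs \<rho>) S"
      "sublinear_op D T \<and> ?dec \<longrightarrow> sublinear_op (bfs \<rho>) S" by blast
    show "\<exists>S. operator_in_L0 (bfs \<rho>) S \<and> (\<forall>f\<in>bfs \<rho>. S f \<in> bfs \<rho>) \<and>
            (\<forall>f\<in>bfs \<rho>. compactly_supported f \<longrightarrow> representative \<rho> (T f) (S f)) \<and>
            (linear_op D T \<longrightarrow> linear_op (bfs \<rho>) S) \<and>
            (sublinear_op D T \<and> ?dec \<longrightarrow> sublinear_op (bfs \<rho>) S) \<and>
            op_norm (bfs \<rho>) \<rho> (\<lambda>f. eabs (S f)) < \<infinity> \<and>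
            op_norm (bfs \<rho>) \<rho> (\<lambda>f. eabs (S f)) \<le> ennreal C * sharp_const sh \<rho> * \<Phi> \<and>
            op_norm (bfs \<rho>) \<rho> (\<lambda>f. eabs (S f)) \<le> ennreal C * MX' * \<Phi>"
    proof (intro exI[of _ S] conjI S(2,3))
      show "operator_in_L0 (bfs \<rho>) S" "\<forall>f\<in>bfs \<rho>. S f \<in> bfs \<rho>"
        "\<forall>f\<in>bfs \<rho>. compactly_supported f \<longrightarrow> representative \<rho> (T f) (S f)"
        using S(1) by (simp_all add: bounded_extension_def)
      show "op_norm (bfs \<rho>) \<rho> (\<lambda>f. eabs (S f)) < \<infinity>" by (rule le_less_trans[OF norm[OF S(1)] Kc_finite])
      show "op_norm (bfs \<rho>) \<rho> (\<lambda>f. eabs (S f)) \<le> ennreal C * sharp_const sh \<rho> * \<Phi>"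
        by (rule order_trans[OF norm[OF S(1)] KcC])
      show "op_norm (bfs \<rho>) \<rho> (\<lambda>f. eabs (S f)) \<le> ennreal C * MX' * \<Phi>"
        by (rule order_trans[OF norm[OF S(1)] KcM])
    qed
  qed
qed

end

section \<open>The extrapolation theorem\<close>

theorem theorem3p1:
  shows "\<exists>C::real. C > 0 \<and>
    (\<forall>(bmo :: ('n::finite) rfun \<Rightarrow> 'n rfun \<Rightarrow> ennreal, sharp :: 'n rfun \<Rightarrow> 'n efun) \<in>
        {(BMO_norm, sharp_max), (BMO_weak_norm, sharp_max_weak)}.
     \<forall>(D :: 'n rfun set) (T :: 'n rfun \<Rightarrow> 'n rfun) (\<phi> :: real \<Rightarrow> real).
      operator_in_L0 D T \<longrightarrow>
      mono_on {1..} \<phi> \<longrightarrow>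
      (\<forall>t\<ge>1. \<phi> t > 0) \<longrightarrow>
      (\<forall>w f. weight w \<longrightarrow> A1_const (\<lambda>x. inverse (w x)) < \<infinity> \<longrightarrow>
         f \<in> Linf w \<longrightarrow> compactly_supported f \<longrightarrow>
         f \<in> D \<and>
         bmo w (T f) \<le> ennreal (\<phi> (enn2real (A1_const (\<lambda>x. inverse (w x))))) * Linf_norm w f) \<longrightarrow>
      (\<forall>\<rho> :: 'n efun \<Rightarrow> ennreal.
         banach_function_norm \<rho> \<longrightarrow>
         op_norm (bfs \<rho>) \<rho> HL_max < \<infinity> \<longrightarrow>
         op_norm (kothe_dual \<rho>) (kothe_norm \<rho>) HL_max < \<infinity> \<longrightarrow>
         (let \<Phi> = ennreal (\<phi> (2 * enn2real (op_norm (bfs \<rho>) \<rho> HL_max))) in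
          (\<forall>f\<in>bfs \<rho>. compactly_supported f \<longrightarrow>
             f \<in> D \<and>
             (\<exists>h. representative \<rho> (T f) h \<and>
                  \<rho> (eabs h) \<le> ennreal C * sharp_const sharp \<rho> * \<Phi> * \<rho> (eabs f))) \<and>
          ((linear_op D T \<or> sublinear_op D T) \<and> order_continuous \<rho> \<longrightarrow>
             (\<exists>S. operator_in_L0 (bfs \<rho>) S \<and> (\<forall>f\<in>bfs \<rho>. S f \<in> bfs \<rho>) \<and>
                  (\<forall>f\<in>bfs \<rho>. compactly_supported f \<longrightarrow> representative \<rho> (T f) (S f)) \<and>
                  (linear_op D T \<longrightarrow> linear_op (bfs \<rho>) S) \<and>
                  (sublinear_op D T \<and>
                   (\<forall>f\<in>bfs \<rho>. compactly_supported f \<longrightarrow> T f \<in> bfs \<rho> \<or> finite_level_sets (T f)) \<longrightarrow>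
                     sublinear_op (bfs \<rho>) S) \<and>
                  op_norm (bfs \<rho>) \<rho> (\<lambda>f. eabs (S f)) < \<infinity> \<and>
                  op_norm (bfs \<rho>) \<rho> (\<lambda>f. eabs (S f)) \<le> ennreal C * sharp_const sharp \<rho> * \<Phi> \<and>
                  op_norm (bfs \<rho>) \<rho> (\<lambda>f. eabs (S f)) \<le>
                    ennreal C * op_norm (kothe_dual \<rho>) (kothe_norm \<rho>) HL_max * \<Phi>)))))"
proof (rule exI[of _ "2 * (1 + fs_const CARD('n))"], intro conjI ballI, goal_cases)
  case 1
  show ?case using osc_mult_pos[of "CARD('n)"] by (simp add: fs_const_def add_pos_pos)
next
  case (2 p)
  then consider "p = (BMO_norm, sharp_max)" | "p = (BMO_weak_norm, sharp_max_weak)" by blast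
  then show ?case
  proof cases
    case 1
    show ?thesis unfolding 1
    proof (simp only: prod.case, intro allI impI, unfold Let_def, goal_cases)
      case (1 D T \<phi> \<rho>)
      interpret bmo_operator \<rho> osc D T \<phi>
      proof
        show "banach_function_norm \<rho>" "op_norm (bfs \<rho>) \<rho> HL_max < \<infinity>"
          "op_norm (kothe_dual \<rho>) (kothe_norm \<rho>) HL_max < \<infinity>" "operator_in_L0 D T" "mono_on {1..} \<phi>"
          using 1 by blast+
        fix w f :: "'n rfun" assume "weight w" "A1_const (\<lambda>x. inverse (w x)) < \<infinity>" "f \<in> Linf w" "compactly_supported f"
        then show "f \<in> D \<and> (SUP Q\<in>cubes. avg_inf Q w * osc Q (T f))
            \<le> ennreal (\<phi> (enn2real (A1_const (\<lambda>x. inverse (w x))))) * Linf_norm w f"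
          using 1(4) unfolding BMO_norm_def by blast
      qed (simp_all add: osc_weak_le_osc outer_cont_osc osc_shift)
      have "sh = sharp_max" by (simp add: fun_eq_iff sh_def sharp_max_eq)
      then show ?case using extrapolation[OF refl] by (simp only:)
    qed
  next
    case 2
    show ?thesis unfolding 2
    proof (simp only: prod.case, intro allI impI, unfold Let_def, goal_cases)
      case (1 D T \<phi> \<rho>)
      interpret bmo_operator \<rho> osc_weak D T \<phi>
      proof
        show "banach_function_norm \<rho>" "op_norm (bfs \<rho>) \<rho> HL_max < \<infinity>"
          "op_norm (kothe_dual \<rho>) (kothe_norm \<rho>) HL_max < \<infinity>" "operator_in_L0 D T" "mono_on {1..} \<phi>"
          using 1 by blast+
        fix w f :: "'n rfun" assume "weight w" "A1_const (\<lambda>x. inverse (w x)) < \<infinity>" "f \<in> Linf w" "compactly_supported f"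
        then show "f \<in> D \<and> (SUP Q\<in>cubes. avg_inf Q w * osc_weak Q (T f))
            \<le> ennreal (\<phi> (enn2real (A1_const (\<lambda>x. inverse (w x))))) * Linf_norm w f"
          using 1(4) unfolding BMO_weak_norm_def by blast
      qed (simp_all add: order_refl outer_cont_osc_weak osc_weak_shift)
      have "sh = sharp_max_weak" by (simp add: fun_eq_iff sh_def sharp_max_weak_eq)
      then show ?case using extrapolation[OF refl] by (simp only:)
    qed
  qed
qed

end
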